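(* Let $(\Phi, G, X)$ be any one of the following triples, consisting of a root system $\Phi$ in two or three dimensions, a finite group $G$, and a simply-laced ($ADE$) Dynkin type $X$: (i) $(I_2(n),\ C_{2n},\ A_{2n-1})$ for an integer $n\ge 2$; (ii) $(A_1\times I_2(n),\ \mathrm{Dic}_n,\ D_{n+2})$ for an integer $n\ge 2$; (iii) $(A_3,\ 2T,\ E_6)$; (iv) $(B_3,\ 2O,\ E_7)$; (v) $(H_3,\ 2I,\ E_8)$. Then $$|\Phi| \;=\; \sum_{\rho\in\mathrm{Irr}(G)} \dim\rho \;=\; h(X),$$ where $|\Phi|$ is the number of roots of $\Phi$, the sum is over the isomorphism classes of irreducible complex representations of $G$, and $h(X)$ is the Coxeter number of the root system of type $X$. The common value is $2n$, $2n+2$, $12$, $18$, $30$ in cases (i)--(v), respectively.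
   Context: A root system is a finite collection $\Phi$ of non-zero vectors spanning a Euclidean space $V$ such that $\Phi\cap\mathbb{R}\alpha=\{\alpha,-\alpha\}$ for all $\alpha\in\Phi$, and $\Phi$ is invariant under all reflections $s_\alpha(x)=x-2\frac{(x|\alpha)}{(\alpha|\alpha)}\alpha$ with $\alpha\in\Phi$. Crystallographic integrality is not assumed. Only the number of roots matters here, so roots may be taken of unit length. Notation for root systems: $I_2(n)$ is the planar root system whose reflection group is the symmetry group of the regular $n$-gon (dihedral of order $2n$), with simple roots $e_1$ and $-\cos\frac{\pi}{n}e_1+\sin\frac{\pi}{n}e_2$ (so $I_2(2)=A_1\times A_1$). $A_1\times I_2(n)$ is the three-dimensional root system which is the orthogonal union of $A_1=\{\pm e\}$ ($e$ a unit vector) and $I_2(n)$. $A_3, B_3, H_3$ are the three-dimensional root systems whose reflection groups are the full tetrahedral, octahedral and icosahedral groups. Notation for groups: $C_{2n}$ is the cyclic group of order $2n$. $\mathrm{Dic}_n$ is the dicyclic (binary dihedral) group of order $4n$, $\langle a,x \mid a^{2n}=1,\ x^2=a^n,\ x^{-1}ax=a^{-1}\rangle$. $2T, 2O, 2I$ are the binary tetrahedral, octahedral and icosahedral groups, of orders $24,48,120$, i.e. the preimages in $\mathrm{Spin}(3)$ (the unit quaternions) of the rotation groups of the tetrahedron, octahedron and icosahedron. The Coxeter number of a (finite) root system is the order of a Coxeter element, i.e. of the product, in any order, of all its simple reflections. *)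

theory Defs
  imports
    "HOL-Analysis.Analysis"
    "HOL-Algebra.Elementary_Groups"
    "HOL-Algebra.Bij"
    "HOL-Algebra.Multiplicative_Group"
    "Jordan_Normal_Form.VS_Connect"
begin

section \<open>Root systems\<close>

definition reflection :: "'a::real_inner \<Rightarrow> 'a \<Rightarrow> 'a"
  where "reflection \<alpha> x = x - (2 * (inner x \<alpha> / inner \<alpha> \<alpha>)) *\<^sub>R \<alpha>"

definition root_system :: "'a::euclidean_space set \<Rightarrow> bool"
  where "root_system \<Phi> \<longleftrightarrow>
    finite \<Phi> \<and> 0 \<notin> \<Phi> \<and> span \<Phi> = UNIV \<and>
    (\<forall>\<alpha>\<in>\<Phi>. \<Phi> \<inter> range (\<lambda>c::real. c *\<^sub>R \<alpha>) = {\<alpha>, - \<alpha>}) \<and>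
    (\<forall>\<alpha>\<in>\<Phi>. reflection \<alpha> ` \<Phi> = \<Phi>)"

definition reflection_group :: "'a::euclidean_space set \<Rightarrow> ('a \<Rightarrow> 'a) set"
  where "reflection_group \<Phi> = generate (BijGroup UNIV) (reflection ` \<Phi>)"

definition simple_system :: "'a::euclidean_space set \<Rightarrow> 'a set \<Rightarrow> bool"
  where "simple_system \<Phi> \<Delta> \<longleftrightarrow>
    \<Delta> \<subseteq> \<Phi> \<and> independent \<Delta> \<and> span \<Delta> = UNIV \<and>
    (\<forall>\<alpha>\<in>\<Phi>. \<exists>c. \<alpha> = (\<Sum>\<delta>\<in>\<Delta>. c \<delta> *\<^sub>R \<delta>) \<and>
      ((\<forall>\<delta>\<in>\<Delta>. c \<delta> \<ge> 0) \<or> (\<forall>\<delta>\<in>\<Delta>. c \<delta> \<le> 0)))"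

definition coxeter_element :: "'a::euclidean_space set \<Rightarrow> ('a \<Rightarrow> 'a) \<Rightarrow> bool"
  where "coxeter_element \<Phi> w \<longleftrightarrow>
    (\<exists>\<alpha>s. distinct \<alpha>s \<and> simple_system \<Phi> (set \<alpha>s) \<and>
          w = foldr (\<circ>) (map reflection \<alpha>s) id)"

text \<open>The common order of all Coxeter elements, for all simple systems and all orderings of the
  simple reflections; unspecified if these orders differ.\<close>

definition coxeter_number :: "'a::euclidean_space set \<Rightarrow> nat"
  where "coxeter_number \<Phi> =
    (THE h. \<forall>w. coxeter_element \<Phi> w \<longrightarrow> group.ord (BijGroup UNIV) w = h)"

section \<open>Simply-laced Dynkin types\<close>

datatype ade_type = Type_A nat | Type_D nat | Type_E6 | Type_E7 | Type_E8

fun rank :: "ade_type \<Rightarrow> nat"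
  where
    "rank (Type_A m) = m"
  | "rank (Type_D m) = m"
  | "rank Type_E6 = 6"
  | "rank Type_E7 = 7"
  | "rank Type_E8 = 8"

text \<open>Edges of the Dynkin diagrams, each listed once. The nodes are the numbers below the rank
  \<open>m\<close>. Type \<open>A\<close> is the path \<open>0, ..., m-1\<close>. Types \<open>D\<close> and \<open>E\<close> are the path \<open>0, ..., m-2\<close> together
  with the node \<open>m-1\<close>, joined to \<open>m-3\<close> for \<open>D\<close> (where \<open>m \<ge> 4\<close>) and to \<open>2\<close> for \<open>E\<close>.\<close>

fun dynkin_edges :: "ade_type \<Rightarrow> (nat \<times> nat) set"
  where
    "dynkin_edges (Type_A m) = {(i, i + 1) | i. i + 1 < m}"
  | "dynkin_edges (Type_D m) = {(i, i + 1) | i. i + 1 < m - 1} \<union> {(m - 3, m - 1)}"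
  | "dynkin_edges Type_E6 = {(i, i + 1) | i. i + 1 < 5} \<union> {(2, 5)}"
  | "dynkin_edges Type_E7 = {(i, i + 1) | i. i + 1 < 6} \<union> {(2, 6)}"
  | "dynkin_edges Type_E8 = {(i, i + 1) | i. i + 1 < 7} \<union> {(2, 7)}"

definition root_system_of_type :: "ade_type \<Rightarrow> 'a::euclidean_space set \<Rightarrow> bool"
  where "root_system_of_type X \<Psi> \<longleftrightarrow>
    root_system \<Psi> \<and>
    (\<exists>\<alpha>s. length \<alpha>s = rank X \<and> distinct \<alpha>s \<and> simple_system \<Psi> (set \<alpha>s) \<and>
      (\<forall>i<rank X. \<forall>j<rank X. i \<noteq> j \<longrightarrow>
        2 * inner (\<alpha>s ! i) (\<alpha>s ! j) / inner (\<alpha>s ! j) (\<alpha>s ! j) =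
          (if (i, j) \<in> dynkin_edges X \<or> (j, i) \<in> dynkin_edges X then -1 else 0)))"

section \<open>The root systems in dimensions two and three\<close>

definition symmetry_group :: "'a::euclidean_space set \<Rightarrow> ('a \<Rightarrow> 'a) set"
  where "symmetry_group S = {f. orthogonal_transformation f \<and> f ` S = S}"

definition rotation_group :: "(real^3) set \<Rightarrow> (real^3 \<Rightarrow> real^3) set"
  where "rotation_group S = {f \<in> symmetry_group S. Determinants.det (matrix f) = 1}"

text \<open>The \<open>n\<close>-gon has a vertex on the second axis, so that the line orthogonal to the first axis is
  one of its mirrors.\<close>

definition regular_polygon :: "nat \<Rightarrow> (real^2) set"
  where "regular_polygon n =
    {vector [sin (2 * pi * real k / real n), cos (2 * pi * real k / real n)] | k. k < n}"

definition tetrahedron :: "(real^3) set"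
  where "tetrahedron =
    {vector [1, 1, 1], vector [1, -1, -1], vector [-1, 1, -1], vector [-1, -1, 1]}"

definition octahedron :: "(real^3) set"
  where "octahedron = {s *\<^sub>R axis i 1 | s i. s \<in> {1, -1}}"

definition golden_ratio :: real
  where "golden_ratio = (1 + sqrt 5) / 2"

definition icosahedron :: "(real^3) set"
  where "icosahedron =
    (\<Union>s\<in>{1, -1}. \<Union>t\<in>{golden_ratio, - golden_ratio}.
      {vector [0, s, t], vector [s, t, 0], vector [t, 0, s]})"

definition is_I2 :: "nat \<Rightarrow> (real^2) set \<Rightarrow> bool"
  where "is_I2 n \<Phi> \<longleftrightarrow>
    root_system \<Phi> \<and>
    reflection_group \<Phi> = symmetry_group (regular_polygon n) \<and>
    simple_system \<Phi> {vector [1, 0], vector [- cos (pi / real n), sin (pi / real n)]}"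

definition is_A1_I2 :: "nat \<Rightarrow> (real^3) set \<Rightarrow> bool"
  where "is_A1_I2 n \<Phi> \<longleftrightarrow>
    (\<exists>\<Phi>'. is_I2 n \<Phi>' \<and>
      \<Phi> = {vector [0, 0, 1], vector [0, 0, -1]} \<union>
          (\<lambda>v. vector [vec_nth v 1, vec_nth v 2, 0]) ` \<Phi>')"

definition is_A3 :: "(real^3) set \<Rightarrow> bool"
  where "is_A3 \<Phi> \<longleftrightarrow> root_system \<Phi> \<and> reflection_group \<Phi> = symmetry_group tetrahedron"

definition is_B3 :: "(real^3) set \<Rightarrow> bool"
  where "is_B3 \<Phi> \<longleftrightarrow> root_system \<Phi> \<and> reflection_group \<Phi> = symmetry_group octahedron"

definition is_H3 :: "(real^3) set \<Rightarrow> bool"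
  where "is_H3 \<Phi> \<longleftrightarrow> root_system \<Phi> \<and> reflection_group \<Phi> = symmetry_group icosahedron"

section \<open>The groups\<close>

text \<open>The group presented by these relations has order \<open>4 * n\<close>, so a group of that order which is
  generated by two elements satisfying the relations is isomorphic to it.\<close>

definition is_dicyclic :: "nat \<Rightarrow> ('g, 'm) monoid_scheme \<Rightarrow> bool"
  where "is_dicyclic n G \<longleftrightarrow>
    group G \<and> order G = 4 * n \<and>
    (\<exists>a\<in>carrier G. \<exists>x\<in>carrier G.
      generate G {a, x} = carrier G \<and>
      a [^]\<^bsub>G\<^esub> (2 * n) = \<one>\<^bsub>G\<^esub> \<and>
      x [^]\<^bsub>G\<^esub> (2::nat) = a [^]\<^bsub>G\<^esub> n \<and>
      inv\<^bsub>G\<^esub> x \<otimes>\<^bsub>G\<^esub> a \<otimes>\<^bsub>G\<^esub> x = inv\<^bsub>G\<^esub> a)"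

text \<open>Quaternions as pairs of a real part and an imaginary part in \<open>real^3\<close>.\<close>

type_synonym quaternion = "real \<times> (real^3)"

definition quat_mult :: "quaternion \<Rightarrow> quaternion \<Rightarrow> quaternion"
  where "quat_mult p q =
    (fst p * fst q - inner (snd p) (snd q),
     fst p *\<^sub>R snd q + fst q *\<^sub>R snd p + cross3 (snd p) (snd q))"

definition quat_conj :: "quaternion \<Rightarrow> quaternion"
  where "quat_conj q = (fst q, - snd q)"

definition quat_rotation :: "quaternion \<Rightarrow> real^3 \<Rightarrow> real^3"
  where "quat_rotation q v = snd (quat_mult (quat_mult q (0, v)) (quat_conj q))"

definition spin_preimage :: "(real^3 \<Rightarrow> real^3) set \<Rightarrow> quaternion monoid"
  where "spin_preimage R =
    \<lparr>carrier = {q. norm q = 1 \<and> quat_rotation q \<in> R}, mult = quat_mult, one = (1, 0)\<rparr>"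

definition binary_tetrahedral :: "quaternion monoid"
  where "binary_tetrahedral = spin_preimage (rotation_group tetrahedron)"

definition binary_octahedral :: "quaternion monoid"
  where "binary_octahedral = spin_preimage (rotation_group octahedron)"

definition binary_icosahedral :: "quaternion monoid"
  where "binary_icosahedral = spin_preimage (rotation_group icosahedron)"

section \<open>Irreducible complex representations\<close>

abbreviation GL :: "nat \<Rightarrow> complex mat monoid"
  where "GL d \<equiv> units_of (ring_mat TYPE(complex) d ())"

text \<open>A pair \<open>(d, \<rho>)\<close> stands for a representation on column vectors of dimension \<open>d\<close>. Values of \<open>\<rho>\<close>
  outside \<open>carrier G\<close> are irrelevant and are disregarded by the isomorphism relation.\<close>

type_synonym 'g rep = "nat \<times> ('g \<Rightarrow> complex mat)"

definition irreps :: "('g, 'm) monoid_scheme \<Rightarrow> 'g rep set"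
  where "irreps G = {(d, \<rho>). \<rho> \<in> hom G (GL d) \<and> d > 0 \<and>
    (\<forall>W. VectorSpace.subspace class_ring W (module_vec TYPE(complex) d) \<and>
         (\<forall>g\<in>carrier G. \<forall>w\<in>W. \<rho> g *\<^sub>v w \<in> W) \<longrightarrow>
         W = {0\<^sub>v d} \<or> W = carrier_vec d)}"

definition rep_iso :: "('g, 'm) monoid_scheme \<Rightarrow> ('g rep \<times> 'g rep) set"
  where "rep_iso G = {((d, \<rho>), (e, \<sigma>)). (d, \<rho>) \<in> irreps G \<and> (e, \<sigma>) \<in> irreps G \<and> d = e \<and>
    (\<exists>T\<in>carrier (GL d). \<forall>g\<in>carrier G. T * \<rho> g = \<sigma> g * T)}"

definition Irr :: "('g, 'm) monoid_scheme \<Rightarrow> 'g rep set set"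
  where "Irr G = irreps G // rep_iso G"

definition class_dim :: "'g rep set \<Rightarrow> nat"
  where "class_dim C = (THE d. \<exists>\<rho>. (d, \<rho>) \<in> C)"

definition irr_dim_sum :: "('g, 'm) monoid_scheme \<Rightarrow> nat"
  where "irr_dim_sum G = (\<Sum>C\<in>Irr G. class_dim C)"

end

(*
  The degree sums: orthogonality of characters and the decomposition of the regular representation
  give |G| = sum of the squared degrees. For commutative G all degrees are 1. In Dic_n a cyclic
  subgroup of index 2 bounds the degrees by 2, there are between 1 and 4 degree-1 characters, and
  their number is divisible by 4 because |G| = 4n is. For 2T, 2O, 2I the irreducible characters are cut out, by norm computations, of the symmetric powers of the
  defining representation on C^2, its Galois conjugate and their products; inner products only
  depend on the distribution of real parts in the group, which is computed exactly in Z[phi].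

  The roots: the reflection in a root preserves the given polygon or polyhedron and is thus one of
  its finitely many mirrors. Conversely every mirror occurs, as it is conjugate under the group to
  one that does.

  The Coxeter numbers: two simple systems are related by an isometry in the reflection group, and,
  the diagram being a forest, the products of the simple reflections in all orders are conjugate. So
  it suffices to find the order for one order of the simple roots of the diagram. In types A and D
  the element is a permutation and a signed permutation; in type E it is iterated on the simple roots.
*)
theory Submission
  imports Defs "Jordan_Normal_Form.Spectral_Radius"
begin

section \<open>Linear algebra\<close>

text \<open>Three choices shape the proof. Linear independence always comes with a dual family of
  functionals, so statements about dimensions become identities between explicit matrices, and equal
  traces of \<open>P * Q\<close> and \<open>Q * P\<close> give equal dimensions. Representations
  enter only through their characters, where a composition series is as good as a direct sum, so
  that everything reduces to integer multiplicities. The polyhedral root systems are known only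
  through their reflection groups, which leaves the lengths of the roots open; hence roots are
  compared with explicit vectors by direction alone. The geometric data that are checked by
  evaluation stay unnormalised: quaternions and mirror vectors have coordinates in Z[phi], their
  rotations and reflections are multiplied by the squared norm, and square roots appear only after
  the evaluation. That two values differ is certified by the bounds 8/5 and 17/10 on the golden
  ratio.\<close>

lemma index_mult_mat_sum:
  assumes "A \<in> carrier_mat n m" "B \<in> carrier_mat m p" "i < n" "j < p"
  shows "(A * B) $$ (i, j) = (\<Sum>k<m. A $$ (i, k) * B $$ (k, j))"
  using assms by (auto simp: scalar_prod_def lessThan_atLeast0 intro!: sum.cong)

lemma index_mult_vec_sum:
  assumes "A \<in> carrier_mat n m" "v \<in> carrier_vec m" "i < n"
  shows "Matrix.vec_index (A *\<^sub>v v) i = (\<Sum>k<m. A $$ (i, k) * Matrix.vec_index v k)"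
  using assms by (auto simp: scalar_prod_def lessThan_atLeast0 intro!: sum.cong)

definition mtr :: "nat \<Rightarrow> complex mat \<Rightarrow> complex"
  where "mtr d A = (\<Sum>i<d. A $$ (i, i))"

lemma mtr_mult_commute:
  assumes "A \<in> carrier_mat n m" "B \<in> carrier_mat m n"
  shows "mtr n (A * B) = mtr m (B * A)"
proof -
  have "mtr n (A * B) = (\<Sum>i<n. \<Sum>k<m. A $$ (i, k) * B $$ (k, i))"
    unfolding mtr_def using assms by (intro sum.cong refl index_mult_mat_sum) auto
  also have "\<dots> = (\<Sum>k<m. \<Sum>i<n. B $$ (k, i) * A $$ (i, k))"
    by (subst sum.swap) (simp add: mult.commute)
  also have "\<dots> = mtr m (B * A)"
    unfolding mtr_def using assms by (intro sum.cong refl index_mult_mat_sum[symmetric]) auto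
  finally show ?thesis .
qed

lemma mtr_one: "mtr d (1\<^sub>m d) = of_nat d"
  by (simp add: mtr_def)

lemma subspace_module_vec_iff:
  "VectorSpace.subspace class_ring W (module_vec TYPE(complex) d) \<longleftrightarrow>
    W \<subseteq> carrier_vec d \<and> 0\<^sub>v d \<in> W \<and> (\<forall>v\<in>W. \<forall>w\<in>W. v + w \<in> W) \<and> (\<forall>c. \<forall>v\<in>W. c \<cdot>\<^sub>v v \<in> W)"
proof -
  interpret vec_space "TYPE(complex)" d .
  have "VectorSpace.subspace class_ring W (module_vec TYPE(complex) d) \<longleftrightarrow>
        submodule class_ring W (module_vec TYPE(complex) d)"
    unfolding VectorSpace.subspace_def using vectorspace_axioms by blast
  also have "\<dots> \<longleftrightarrow> W \<subseteq> carrier_vec d \<and> 0\<^sub>v d \<in> W \<and> (\<forall>v\<in>W. \<forall>w\<in>W. v + w \<in> W) \<and>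
      (\<forall>c. \<forall>v\<in>W. c \<cdot>\<^sub>v v \<in> W)"
    unfolding submodule_def using module_axioms
    by (auto simp: module_vec_simps class_ring_simps)
  finally show ?thesis .
qed

text \<open>Linear independence with a witness: the functionals \<open>b\<close> are dual to the
  vectors \<open>a\<close>, both given by their coordinates.\<close>

definition biorthogonal :: "nat \<Rightarrow> nat \<Rightarrow> (nat \<Rightarrow> nat \<Rightarrow> complex) \<Rightarrow> (nat \<Rightarrow> nat \<Rightarrow> complex) \<Rightarrow> bool"
  where "biorthogonal d k a b \<longleftrightarrow> (\<forall>i<k. \<forall>j<k. (\<Sum>t<d. b i t * a j t) = (if i = j then 1 else 0))"

text \<open>For biorthogonal families this says that \<open>w\<close> lies in the span of
  \<open>a\<close>; the coefficients are read off by \<open>b\<close>.\<close>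

definition reconstructs :: "nat \<Rightarrow> nat \<Rightarrow> (nat \<Rightarrow> nat \<Rightarrow> complex) \<Rightarrow> (nat \<Rightarrow> nat \<Rightarrow> complex) \<Rightarrow> complex Matrix.vec \<Rightarrow> bool"
  where "reconstructs d k a b w \<longleftrightarrow>
    (\<forall>t<d. Matrix.vec_index w t = (\<Sum>j<k. (\<Sum>s<d. b j s * Matrix.vec_index w s) * a j t))"

lemma reconstructsD:
  "reconstructs d k a b w \<Longrightarrow> t < d \<Longrightarrow> Matrix.vec_index w t = (\<Sum>j<k. (\<Sum>s<d. b j s * Matrix.vec_index w s) * a j t)"
  unfolding reconstructs_def by blast

text \<open>If d < k, both families are padded with zeros to square matrices of size k. Then B * A =
  1 forces A * B = 1, but A has a zero row at index d.\<close>

lemma biorthogonal_le: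
  assumes "biorthogonal d k a b"
  shows "k \<le> d"
proof (rule ccontr)
  assume "\<not> k \<le> d"
  then have dk: "d < k" by simp
  define A where "A = mat k k (\<lambda>(t, j). if t < d then a j t else 0)"
  define B where "B = mat k k (\<lambda>(i, t). if t < d then b i t else 0)"
  have A: "A \<in> carrier_mat k k" and B: "B \<in> carrier_mat k k" by (auto simp: A_def B_def)
  have "B * A = 1\<^sub>m k"
  proof (rule eq_matI)
    fix i j assume ij: "i < dim_row (1\<^sub>m k)" "j < dim_col (1\<^sub>m k)"
    have "(B * A) $$ (i, j) = (\<Sum>t<k. B $$ (i, t) * A $$ (t, j))"
      using ij A B by (intro index_mult_mat_sum) auto
    also have "\<dots> = (\<Sum>t<d. b i t * a j t)"
      using ij dk by (intro sum.mono_neutral_cong_right) (auto simp: A_def B_def)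
    finally show "(B * A) $$ (i, j) = 1\<^sub>m k $$ (i, j)"
      using assms ij by (auto simp: biorthogonal_def)
  qed (use A B in auto)
  then have "A * B = 1\<^sub>m k" by (rule mat_mult_left_right_inverse[OF B A])
  then have "(A * B) $$ (d, d) = 1" using dk by simp
  moreover have "(A * B) $$ (d, d) = (\<Sum>t<k. A $$ (d, t) * B $$ (t, d))"
    using dk A B by (intro index_mult_mat_sum) auto
  moreover have "\<dots> = 0" using dk by (intro sum.neutral) (auto simp: A_def)
  ultimately show False by simp
qed

text \<open>A vector of W outside the span leaves a nonzero remainder, which joins the family
  together with a new functional. The length bound for biorthogonal families makes
  \<open>d - k\<close> a termination measure.\<close>

lemma biorthogonal_extend:
  fixes W :: "complex Matrix.vec set"
  assumes W: "W \<subseteq> carrier_vec d" "\<And>v w. v \<in> W \<Longrightarrow> w \<in> W \<Longrightarrow> v + w \<in> W" "\<And>c v. v \<in> W \<Longrightarrow> c \<cdot>\<^sub>v v \<in> W"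
    and "biorthogonal d k a b" "\<And>j. j < k \<Longrightarrow> Matrix.vec d (a j) \<in> W"
  shows "\<exists>K a' b'. k \<le> K \<and> (\<forall>j<k. a' j = a j \<and> b' j = b j) \<and> biorthogonal d K a' b' \<and>
    (\<forall>j<K. Matrix.vec d (a' j) \<in> W) \<and>
    (\<forall>w\<in>W. reconstructs d K a' b' w)"
  using assms(4,5)
proof (induction "d - k" arbitrary: k a b rule: less_induct)
  case less
  note bi = less.prems(1) and aW = less.prems(2)
  show ?case
  proof (cases "\<forall>w\<in>W. reconstructs d k a b w")
    case True
    then show ?thesis using bi aW by (intro exI[of _ k] exI[of _ a] exI[of _ b]) auto
  next
    case False
    then obtain w t0 where w: "w \<in> W" "t0 < d"
      "Matrix.vec_index w t0 \<noteq> (\<Sum>j<k. (\<Sum>s<d. b j s * Matrix.vec_index w s) * a j t0)" unfolding reconstructs_def by blast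
    define c where "c j = (\<Sum>s<d. b j s * Matrix.vec_index w s)" for j
    \<comment> \<open>The remainder of w after its expansion; all old functionals vanish on
      it.\<close>
    define w' where "w' t = Matrix.vec_index w t - (\<Sum>j<k. c j * a j t)" for t
    have "Matrix.vec d (\<lambda>t. Matrix.vec_index w t - (\<Sum>j<m. c j * a j t)) \<in> W" if "m \<le> k" for m
      using that
    proof (induction m)
      case 0
      have "w \<in> carrier_vec d" using w W(1) by auto
      then have "Matrix.vec d (\<lambda>t. Matrix.vec_index w t) = w" by (intro eq_vecI) auto
      then show ?case using w(1) by simp
    next
      case (Suc m)
      have "Matrix.vec d (\<lambda>t. Matrix.vec_index w t - (\<Sum>j<m. c j * a j t)) + (- c m) \<cdot>\<^sub>v Matrix.vec d (a m) \<in> W"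
        using Suc aW by (intro W(2,3)) auto
      also have "Matrix.vec d (\<lambda>t. Matrix.vec_index w t - (\<Sum>j<m. c j * a j t)) + (- c m) \<cdot>\<^sub>v Matrix.vec d (a m)
          = Matrix.vec d (\<lambda>t. Matrix.vec_index w t - (\<Sum>j<Suc m. c j * a j t))"
        by (rule eq_vecI) auto
      finally show ?case .
    qed
    then have w'W: "Matrix.vec d w' \<in> W" unfolding w'_def by blast
    have nz: "w' t0 \<noteq> 0" using w by (simp add: w'_def c_def)
    have bw: "(\<Sum>t<d. b i t * w' t) = 0" if "i < k" for i
    proof -
      have "(\<Sum>t<d. b i t * w' t) = c i - (\<Sum>t<d. \<Sum>j<k. c j * (b i t * a j t))"
        by (simp add: w'_def c_def algebra_simps sum_subtractf sum_distrib_left)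
      also have "\<dots> = c i - (\<Sum>j<k. c j * (\<Sum>t<d. b i t * a j t))"
        by (subst sum.swap) (simp add: sum_distrib_left)
      also have "\<dots> = c i - (\<Sum>j<k. c j * (if i = j then 1 else 0))"
        using bi that by (simp add: biorthogonal_def)
      also have "\<dots> = 0" using that by (simp add: if_distrib cong: if_cong)
      finally show ?thesis .
    qed
    \<comment> \<open>The coordinate functional at \<open>t0\<close>, scaled to take the value 1 on
      \<open>w'\<close> and corrected to vanish on the old vectors.\<close>
    define y where "y t = (if t = t0 then 1 / w' t0 else 0) - (\<Sum>i<k. (a i t0 / w' t0) * b i t)" for t
    have y: "(\<Sum>t<d. y t * f t) = f t0 / w' t0 - (\<Sum>i<k. (a i t0 / w' t0) * (\<Sum>t<d. b i t * f t))" for f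
    proof -
      have "(\<Sum>t<d. y t * f t) = (\<Sum>t<d. if t = t0 then f t / w' t0 else 0) - (\<Sum>t<d. \<Sum>i<k. (a i t0 / w' t0) * (b i t * f t))"
        unfolding sum_subtractf[symmetric] y_def
        by (intro sum.cong refl) (simp add: left_diff_distrib sum_distrib_right mult.assoc)
      also have "(\<Sum>t<d. \<Sum>i<k. (a i t0 / w' t0) * (b i t * f t)) = (\<Sum>i<k. (a i t0 / w' t0) * (\<Sum>t<d. b i t * f t))"
        by (subst sum.swap) (simp add: sum_distrib_left)
      finally show ?thesis using w(2) by simp
    qed
    have ya: "(\<Sum>t<d. y t * a j t) = 0" if "j < k" for j
    proof -
      have "(\<Sum>i<k. (a i t0 / w' t0) * (\<Sum>t<d. b i t * a j t)) = (\<Sum>i<k. (a i t0 / w' t0) * (if i = j then 1 else 0))"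
        using bi that by (simp add: biorthogonal_def)
      also have "\<dots> = a j t0 / w' t0" using that by (simp add: if_distrib cong: if_cong)
      finally show ?thesis by (simp add: y)
    qed
    have yw: "(\<Sum>t<d. y t * w' t) = 1" using nz bw by (simp add: y)
    define a2 where "a2 = a(k := w')"
    define b2 where "b2 = b(k := y)"
    have bi2: "biorthogonal d (Suc k) a2 b2"
      using bi bw ya yw unfolding biorthogonal_def a2_def b2_def by (auto simp: less_Suc_eq)
    have "d - Suc k < d - k" using biorthogonal_le[OF bi2] by simp
    moreover have "Matrix.vec d (a2 j) \<in> W" if "j < Suc k" for j
      using that aW w'W by (auto simp: a2_def less_Suc_eq)
    ultimately obtain K a' b' where K: "Suc k \<le> K" "\<forall>j<Suc k. a' j = a2 j \<and> b' j = b2 j" "biorthogonal d K a' b'"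
       "\<forall>j<K. Matrix.vec d (a' j) \<in> W"
       "\<forall>w\<in>W. reconstructs d K a' b' w"
      using less.hyps[OF _ bi2] by blast
    then show ?thesis
      by (intro exI[of _ K] exI[of _ a'] exI[of _ b']) (auto simp: a2_def b2_def)
  qed
qed

lemma sum_lessThan_split:
  fixes f :: "nat \<Rightarrow> 'a::comm_monoid_add"
  assumes "k \<le> d"
  shows "(\<Sum>l<d. f l) = (\<Sum>l<k. f l) + (\<Sum>l<d-k. f (k + l))"
proof -
  have eq: "{..<d} = {..<k} \<union> {k..<d}" using assms by auto
  have "(\<Sum>l<d. f l) = (\<Sum>l<k. f l) + (\<Sum>l\<in>{k..<d}. f l)"
    unfolding eq by (rule sum.union_disjoint) auto
  also have "(\<Sum>l\<in>{k..<d}. f l) = (\<Sum>l<d-k. f (k + l))"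
    using sum.shift_bounds_nat_ivl[of f 0 k "d-k"] assms by (simp add: lessThan_atLeast0 add.commute)
  finally show ?thesis .
qed

section \<open>Representations and characters\<close>

definition is_rep :: "('g, 'm) monoid_scheme \<Rightarrow> nat \<Rightarrow> ('g \<Rightarrow> complex mat) \<Rightarrow> bool"
  where "is_rep G d \<rho> \<longleftrightarrow> (\<forall>g\<in>carrier G. \<rho> g \<in> carrier_mat d d) \<and>
    (\<forall>g\<in>carrier G. \<forall>h\<in>carrier G. \<rho> (g \<otimes>\<^bsub>G\<^esub> h) = \<rho> g * \<rho> h) \<and> \<rho> \<one>\<^bsub>G\<^esub> = 1\<^sub>m d"

lemma is_repD:
  assumes "is_rep G d \<rho>"
  shows "g \<in> carrier G \<Longrightarrow> \<rho> g \<in> carrier_mat d d"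
    and "g \<in> carrier G \<Longrightarrow> h \<in> carrier G \<Longrightarrow> \<rho> (g \<otimes>\<^bsub>G\<^esub> h) = \<rho> g * \<rho> h"
    and "\<rho> \<one>\<^bsub>G\<^esub> = 1\<^sub>m d"
  using assms by (auto simp: is_rep_def)

lemma carrier_GL: "carrier (GL d) = {A \<in> carrier_mat d d. \<exists>B\<in>carrier_mat d d. B * A = 1\<^sub>m d \<and> A * B = 1\<^sub>m d}"
  by (simp add: units_of_def Units_def ring_mat_def)

lemma mult_GL: "monoid.mult (GL d) = (*)" and one_GL: "one (GL d) = 1\<^sub>m d"
  by (simp_all add: units_of_def ring_mat_def)

text \<open>A homomorphism into GL sends the identity to an invertible idempotent, which is the
  identity matrix. Conversely the image of the inverse element inverts the matrix.\<close>

lemma hom_GL_iff: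
  assumes "group G"
  shows "\<rho> \<in> hom G (GL d) \<longleftrightarrow> is_rep G d \<rho>"
proof
  interpret group G by fact
  assume h: "\<rho> \<in> hom G (GL d)"
  then have c: "\<rho> g \<in> carrier (GL d)" if "g \<in> carrier G" for g
    using that by (auto simp: hom_def)
  have m: "\<rho> (g \<otimes>\<^bsub>G\<^esub> h) = \<rho> g * \<rho> h" if "g \<in> carrier G" "h \<in> carrier G" for g h
    using h that by (auto simp: hom_def mult_GL)
  obtain B where B: "\<rho> \<one>\<^bsub>G\<^esub> \<in> carrier_mat d d" "B \<in> carrier_mat d d" "B * \<rho> \<one>\<^bsub>G\<^esub> = 1\<^sub>m d"
    using c[OF one_closed] by (auto simp: carrier_GL)
  have "\<rho> \<one>\<^bsub>G\<^esub> = (B * \<rho> \<one>\<^bsub>G\<^esub>) * \<rho> \<one>\<^bsub>G\<^esub>" using B by simp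
  also have "\<dots> = B * (\<rho> \<one>\<^bsub>G\<^esub> * \<rho> \<one>\<^bsub>G\<^esub>)" using B by (intro assoc_mult_mat) auto
  also have "\<dots> = 1\<^sub>m d" using m[of "\<one>\<^bsub>G\<^esub>" "\<one>\<^bsub>G\<^esub>"] B by simp
  finally show "is_rep G d \<rho>" using c m by (auto simp: is_rep_def carrier_GL)
next
  interpret group G by fact
  assume h: "is_rep G d \<rho>"
  have "\<rho> g \<in> carrier (GL d)" if "g \<in> carrier G" for g
  proof -
    have "\<rho> (inv\<^bsub>G\<^esub> g) * \<rho> g = 1\<^sub>m d" "\<rho> g * \<rho> (inv\<^bsub>G\<^esub> g) = 1\<^sub>m d"
      using is_repD[OF h] that by (metis inv_closed l_inv r_inv)+
    then show ?thesis using is_repD(1)[OF h] that by (auto simp: carrier_GL)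
  qed
  then show "\<rho> \<in> hom G (GL d)" using is_repD(2)[OF h] by (auto simp: hom_def mult_GL)
qed

definition irreducible_rep :: "('g, 'm) monoid_scheme \<Rightarrow> nat \<Rightarrow> ('g \<Rightarrow> complex mat) \<Rightarrow> bool"
  where "irreducible_rep G d \<rho> \<longleftrightarrow> is_rep G d \<rho> \<and> d > 0 \<and>
    (\<forall>W. W \<subseteq> carrier_vec d \<and> 0\<^sub>v d \<in> W \<and> (\<forall>v\<in>W. \<forall>w\<in>W. v + w \<in> W) \<and> (\<forall>c. \<forall>v\<in>W. c \<cdot>\<^sub>v v \<in> W) \<and>
         (\<forall>g\<in>carrier G. \<forall>w\<in>W. \<rho> g *\<^sub>v w \<in> W) \<longrightarrow> W = {0\<^sub>v d} \<or> W = carrier_vec d)"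

lemma irreps_iff:
  assumes "group G"
  shows "(d, \<rho>) \<in> irreps G \<longleftrightarrow> irreducible_rep G d \<rho>"
  using assms by (simp add: irreps_def irreducible_rep_def hom_GL_iff subspace_module_vec_iff)

lemma irreducible_repD:
  assumes "irreducible_rep G d \<rho>" "W \<subseteq> carrier_vec d" "0\<^sub>v d \<in> W"
    "\<And>v w. v \<in> W \<Longrightarrow> w \<in> W \<Longrightarrow> v + w \<in> W" "\<And>c v. v \<in> W \<Longrightarrow> c \<cdot>\<^sub>v v \<in> W"
    "\<And>g w. g \<in> carrier G \<Longrightarrow> w \<in> W \<Longrightarrow> \<rho> g *\<^sub>v w \<in> W"
  shows "W = {0\<^sub>v d} \<or> W = carrier_vec d"
  using assms(1)[unfolded irreducible_rep_def, THEN conjunct2, THEN conjunct2, THEN spec, of W]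
  by (rule mp) (use assms(2-) in simp)

text \<open>In a basis adapted to an invariant subspace the representation is block triangular, and the
  diagonal blocks are representations; no complement is needed.\<close>

lemma reducible_split:
  assumes rep: "is_rep G d \<rho>"
    and W: "W \<subseteq> carrier_vec d" "\<And>v w. v \<in> W \<Longrightarrow> w \<in> W \<Longrightarrow> v + w \<in> W" "\<And>c v. v \<in> W \<Longrightarrow> c \<cdot>\<^sub>v v \<in> W"
      "0\<^sub>v d \<in> W" "\<And>g w. g \<in> carrier G \<Longrightarrow> w \<in> W \<Longrightarrow> \<rho> g *\<^sub>v w \<in> W"
    and ne: "W \<noteq> {0\<^sub>v d}" "W \<noteq> carrier_vec d" and grp: "group G"
  shows "\<exists>k \<rho>1 \<rho>2. 0 < k \<and> k < d \<and> is_rep G k \<rho>1 \<and> is_rep G (d - k) \<rho>2 \<and>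
    (\<forall>g\<in>carrier G. mtr d (\<rho> g) = mtr k (\<rho>1 g) + mtr (d - k) (\<rho>2 g))"
proof -
  interpret group G by fact
  obtain k a b where k: "biorthogonal d k a b" "\<forall>j<k. Matrix.vec d (a j) \<in> W"
    "\<forall>w\<in>W. reconstructs d k a b w"
    using biorthogonal_extend[OF W(1-3), where k = 0 and a="\<lambda>_ _. 0" and b="\<lambda>_ _. 0"] 
    by (auto simp: biorthogonal_def)
  \<comment> \<open>The basis of W extended to the whole space; its first k vectors are those of
    W.\<close>
  obtain K a' b' where K: "k \<le> K" "\<forall>j<k. a' j = a j \<and> b' j = b j" "biorthogonal d K a' b'"
    "\<forall>w\<in>carrier_vec d. reconstructs d K a' b' w"
    using biorthogonal_extend[of "carrier_vec d" d k a b] k by auto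
  define P where "P = mat d K (\<lambda>(t, j). a' j t)"
  define Q where "Q = mat K d (\<lambda>(i, t). b' i t)"
  have P: "P \<in> carrier_mat d K" and Q: "Q \<in> carrier_mat K d" by (auto simp: P_def Q_def)
  have PQ: "P * Q = 1\<^sub>m d"
  proof (rule eq_matI)
    fix i j assume ij: "i < dim_row (1\<^sub>m d)" "j < dim_col (1\<^sub>m d)"
    have "(P * Q) $$ (i, j) = (\<Sum>l<K. P $$ (i, l) * Q $$ (l, j))"
      using ij P Q by (intro index_mult_mat_sum) auto
    also have "\<dots> = (\<Sum>l<K. (\<Sum>s<d. b' l s * Matrix.vec_index (unit_vec d j) s) * a' l i)"
    proof (intro sum.cong refl)
      fix l assume "l \<in> {..<K}"
      have "(\<Sum>s<d. b' l s * Matrix.vec_index (unit_vec d j) s) = (\<Sum>s<d. if s = j then b' l s else 0)"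
        using ij by (intro sum.cong refl) (auto simp: unit_vec_def)
      then show "P $$ (i, l) * Q $$ (l, j) = (\<Sum>s<d. b' l s * Matrix.vec_index (unit_vec d j) s) * a' l i"
        using ij \<open>l \<in> {..<K}\<close> by (simp add: P_def Q_def mult.commute)
    qed
    also have "\<dots> = Matrix.vec_index (unit_vec d j) i"
      using K(4) ij by (intro reconstructsD[symmetric, of d]) auto
    finally show "(P * Q) $$ (i, j) = 1\<^sub>m d $$ (i, j)" using ij by (auto simp: unit_vec_def)
  qed (use P Q in auto)
  have QP: "Q * P = 1\<^sub>m K"
  proof (rule eq_matI)
    fix i j assume ij: "i < dim_row (1\<^sub>m K)" "j < dim_col (1\<^sub>m K)"
    have "(Q * P) $$ (i, j) = (\<Sum>l<d. Q $$ (i, l) * P $$ (l, j))"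
      using ij P Q by (intro index_mult_mat_sum) auto
    then show "(Q * P) $$ (i, j) = 1\<^sub>m K $$ (i, j)" 
      using ij K(3) by (auto simp: biorthogonal_def P_def Q_def)
  qed (use P Q in auto)
  \<comment> \<open>\<open>P * Q\<close> and \<open>Q * P\<close> are both identity matrices, and
    their equal traces are d and K.\<close>
  have "(of_nat d :: complex) = of_nat K"
    using mtr_mult_commute[OF P Q] by (simp add: PQ QP mtr_one)
  then have Kd: "K = d" by simp
  note P = P[unfolded Kd] and Q = Q[unfolded Kd] and QP = QP[unfolded Kd] and K = K[unfolded Kd]
  define M where "M g = Q * \<rho> g * P" for g
  have Mc: "M g \<in> carrier_mat d d" if "g \<in> carrier G" for g
    using P Q is_repD(1)[OF rep that] by (simp add: M_def)
  have Mm: "M (g \<otimes>\<^bsub>G\<^esub> h) = M g * M h" if "g \<in> carrier G" "h \<in> carrier G" for g h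
  proof -
    note g = is_repD(1)[OF rep that(1)] and h = is_repD(1)[OF rep that(2)]
    have "M g * M h = Q * \<rho> g * (P * Q) * \<rho> h * P"
      unfolding M_def using P Q g h by (simp add: assoc_mult_mat[of _ d d _ d _ d])
    also have "\<dots> = Q * (\<rho> g * \<rho> h) * P" unfolding PQ
      using P Q g h by (simp add: assoc_mult_mat[of _ d d _ d _ d])
    finally show ?thesis using is_repD(2)[OF rep that] by (simp add: M_def)
  qed
  have M1: "M \<one>\<^bsub>G\<^esub> = 1\<^sub>m d" using P Q QP by (simp add: M_def is_repD(3)[OF rep])
  have Mtr: "mtr d (M g) = mtr d (\<rho> g)" if "g \<in> carrier G" for g
  proof -
    note g = is_repD(1)[OF rep that]
    have "mtr d (M g) = mtr d (P * (Q * \<rho> g))" unfolding M_def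
      using P Q g by (intro mtr_mult_commute) auto
    also have "P * (Q * \<rho> g) = \<rho> g"
      using P Q g PQ by (simp add: assoc_mult_mat[of _ d d _ d _ d, symmetric])
    finally show ?thesis .
  qed
  have kd: "k \<le> d" using K(1) by simp
  \<comment> \<open>\<open>\<rho> g\<close> maps the j-th basis vector into W, and the functionals
    with index at least k vanish on the basis of W.\<close>
  have zero: "M g $$ (i, j) = 0" if g: "g \<in> carrier G" and i: "k \<le> i" "i < d" and j: "j < k" for g i j
  proof -
    note r = is_repD(1)[OF rep g]
    define w where "w = \<rho> g *\<^sub>v Matrix.vec d (a j)"
    have wW: "w \<in> W" unfolding w_def using W(5) g k(2) j by blast
    then have w: "w \<in> carrier_vec d" using W(1) by auto
    have "M g = Q * (\<rho> g * P)" using P Q r by (simp add: M_def assoc_mult_mat[of _ d d _ d _ d])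
    then have "M g $$ (i, j) = (\<Sum>t<d. Q $$ (i, t) * (\<rho> g * P) $$ (t, j))"
      using P Q r i j kd by (simp only:) (rule index_mult_mat_sum[of _ d d _ d], auto)
    also have "\<dots> = (\<Sum>t<d. b' i t * Matrix.vec_index w t)"
    proof (intro sum.cong refl)
      fix t assume t: "t \<in> {..<d}"
      have "(\<rho> g * P) $$ (t, j) = (\<Sum>s<d. \<rho> g $$ (t, s) * P $$ (s, j))"
        using P r t j kd by (intro index_mult_mat_sum[of _ d d _ d]) auto
      also have "\<dots> = Matrix.vec_index w t"
        unfolding w_def using r t j kd K(2) by (subst index_mult_vec_sum[of _ d d]) (auto simp: P_def Kd)
      finally show "Q $$ (i, t) * (\<rho> g * P) $$ (t, j) = b' i t * Matrix.vec_index w t"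
        using i t by (simp add: Q_def Kd)
    qed
    also have "\<dots> = (\<Sum>t<d. b' i t * (\<Sum>l<k. (\<Sum>s<d. b l s * Matrix.vec_index w s) * a l t))"
      using k(3) wW by (intro sum.cong refl arg_cong2[where f="(*)"] reconstructsD) auto
    also have "\<dots> = (\<Sum>t<d. \<Sum>l<k. (\<Sum>s<d. b l s * Matrix.vec_index w s) * (b' i t * a' l t))"
      using K(2) by (intro sum.cong refl) (simp add: sum_distrib_left mult.left_commute)
    also have "\<dots> = (\<Sum>l<k. (\<Sum>s<d. b l s * Matrix.vec_index w s) * (\<Sum>t<d. b' i t * a' l t))"
      by (subst sum.swap) (simp add: sum_distrib_left)
    also have "\<dots> = 0"
      using K(3) i j kd by (intro sum.neutral) (auto simp: biorthogonal_def)
    finally show ?thesis .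
  qed
  define \<rho>1 where "\<rho>1 g = mat k k (\<lambda>(i, j). M g $$ (i, j))" for g
  define \<rho>2 where "\<rho>2 g = mat (d - k) (d - k) (\<lambda>(i, j). M g $$ (k + i, k + j))" for g
  note split = sum_lessThan_split[OF kd]
  have Mg: "M (g \<otimes>\<^bsub>G\<^esub> h) $$ (i, j) = (\<Sum>l<d. M g $$ (i, l) * M h $$ (l, j))"
    if "g \<in> carrier G" "h \<in> carrier G" "i < d" "j < d" for g h i j
    unfolding Mm[OF that(1,2)] using Mc that by (intro index_mult_mat_sum) auto
  have r1: "is_rep G k \<rho>1"
    unfolding is_rep_def
  proof (intro conjI ballI)
    fix g h assume gh: "g \<in> carrier G" "h \<in> carrier G"
    show "\<rho>1 (g \<otimes>\<^bsub>G\<^esub> h) = \<rho>1 g * \<rho>1 h"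
    proof (rule eq_matI)
      fix i j assume "i < dim_row (\<rho>1 g * \<rho>1 h)" "j < dim_col (\<rho>1 g * \<rho>1 h)"
      then have ij: "i < k" "j < k" by (auto simp: \<rho>1_def)
      have "(\<rho>1 g * \<rho>1 h) $$ (i, j) = (\<Sum>l<k. M g $$ (i, l) * M h $$ (l, j))"
        using ij by (subst index_mult_mat_sum[of _ k k _ k]) (auto simp: \<rho>1_def)
      moreover have "M (g \<otimes>\<^bsub>G\<^esub> h) $$ (i, j) = (\<Sum>l<k. M g $$ (i, l) * M h $$ (l, j))"
        using gh ij kd by (simp add: Mg split zero)
      ultimately show "\<rho>1 (g \<otimes>\<^bsub>G\<^esub> h) $$ (i, j) = (\<rho>1 g * \<rho>1 h) $$ (i, j)"
        using ij by (simp add: \<rho>1_def)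
    qed (auto simp: \<rho>1_def)
  next
    show "\<rho>1 \<one>\<^bsub>G\<^esub> = 1\<^sub>m k" using kd by (auto simp: \<rho>1_def M1 intro!: eq_matI)
  qed (simp add: \<rho>1_def)
  have r2: "is_rep G (d - k) \<rho>2"
    unfolding is_rep_def
  proof (intro conjI ballI)
    fix g h assume gh: "g \<in> carrier G" "h \<in> carrier G"
    show "\<rho>2 (g \<otimes>\<^bsub>G\<^esub> h) = \<rho>2 g * \<rho>2 h"
    proof (rule eq_matI)
      fix i j assume "i < dim_row (\<rho>2 g * \<rho>2 h)" "j < dim_col (\<rho>2 g * \<rho>2 h)"
      then have ij: "i < d - k" "j < d - k" by (auto simp: \<rho>2_def)
      have "(\<rho>2 g * \<rho>2 h) $$ (i, j) = (\<Sum>l<d-k. M g $$ (k + i, k + l) * M h $$ (k + l, k + j))"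
        using ij by (subst index_mult_mat_sum[of _ "d-k" "d-k" _ "d-k"]) (auto simp: \<rho>2_def)
      moreover have "M (g \<otimes>\<^bsub>G\<^esub> h) $$ (k + i, k + j) = (\<Sum>l<d-k. M g $$ (k + i, k + l) * M h $$ (k + l, k + j))"
        using gh ij kd by (simp add: Mg split zero)
      ultimately show "\<rho>2 (g \<otimes>\<^bsub>G\<^esub> h) $$ (i, j) = (\<rho>2 g * \<rho>2 h) $$ (i, j)"
        using ij by (simp add: \<rho>2_def)
    qed (auto simp: \<rho>2_def)
  next
    show "\<rho>2 \<one>\<^bsub>G\<^esub> = 1\<^sub>m (d - k)" using kd by (auto simp: \<rho>2_def M1 intro!: eq_matI)
  qed (simp add: \<rho>2_def)
  have tr: "mtr d (\<rho> g) = mtr k (\<rho>1 g) + mtr (d - k) (\<rho>2 g)" if "g \<in> carrier G" for g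
    using Mtr[OF that] by (simp add: mtr_def split \<rho>1_def \<rho>2_def)
  have "k \<noteq> 0"
  proof
    assume "k = 0"
    have "w = 0\<^sub>v d" if "w \<in> W" for w
      using reconstructsD[of d 0 a b w] k(3) that W(1) \<open>k = 0\<close> by (intro eq_vecI) auto
    then show False using ne(1) W(4) by blast
  qed
  moreover have "k \<noteq> d"
  proof
    assume "k = d"
    have "w \<in> W" if w: "w \<in> carrier_vec d" for w
    proof -
      have "Matrix.vec d (\<lambda>t. \<Sum>j<m. (\<Sum>s<d. b j s * Matrix.vec_index w s) * a j t) \<in> W" if "m \<le> k" for m
        using that
      proof (induction m)
        case 0
        then show ?case using W(4) by (simp add: zero_vec_def)
      next
        case (Suc m)
        have "Matrix.vec d (\<lambda>t. \<Sum>j<m. (\<Sum>s<d. b j s * Matrix.vec_index w s) * a j t) +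
           (\<Sum>s<d. b m s * Matrix.vec_index w s) \<cdot>\<^sub>v Matrix.vec d (a m) \<in> W"
          using Suc k(2) by (intro W(2,3)) auto
        also have "Matrix.vec d (\<lambda>t. \<Sum>j<m. (\<Sum>s<d. b j s * Matrix.vec_index w s) * a j t) +
           (\<Sum>s<d. b m s * Matrix.vec_index w s) \<cdot>\<^sub>v Matrix.vec d (a m) =
           Matrix.vec d (\<lambda>t. \<Sum>j<Suc m. (\<Sum>s<d. b j s * Matrix.vec_index w s) * a j t)"
          by (rule eq_vecI) auto
        finally show ?case .
      qed
      from this[of k] have "Matrix.vec d (\<lambda>t. \<Sum>j<k. (\<Sum>s<d. b j s * Matrix.vec_index w s) * a j t) \<in> W" by simp
      also have "Matrix.vec d (\<lambda>t. \<Sum>j<k. (\<Sum>s<d. b j s * Matrix.vec_index w s) * a j t) = w"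
      proof (rule eq_vecI)
        fix t assume "t < dim_vec w"
        then have t: "t < d" using w by auto
        have "(\<Sum>j<d. (\<Sum>s<d. b j s * Matrix.vec_index w s) * a j t) = (\<Sum>j<d. (\<Sum>s<d. b' j s * Matrix.vec_index w s) * a' j t)"
          using K(2) \<open>k = d\<close> by (intro sum.cong refl) auto
        also have "\<dots> = Matrix.vec_index w t"
          using K(4) w t by (intro reconstructsD[symmetric, of d]) (auto simp: Kd)
        finally show "Matrix.vec_index (Matrix.vec d (\<lambda>t. \<Sum>j<k. (\<Sum>s<d. b j s * Matrix.vec_index w s) * a j t)) t = Matrix.vec_index w t"
          using t \<open>k = d\<close> by simp
      qed (use w in auto)
      finally show ?thesis .
    qed
    then show False using ne(2) W(1) by blast
  qed
  ultimately show ?thesis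
    using kd r1 r2 tr by (intro exI[of _ k] exI[of _ \<rho>1] exI[of _ \<rho>2]) auto
qed

lemma mat_eq_if_mult_vec_eq:
  assumes "A \<in> carrier_mat n m" "B \<in> carrier_mat n m" "\<And>v. v \<in> carrier_vec m \<Longrightarrow> A *\<^sub>v v = B *\<^sub>v v"
  shows "A = (B :: complex mat)"
proof (rule eq_matI)
  fix i j assume "i < dim_row B" "j < dim_col B"
  then have ij: "i < n" "j < m" using assms by auto
  have "Matrix.vec_index (C *\<^sub>v unit_vec m j) i = C $$ (i, j)" if "C \<in> carrier_mat n m" for C :: "complex mat"
  proof -
    have "Matrix.vec_index (C *\<^sub>v unit_vec m j) i = (\<Sum>k<m. if k = j then C $$ (i, k) else 0)"
      using that ij by (subst index_mult_vec_sum[of _ n m]) (auto simp: unit_vec_def if_distrib cong: if_cong)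
    then show ?thesis using ij by simp
  qed
  then show "A $$ (i, j) = B $$ (i, j)" using assms by (metis unit_vec_carrier)
qed (use assms in auto)

lemma zero_mat_mult_vec: "v \<in> carrier_vec d \<Longrightarrow> 0\<^sub>m e d *\<^sub>v v = (0\<^sub>v e :: complex Matrix.vec)"
  by (rule eq_vecI) auto

lemma smult_one_mult_vec:
  assumes "v \<in> carrier_vec d"
  shows "(c \<cdot>\<^sub>m 1\<^sub>m d) *\<^sub>v v = c \<cdot>\<^sub>v (v :: complex Matrix.vec)"
proof (rule eq_vecI)
  fix i assume "i < dim_vec (c \<cdot>\<^sub>v v)"
  then have i: "i < d" using assms by simp
  have "Matrix.vec_index ((c \<cdot>\<^sub>m 1\<^sub>m d) *\<^sub>v v) i = (\<Sum>k<d. (c \<cdot>\<^sub>m 1\<^sub>m d) $$ (i, k) * Matrix.vec_index v k)"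
    using assms i by (intro index_mult_vec_sum) auto
  also have "\<dots> = (\<Sum>k<d. if k = i then c * Matrix.vec_index v k else 0)"
    using i by (intro sum.cong refl) auto
  finally show "Matrix.vec_index ((c \<cdot>\<^sub>m 1\<^sub>m d) *\<^sub>v v) i = Matrix.vec_index (c \<cdot>\<^sub>v v) i"
    using assms i by simp
qed (use assms in auto)

text \<open>Kernel and image of T are invariant, so T is injective and surjective. A right inverse
  is assembled from preimages of the unit vectors, injectivity makes it a left inverse, and the
  traces of the two products give e = d.\<close>

lemma schur_iso:
  assumes rho: "irreducible_rep G d \<rho>" and sigma: "irreducible_rep G e \<sigma>"
    and T: "T \<in> carrier_mat e d" and comm: "\<And>g. g \<in> carrier G \<Longrightarrow> T * \<rho> g = \<sigma> g * T"
    and nz: "T \<noteq> 0\<^sub>m e d"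
  shows "e = d \<and> T \<in> carrier (GL d)"
proof -
  have rc: "\<rho> g \<in> carrier_mat d d" and sc: "\<sigma> g \<in> carrier_mat e e" if "g \<in> carrier G" for g
    using rho sigma that by (auto simp: irreducible_rep_def is_rep_def)
  define W where "W = {v \<in> carrier_vec d. T *\<^sub>v v = 0\<^sub>v e}"
  have "W = {0\<^sub>v d} \<or> W = carrier_vec d"
  proof (rule irreducible_repD[OF rho])
    fix g w assume g: "g \<in> carrier G" and w: "w \<in> W"
    have "T *\<^sub>v (\<rho> g *\<^sub>v w) = (T * \<rho> g) *\<^sub>v w"
      using T rc[OF g] w by (auto simp: W_def assoc_mult_mat_vec[of _ e d _ d])
    also have "\<dots> = \<sigma> g *\<^sub>v (T *\<^sub>v w)"
      unfolding comm[OF g] using T sc[OF g] w by (auto simp: W_def assoc_mult_mat_vec[of _ e e _ d])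
    also have "\<dots> = 0\<^sub>v e" using sc[OF g] w by (auto simp: W_def)
    finally show "\<rho> g *\<^sub>v w \<in> W" using rc[OF g] w by (auto simp: W_def)
  qed (use T in \<open>auto simp: W_def mult_add_distrib_mat_vec mult_mat_vec\<close>)
  moreover have "W \<noteq> carrier_vec d"
  proof
    assume W: "W = carrier_vec d"
    have "T = 0\<^sub>m e d"
      by (rule mat_eq_if_mult_vec_eq[OF T]) (use W T in \<open>auto simp: W_def zero_mat_mult_vec\<close>)
    then show False using nz by simp
  qed
  ultimately have W: "W = {0\<^sub>v d}" by simp
  define W' where "W' = (\<lambda>v. T *\<^sub>v v) ` carrier_vec d"
  have "W' = {0\<^sub>v e} \<or> W' = carrier_vec e"
  proof (rule irreducible_repD[OF sigma])
    fix g w assume g: "g \<in> carrier G" and w: "w \<in> W'"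
    then obtain v where v: "v \<in> carrier_vec d" "w = T *\<^sub>v v" by (auto simp: W'_def)
    have "\<sigma> g *\<^sub>v w = T *\<^sub>v (\<rho> g *\<^sub>v v)"
      using T sc[OF g] rc[OF g] v comm[OF g]
      by (metis assoc_mult_mat_vec)
    then show "\<sigma> g *\<^sub>v w \<in> W'" using rc[OF g] v by (auto simp: W'_def)
  next
    fix v w assume "v \<in> W'" "w \<in> W'"
    then obtain v' w' where "v' \<in> carrier_vec d" "v = T *\<^sub>v v'" "w' \<in> carrier_vec d" "w = T *\<^sub>v w'" by (auto simp: W'_def)
    then have "v + w = T *\<^sub>v (v' + w')" "v' + w' \<in> carrier_vec d"
      using T by (auto simp: mult_add_distrib_mat_vec)
    then show "v + w \<in> W'" by (auto simp: W'_def)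
  next
    fix c v assume "v \<in> W'"
    then obtain v' where "v' \<in> carrier_vec d" "v = T *\<^sub>v v'" by (auto simp: W'_def)
    then have "c \<cdot>\<^sub>v v = T *\<^sub>v (c \<cdot>\<^sub>v v')" "c \<cdot>\<^sub>v v' \<in> carrier_vec d"
      using T by (auto simp: mult_mat_vec)
    then show "c \<cdot>\<^sub>v v \<in> W'" by (auto simp: W'_def)
  next
    have "0\<^sub>v e = T *\<^sub>v 0\<^sub>v d" using T by auto
    then show "0\<^sub>v e \<in> W'" by (auto simp: W'_def)
  qed (use T in \<open>auto simp: W'_def\<close>)
  moreover have "W' \<noteq> {0\<^sub>v e}"
  proof
    assume W': "W' = {0\<^sub>v e}"
    have "T = 0\<^sub>m e d"
    proof (rule mat_eq_if_mult_vec_eq[OF T])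
      fix v :: "complex Matrix.vec" assume v: "v \<in> carrier_vec d"
      then have "T *\<^sub>v v \<in> W'" by (simp add: W'_def)
      then show "T *\<^sub>v v = 0\<^sub>m e d *\<^sub>v v" using W' v by (simp add: zero_mat_mult_vec)
    qed simp
    then show False using nz by simp
  qed
  ultimately have "W' = carrier_vec e" by simp
  then have "\<forall>i. \<exists>s. s \<in> carrier_vec d \<and> T *\<^sub>v s = unit_vec e i"
    unfolding W'_def by (metis (no_types, lifting) imageE unit_vec_carrier)
  then obtain s where s: "\<And>i. s i \<in> carrier_vec d" "\<And>i. T *\<^sub>v s i = unit_vec e i" by metis
  define S where "S = mat d e (\<lambda>(t, i). Matrix.vec_index (s i) t)"
  have S: "S \<in> carrier_mat d e" by (simp add: S_def)
  have TS: "T * S = 1\<^sub>m e"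
  proof (rule eq_matI)
    fix i j assume ij: "i < dim_row (1\<^sub>m e)" "j < dim_col (1\<^sub>m e)"
    have "(T * S) $$ (i, j) = (\<Sum>k<d. T $$ (i, k) * S $$ (k, j))"
      using T S ij by (intro index_mult_mat_sum) auto
    also have "\<dots> = Matrix.vec_index (T *\<^sub>v s j) i"
      using T s(1)[of j] ij by (subst index_mult_vec_sum[of _ e d]) (auto simp: S_def)
    finally show "(T * S) $$ (i, j) = 1\<^sub>m e $$ (i, j)" using ij by (auto simp: s(2) unit_vec_def)
  qed (use T S in auto)
  have ST: "S * T = 1\<^sub>m d"
  proof (rule mat_eq_if_mult_vec_eq)
    fix v :: "complex Matrix.vec" assume v: "v \<in> carrier_vec d"
    have c: "S *\<^sub>v (T *\<^sub>v v) \<in> carrier_vec d" using S T v by auto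
    have "T *\<^sub>v (S *\<^sub>v (T *\<^sub>v v)) = (T * S) *\<^sub>v (T *\<^sub>v v)"
      using T S v by (intro assoc_mult_mat_vec[symmetric]) auto
    then have "T *\<^sub>v (S *\<^sub>v (T *\<^sub>v v)) = T *\<^sub>v v" using T v by (simp add: TS)
    then have "T *\<^sub>v (S *\<^sub>v (T *\<^sub>v v) - v) = 0\<^sub>v e"
      using T v c by (subst mult_minus_distrib_mat_vec) auto
    then have "S *\<^sub>v (T *\<^sub>v v) - v \<in> W" using c v by (auto simp: W_def)
    then have z: "S *\<^sub>v (T *\<^sub>v v) - v = 0\<^sub>v d" using W by simp
    have "S *\<^sub>v (T *\<^sub>v v) = v"
    proof (rule eq_vecI)
      fix i assume i: "i < dim_vec v"
      have "Matrix.vec_index (S *\<^sub>v (T *\<^sub>v v) - v) i = 0" unfolding z using i v by auto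
      then show "Matrix.vec_index (S *\<^sub>v (T *\<^sub>v v)) i = Matrix.vec_index v i"
        using i by (simp del: index_mult_mat_vec)
    qed (use c v S in auto)
    then show "(S * T) *\<^sub>v v = 1\<^sub>m d *\<^sub>v v" using S T v by (subst assoc_mult_mat_vec) auto
  qed (use S T in auto)
  have "(of_nat e :: complex) = of_nat d"
    using mtr_mult_commute[OF T S] by (simp add: TS ST mtr_one)
  then have "e = d" by simp
  then show ?thesis using T S TS ST by (auto simp: carrier_GL)
qed

text \<open>Over the complex numbers T has an eigenvalue c. The matrix T - c also commutes with the
  representation and kills an eigenvector, so it is not invertible and must be zero.\<close>

lemma schur_scalar:
  assumes rho: "irreducible_rep G d \<rho>"
    and T: "T \<in> carrier_mat d d" and comm: "\<And>g. g \<in> carrier G \<Longrightarrow> T * \<rho> g = \<rho> g * T"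
  shows "\<exists>c. T = c \<cdot>\<^sub>m 1\<^sub>m d"
proof -
  have rc: "\<rho> g \<in> carrier_mat d d" if "g \<in> carrier G" for g
    using rho that by (auto simp: irreducible_rep_def is_rep_def)
  have "d > 0" using rho by (simp add: irreducible_rep_def)
  then obtain c v where v: "v \<in> carrier_vec d" "v \<noteq> 0\<^sub>v d" "T *\<^sub>v v = c \<cdot>\<^sub>v v"
    using spectrum_non_empty[OF T] T by (auto simp: spectrum_def eigenvalue_def eigenvector_def)
  define U where "U = T + (- c) \<cdot>\<^sub>m 1\<^sub>m d"
  have U: "U \<in> carrier_mat d d" using T by (simp add: U_def)
  have Uc: "U * \<rho> g = \<rho> g * U" if g: "g \<in> carrier G" for g
  proof -
    have "U * \<rho> g = T * \<rho> g + (- c) \<cdot>\<^sub>m \<rho> g"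
      unfolding U_def using T rc[OF g]
      by (subst add_mult_distrib_mat[of _ d d _ _ d]) (auto simp: mult_smult_assoc_mat[of _ d d _ d])
    moreover have "\<rho> g * U = \<rho> g * T + (- c) \<cdot>\<^sub>m \<rho> g"
      unfolding U_def using T rc[OF g]
      by (subst mult_add_distrib_mat[of _ d d _ d]) (auto simp: mult_smult_distrib[of _ d d _ d])
    ultimately show ?thesis using comm[OF g] by simp
  qed
  have Uv: "U *\<^sub>v v = 0\<^sub>v d"
  proof -
    have "U *\<^sub>v v = T *\<^sub>v v + (- c) \<cdot>\<^sub>v v"
    proof -
      have "((- c) \<cdot>\<^sub>m 1\<^sub>m d) *\<^sub>v v = (- c) \<cdot>\<^sub>v v" 
        using v(1) by (rule smult_one_mult_vec)
      then show ?thesis unfolding U_def using T v(1) by (subst add_mult_distrib_mat_vec[of _ d d]) auto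
    qed
    then show ?thesis using v by (auto intro!: eq_vecI)
  qed
  have "U = 0\<^sub>m d d"
  proof (rule ccontr)
    assume "U \<noteq> 0\<^sub>m d d"
    from schur_iso[OF rho rho U Uc this] obtain B where B: "B \<in> carrier_mat d d" "B * U = 1\<^sub>m d"
      by (auto simp: carrier_GL)
    have "v = (B * U) *\<^sub>v v" using B v by simp
    also have "\<dots> = B *\<^sub>v (U *\<^sub>v v)" using B U v by (intro assoc_mult_mat_vec) auto
    also have "\<dots> = 0\<^sub>v d" using Uv B by auto
    finally show False using v by simp
  qed
  have "T = c \<cdot>\<^sub>m 1\<^sub>m d"
  proof (rule eq_matI)
    fix i j assume ij: "i < dim_row (c \<cdot>\<^sub>m 1\<^sub>m d)" "j < dim_col (c \<cdot>\<^sub>m 1\<^sub>m d)"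
    have "U $$ (i, j) = 0" using \<open>U = 0\<^sub>m d d\<close> ij by simp
    then show "T $$ (i, j) = (c \<cdot>\<^sub>m 1\<^sub>m d) $$ (i, j)" using T ij by (simp add: U_def)
  qed (use T in auto)
  then show ?thesis by blast
qed

section \<open>Characters and their orthogonality relations\<close>

definition rchar :: "('g, 'm) monoid_scheme \<Rightarrow> nat \<Rightarrow> ('g \<Rightarrow> complex mat) \<Rightarrow> 'g \<Rightarrow> complex"
  where "rchar G d \<rho> = restrict (\<lambda>g. mtr d (\<rho> g)) (carrier G)"

text \<open>Since \<open>rchar\<close> is restricted to the carrier, two characters are equal as
  functions exactly if they agree on G, and the elements of this set count isomorphism
  classes.\<close>

definition irr_chars :: "('g, 'm) monoid_scheme \<Rightarrow> ('g \<Rightarrow> complex) set"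
  where "irr_chars G = {rchar G d \<rho> | d \<rho>. irreducible_rep G d \<rho>}"

text \<open>The value at the inverse stands in for the complex conjugate. This keeps the form
  bilinear and the orthogonality relations purely algebraic.\<close>

definition cinner :: "('g, 'm) monoid_scheme \<Rightarrow> ('g \<Rightarrow> complex) \<Rightarrow> ('g \<Rightarrow> complex) \<Rightarrow> complex"
  where "cinner G f h = (\<Sum>g\<in>carrier G. f g * h (inv\<^bsub>G\<^esub> g)) / of_nat (order G)"

locale fin_group = group G for G (structure) +
  assumes fin: "finite (carrier G)"
begin

lemma order_pos: "order G > 0"
  using fin by (simp add: order_def card_gt_0_iff) (use one_closed in blast)

lemma sum_translate:
  assumes "h \<in> carrier G"
  shows "(\<Sum>g\<in>carrier G. f (h \<otimes> g)) = (\<Sum>g\<in>carrier G. f g)"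
proof (rule sum.reindex_bij_betw)
  show "bij_betw (\<lambda>g. h \<otimes> g) (carrier G) (carrier G)"
    by (rule bij_betw_byWitness[where f'="\<lambda>g. inv h \<otimes> g"]) (use assms in \<open>auto simp: m_assoc[symmetric]\<close>)
qed

text \<open>The sum of \<open>\<sigma> g * E * \<rho> (inv g)\<close> over the group, where E is the
  matrix unit with its entry 1 at (k, l).\<close>

definition average :: "nat \<Rightarrow> nat \<Rightarrow> ('a \<Rightarrow> complex mat) \<Rightarrow> ('a \<Rightarrow> complex mat) \<Rightarrow> nat \<Rightarrow> nat \<Rightarrow> complex mat"
  where "average e d \<sigma> \<rho> k l = mat e d (\<lambda>(i, j). \<Sum>g\<in>carrier G. \<sigma> g $$ (i, k) * \<rho> (inv g) $$ (l, j))"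

text \<open>Substitute \<open>h \<otimes> g\<close> for \<open>g\<close> in the sum.\<close>

lemma average_intertwines:
  assumes rho: "is_rep G d \<rho>" and sigma: "is_rep G e \<sigma>" and h: "h \<in> carrier G" and kl: "k < e" "l < d"
  shows "average e d \<sigma> \<rho> k l * \<rho> h = \<sigma> h * average e d \<sigma> \<rho> k l"
proof (rule eq_matI)
  note rc = is_repD(1)[OF rho] and sc = is_repD(1)[OF sigma]
  let ?T = "average e d \<sigma> \<rho> k l"
  have T: "?T \<in> carrier_mat e d" by (simp add: average_def)
  fix i j assume "i < dim_row (\<sigma> h * ?T)" "j < dim_col (\<sigma> h * ?T)"
  then have ij: "i < e" "j < d" using sc[OF h] T by auto
  have "(?T * \<rho> h) $$ (i, j) = (\<Sum>m<d. (\<Sum>g\<in>carrier G. \<sigma> g $$ (i, k) * \<rho> (inv g) $$ (l, m)) * \<rho> h $$ (m, j))"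
    using ij T rc[OF h] by (subst index_mult_mat_sum[of _ e d _ d]) (auto simp: average_def)
  also have "\<dots> = (\<Sum>g\<in>carrier G. \<sigma> g $$ (i, k) * (\<Sum>m<d. \<rho> (inv g) $$ (l, m) * \<rho> h $$ (m, j)))"
    by (simp add: sum_distrib_left sum_distrib_right mult.assoc) (rule sum.swap)
  also have "\<dots> = (\<Sum>g\<in>carrier G. \<sigma> g $$ (i, k) * \<rho> (inv g \<otimes> h) $$ (l, j))"
    using h kl ij by (intro sum.cong refl) (simp add: is_repD(2)[OF rho] index_mult_mat_sum[OF rc rc] del: index_mult_mat)
  also have "\<dots> = (\<Sum>g\<in>carrier G. \<sigma> (h \<otimes> g) $$ (i, k) * \<rho> (inv (h \<otimes> g) \<otimes> h) $$ (l, j))"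
    by (rule sum_translate[OF h, symmetric])
  also have "\<dots> = (\<Sum>g\<in>carrier G. (\<Sum>m<e. \<sigma> h $$ (i, m) * \<sigma> g $$ (m, k)) * \<rho> (inv g) $$ (l, j))"
  proof (intro sum.cong refl)
    fix g assume g: "g \<in> carrier G"
    have "inv (h \<otimes> g) \<otimes> h = inv g" using g h by (simp add: inv_mult_group m_assoc)
    then show "\<sigma> (h \<otimes> g) $$ (i, k) * \<rho> (inv (h \<otimes> g) \<otimes> h) $$ (l, j) = (\<Sum>m<e. \<sigma> h $$ (i, m) * \<sigma> g $$ (m, k)) * \<rho> (inv g) $$ (l, j)"
      using g h kl ij by (simp add: is_repD(2)[OF sigma] index_mult_mat_sum[OF sc sc] del: index_mult_mat)
  qed
  also have "\<dots> = (\<Sum>m<e. \<sigma> h $$ (i, m) * (\<Sum>g\<in>carrier G. \<sigma> g $$ (m, k) * \<rho> (inv g) $$ (l, j)))"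
    by (simp add: sum_distrib_left sum_distrib_right mult.assoc) (rule sum.swap)
  also have "\<dots> = (\<sigma> h * ?T) $$ (i, j)"
    using ij T sc[OF h] by (subst index_mult_mat_sum[of _ e e _ d]) (auto simp: average_def)
  finally show "(?T * \<rho> h) $$ (i, j) = (\<sigma> h * ?T) $$ (i, j)" .
qed (use is_repD(1)[OF rho h] is_repD(1)[OF sigma h] in \<open>auto simp: average_def\<close>)

lemma sum_chars_eq_average:
  shows "(\<Sum>g\<in>carrier G. mtr e (\<sigma> g) * mtr d (\<rho> (inv g))) = (\<Sum>i<e. \<Sum>l<d. average e d \<sigma> \<rho> i l $$ (i, l))"
proof -
  have "(\<Sum>g\<in>carrier G. mtr e (\<sigma> g) * mtr d (\<rho> (inv g))) =
    (\<Sum>g\<in>carrier G. \<Sum>i<e. \<Sum>l<d. \<sigma> g $$ (i, i) * \<rho> (inv g) $$ (l, l))"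
    by (simp add: mtr_def sum_product)
  also have "\<dots> = (\<Sum>i<e. \<Sum>g\<in>carrier G. \<Sum>l<d. \<sigma> g $$ (i, i) * \<rho> (inv g) $$ (l, l))" by (rule sum.swap)
  also have "\<dots> = (\<Sum>i<e. \<Sum>l<d. \<Sum>g\<in>carrier G. \<sigma> g $$ (i, i) * \<rho> (inv g) $$ (l, l))"
    by (intro sum.cong refl sum.swap)
  finally show ?thesis by (simp add: average_def)
qed

text \<open>The averages intertwine two irreducible representations that are not isomorphic, so all
  of them vanish, and the sum is made of their entries.\<close>

lemma sum_chars_eq_0:
  assumes rho: "irreducible_rep G d \<rho>" and sigma: "irreducible_rep G e \<sigma>"
    and noniso: "\<not> (d = e \<and> (\<exists>T\<in>carrier (GL d). \<forall>g\<in>carrier G. T * \<rho> g = \<sigma> g * T))"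
  shows "(\<Sum>g\<in>carrier G. mtr e (\<sigma> g) * mtr d (\<rho> (inv g))) = 0"
proof -
  have rho': "is_rep G d \<rho>" and sigma': "is_rep G e \<sigma>" using rho sigma by (auto simp: irreducible_rep_def)
  have "average e d \<sigma> \<rho> k l = 0\<^sub>m e d" if "k < e" "l < d" for k l
  proof (rule ccontr)
    assume nz: "average e d \<sigma> \<rho> k l \<noteq> 0\<^sub>m e d"
    have "average e d \<sigma> \<rho> k l \<in> carrier_mat e d" by (simp add: average_def)
    from schur_iso[OF rho sigma this average_intertwines[OF rho' sigma'] nz] that
    have "e = d" "average e d \<sigma> \<rho> k l \<in> carrier (GL d)" by auto
    then show False using noniso average_intertwines[OF rho' sigma' _ that] by auto
  qed
  then show ?thesis unfolding sum_chars_eq_average by (intro sum.neutral ballI) auto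
qed

text \<open>Now the averages are scalar matrices, and only those of the d diagonal matrix units
  contribute, each with |G| / d.\<close>

lemma sum_chars_self:
  assumes rho: "irreducible_rep G d \<rho>"
  shows "(\<Sum>g\<in>carrier G. mtr d (\<rho> g) * mtr d (\<rho> (inv g))) = of_nat (order G)"
proof -
  have rho': "is_rep G d \<rho>" and d: "d > 0" using rho by (auto simp: irreducible_rep_def)
  note rc = is_repD(1)[OF rho']
  have entry: "average d d \<rho> \<rho> i l $$ (i, l) = (if i = l then of_nat (order G) / of_nat d else 0)"
    if il: "i < d" "l < d" for i l
  proof -
    have Tc: "average d d \<rho> \<rho> i l \<in> carrier_mat d d" by (simp add: average_def)
    obtain c where c: "average d d \<rho> \<rho> i l = c \<cdot>\<^sub>m 1\<^sub>m d"
      using schur_scalar[OF rho Tc average_intertwines[OF rho' rho' _ il]] by auto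
    \<comment> \<open>The scalar is found from the trace: summing over the diagonal first turns each
      term into an entry of \<open>\<rho> (inv g) * \<rho> g\<close>, the identity matrix.\<close>
    have "of_nat d * c = mtr d (average d d \<rho> \<rho> i l)" by (simp add: c mtr_def)
    also have "\<dots> = (\<Sum>g\<in>carrier G. \<Sum>m<d. \<rho> g $$ (m, i) * \<rho> (inv g) $$ (l, m))"
      by (simp add: mtr_def average_def) (rule sum.swap)
    also have "\<dots> = (\<Sum>g\<in>carrier G. (\<rho> (inv g) * \<rho> g) $$ (l, i))"
      using il by (intro sum.cong refl) (simp add: index_mult_mat_sum[OF rc rc] mult.commute del: index_mult_mat)
    also have "\<dots> = (\<Sum>g\<in>carrier G. 1\<^sub>m d $$ (l, i))"
      by (intro sum.cong refl) (simp add: is_repD(2)[OF rho', symmetric] is_repD(3)[OF rho'] del: index_mult_mat)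
    also have "\<dots> = (if i = l then of_nat (order G) else 0)" using il by (auto simp: order_def)
    finally have "c = (if i = l then of_nat (order G) else 0) / of_nat d" using d by (auto simp: field_simps)
    then show ?thesis using il by (simp add: c)
  qed
  have "(\<Sum>g\<in>carrier G. mtr d (\<rho> g) * mtr d (\<rho> (inv g))) =
     (\<Sum>i<d. \<Sum>l<d. if i = l then of_nat (order G) / of_nat d else 0)"
    unfolding sum_chars_eq_average by (intro sum.cong refl entry) auto
  also have "\<dots> = of_nat (order G)" using d by simp
  finally show ?thesis .
qed

lemma cinner_cong:
  assumes "\<And>g. g \<in> carrier G \<Longrightarrow> f g = f' g" "\<And>g. g \<in> carrier G \<Longrightarrow> h g = h' g"
  shows "cinner G f h = cinner G f' h'"
  unfolding cinner_def using assms by (intro arg_cong2[where f="(/)"] sum.cong refl) auto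

lemma rchar_apply: "g \<in> carrier G \<Longrightarrow> rchar G d \<rho> g = mtr d (\<rho> g)"
  by (simp add: rchar_def)

lemma rchar_one: "is_rep G d \<rho> \<Longrightarrow> rchar G d \<rho> \<one> = of_nat d"
  by (simp add: rchar_apply is_repD(3) mtr_one)

lemma rchar_eq_if_iso:
  assumes rho: "is_rep G d \<rho>" and sigma: "is_rep G d \<sigma>" and T: "T \<in> carrier (GL d)"
    and comm: "\<And>g. g \<in> carrier G \<Longrightarrow> T * \<rho> g = \<sigma> g * T"
  shows "rchar G d \<rho> = rchar G d \<sigma>"
proof -
  obtain B where B: "T \<in> carrier_mat d d" "B \<in> carrier_mat d d" "B * T = 1\<^sub>m d" "T * B = 1\<^sub>m d"
    using T by (auto simp: carrier_GL)
  have "mtr d (\<rho> g) = mtr d (\<sigma> g)" if g: "g \<in> carrier G" for g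
  proof -
    note c = is_repD(1)[OF rho g] is_repD(1)[OF sigma g]
    have "mtr d (\<sigma> g) = mtr d (\<sigma> g * (T * B))" using B c by simp
    also have "\<sigma> g * (T * B) = \<sigma> g * T * B" using B c by (intro assoc_mult_mat[symmetric]) auto
    also have "\<dots> = T * \<rho> g * B" by (simp add: comm[OF g])
    also have "mtr d (T * \<rho> g * B) = mtr d (B * (T * \<rho> g))" using B c by (intro mtr_mult_commute) auto
    also have "B * (T * \<rho> g) = B * T * \<rho> g" using B c by (intro assoc_mult_mat[symmetric]) auto
    also have "\<dots> = \<rho> g" using B c by simp
    finally show ?thesis by simp
  qed
  then show ?thesis by (auto simp: rchar_def intro!: restrict_ext)
qed

lemma cinner_rchar:
  "cinner G (rchar G e \<sigma>) (rchar G d \<rho>) = (\<Sum>g\<in>carrier G. mtr e (\<sigma> g) * mtr d (\<rho> (inv g))) / of_nat (order G)"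
  unfolding cinner_def by (intro arg_cong2[where f="(/)"] sum.cong refl) (auto simp: rchar_apply)

text \<open>If two irreducible representations without an isomorphism shared a character, its norm
  would be 0 and 1 at once.\<close>

lemma iso_iff_rchar_eq:
  assumes rho: "irreducible_rep G d \<rho>" and sigma: "irreducible_rep G e \<sigma>"
  shows "(d = e \<and> (\<exists>T\<in>carrier (GL d). \<forall>g\<in>carrier G. T * \<rho> g = \<sigma> g * T)) \<longleftrightarrow> rchar G d \<rho> = rchar G e \<sigma>"
proof
  assume "d = e \<and> (\<exists>T\<in>carrier (GL d). \<forall>g\<in>carrier G. T * \<rho> g = \<sigma> g * T)"
  then show "rchar G d \<rho> = rchar G e \<sigma>"
    using rchar_eq_if_iso[of d \<rho> \<sigma>] rho sigma by (auto simp: irreducible_rep_def)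
next
  assume eq: "rchar G d \<rho> = rchar G e \<sigma>"
  show "d = e \<and> (\<exists>T\<in>carrier (GL d). \<forall>g\<in>carrier G. T * \<rho> g = \<sigma> g * T)"
  proof (rule ccontr)
    assume "\<not> ?thesis"
    from sum_chars_eq_0[OF rho sigma this] have "cinner G (rchar G d \<rho>) (rchar G d \<rho>) = 0"
      by (subst eq) (simp add: cinner_rchar)
    moreover have "cinner G (rchar G d \<rho>) (rchar G d \<rho>) = 1"
      unfolding cinner_rchar sum_chars_self[OF rho] using order_pos by simp
    ultimately show False by simp
  qed
qed

lemma cinner_irr_chars:
  assumes "\<theta> \<in> irr_chars G" "\<psi> \<in> irr_chars G"
  shows "cinner G \<theta> \<psi> = (if \<theta> = \<psi> then 1 else 0)"
proof -
  obtain d \<rho> where \<psi>: "\<psi> = rchar G d \<rho>" "irreducible_rep G d \<rho>" using assms by (auto simp: irr_chars_def)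
  obtain e \<sigma> where \<theta>: "\<theta> = rchar G e \<sigma>" "irreducible_rep G e \<sigma>" using assms by (auto simp: irr_chars_def)
  show ?thesis
  proof (cases "\<theta> = \<psi>")
    case True
    have "cinner G \<psi> \<psi> = 1" unfolding \<psi>(1) cinner_rchar sum_chars_self[OF \<psi>(2)] using order_pos by simp
    then show ?thesis using True by simp
  next
    case False
    then have "\<not> (d = e \<and> (\<exists>T\<in>carrier (GL d). \<forall>g\<in>carrier G. T * \<rho> g = \<sigma> g * T))"
      using iso_iff_rchar_eq[OF \<psi>(2) \<theta>(2)] \<psi>(1) \<theta>(1) by auto
    from sum_chars_eq_0[OF \<psi>(2) \<theta>(2) this] show ?thesis using False by (simp add: \<theta>(1) \<psi>(1) cinner_rchar)
  qed
qed

end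

section \<open>Decomposition of representations and the regular representation\<close>

context fin_group
begin

text \<open>Induction on the dimension: an invariant subspace splits the trace into the traces of
  two smaller representations. Repetitions in the list are the multiplicities.\<close>

lemma decompose_list:
  assumes "is_rep G d \<rho>"
  shows "\<exists>xs. set xs \<subseteq> irr_chars G \<and> (\<forall>g\<in>carrier G. mtr d (\<rho> g) = (\<Sum>\<psi>\<leftarrow>xs. \<psi> g))"
  using assms
proof (induction d arbitrary: \<rho> rule: less_induct)
  case (less d)
  show ?case
  proof (cases "d = 0")
    case True
    then show ?thesis by (intro exI[of _ "[]"]) (simp add: mtr_def)
  next
    case False
    show ?thesis
    proof (cases "irreducible_rep G d \<rho>")
      case True
      then show ?thesis
        by (intro exI[of _ "[rchar G d \<rho>]"]) (auto simp: irr_chars_def rchar_apply)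
    next
      case red: False
      then obtain W where W: "W \<subseteq> carrier_vec d" "0\<^sub>v d \<in> W" "\<forall>v\<in>W. \<forall>w\<in>W. v + w \<in> W" "\<forall>c. \<forall>v\<in>W. c \<cdot>\<^sub>v v \<in> W"
        "\<forall>g\<in>carrier G. \<forall>w\<in>W. \<rho> g *\<^sub>v w \<in> W" "W \<noteq> {0\<^sub>v d}" "W \<noteq> carrier_vec d"
        using less.prems False unfolding irreducible_rep_def by blast
      obtain k \<rho>1 \<rho>2 where k: "0 < k" "k < d" "is_rep G k \<rho>1" "is_rep G (d - k) \<rho>2"
        "\<forall>g\<in>carrier G. mtr d (\<rho> g) = mtr k (\<rho>1 g) + mtr (d - k) (\<rho>2 g)"
        using reducible_split[OF less.prems W(1) _ _ W(2) _ W(6,7) is_group] W(3,4,5) by blast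
      obtain xs where xs: "set xs \<subseteq> irr_chars G" "\<forall>g\<in>carrier G. mtr k (\<rho>1 g) = (\<Sum>\<psi>\<leftarrow>xs. \<psi> g)"
        using less.IH[OF k(2,3)] by blast
      have "d - k < d" using k(1,2) by simp
      obtain ys where ys: "set ys \<subseteq> irr_chars G" "\<forall>g\<in>carrier G. mtr (d - k) (\<rho>2 g) = (\<Sum>\<psi>\<leftarrow>ys. \<psi> g)"
        using less.IH[OF \<open>d - k < d\<close> k(4)] by blast
      show ?thesis using xs ys k(5) by (intro exI[of _ "xs @ ys"]) auto
    qed
  qed
qed

text \<open>Left multiplication as a permutation matrix, with the group elements numbered by
  \<open>f\<close>.\<close>

definition regular_rep :: "(nat \<Rightarrow> 'a) \<Rightarrow> 'a \<Rightarrow> complex mat"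
  where "regular_rep f g = mat (order G) (order G) (\<lambda>(i, j). if f i = g \<otimes> f j then 1 else 0)"

lemma regular_rep:
  assumes f: "bij_betw f {..<order G} (carrier G)"
  shows "is_rep G (order G) (regular_rep f)"
    and "g \<in> carrier G \<Longrightarrow> mtr (order G) (regular_rep f g) = (if g = \<one> then of_nat (order G) else 0)"
proof -
  have fc: "f i \<in> carrier G" if "i < order G" for i using f that by (auto simp: bij_betw_def)
  have finj: "f i = f j \<longleftrightarrow> i = j" if "i < order G" "j < order G" for i j
    using f that by (auto simp: bij_betw_def inj_on_def)
  show "is_rep G (order G) (regular_rep f)"
    unfolding is_rep_def
  proof (intro conjI ballI)
    fix g h assume gh: "g \<in> carrier G" "h \<in> carrier G"
    show "regular_rep f (g \<otimes> h) = regular_rep f g * regular_rep f h"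
    proof (rule eq_matI)
      fix i j assume "i < dim_row (regular_rep f g * regular_rep f h)" "j < dim_col (regular_rep f g * regular_rep f h)"
      then have ij: "i < order G" "j < order G" by (auto simp: regular_rep_def)
      obtain k where k: "k < order G" "f k = h \<otimes> f j"
        using f gh fc[OF ij(2)] unfolding bij_betw_def by (metis imageE lessThan_iff m_closed)
      have "(regular_rep f g * regular_rep f h) $$ (i, j) =
        (\<Sum>l<order G. regular_rep f g $$ (i, l) * regular_rep f h $$ (l, j))"
        using ij by (intro index_mult_mat_sum) (auto simp: regular_rep_def)
      also have "\<dots> = (\<Sum>l<order G. if l = k then (if f i = g \<otimes> f l then 1 else 0) else 0)"
      proof (intro sum.cong refl)
        fix l assume l: "l \<in> {..<order G}"
        have "f l = h \<otimes> f j \<longleftrightarrow> l = k" using finj[of l k] k l by auto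
        then show "regular_rep f g $$ (i, l) * regular_rep f h $$ (l, j) = (if l = k then (if f i = g \<otimes> f l then 1 else 0) else 0)"
          using ij l by (simp add: regular_rep_def)
      qed
      also have "\<dots> = (if f i = g \<otimes> (h \<otimes> f j) then 1 else 0)" using k by simp
      also have "\<dots> = regular_rep f (g \<otimes> h) $$ (i, j)"
        using ij gh fc by (simp add: regular_rep_def m_assoc)
      finally show "regular_rep f (g \<otimes> h) $$ (i, j) = (regular_rep f g * regular_rep f h) $$ (i, j)" by simp
    qed (auto simp: regular_rep_def)
  next
    show "regular_rep f \<one> = 1\<^sub>m (order G)"
      using fc finj by (intro eq_matI) (auto simp: regular_rep_def)
  qed (auto simp: regular_rep_def)
  assume g: "g \<in> carrier G"
  have "mtr (order G) (regular_rep f g) = (\<Sum>i<order G. if g = \<one> then 1 else 0)"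
    unfolding mtr_def
  proof (intro sum.cong refl)
    fix i assume i: "i \<in> {..<order G}"
    have "f i = g \<otimes> f i \<longleftrightarrow> g = \<one>" using fc g i by (metis lessThan_iff l_one one_closed right_cancel)
    then show "regular_rep f g $$ (i, i) = (if g = \<one> then 1 else 0)" using i by (simp add: regular_rep_def)
  qed
  then show "mtr (order G) (regular_rep f g) = (if g = \<one> then of_nat (order G) else 0)" by simp
qed

lemma cinner_sum_list_left:
  "cinner G (\<lambda>g. \<Sum>\<psi>\<leftarrow>xs. \<psi> g) f = (\<Sum>\<psi>\<leftarrow>xs. cinner G \<psi> f)"
proof (induction xs)
  case (Cons a xs)
  have "cinner G (\<lambda>g. \<Sum>\<psi>\<leftarrow>a # xs. \<psi> g) f = cinner G a f + cinner G (\<lambda>g. \<Sum>\<psi>\<leftarrow>xs. \<psi> g) f"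
    by (simp add: cinner_def algebra_simps sum.distrib add_divide_distrib)
  then show ?case using Cons by simp
qed (simp add: cinner_def)

lemma irr_chars_one:
  assumes "\<psi> \<in> irr_chars G"
  obtains d where "d > 0" "\<psi> \<one> = of_nat d"
  using assms by (auto simp: irr_chars_def irreducible_rep_def rchar_one)

lemma cinner_delta_left:
  assumes "\<And>g. g \<in> carrier G \<Longrightarrow> f g = (if g = \<one> then of_nat (order G) else 0)"
  shows "cinner G f h = h \<one>"
proof -
  have "(\<Sum>g\<in>carrier G. f g * h (inv g)) = (\<Sum>g\<in>carrier G. if g = \<one> then of_nat (order G) * h \<one> else 0)"
    using assms by (intro sum.cong refl) auto
  then show ?thesis using fin order_pos by (simp add: cinner_def)
qed

lemma regular_char_list:
  obtains xs where "set xs \<subseteq> irr_chars G"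
    "\<And>g. g \<in> carrier G \<Longrightarrow> (\<Sum>\<psi>\<leftarrow>xs. \<psi> g) = (if g = \<one> then of_nat (order G) else 0)"
proof -
  obtain f where "bij_betw f {..<order G} (carrier G)"
    using ex_bij_betw_nat_finite[OF fin] by (auto simp: order_def lessThan_atLeast0)
  note reg = regular_rep[OF this]
  show ?thesis using decompose_list[OF reg(1)] reg(2) that by metis
qed

text \<open>Pairing with the regular character is evaluation at the identity, where an irreducible
  character is nonzero. Hence each one occurs in the finite decomposition of the regular
  character.\<close>

lemma finite_irr_chars: "finite (irr_chars G)"
proof -
  obtain xs where xs: "set xs \<subseteq> irr_chars G"
    "\<And>g. g \<in> carrier G \<Longrightarrow> (\<Sum>\<psi>\<leftarrow>xs. \<psi> g) = (if g = \<one> then of_nat (order G) else 0)"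
    using regular_char_list by blast
  have "\<psi> \<in> set xs" if \<psi>: "\<psi> \<in> irr_chars G" for \<psi>
  proof (rule ccontr)
    assume n: "\<psi> \<notin> set xs"
    have "\<psi> \<one> = (\<Sum>\<theta>\<leftarrow>xs. cinner G \<theta> \<psi>)"
      unfolding cinner_sum_list_left[symmetric] using xs(2) by (rule cinner_delta_left[symmetric])
    also have "(\<Sum>\<theta>\<leftarrow>xs. cinner G \<theta> \<psi>) = (\<Sum>\<theta>\<leftarrow>xs. 0)"
    proof -
      have "map (\<lambda>\<theta>. cinner G \<theta> \<psi>) xs = map (\<lambda>\<theta>. 0) xs"
        using n xs(1) \<psi> cinner_irr_chars by (intro map_cong refl) (metis subsetD)
      then show ?thesis by (rule arg_cong)
    qed
    finally have "\<psi> \<one> = 0" by simp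
    moreover obtain d where "d > 0" "\<psi> \<one> = of_nat d" using irr_chars_one[OF \<psi>] .
    ultimately show False by simp
  qed
  then show ?thesis by (meson finite_set finite_subset subsetI)
qed

section \<open>Genuine and virtual characters\<close>

definition gchar :: "('a \<Rightarrow> complex) \<Rightarrow> bool"
  where "gchar f \<longleftrightarrow> (\<exists>m::('a \<Rightarrow> complex) \<Rightarrow> nat. \<forall>g\<in>carrier G. f g = (\<Sum>\<psi>\<in>irr_chars G. of_nat (m \<psi>) * \<psi> g))"

text \<open>Integer multiplicities give the character ring, in contrast to the natural
  multiplicities of \<open>gchar\<close>, which belong to actual representations.\<close>

definition vchar :: "('a \<Rightarrow> complex) \<Rightarrow> bool"
  where "vchar f \<longleftrightarrow> (\<exists>m::('a \<Rightarrow> complex) \<Rightarrow> int. \<forall>g\<in>carrier G. f g = (\<Sum>\<psi>\<in>irr_chars G. of_int (m \<psi>) * \<psi> g))"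

lemma gchar_sum_list:
  assumes "set xs \<subseteq> irr_chars G"
  shows "gchar (\<lambda>g. \<Sum>\<psi>\<leftarrow>xs. \<psi> g)"
  using assms
proof (induction xs)
  case Nil
  show ?case unfolding gchar_def by (intro exI[of _ "\<lambda>_. 0"]) simp
next
  case (Cons a xs)
  then obtain m :: "('a \<Rightarrow> complex) \<Rightarrow> nat" where m: "\<forall>g\<in>carrier G. (\<Sum>\<psi>\<leftarrow>xs. \<psi> g) = (\<Sum>\<psi>\<in>irr_chars G. of_nat (m \<psi>) * \<psi> g)"
    by (auto simp: gchar_def)
  have "(\<Sum>\<psi>\<in>irr_chars G. of_nat ((m(a := Suc (m a))) \<psi>) * \<psi> g) = a g + (\<Sum>\<psi>\<in>irr_chars G. of_nat (m \<psi>) * \<psi> g)" for g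
  proof -
    have a: "a \<in> irr_chars G" using Cons.prems by simp
    have "(\<Sum>\<psi>\<in>irr_chars G. of_nat ((m(a := Suc (m a))) \<psi>) * \<psi> g) =
      (\<Sum>\<psi>\<in>irr_chars G. (if \<psi> = a then \<psi> g else 0) + of_nat (m \<psi>) * \<psi> g)"
      by (intro sum.cong refl) (auto simp: algebra_simps)
    also have "\<dots> = a g + (\<Sum>\<psi>\<in>irr_chars G. of_nat (m \<psi>) * \<psi> g)"
      using a finite_irr_chars by (simp add: sum.distrib)
    finally show ?thesis .
  qed
  then show ?case using m unfolding gchar_def by (intro exI[of _ "m(a := Suc (m a))"]) auto
qed

lemma gchar_cong: "gchar f \<Longrightarrow> (\<And>g. g \<in> carrier G \<Longrightarrow> f' g = f g) \<Longrightarrow> gchar f'"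
  by (auto simp: gchar_def)

lemma vchar_cong: "vchar f \<Longrightarrow> (\<And>g. g \<in> carrier G \<Longrightarrow> f' g = f g) \<Longrightarrow> vchar f'"
  by (auto simp: vchar_def)

lemma gchar_rep:
  assumes "is_rep G d \<rho>"
  shows "gchar (\<lambda>g. mtr d (\<rho> g))"
proof -
  obtain xs where xs: "set xs \<subseteq> irr_chars G" "\<forall>g\<in>carrier G. mtr d (\<rho> g) = (\<Sum>\<psi>\<leftarrow>xs. \<psi> g)"
    using decompose_list[OF assms] by blast
  show ?thesis by (rule gchar_cong[OF gchar_sum_list[OF xs(1)]]) (use xs(2) in simp)
qed

lemma gchar_imp_vchar:
  assumes "gchar f"
  shows "vchar f"
proof -
  obtain m :: "('a \<Rightarrow> complex) \<Rightarrow> nat" where "\<forall>g\<in>carrier G. f g = (\<Sum>\<psi>\<in>irr_chars G. of_nat (m \<psi>) * \<psi> g)"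
    using assms by (auto simp: gchar_def)
  then show ?thesis unfolding vchar_def by (intro exI[of _ "\<lambda>\<psi>. int (m \<psi>)"]) simp
qed

lemma cinner_combination:
  assumes f: "\<And>g. g \<in> carrier G \<Longrightarrow> f g = (\<Sum>\<psi>\<in>irr_chars G. m \<psi> * \<psi> g)"
    and h: "\<And>g. g \<in> carrier G \<Longrightarrow> h g = (\<Sum>\<psi>\<in>irr_chars G. n \<psi> * \<psi> g)"
  shows "cinner G f h = (\<Sum>\<psi>\<in>irr_chars G. m \<psi> * n \<psi>)"
proof -
  have "(\<Sum>g\<in>carrier G. f g * h (inv g)) =
    (\<Sum>g\<in>carrier G. \<Sum>\<psi>\<in>irr_chars G. \<Sum>\<phi>\<in>irr_chars G. (m \<psi> * n \<phi>) * (\<psi> g * \<phi> (inv g)))"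
    using f h by (intro sum.cong refl) (simp add: sum_product mult_ac)
  also have "\<dots> = (\<Sum>\<psi>\<in>irr_chars G. \<Sum>g\<in>carrier G. \<Sum>\<phi>\<in>irr_chars G. (m \<psi> * n \<phi>) * (\<psi> g * \<phi> (inv g)))"
    by (rule sum.swap)
  also have "\<dots> = (\<Sum>\<psi>\<in>irr_chars G. \<Sum>\<phi>\<in>irr_chars G. \<Sum>g\<in>carrier G. (m \<psi> * n \<phi>) * (\<psi> g * \<phi> (inv g)))"
    by (intro sum.cong refl sum.swap)
  finally have "cinner G f h = (\<Sum>\<psi>\<in>irr_chars G. \<Sum>\<phi>\<in>irr_chars G. (m \<psi> * n \<phi>) * cinner G \<psi> \<phi>)"
    unfolding cinner_def by (simp only: sum_divide_distrib sum_distrib_left times_divide_eq_right)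
  also have "\<dots> = (\<Sum>\<psi>\<in>irr_chars G. \<Sum>\<phi>\<in>irr_chars G. if \<psi> = \<phi> then m \<psi> * n \<phi> else 0)"
    by (intro sum.cong refl) (auto simp: cinner_irr_chars)
  also have "\<dots> = (\<Sum>\<psi>\<in>irr_chars G. m \<psi> * n \<psi>)" using finite_irr_chars by simp
  finally show ?thesis .
qed

lemma irr_char_combination:
  assumes "\<psi> \<in> irr_chars G"
  shows "\<psi> g = (\<Sum>\<phi>\<in>irr_chars G. (if \<phi> = \<psi> then 1 else 0) * \<phi> g)"
  using assms finite_irr_chars by (simp add: if_distrib[of "\<lambda>x. x * _"] cong: if_cong)

lemma gchar_irr: "\<psi> \<in> irr_chars G \<Longrightarrow> gchar \<psi>"
  unfolding gchar_def using irr_char_combination[of \<psi>]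
  by (intro exI[of _ "\<lambda>\<phi>. if \<phi> = \<psi> then 1 else 0"]) (simp add: if_distrib[of of_nat] cong: if_cong)

lemma cinner_combination_irr:
  assumes "\<And>g. g \<in> carrier G \<Longrightarrow> f g = (\<Sum>\<psi>\<in>irr_chars G. m \<psi> * \<psi> g)" "\<psi> \<in> irr_chars G"
  shows "cinner G f \<psi> = m \<psi>"
proof -
  have "cinner G f \<psi> = (\<Sum>\<phi>\<in>irr_chars G. m \<phi> * (if \<phi> = \<psi> then 1 else 0))"
    by (rule cinner_combination[OF assms(1) irr_char_combination[OF assms(2)]])
  then show ?thesis using assms(2) finite_irr_chars by (simp add: if_distrib cong: if_cong)
qed

text \<open>The multiplicity of an irreducible character in the regular one is its degree; the
  decomposition is then evaluated at the identity.\<close>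

lemma sum_irr_chars_squared: "(\<Sum>\<psi>\<in>irr_chars G. \<psi> \<one> * \<psi> \<one>) = of_nat (order G)"
proof -
  obtain xs where xs: "set xs \<subseteq> irr_chars G"
    "\<And>g. g \<in> carrier G \<Longrightarrow> (\<Sum>\<psi>\<leftarrow>xs. \<psi> g) = (if g = \<one> then of_nat (order G) else 0)"
    using regular_char_list by blast
  from gchar_sum_list[OF xs(1)] obtain m :: "('a \<Rightarrow> complex) \<Rightarrow> nat"
    where m: "\<And>g. g \<in> carrier G \<Longrightarrow> (\<Sum>\<psi>\<leftarrow>xs. \<psi> g) = (\<Sum>\<psi>\<in>irr_chars G. of_nat (m \<psi>) * \<psi> g)"
    by (auto simp: gchar_def)
  have "of_nat (m \<psi>) = \<psi> \<one>" if "\<psi> \<in> irr_chars G" for \<psi>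
    using cinner_combination_irr[OF m that] cinner_delta_left[OF xs(2)] by metis
  then have "(\<Sum>\<psi>\<in>irr_chars G. \<psi> \<one> * \<psi> \<one>) = (\<Sum>\<psi>\<in>irr_chars G. of_nat (m \<psi>) * \<psi> \<one>)" by simp
  also have "\<dots> = of_nat (order G)" using m[of \<one>] xs(2)[of \<one>] by simp
  finally show ?thesis .
qed

definition cdeg :: "('a \<Rightarrow> complex) \<Rightarrow> nat"
  where "cdeg \<psi> = nat \<lfloor>Re (\<psi> \<one>)\<rfloor>"

lemma cdeg_rchar: "is_rep G d \<rho> \<Longrightarrow> cdeg (rchar G d \<rho>) = d"
  by (simp add: cdeg_def rchar_one)

lemma cdeg_irr:
  assumes "\<psi> \<in> irr_chars G"
  shows "\<psi> \<one> = of_nat (cdeg \<psi>)" "cdeg \<psi> > 0"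
proof -
  obtain d where "d > 0" "\<psi> \<one> = of_nat d" using irr_chars_one[OF assms] .
  then show "\<psi> \<one> = of_nat (cdeg \<psi>)" "cdeg \<psi> > 0" by (auto simp: cdeg_def)
qed

lemma sum_cdeg_squared: "(\<Sum>\<psi>\<in>irr_chars G. (cdeg \<psi>)\<^sup>2) = order G"
proof -
  have "(of_nat (\<Sum>\<psi>\<in>irr_chars G. (cdeg \<psi>)\<^sup>2) :: complex) = (\<Sum>\<psi>\<in>irr_chars G. \<psi> \<one> * \<psi> \<one>)"
    by (simp add: cdeg_irr(1) power2_eq_square)
  then show ?thesis unfolding sum_irr_chars_squared by (simp only: of_nat_eq_iff)
qed

lemma irr_dim_sum_eq: "irr_dim_sum G = (\<Sum>\<psi>\<in>irr_chars G. cdeg \<psi>)"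
proof -
  \<comment> \<open>The class of all irreducible representations with a given character.\<close>
  define F where "F \<psi> = {(d, \<rho>). irreducible_rep G d \<rho> \<and> rchar G d \<rho> = \<psi>}" for \<psi>
  have iso: "((d, \<rho>), (e, \<sigma>)) \<in> rep_iso G \<longleftrightarrow>
    irreducible_rep G d \<rho> \<and> irreducible_rep G e \<sigma> \<and> rchar G d \<rho> = rchar G e \<sigma>" for d \<rho> e \<sigma>
  proof (cases "irreducible_rep G d \<rho> \<and> irreducible_rep G e \<sigma>")
    case True
    then show ?thesis using iso_iff_rchar_eq[of d \<rho> e \<sigma>]
      by (auto simp: rep_iso_def irreps_iff[OF is_group])
  qed (auto simp: rep_iso_def irreps_iff[OF is_group])
  have cls: "rep_iso G `` {(d, \<rho>)} = F (rchar G d \<rho>)" if "irreducible_rep G d \<rho>" for d \<rho>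
    using that iso by (auto simp: F_def)
  have "Irr G = F ` irr_chars G"
  proof (intro equalityI subsetI)
    fix C assume "C \<in> Irr G"
    then obtain d \<rho> where "(d, \<rho>) \<in> irreps G" "C = rep_iso G `` {(d, \<rho>)}"
      by (auto simp: Irr_def quotient_def)
    then show "C \<in> F ` irr_chars G" using cls by (auto simp: irreps_iff[OF is_group] irr_chars_def)
  next
    fix C assume "C \<in> F ` irr_chars G"
    then obtain d \<rho> where "irreducible_rep G d \<rho>" "C = F (rchar G d \<rho>)" by (auto simp: irr_chars_def)
    then show "C \<in> Irr G" using cls[of d \<rho>] unfolding Irr_def
      by (intro quotientI[of "(d, \<rho>)", THEN back_subst[where P="\<lambda>x. x \<in> _"]]) (auto simp: irreps_iff[OF is_group])
  qed
  moreover have "inj_on F (irr_chars G)"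
    by (rule inj_onI) (auto simp: irr_chars_def F_def)
  moreover have "class_dim (F \<psi>) = cdeg \<psi>" if psi: "\<psi> \<in> irr_chars G" for \<psi>
  proof -
    obtain d \<rho> where d: "irreducible_rep G d \<rho>" "\<psi> = rchar G d \<rho>" using psi by (auto simp: irr_chars_def)
    have "(THE d. \<exists>\<rho>. (d, \<rho>) \<in> F \<psi>) = cdeg \<psi>"
    proof (rule the_equality)
      show "\<exists>\<rho>. (cdeg \<psi>, \<rho>) \<in> F \<psi>" using d cdeg_rchar[of d \<rho>] by (auto simp: F_def irreducible_rep_def)
    next
      fix e assume "\<exists>\<rho>. (e, \<rho>) \<in> F \<psi>"
      then show "e = cdeg \<psi>" using cdeg_rchar by (auto simp: F_def irreducible_rep_def)
    qed
    then show ?thesis by (simp add: class_dim_def)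
  qed
  ultimately show ?thesis by (simp add: irr_dim_sum_def sum.reindex)
qed

text \<open>The completeness test for a list of characters: degrees are positive, so once the
  squares exhaust the order no further irreducible character is left.\<close>

lemma irr_dim_sumI:
  assumes "S \<subseteq> irr_chars G" "(\<Sum>\<psi>\<in>S. (cdeg \<psi>)\<^sup>2) = order G"
  shows "irr_dim_sum G = (\<Sum>\<psi>\<in>S. cdeg \<psi>)"
proof -
  have "(\<Sum>\<psi>\<in>irr_chars G. (cdeg \<psi>)\<^sup>2) = (\<Sum>\<psi>\<in>irr_chars G - S. (cdeg \<psi>)\<^sup>2) + (\<Sum>\<psi>\<in>S. (cdeg \<psi>)\<^sup>2)"
    by (rule sum.subset_diff[OF assms(1) finite_irr_chars])
  then have "(\<Sum>\<psi>\<in>irr_chars G - S. (cdeg \<psi>)\<^sup>2) = 0" using assms(2) sum_cdeg_squared by simp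
  then have "\<forall>\<psi>\<in>irr_chars G - S. cdeg \<psi> = 0" using finite_irr_chars by simp
  then have "irr_chars G \<subseteq> S" using cdeg_irr(2) by (metis DiffI less_irrefl subsetI)
  then have "irr_chars G = S" using assms(1) by simp
  then show ?thesis by (simp add: irr_dim_sum_eq)
qed

lemma vchar_one: "vchar (\<lambda>_. 1)"
proof -
  have "is_rep G 1 (\<lambda>_. 1\<^sub>m 1)" by (simp add: is_rep_def)
  from gchar_imp_vchar[OF gchar_rep[OF this]] show ?thesis by (rule vchar_cong) (simp add: mtr_def)
qed

lemma vchar_add: "vchar f \<Longrightarrow> vchar h \<Longrightarrow> vchar (\<lambda>g. f g + h g)"
  unfolding vchar_def
proof (elim exE)
  fix m n :: "('a \<Rightarrow> complex) \<Rightarrow> int"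
  assume "\<forall>g\<in>carrier G. f g = (\<Sum>\<psi>\<in>irr_chars G. of_int (m \<psi>) * \<psi> g)"
    "\<forall>g\<in>carrier G. h g = (\<Sum>\<psi>\<in>irr_chars G. of_int (n \<psi>) * \<psi> g)"
  then show "\<exists>m. \<forall>g\<in>carrier G. f g + h g = (\<Sum>\<psi>\<in>irr_chars G. of_int (m \<psi>) * \<psi> g)"
    by (intro exI[of _ "\<lambda>\<psi>. m \<psi> + n \<psi>"]) (simp add: algebra_simps sum.distrib)
qed

lemma vchar_scale: "vchar f \<Longrightarrow> vchar (\<lambda>g. of_int k * f g)"
  unfolding vchar_def
proof (elim exE)
  fix m :: "('a \<Rightarrow> complex) \<Rightarrow> int"
  assume "\<forall>g\<in>carrier G. f g = (\<Sum>\<psi>\<in>irr_chars G. of_int (m \<psi>) * \<psi> g)"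
  then show "\<exists>m. \<forall>g\<in>carrier G. of_int k * f g = (\<Sum>\<psi>\<in>irr_chars G. of_int (m \<psi>) * \<psi> g)"
    by (intro exI[of _ "\<lambda>\<psi>. k * m \<psi>"]) (simp add: mult.assoc sum_distrib_left)
qed

lemma vchar_sum:
  assumes "finite A" "\<And>a. a \<in> A \<Longrightarrow> vchar (F a)"
  shows "vchar (\<lambda>g. \<Sum>a\<in>A. F a g)"
  using assms
proof (induction A rule: finite_induct)
  case empty
  show ?case unfolding vchar_def by (auto intro!: exI[of _ "\<lambda>_. 0"])
qed (auto intro: vchar_add)

section \<open>Tensor products and recognition of irreducible characters\<close>

definition tensor :: "nat \<Rightarrow> nat \<Rightarrow> complex mat \<Rightarrow> complex mat \<Rightarrow> complex mat"
  where "tensor d e A B = mat (d * e) (d * e) (\<lambda>(i, j). A $$ (i div e, j div e) * B $$ (i mod e, j mod e))"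

text \<open>The index pair (i, j) is coded as \<open>i * e + j\<close>, in accordance with
  \<open>div\<close> and \<open>mod\<close> in \<open>tensor\<close>.\<close>

lemma sum_lessThan_mult:
  fixes f :: "nat \<Rightarrow> complex"
  shows "(\<Sum>l<d * e. f l) = (\<Sum>i<d. \<Sum>j<e. f (i * e + j))"
proof (induction d)
  case (Suc d)
  have "(\<Sum>l<Suc d * e. f l) = (\<Sum>l<d * e. f l) + (\<Sum>l<e. f (d * e + l))"
    using sum_lessThan_split[of "d * e" "Suc d * e" f] by simp
  then show ?case using Suc by simp
qed simp

lemma is_rep_tensor:
  assumes rho: "is_rep G d \<rho>" and sigma: "is_rep G e \<sigma>"
  shows "is_rep G (d * e) (\<lambda>g. tensor d e (\<rho> g) (\<sigma> g))"
  unfolding is_rep_def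
proof (intro conjI ballI)
  fix g h assume gh: "g \<in> carrier G" "h \<in> carrier G"
  note rc = is_repD(1)[OF rho] and sc = is_repD(1)[OF sigma]
  show "tensor d e (\<rho> (g \<otimes> h)) (\<sigma> (g \<otimes> h)) = tensor d e (\<rho> g) (\<sigma> g) * tensor d e (\<rho> h) (\<sigma> h)"
    (is "?L = ?A * ?B")
  proof (rule eq_matI)
    fix i j assume "i < dim_row (?A * ?B)" "j < dim_col (?A * ?B)"
    then have ij: "i < d * e" "j < d * e" by (auto simp: tensor_def)
    then have e: "e > 0" by (cases e) auto
    have q: "i div e < d" "j div e < d" "i mod e < e" "j mod e < e"
      using ij e by (auto simp: less_mult_imp_div_less)
    have bound: "a * e + b < d * e" if "a < d" "b < e" for a b
    proof -
      have "a * e + b < Suc a * e" using that by simp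
      also have "\<dots> \<le> d * e" using that by (intro mult_le_mono1) auto
      finally show ?thesis .
    qed
    have "(?A * ?B) $$ (i, j) = (\<Sum>k<d * e. ?A $$ (i, k) * ?B $$ (k, j))"
      using ij by (intro index_mult_mat_sum) (auto simp: tensor_def)
    also have "\<dots> = (\<Sum>a<d. \<Sum>b<e. (\<rho> g $$ (i div e, a) * \<sigma> g $$ (i mod e, b)) * (\<rho> h $$ (a, j div e) * \<sigma> h $$ (b, j mod e)))"
      unfolding sum_lessThan_mult using ij bound by (intro sum.cong refl) (simp add: tensor_def)
    also have "\<dots> = (\<Sum>a<d. \<rho> g $$ (i div e, a) * \<rho> h $$ (a, j div e)) * (\<Sum>b<e. \<sigma> g $$ (i mod e, b) * \<sigma> h $$ (b, j mod e))"
      by (simp add: sum_product mult_ac)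
    also have "\<dots> = (\<rho> g * \<rho> h) $$ (i div e, j div e) * (\<sigma> g * \<sigma> h) $$ (i mod e, j mod e)"
      using q gh by (simp add: index_mult_mat_sum[OF rc rc] index_mult_mat_sum[OF sc sc] del: index_mult_mat)
    finally show "?L $$ (i, j) = (?A * ?B) $$ (i, j)"
      using ij gh by (simp add: tensor_def is_repD(2)[OF rho] is_repD(2)[OF sigma] del: index_mult_mat)
  qed (auto simp: tensor_def)
next
  show "tensor d e (\<rho> \<one>) (\<sigma> \<one>) = 1\<^sub>m (d * e)"
  proof (rule eq_matI)
    fix i j assume "i < dim_row (1\<^sub>m (d * e))" "j < dim_col (1\<^sub>m (d * e))"
    then have ij: "i < d * e" "j < d * e" by auto
    then have e: "e > 0" by (cases e) auto
    have q: "i div e < d" "j div e < d" "i mod e < e" "j mod e < e"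
      using ij e by (auto simp: less_mult_imp_div_less)
    have "i = j \<longleftrightarrow> i div e = j div e \<and> i mod e = j mod e" by (metis div_mult_mod_eq)
    then show "tensor d e (\<rho> \<one>) (\<sigma> \<one>) $$ (i, j) = 1\<^sub>m (d * e) $$ (i, j)"
      using ij q by (auto simp: tensor_def is_repD(3)[OF rho] is_repD(3)[OF sigma])
  qed (auto simp: tensor_def)
qed (auto simp: tensor_def)

lemma mtr_tensor: "mtr (d * e) (tensor d e A B) = mtr d A * mtr e B"
proof -
  have bound: "a * e + b < d * e" if "a < d" "b < e" for a b
  proof -
    have "a * e + b < Suc a * e" using that by simp
    also have "\<dots> \<le> d * e" using that by (intro mult_le_mono1) auto
    finally show ?thesis .
  qed
  have "mtr (d * e) (tensor d e A B) = (\<Sum>a<d. \<Sum>b<e. A $$ (a, a) * B $$ (b, b))"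
    unfolding mtr_def sum_lessThan_mult using bound by (intro sum.cong refl) (simp add: tensor_def)
  then show ?thesis by (simp add: mtr_def sum_product)
qed

lemma gchar_rep_mult:
  assumes "is_rep G d \<rho>" "is_rep G e \<sigma>"
  shows "gchar (\<lambda>g. mtr d (\<rho> g) * mtr e (\<sigma> g))"
  using gchar_rep[OF is_rep_tensor[OF assms]] by (simp add: mtr_tensor)

lemma vchar_irr_mult:
  assumes "\<psi> \<in> irr_chars G" "\<phi> \<in> irr_chars G"
  shows "vchar (\<lambda>g. \<psi> g * \<phi> g)"
proof -
  obtain d \<rho> where 1: "\<psi> = rchar G d \<rho>" "is_rep G d \<rho>"
    using assms by (auto simp: irr_chars_def irreducible_rep_def)
  obtain e \<sigma> where 2: "\<phi> = rchar G e \<sigma>" "is_rep G e \<sigma>"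
    using assms by (auto simp: irr_chars_def irreducible_rep_def)
  show ?thesis
    using gchar_imp_vchar[OF gchar_rep_mult[OF 1(2) 2(2)]] by (rule vchar_cong) (simp add: 1 2 rchar_apply)
qed

lemma vchar_mult:
  assumes "vchar f" "vchar h"
  shows "vchar (\<lambda>g. f g * h g)"
proof -
  obtain m :: "('a \<Rightarrow> complex) \<Rightarrow> int" where m: "\<forall>g\<in>carrier G. f g = (\<Sum>\<psi>\<in>irr_chars G. of_int (m \<psi>) * \<psi> g)"
    using assms by (auto simp: vchar_def)
  obtain n :: "('a \<Rightarrow> complex) \<Rightarrow> int" where n: "\<forall>g\<in>carrier G. h g = (\<Sum>\<psi>\<in>irr_chars G. of_int (n \<psi>) * \<psi> g)"
    using assms by (auto simp: vchar_def)
  have "vchar (\<lambda>g. \<Sum>\<psi>\<in>irr_chars G. \<Sum>\<phi>\<in>irr_chars G. of_int (m \<psi> * n \<phi>) * (\<psi> g * \<phi> g))"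
    by (intro vchar_sum finite_irr_chars vchar_scale vchar_irr_mult)
  then show ?thesis
    by (rule vchar_cong) (use m n in \<open>simp add: sum_product mult_ac\<close>)
qed

text \<open>Integers whose squares add up to 1 leave a single irreducible character up to sign, and
  the value at the identity decides the sign.\<close>

lemma vchar_irreducible:
  assumes f: "vchar f" and norm: "cinner G f f = 1" and pos: "Re (f \<one>) > 0"
  shows "restrict f (carrier G) \<in> irr_chars G"
proof -
  obtain m :: "('a \<Rightarrow> complex) \<Rightarrow> int" where m: "\<And>g. g \<in> carrier G \<Longrightarrow> f g = (\<Sum>\<psi>\<in>irr_chars G. of_int (m \<psi>) * \<psi> g)"
    using f by (auto simp: vchar_def)
  have "(of_int (\<Sum>\<psi>\<in>irr_chars G. (m \<psi>)\<^sup>2) :: complex) = of_int 1"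
    using cinner_combination[OF m m] norm by (simp add: power2_eq_square)
  then have s: "(\<Sum>\<psi>\<in>irr_chars G. (m \<psi>)\<^sup>2) = 1" by (simp only: of_int_eq_iff)
  then obtain \<theta> where \<theta>: "\<theta> \<in> irr_chars G" "m \<theta> \<noteq> 0"
    by (metis (no_types, lifting) power_zero_numeral sum.neutral zero_neq_one)
  have r: "(m \<theta>)\<^sup>2 + (\<Sum>\<psi>\<in>irr_chars G - {\<theta>}. (m \<psi>)\<^sup>2) = 1"
    using s sum.remove[OF finite_irr_chars \<theta>(1), of "\<lambda>\<psi>. (m \<psi>)\<^sup>2"] by simp
  have "(m \<theta>)\<^sup>2 \<ge> 1" using \<theta>(2) by (simp add: int_one_le_iff_zero_less)
  moreover have "(\<Sum>\<psi>\<in>irr_chars G - {\<theta>}. (m \<psi>)\<^sup>2) \<ge> 0" by (intro sum_nonneg) simp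
  ultimately have m1: "(m \<theta>)\<^sup>2 = 1" and "(\<Sum>\<psi>\<in>irr_chars G - {\<theta>}. (m \<psi>)\<^sup>2) = 0" using r by auto
  then have m0: "\<forall>\<psi>\<in>irr_chars G - {\<theta>}. m \<psi> = 0"
    using finite_irr_chars by (subst (asm) sum_nonneg_eq_0_iff) auto
  have fe: "f g = of_int (m \<theta>) * \<theta> g" if "g \<in> carrier G" for g
    using m[OF that] sum.remove[OF finite_irr_chars \<theta>(1), of "\<lambda>\<psi>. of_int (m \<psi>) * \<psi> g"] m0 by simp
  have "m \<theta> = 1"
  proof (rule ccontr)
    assume "m \<theta> \<noteq> 1"
    then have "m \<theta> = -1" using m1 by (simp add: power2_eq_1_iff)
    then have "Re (f \<one>) = - real (cdeg \<theta>)" using fe[of \<one>] cdeg_irr[OF \<theta>(1)] by simp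
    then show False using pos by simp
  qed
  moreover have "\<theta> \<in> extensional (carrier G)" using \<theta>(1) by (auto simp: irr_chars_def rchar_def)
  ultimately have "restrict f (carrier G) = \<theta>"
    using fe by (auto simp: restrict_def extensional_def)
  then show ?thesis using \<theta>(1) by simp
qed

text \<open>The only way to write 2 as a sum of squares of naturals is 1 + 1. Genuineness rules out
  a difference of two irreducible characters.\<close>

lemma gchar_norm2:
  assumes f: "gchar f" and norm: "cinner G f f = 2"
  obtains \<alpha> \<beta> where "\<alpha> \<in> irr_chars G" "\<beta> \<in> irr_chars G" "\<alpha> \<noteq> \<beta>" "\<And>g. g \<in> carrier G \<Longrightarrow> f g = \<alpha> g + \<beta> g"
proof -
  obtain m :: "('a \<Rightarrow> complex) \<Rightarrow> nat" where m: "\<And>g. g \<in> carrier G \<Longrightarrow> f g = (\<Sum>\<psi>\<in>irr_chars G. of_nat (m \<psi>) * \<psi> g)"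
    using f by (auto simp: gchar_def)
  have "(of_nat (\<Sum>\<psi>\<in>irr_chars G. (m \<psi>)\<^sup>2) :: complex) = of_nat 2"
    using cinner_combination[OF m m] norm by (simp add: power2_eq_square)
  then have s: "(\<Sum>\<psi>\<in>irr_chars G. (m \<psi>)\<^sup>2) = 2" by (simp only: of_nat_eq_iff)
  then obtain \<alpha> where \<alpha>: "\<alpha> \<in> irr_chars G" "m \<alpha> \<noteq> 0"
    by (metis (no_types, lifting) power_zero_numeral sum.neutral zero_neq_numeral)
  have r: "(m \<alpha>)\<^sup>2 + (\<Sum>\<psi>\<in>irr_chars G - {\<alpha>}. (m \<psi>)\<^sup>2) = 2"
    using s sum.remove[OF finite_irr_chars \<alpha>(1), of "\<lambda>\<psi>. (m \<psi>)\<^sup>2"] by simp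
  have one: "x = 1" if "x \<noteq> 0" "x\<^sup>2 \<le> 2" for x :: nat
  proof (rule ccontr)
    assume "x \<noteq> 1"
    then have "2 \<le> x" using that by simp
    then have "2\<^sup>2 \<le> x\<^sup>2" by (rule power_mono) simp
    then show False using that by simp
  qed
  have m\<alpha>: "m \<alpha> = 1" using one[OF \<alpha>(2)] r by simp
  then have r1: "(\<Sum>\<psi>\<in>irr_chars G - {\<alpha>}. (m \<psi>)\<^sup>2) = 1" using r by simp
  then obtain \<beta> where \<beta>: "\<beta> \<in> irr_chars G - {\<alpha>}" "m \<beta> \<noteq> 0"
    by (metis (no_types, lifting) power_zero_numeral sum.neutral zero_neq_one)
  have r2: "(m \<beta>)\<^sup>2 + (\<Sum>\<psi>\<in>irr_chars G - {\<alpha>} - {\<beta>}. (m \<psi>)\<^sup>2) = 1"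
    using r1 sum.remove[of "irr_chars G - {\<alpha>}" \<beta> "\<lambda>\<psi>. (m \<psi>)\<^sup>2"] \<beta> finite_irr_chars by simp
  have m\<beta>: "m \<beta> = 1" using one[OF \<beta>(2)] r2 by simp
  then have m0: "\<forall>\<psi>\<in>irr_chars G - {\<alpha>} - {\<beta>}. m \<psi> = 0" using r2 finite_irr_chars by simp
  show ?thesis
  proof (rule that[of \<alpha> \<beta>])
    fix g assume g: "g \<in> carrier G"
    have "f g = \<alpha> g + (\<Sum>\<psi>\<in>irr_chars G - {\<alpha>}. of_nat (m \<psi>) * \<psi> g)"
      using m[OF g] sum.remove[OF finite_irr_chars \<alpha>(1), of "\<lambda>\<psi>. of_nat (m \<psi>) * \<psi> g"] m\<alpha> by simp
    also have "(\<Sum>\<psi>\<in>irr_chars G - {\<alpha>}. of_nat (m \<psi>) * \<psi> g) = \<beta> g"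
      using sum.remove[of "irr_chars G - {\<alpha>}" \<beta> "\<lambda>\<psi>. of_nat (m \<psi>) * \<psi> g"] \<beta> finite_irr_chars m\<beta> m0 by simp
    finally show "f g = \<alpha> g + \<beta> g" .
  qed (use \<alpha> \<beta> in auto)
qed

text \<open>Serves to split known constituents off a tensor product while keeping it genuine, before
  its norm is examined.\<close>

lemma gchar_diff:
  assumes f: "gchar f" and \<psi>: "\<psi> \<in> irr_chars G" and k: "cinner G f \<psi> = of_nat k" "j \<le> k"
  shows "gchar (\<lambda>g. f g - of_nat j * \<psi> g)"
proof -
  obtain m :: "('a \<Rightarrow> complex) \<Rightarrow> nat" where m: "\<And>g. g \<in> carrier G \<Longrightarrow> f g = (\<Sum>\<psi>\<in>irr_chars G. of_nat (m \<psi>) * \<psi> g)"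
    using f by (auto simp: gchar_def)
  have mk: "m \<psi> = k" using cinner_combination_irr[OF m \<psi>] k(1) by simp
  have "f g - of_nat j * \<psi> g = (\<Sum>\<phi>\<in>irr_chars G. of_nat ((m(\<psi> := m \<psi> - j)) \<phi>) * \<phi> g)" if "g \<in> carrier G" for g
    using m[OF that] mk k(2) sum.remove[OF finite_irr_chars \<psi>, of "\<lambda>\<phi>. of_nat (m \<phi>) * \<phi> g"]
      sum.remove[OF finite_irr_chars \<psi>, of "\<lambda>\<phi>. of_nat ((m(\<psi> := m \<psi> - j)) \<phi>) * \<phi> g"]
    by (simp add: of_nat_diff algebra_simps)
  then show ?thesis unfolding gchar_def by blast
qed

lemma gchar_mult_rep:
  assumes f: "gchar f" and rho: "is_rep G d \<rho>"
  shows "gchar (\<lambda>g. f g * mtr d (\<rho> g))"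
proof -
  obtain m :: "('a \<Rightarrow> complex) \<Rightarrow> nat" where m: "\<And>g. g \<in> carrier G \<Longrightarrow> f g = (\<Sum>\<psi>\<in>irr_chars G. of_nat (m \<psi>) * \<psi> g)"
    using f by (auto simp: gchar_def)
  have "\<exists>n::('a \<Rightarrow> complex) \<Rightarrow> nat. \<forall>g\<in>carrier G. \<psi> g * mtr d (\<rho> g) = (\<Sum>\<phi>\<in>irr_chars G. of_nat (n \<phi>) * \<phi> g)" if psi: "\<psi> \<in> irr_chars G" for \<psi>
  proof -
    obtain e \<sigma> where 2: "\<psi> = rchar G e \<sigma>" "is_rep G e \<sigma>"
      using psi by (auto simp: irr_chars_def irreducible_rep_def)
    have "gchar (\<lambda>g. \<psi> g * mtr d (\<rho> g))"
      using gchar_rep_mult[OF 2(2) rho] by (rule gchar_cong) (simp add: 2 rchar_apply)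
    then show ?thesis by (simp add: gchar_def)
  qed
  then have "\<forall>\<psi>\<in>irr_chars G. \<exists>n::('a \<Rightarrow> complex) \<Rightarrow> nat. \<forall>g\<in>carrier G. \<psi> g * mtr d (\<rho> g) = (\<Sum>\<phi>\<in>irr_chars G. of_nat (n \<phi>) * \<phi> g)"
    by blast
  from bchoice[OF this] obtain n :: "('a \<Rightarrow> complex) \<Rightarrow> ('a \<Rightarrow> complex) \<Rightarrow> nat" where n:
    "\<And>\<psi> g. \<psi> \<in> irr_chars G \<Longrightarrow> g \<in> carrier G \<Longrightarrow> \<psi> g * mtr d (\<rho> g) = (\<Sum>\<phi>\<in>irr_chars G. of_nat (n \<psi> \<phi>) * \<phi> g)"
    by blast
  have "f g * mtr d (\<rho> g) = (\<Sum>\<phi>\<in>irr_chars G. of_nat (\<Sum>\<psi>\<in>irr_chars G. m \<psi> * n \<psi> \<phi>) * \<phi> g)" if g: "g \<in> carrier G" for g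
  proof -
    have "f g * mtr d (\<rho> g) = (\<Sum>\<psi>\<in>irr_chars G. of_nat (m \<psi>) * (\<psi> g * mtr d (\<rho> g)))"
      by (simp add: m[OF g] sum_distrib_right mult.assoc)
    also have "\<dots> = (\<Sum>\<psi>\<in>irr_chars G. \<Sum>\<phi>\<in>irr_chars G. of_nat (m \<psi> * n \<psi> \<phi>) * \<phi> g)"
      using n g by (intro sum.cong refl) (simp add: sum_distrib_left mult.assoc)
    also have "\<dots> = (\<Sum>\<phi>\<in>irr_chars G. \<Sum>\<psi>\<in>irr_chars G. of_nat (m \<psi> * n \<psi> \<phi>) * \<phi> g)" by (rule sum.swap)
    finally show ?thesis by (simp add: sum_distrib_right)
  qed
  then show ?thesis
    unfolding gchar_def by (intro exI[of _ "\<lambda>\<phi>. \<Sum>\<psi>\<in>irr_chars G. m \<psi> * n \<psi> \<phi>"] ballI)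
qed

end

section \<open>Degrees in commutative and dicyclic groups\<close>

context fin_group
begin

lemma inv_as_pow:
  assumes "g \<in> carrier G"
  shows "inv g = g [^] (order G - 1)"
proof -
  have "g [^] (order G - 1) \<otimes> g = g [^] order G"
    using assms order_pos by (metis Suc_pred' nat_pow_Suc)
  also have "\<dots> = \<one>" using assms by (rule pow_order_eq_1)
  finally show ?thesis using assms by (metis inv_equality nat_pow_closed)
qed

text \<open>In a finite group an inverse is a power, so closure under products also covers the
  inverse clause of \<open>generate\<close>.\<close>

lemma generate_induct_mult:
  assumes "h \<in> generate G A" "A \<subseteq> carrier G" "P \<one>" "\<And>a. a \<in> A \<Longrightarrow> P a"
    and mult: "\<And>g h. g \<in> carrier G \<Longrightarrow> h \<in> carrier G \<Longrightarrow> P g \<Longrightarrow> P h \<Longrightarrow> P (g \<otimes> h)"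
  shows "P h"
  using assms(1)
proof (induction rule: generate.induct)
  case (inv h)
  then have h: "h \<in> carrier G" "P h" using assms by auto
  have "P (h [^] (k::nat))" for k
    by (induction k) (use h assms(3) mult in auto)
  then show ?case using inv_as_pow[OF h(1)] by simp
next
  case (eng h1 h2)
  then show ?case using mult generate_in_carrier[OF assms(2)] by auto
qed (use assms in auto)

text \<open>By Schur's lemma every matrix is scalar, so the line of the first unit vector is
  invariant; it is proper if d > 1.\<close>

lemma irreducible_of_commuting:
  assumes "irreducible_rep G d \<rho>" "comm_group G"
  shows "d = 1"
proof (rule ccontr)
  interpret comm_group G by fact
  have rep: "is_rep G d \<rho>" and d: "d > 0" using assms by (auto simp: irreducible_rep_def)
  assume "d \<noteq> 1"
  then have d1: "1 < d" using d by simp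
  define W where "W = {v \<in> carrier_vec d. \<forall>i. 0 < i \<and> i < d \<longrightarrow> Matrix.vec_index v i = (0 :: complex)}"
  have "W = {0\<^sub>v d} \<or> W = carrier_vec d"
  proof (rule irreducible_repD[OF assms(1)])
    fix g w assume g: "g \<in> carrier G" and w: "w \<in> W"
    have "\<rho> g * \<rho> h = \<rho> h * \<rho> g" if "h \<in> carrier G" for h
      using is_repD(2)[OF rep] g that by (metis m_comm)
    then obtain c where c: "\<rho> g = c \<cdot>\<^sub>m 1\<^sub>m d"
      using schur_scalar[OF assms(1) is_repD(1)[OF rep g]] by auto
    have "\<rho> g *\<^sub>v w = c \<cdot>\<^sub>v w" unfolding c using w by (intro smult_one_mult_vec) (simp add: W_def)
    then show "\<rho> g *\<^sub>v w \<in> W" using w by (auto simp: W_def)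
  qed (auto simp: W_def)
  moreover have "unit_vec d 0 \<in> W" using d by (auto simp: W_def)
  moreover have "unit_vec d 0 \<noteq> (0\<^sub>v d :: complex Matrix.vec)" using d by auto
  moreover have "unit_vec d 1 \<notin> W" using d1 by (auto simp: W_def)
  ultimately show False by (metis singletonD unit_vec_carrier)
qed

lemma irr_dim_sum_commutative:
  assumes "comm_group G"
  shows "irr_dim_sum G = order G"
proof -
  have "cdeg \<psi> = 1" if "\<psi> \<in> irr_chars G" for \<psi>
  proof -
    obtain d \<rho> where d: "\<psi> = rchar G d \<rho>" "irreducible_rep G d \<rho>" using \<open>\<psi> \<in> irr_chars G\<close> by (auto simp: irr_chars_def)
    then have "cdeg \<psi> = d" using cdeg_rchar by (auto simp: irreducible_rep_def)
    then show ?thesis using irreducible_of_commuting[OF d(2) assms] by simp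
  qed
  then show ?thesis using sum_cdeg_squared irr_dim_sum_eq by simp
qed

lemma trivial_irr_char: "restrict (\<lambda>_. 1) (carrier G) \<in> irr_chars G"
proof (rule vchar_irreducible[OF vchar_one])
  show "cinner G (\<lambda>_. 1) (\<lambda>_. 1) = 1" using order_pos by (simp add: cinner_def order_def)
qed simp

text \<open>Let v be an eigenvector of \<open>\<rho> a\<close> with eigenvalue l, and let w be its
  image under \<open>\<rho> x\<close>. Then \<open>\<rho> a\<close> scales w by 1 / l, and
  \<open>\<rho> x\<close> takes w to l^n v, so v and w span an invariant subspace.\<close>

lemma irreducible_dim_le_2:
  assumes irr: "irreducible_rep G d \<rho>" and a: "a \<in> carrier G" and x: "x \<in> carrier G"
    and gen: "generate G {a, x} = carrier G"
    and x2: "x \<otimes> x = a [^] (n::nat)" and ax: "a \<otimes> x = x \<otimes> inv a"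
  shows "d \<le> 2"
proof -
  have rep: "is_rep G d \<rho>" and d: "d > 0" using irr by (auto simp: irreducible_rep_def)
  note rc = is_repD(1)[OF rep] and rm = is_repD(2)[OF rep]
  obtain l v where v: "v \<in> carrier_vec d" "v \<noteq> 0\<^sub>v d" "\<rho> a *\<^sub>v v = l \<cdot>\<^sub>v v"
    using spectrum_non_empty[OF rc[OF a] d] rc[OF a] by (auto simp: spectrum_def eigenvalue_def eigenvector_def)
  have act: "\<rho> (g \<otimes> h) *\<^sub>v u = \<rho> g *\<^sub>v (\<rho> h *\<^sub>v u)" if "g \<in> carrier G" "h \<in> carrier G" "u \<in> carrier_vec d" for g h u
    unfolding rm[OF that(1,2)] using rc that by (intro assoc_mult_mat_vec) auto
  have act_c: "\<rho> g *\<^sub>v u \<in> carrier_vec d" if "g \<in> carrier G" "u \<in> carrier_vec d" for g u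
    using rc[OF that(1)] that(2) by auto
  have smult: "\<rho> g *\<^sub>v (c \<cdot>\<^sub>v u) = c \<cdot>\<^sub>v (\<rho> g *\<^sub>v u)" if "g \<in> carrier G" "u \<in> carrier_vec d" for g u c
    using rc[OF that(1)] that(2) by (intro mult_mat_vec) auto
  define l' where "l' = inverse l"
  have vinv: "v = l \<cdot>\<^sub>v (\<rho> (inv a) *\<^sub>v v)"
  proof -
    have "v = \<rho> (inv a \<otimes> a) *\<^sub>v v" using a v is_repD(3)[OF rep] by simp
    then show ?thesis using act[of "inv a" a v] a v smult by simp
  qed
  have l: "l \<noteq> 0"
  proof
    assume "l = 0"
    then have "v = 0 \<cdot>\<^sub>v (\<rho> (inv a) *\<^sub>v v)" using vinv by simp
    also have "\<dots> = 0\<^sub>v d"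
    proof -
      have "0 \<cdot>\<^sub>v u = 0\<^sub>v d" if "u \<in> carrier_vec d" for u :: "complex Matrix.vec"
        by (rule eq_vecI) (use that in auto)
      then show ?thesis using act_c[of "inv a" v] a v by simp
    qed
    finally show False using v by simp
  qed
  have inva: "\<rho> (inv a) *\<^sub>v v = l' \<cdot>\<^sub>v v"
  proof -
    have "l' \<cdot>\<^sub>v v = l' \<cdot>\<^sub>v (l \<cdot>\<^sub>v (\<rho> (inv a) *\<^sub>v v))" using vinv by simp
    then show ?thesis using l by (simp add: l'_def smult_smult_assoc)
  qed
  have pw: "\<rho> (a [^] k) *\<^sub>v v = l ^ k \<cdot>\<^sub>v v" for k :: nat
  proof (induction k)
    case 0
    then show ?case using v is_repD(3)[OF rep] by simp
  next
    case (Suc k)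
    then show ?case using act[of "a [^] k" a v] a v smult[of "a [^] k" v l]
      by (simp add: smult_smult_assoc mult.commute)
  qed
  define w where "w = \<rho> x *\<^sub>v v"
  have w: "w \<in> carrier_vec d" using act_c x v by (simp add: w_def)
  have aw: "\<rho> a *\<^sub>v w = l' \<cdot>\<^sub>v w"
    using act[of a x v] act[of x "inv a" v] a x v ax inva smult[of x v l'] by (simp add: w_def)
  have xw: "\<rho> x *\<^sub>v w = l ^ n \<cdot>\<^sub>v v"
    using act[of x x v] x v x2 pw[of n] by (simp add: w_def)
  define W where "W = {s \<cdot>\<^sub>v v + t \<cdot>\<^sub>v w | s t. True}"
  have Wc: "W \<subseteq> carrier_vec d" using v w by (auto simp: W_def)
  have lin: "\<rho> g *\<^sub>v (s \<cdot>\<^sub>v v + t \<cdot>\<^sub>v w) = s \<cdot>\<^sub>v (\<rho> g *\<^sub>v v) + t \<cdot>\<^sub>v (\<rho> g *\<^sub>v w)" if "g \<in> carrier G" for g s t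
    using mult_add_distrib_mat_vec[OF rc[OF that], of "s \<cdot>\<^sub>v v" "t \<cdot>\<^sub>v w"] smult[OF that] v w by simp
  have memW: "s \<cdot>\<^sub>v v + t \<cdot>\<^sub>v w \<in> W" for s t by (auto simp: W_def)
  have inv: "\<forall>u\<in>W. \<rho> g *\<^sub>v u \<in> W" if g: "g \<in> carrier G" for g
  proof (rule generate_induct_mult[of g "{a, x}" "\<lambda>g. \<forall>u\<in>W. \<rho> g *\<^sub>v u \<in> W"])
    show "g \<in> generate G {a, x}" using g gen by simp
    show "\<forall>u\<in>W. \<rho> \<one> *\<^sub>v u \<in> W" using Wc by (auto simp: is_repD(3)[OF rep])
    fix b assume "b \<in> {a, x}"
    moreover have "\<rho> a *\<^sub>v (s \<cdot>\<^sub>v v + t \<cdot>\<^sub>v w) \<in> W" for s t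
    proof -
      have "\<rho> a *\<^sub>v (s \<cdot>\<^sub>v v + t \<cdot>\<^sub>v w) = (s * l) \<cdot>\<^sub>v v + (t * l') \<cdot>\<^sub>v w"
        by (simp add: lin a v(3) aw smult_smult_assoc)
      then show ?thesis using memW by simp
    qed
    moreover have "\<rho> x *\<^sub>v (s \<cdot>\<^sub>v v + t \<cdot>\<^sub>v w) \<in> W" for s t
    proof -
      have "\<rho> x *\<^sub>v (s \<cdot>\<^sub>v v + t \<cdot>\<^sub>v w) = s \<cdot>\<^sub>v w + (t * l ^ n) \<cdot>\<^sub>v v"
        by (simp add: lin x xw smult_smult_assoc) (simp add: w_def)
      also have "\<dots> = (t * l ^ n) \<cdot>\<^sub>v v + s \<cdot>\<^sub>v w" using v w by (intro comm_add_vec) auto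
      finally show ?thesis using memW by simp
    qed
    ultimately show "\<forall>u\<in>W. \<rho> b *\<^sub>v u \<in> W" by (auto simp: W_def)
  next
    fix g h assume "g \<in> carrier G" "h \<in> carrier G" "\<forall>u\<in>W. \<rho> g *\<^sub>v u \<in> W" "\<forall>u\<in>W. \<rho> h *\<^sub>v u \<in> W"
    then show "\<forall>u\<in>W. \<rho> (g \<otimes> h) *\<^sub>v u \<in> W" using act Wc by (metis subsetD)
  qed (use a x in auto)
  have "W = {0\<^sub>v d} \<or> W = carrier_vec d"
  proof (rule irreducible_repD[OF irr Wc])
    have "0\<^sub>v d = 0 \<cdot>\<^sub>v v + 0 \<cdot>\<^sub>v w" using v w by (intro eq_vecI) auto
    then show "0\<^sub>v d \<in> W" using memW by metis
  next
    fix p q assume "p \<in> W" "q \<in> W"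
    then obtain s t s' t' where pq: "p = s \<cdot>\<^sub>v v + t \<cdot>\<^sub>v w" "q = s' \<cdot>\<^sub>v v + t' \<cdot>\<^sub>v w" by (auto simp: W_def)
    have "p + q = (s + s') \<cdot>\<^sub>v v + (t + t') \<cdot>\<^sub>v w"
      unfolding pq using v w by (intro eq_vecI) (auto simp: algebra_simps)
    then show "p + q \<in> W" using memW by simp
  next
    fix c p assume "p \<in> W"
    then obtain s t where p: "p = s \<cdot>\<^sub>v v + t \<cdot>\<^sub>v w" by (auto simp: W_def)
    have "c \<cdot>\<^sub>v p = (c * s) \<cdot>\<^sub>v v + (c * t) \<cdot>\<^sub>v w"
      unfolding p using v w by (intro eq_vecI) (auto simp: algebra_simps)
    then show "c \<cdot>\<^sub>v p \<in> W" using memW by simp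
  qed (use inv in auto)
  moreover have "v \<in> W"
  proof -
    have "v = 1 \<cdot>\<^sub>v v + 0 \<cdot>\<^sub>v w" using v w by (intro eq_vecI) auto
    then show ?thesis using memW by metis
  qed
  ultimately have Wall: "W = carrier_vec d" using v by auto
  have "\<forall>j. \<exists>st. unit_vec d j = fst st \<cdot>\<^sub>v v + snd st \<cdot>\<^sub>v w"
  proof
    fix j
    have "unit_vec d j \<in> W" by (simp add: Wall)
    then obtain s t where "unit_vec d j = s \<cdot>\<^sub>v v + t \<cdot>\<^sub>v w" by (auto simp: W_def)
    then show "\<exists>st. unit_vec d j = fst st \<cdot>\<^sub>v v + snd st \<cdot>\<^sub>v w" by (intro exI[of _ "(s, t)"]) simp
  qed
  then obtain c where c: "\<And>j. unit_vec d j = fst (c j) \<cdot>\<^sub>v v + snd (c j) \<cdot>\<^sub>v w" by metis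
  \<comment> \<open>All d unit vectors are combinations of v and w. The coefficient pairs are d
    vectors in C^2, and the coordinates of v and w form their dual family.\<close>
  have "biorthogonal 2 d (\<lambda>j t. if t = 0 then fst (c j) else snd (c j))
    (\<lambda>i t. if t = 0 then Matrix.vec_index v i else Matrix.vec_index w i)"
    unfolding biorthogonal_def
  proof (intro allI impI)
    fix i j assume ij: "i < d" "j < d"
    have "Matrix.vec_index (unit_vec d j) i = fst (c j) * Matrix.vec_index v i + snd (c j) * Matrix.vec_index w i"
      unfolding c[of j] using ij v w by auto
    then show "(\<Sum>t<(2::nat). (if t = 0 then Matrix.vec_index v i else Matrix.vec_index w i) *
      (if t = 0 then fst (c j) else snd (c j))) = (if i = j then 1 else 0 :: complex)"
      using ij by (simp add: numeral_2_eq_2 mult.commute)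
  qed
  then show ?thesis by (rule biorthogonal_le)
qed

lemma linear_char_mult:
  assumes "\<psi> \<in> irr_chars G" "cdeg \<psi> = 1" "g \<in> carrier G" "h \<in> carrier G"
  shows "\<psi> (g \<otimes> h) = \<psi> g * \<psi> h"
proof -
  obtain d \<rho> where d: "\<psi> = rchar G d \<rho>" "is_rep G d \<rho>" using assms(1) by (auto simp: irr_chars_def irreducible_rep_def)
  then have d1: "is_rep G 1 \<rho>" "\<psi> = rchar G 1 \<rho>" using cdeg_rchar[OF d(2)] assms(2) by auto
  have "(\<rho> g * \<rho> h) $$ (0, 0) = (\<Sum>k<1. \<rho> g $$ (0, k) * \<rho> h $$ (k, 0))"
    using is_repD(1)[OF d1(1)] assms by (intro index_mult_mat_sum[of _ 1 1 _ 1]) auto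
  then show ?thesis using assms(3,4) by (simp add: d1(2) rchar_apply mtr_def is_repD(2)[OF d1(1)] del: index_mult_mat)
qed

lemma linear_char_inv:
  assumes "\<psi> \<in> irr_chars G" "cdeg \<psi> = 1" "g \<in> carrier G"
  shows "\<psi> (inv g) * \<psi> g = 1"
  using linear_char_mult[OF assms(1,2), of "inv g" g] assms(3) cdeg_irr(1)[OF assms(1)] assms(2) by simp

lemma linear_char_pow:
  assumes "\<psi> \<in> irr_chars G" "cdeg \<psi> = 1" "g \<in> carrier G"
  shows "\<psi> (g [^] (k::nat)) = \<psi> g ^ k"
  by (induction k) (use linear_char_mult[OF assms(1,2)] assms cdeg_irr(1)[OF assms(1)] in auto)

end

lemma irr_dim_sum_dicyclic:
  assumes dic: "is_dicyclic n G" and n: "n \<ge> 2"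
  shows "irr_dim_sum G = 2 * n + 2"
proof -
  interpret group G using dic by (simp add: is_dicyclic_def)
  have ord: "order G = 4 * n" using dic by (simp add: is_dicyclic_def)
  have "finite (carrier G)" using ord n by (metis order_def card_ge_0_finite mult_pos_pos zero_less_numeral less_le_trans pos2)
  then interpret fin_group G by unfold_locales
  obtain a x where a: "a \<in> carrier G" and x: "x \<in> carrier G" and gen: "generate G {a, x} = carrier G"
    and x2: "x [^]\<^bsub>G\<^esub> (2::nat) = a [^]\<^bsub>G\<^esub> n" and rel: "inv\<^bsub>G\<^esub> x \<otimes>\<^bsub>G\<^esub> a \<otimes>\<^bsub>G\<^esub> x = inv\<^bsub>G\<^esub> a"
    using dic by (auto simp: is_dicyclic_def)
  have xx: "x \<otimes>\<^bsub>G\<^esub> x = a [^]\<^bsub>G\<^esub> n" using x2 x by (simp add: numeral_2_eq_2)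
  have ax: "a \<otimes>\<^bsub>G\<^esub> x = x \<otimes>\<^bsub>G\<^esub> inv\<^bsub>G\<^esub> a"
  proof -
    have "x \<otimes>\<^bsub>G\<^esub> (inv\<^bsub>G\<^esub> x \<otimes>\<^bsub>G\<^esub> a \<otimes>\<^bsub>G\<^esub> x) = a \<otimes>\<^bsub>G\<^esub> x" using a x by (simp add: m_assoc[symmetric])
    then show ?thesis by (simp add: rel)
  qed
  have deg: "cdeg \<psi> = 1 \<or> cdeg \<psi> = 2" if psi: "\<psi> \<in> irr_chars G" for \<psi>
  proof -
    obtain d \<rho> where d: "\<psi> = rchar G d \<rho>" "irreducible_rep G d \<rho>" using psi by (auto simp: irr_chars_def)
    then have "cdeg \<psi> = d" using cdeg_rchar by (auto simp: irreducible_rep_def)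
    then show ?thesis using irreducible_dim_le_2[OF d(2) a x gen xx ax] cdeg_irr(2)[OF psi] by auto
  qed
  define L where "L = {\<psi> \<in> irr_chars G. cdeg \<psi> = 1}"
  define M where "M = {\<psi> \<in> irr_chars G. cdeg \<psi> = 2}"
  have fin': "finite L" "finite M" and disj: "L \<inter> M = {}" and un: "irr_chars G = L \<union> M"
    using finite_irr_chars deg by (auto simp: L_def M_def)
  have sq: "card L + 4 * card M = 4 * n"
    using sum_cdeg_squared unfolding un ord sum.union_disjoint[OF fin' disj] by (simp add: L_def M_def)
  have sm: "irr_dim_sum G = card L + 2 * card M"
    unfolding irr_dim_sum_eq un sum.union_disjoint[OF fin' disj] by (simp add: L_def M_def)
  have "card L > 0"
  proof -
    have "restrict (\<lambda>_. 1) (carrier G) \<in> L" using trivial_irr_char by (simp add: L_def cdeg_def)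
    then show ?thesis using fin' by (auto simp: card_gt_0_iff)
  qed
  moreover have "card L \<le> 4"
  proof -
    \<comment> \<open>The relations give \<open>\<psi> a = \<psi> (inv a)\<close>, so
      \<open>\<psi> a\<close> is 1 or -1, and \<open>\<psi> x\<close> is a square root of
      \<open>\<psi> a ^ n\<close>; \<open>csqrt\<close> picks one root and t is the sign.\<close>
    define B :: "(complex \<times> complex) set" where "B = (\<lambda>(s, t). (s, t * csqrt (s ^ n))) ` ({1, -1} \<times> {1, -1})"
    have "(\<lambda>\<psi>. (\<psi> a, \<psi> x)) ` L \<subseteq> B"
    proof (rule image_subsetI)
      fix \<psi> assume "\<psi> \<in> L"
      then have p: "\<psi> \<in> irr_chars G" "cdeg \<psi> = 1" by (auto simp: L_def)
      have nz: "\<psi> x \<noteq> 0" using linear_char_inv[OF p x] by auto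
      have "\<psi> a * \<psi> x = \<psi> x * \<psi> (inv\<^bsub>G\<^esub> a)" using linear_char_mult[OF p] a x ax by (metis inv_closed)
      then have "\<psi> a = \<psi> (inv\<^bsub>G\<^esub> a)" using nz by simp
      then have "\<psi> a * \<psi> a = 1" using linear_char_inv[OF p a] by simp
      then have 1: "\<psi> a = 1 \<or> \<psi> a = -1" by (simp add: square_eq_1_iff)
      have "\<psi> x * \<psi> x = \<psi> a ^ n" using linear_char_mult[OF p x x] linear_char_pow[OF p a] xx by simp
      then have "(\<psi> x)\<^sup>2 = (csqrt (\<psi> a ^ n))\<^sup>2" unfolding power2_csqrt by (simp add: power2_eq_square)
      then have 2: "\<psi> x = csqrt (\<psi> a ^ n) \<or> \<psi> x = - csqrt (\<psi> a ^ n)" by (simp only: power2_eq_iff)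
      from 1 2 show "(\<psi> a, \<psi> x) \<in> B" by (auto simp: B_def)
    qed
    moreover have "card B \<le> 4" unfolding B_def by (rule order_trans[OF card_image_le]) (auto simp: card_insert_if)
    moreover have "finite B" by (simp add: B_def)
    moreover have "inj_on (\<lambda>\<psi>. (\<psi> a, \<psi> x)) L"
    proof (rule inj_onI)
      fix \<psi> \<phi> assume pq: "\<psi> \<in> L" "\<phi> \<in> L" and eq: "(\<psi> a, \<psi> x) = (\<phi> a, \<phi> x)"
      then have p: "\<psi> \<in> irr_chars G" "cdeg \<psi> = 1" and q: "\<phi> \<in> irr_chars G" "cdeg \<phi> = 1" by (auto simp: L_def)
      have "\<psi> g = \<phi> g" if "g \<in> carrier G" for g
      proof (rule generate_induct_mult[of g "{a, x}" "\<lambda>g. \<psi> g = \<phi> g"])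
        show "\<psi> \<one>\<^bsub>G\<^esub> = \<phi> \<one>\<^bsub>G\<^esub>" using cdeg_irr(1)[OF p(1)] cdeg_irr(1)[OF q(1)] p q by simp
      qed (use that gen a x eq linear_char_mult[OF p] linear_char_mult[OF q] in auto)
      moreover have "\<psi> \<in> extensional (carrier G)" "\<phi> \<in> extensional (carrier G)"
        using p q by (auto simp: irr_chars_def rchar_def)
      ultimately show "\<psi> = \<phi>" by (auto intro: extensionalityI)
    qed
    ultimately show ?thesis by (metis card_image card_mono order_trans)
  qed
  ultimately have "card L = 4" using sq by presburger
  then show ?thesis using sq sm by simp
qed

section \<open>Quaternions and rotations\<close>

no_notation Matrix.vec_index (infixl "$" 100)

lemma vec3_eq_iff: "(u :: real^3) = v \<longleftrightarrow> u $ 1 = v $ 1 \<and> u $ 2 = v $ 2 \<and> u $ 3 = v $ 3"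
  by (simp add: Finite_Cartesian_Product.vec_eq_iff forall_3)

lemma inner_vec3: "inner (u :: real^3) v = u $ 1 * v $ 1 + u $ 2 * v $ 2 + u $ 3 * v $ 3"
  by (simp add: inner_vec_def sum_3)

lemma cross3_nth [simp]:
  "cross3 u v $ 1 = u $ 2 * v $ 3 - u $ 3 * v $ 2"
  "cross3 u v $ 2 = u $ 3 * v $ 1 - u $ 1 * v $ 3"
  "cross3 u v $ 3 = u $ 1 * v $ 2 - u $ 2 * v $ 1"
  by (simp_all add: cross3_def)

lemma quat_eq_iff: "(p :: quaternion) = q \<longleftrightarrow>
    fst p = fst q \<and> snd p $ 1 = snd q $ 1 \<and> snd p $ 2 = snd q $ 2 \<and> snd p $ 3 = snd q $ 3"
  by (simp add: prod_eq_iff vec3_eq_iff)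

lemma quat_mult_sel:
  "fst (quat_mult p q) = fst p * fst q - snd p $ 1 * snd q $ 1 - snd p $ 2 * snd q $ 2 - snd p $ 3 * snd q $ 3"
  "snd (quat_mult p q) $ 1 = fst p * snd q $ 1 + fst q * snd p $ 1 + snd p $ 2 * snd q $ 3 - snd p $ 3 * snd q $ 2"
  "snd (quat_mult p q) $ 2 = fst p * snd q $ 2 + fst q * snd p $ 2 + snd p $ 3 * snd q $ 1 - snd p $ 1 * snd q $ 3"
  "snd (quat_mult p q) $ 3 = fst p * snd q $ 3 + fst q * snd p $ 3 + snd p $ 1 * snd q $ 2 - snd p $ 2 * snd q $ 1"
  by (simp_all add: quat_mult_def inner_vec3)

lemma quat_conj_sel:
  "fst (quat_conj q) = fst q" "snd (quat_conj q) $ i = - (snd q $ i)"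
  by (simp_all add: quat_conj_def)

lemma quat_mult_assoc: "quat_mult (quat_mult p q) r = quat_mult p (quat_mult q r)"
  unfolding quat_eq_iff quat_mult_sel by (simp add: algebra_simps)

lemma quat_mult_one [simp]: "quat_mult (1, 0) q = q" "quat_mult q (1, 0) = q"
  unfolding quat_eq_iff quat_mult_sel by simp_all

lemma quat_mult_scaleR: "quat_mult (a *\<^sub>R p) (b *\<^sub>R q) = (a * b) *\<^sub>R quat_mult p q"
  unfolding quat_eq_iff by (simp add: quat_mult_sel algebra_simps)

lemma quat_conj_mult: "quat_conj (quat_mult p q) = quat_mult (quat_conj q) (quat_conj p)"
  unfolding quat_eq_iff quat_mult_sel quat_conj_sel by (simp add: algebra_simps)

lemma norm_quat: "(norm (q :: quaternion))\<^sup>2 = (fst q)\<^sup>2 + (snd q $ 1)\<^sup>2 + (snd q $ 2)\<^sup>2 + (snd q $ 3)\<^sup>2"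
proof -
  have "(norm q)\<^sup>2 = (norm (fst q))\<^sup>2 + (norm (snd q))\<^sup>2"
    by (simp add: norm_prod_def)
  also have "(norm (snd q))\<^sup>2 = inner (snd q) (snd q)" by (simp add: power2_norm_eq_inner)
  finally show ?thesis by (simp add: inner_vec3 power2_eq_square)
qed

lemma norm_quat_one_iff: "norm (q :: quaternion) = 1 \<longleftrightarrow>
    (fst q)\<^sup>2 + (snd q $ 1)\<^sup>2 + (snd q $ 2)\<^sup>2 + (snd q $ 3)\<^sup>2 = 1"
proof -
  have "norm q = 1 \<longleftrightarrow> (norm q)\<^sup>2 = 1" by (simp add: power2_eq_1_iff) (smt (verit) norm_ge_zero)
  then show ?thesis by (simp add: norm_quat)
qed

lemma norm_quat_mult: "norm (quat_mult p q) = norm p * norm q"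
proof -
  have "(norm (quat_mult p q))\<^sup>2 = (norm p * norm q)\<^sup>2"
    unfolding power_mult_distrib norm_quat quat_mult_sel by (simp add: power2_eq_square algebra_simps)
  then show ?thesis by (rule power2_eq_imp_eq) simp_all
qed

lemma norm_quat_conj [simp]: "norm (quat_conj q) = norm q"
proof -
  have "(norm (quat_conj q))\<^sup>2 = (norm q)\<^sup>2" unfolding norm_quat quat_conj_sel by simp
  then show ?thesis by (rule power2_eq_imp_eq) simp_all
qed

lemma quat_conj_inverse:
  assumes "norm q = 1"
  shows "quat_mult (quat_conj q) q = (1, 0)" "quat_mult q (quat_conj q) = (1, 0)"
  using assms unfolding norm_quat_one_iff
  by (simp_all add: quat_eq_iff quat_mult_sel quat_conj_sel power2_eq_square algebra_simps)

text \<open>In vector notation with q = (a, u): the image of v is (a^2 - |u|^2) v + 2 (u . v) u + 2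
  a (u x v).\<close>

lemma quat_rotation_nth:
  "quat_rotation q v $ 1 = ((fst q)\<^sup>2 - (snd q $ 1)\<^sup>2 - (snd q $ 2)\<^sup>2 - (snd q $ 3)\<^sup>2) * v $ 1
     + 2 * (snd q $ 1 * v $ 1 + snd q $ 2 * v $ 2 + snd q $ 3 * v $ 3) * snd q $ 1
     + 2 * fst q * (snd q $ 2 * v $ 3 - snd q $ 3 * v $ 2)"
  "quat_rotation q v $ 2 = ((fst q)\<^sup>2 - (snd q $ 1)\<^sup>2 - (snd q $ 2)\<^sup>2 - (snd q $ 3)\<^sup>2) * v $ 2
     + 2 * (snd q $ 1 * v $ 1 + snd q $ 2 * v $ 2 + snd q $ 3 * v $ 3) * snd q $ 2
     + 2 * fst q * (snd q $ 3 * v $ 1 - snd q $ 1 * v $ 3)"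
  "quat_rotation q v $ 3 = ((fst q)\<^sup>2 - (snd q $ 1)\<^sup>2 - (snd q $ 2)\<^sup>2 - (snd q $ 3)\<^sup>2) * v $ 3
     + 2 * (snd q $ 1 * v $ 1 + snd q $ 2 * v $ 2 + snd q $ 3 * v $ 3) * snd q $ 3
     + 2 * fst q * (snd q $ 1 * v $ 2 - snd q $ 2 * v $ 1)"
  unfolding quat_rotation_def
  by (simp_all only: quat_mult_sel quat_conj_sel fst_conv snd_conv)
    (simp_all add: algebra_simps power2_eq_square)

lemma quat_rotation_pure: "quat_mult (quat_mult q (0, v)) (quat_conj q) = (0, quat_rotation q v)"
proof -
  have "fst (quat_mult (quat_mult q (0, v)) (quat_conj q)) = 0"
    unfolding quat_mult_sel quat_conj_sel by (simp add: algebra_simps)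
  then show ?thesis by (simp add: quat_rotation_def prod_eq_iff)
qed

lemma quat_rotation_mult: "quat_rotation (quat_mult p q) v = quat_rotation p (quat_rotation q v)"
proof -
  have "(0, quat_rotation (quat_mult p q) v) =
      quat_mult (quat_mult p (quat_mult (quat_mult q (0, v)) (quat_conj q))) (quat_conj p)"
    unfolding quat_rotation_pure[symmetric] by (simp add: quat_conj_mult quat_mult_assoc)
  also have "\<dots> = (0, quat_rotation p (quat_rotation q v))"
    by (simp add: quat_rotation_pure)
  finally show ?thesis by simp
qed

lemma quat_rotation_one [simp]: "quat_rotation (1, 0) v = v"
  by (simp add: vec3_eq_iff quat_rotation_nth)

lemma quat_rotation_scaleR: "quat_rotation (c *\<^sub>R q) v = c\<^sup>2 *\<^sub>R quat_rotation q v"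
  unfolding vec3_eq_iff vector_scaleR_component quat_rotation_nth
  by (simp add: algebra_simps power2_eq_square)

lemma quat_rotation_minus [simp]: "quat_rotation (- q) v = quat_rotation q v"
  using quat_rotation_scaleR[of "-1" q v] by simp

lemma linear_quat_rotation: "linear (quat_rotation q)"
  by (rule linearI) (simp_all add: vec3_eq_iff quat_rotation_nth algebra_simps)

lemma orthogonal_quat_rotation:
  assumes "norm q = 1"
  shows "orthogonal_transformation (quat_rotation q)"
proof -
  have "norm (quat_rotation q v) = norm v" for v
  proof -
    have "norm (0 :: real, quat_rotation q v) = norm (0 :: real, v)"
      unfolding quat_rotation_pure[symmetric] by (simp add: norm_quat_mult assms)
    then show ?thesis by (simp add: norm_prod_def)
  qed
  then show ?thesis by (simp add: orthogonal_transformation linear_quat_rotation)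
qed

lemma inner_quat_rotation: "norm q = 1 \<Longrightarrow> inner (quat_rotation q u) (quat_rotation q v) = inner u v"
  using orthogonal_quat_rotation by (simp add: orthogonal_transformation_def)

text \<open>A unit quaternion other than \<open>-1\<close> is the square of a unit quaternion, so its rotation has the
  determinant of a squared orthogonal matrix.\<close>

lemma det_quat_rotation:
  assumes q: "norm q = 1"
  shows "Determinants.det (matrix (quat_rotation q)) = 1"
proof (cases "fst q = -1")
  case True
  then have "(snd q $ 1)\<^sup>2 + (snd q $ 2)\<^sup>2 + (snd q $ 3)\<^sup>2 = 0" using q by (simp add: norm_quat_one_iff)
  then have "snd q $ 1 = 0 \<and> snd q $ 2 = 0 \<and> snd q $ 3 = 0"
    by (smt (verit) power2_less_eq_zero_iff zero_le_power2)
  then have "quat_rotation q = id" using True by (auto simp: vec3_eq_iff quat_rotation_nth)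
  then show ?thesis by (simp add: matrix_id_mat_1)
next
  case False
  \<comment> \<open>The square root of q is the normalised midpoint of 1 and q.\<close>
  define p where "p = (1 / norm ((1, 0) + q)) *\<^sub>R ((1, 0) + q)"
  have n2: "(norm ((1, 0) + q))\<^sup>2 = 2 + 2 * fst q"
    using q unfolding norm_quat norm_quat_one_iff by (simp add: power2_eq_square algebra_simps)
  have "(norm ((1, 0) + q))\<^sup>2 \<noteq> 0" using False unfolding n2 by simp
  then have nz: "norm ((1, 0) + q) \<noteq> 0" by simp
  then have np: "norm p = 1" by (simp add: p_def)
  have "quat_mult ((1, 0) + q) ((1, 0) + q) = (2 + 2 * fst q) *\<^sub>R q"
    using q unfolding norm_quat_one_iff quat_eq_iff quat_mult_sel by (simp add: power2_eq_square algebra_simps)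
  then have "quat_mult p p = q"
    unfolding p_def quat_mult_scaleR n2[symmetric] using nz by (simp add: power2_eq_square)
  then have "quat_rotation q = quat_rotation p \<circ> quat_rotation p" using quat_rotation_mult by fastforce
  then have "Determinants.det (matrix (quat_rotation q)) = (Determinants.det (matrix (quat_rotation p)))\<^sup>2"
    by (simp add: matrix_compose linear_quat_rotation det_mul power2_eq_square)
  moreover have "Determinants.det (matrix (quat_rotation p)) = 1 \<or> Determinants.det (matrix (quat_rotation p)) = -1"
    using orthogonal_quat_rotation[OF np] by (simp add: orthogonal_transformation_matrix det_orthogonal_matrix)
  ultimately show ?thesis by auto
qed

lemma quat_rotation_in_rotation_group_iff:
  "norm q = 1 \<Longrightarrow> quat_rotation q \<in> rotation_group S \<longleftrightarrow> quat_rotation q ` S = S"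
  by (simp add: rotation_group_def symmetry_group_def orthogonal_quat_rotation det_quat_rotation)

text \<open>The carrier of \<open>spin_preimage (rotation_group S)\<close> in a form free of
  determinants.\<close>

definition spin_set :: "(real^3) set \<Rightarrow> quaternion set"
  where "spin_set S = {q. norm q = 1 \<and> quat_rotation q ` S = S}"

lemma carrier_spin: "carrier (spin_preimage (rotation_group S)) = spin_set S"
  unfolding spin_preimage_def spin_set_def
  by (simp add: quat_rotation_in_rotation_group_iff cong: conj_cong)

lemma spin_set_mult: "p \<in> spin_set S \<Longrightarrow> q \<in> spin_set S \<Longrightarrow> quat_mult p q \<in> spin_set S"
  unfolding spin_set_def by (simp add: norm_quat_mult quat_rotation_mult image_image[symmetric])

lemma spin_set_one: "(1, 0) \<in> spin_set S"
  by (simp add: spin_set_def norm_quat_one_iff)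

lemma quat_rotation_conj:
  assumes "norm q = 1"
  shows "quat_rotation (quat_conj q) (quat_rotation q v) = v"
  by (simp add: quat_rotation_mult[symmetric] quat_conj_inverse assms)

lemma spin_set_conj:
  assumes "q \<in> spin_set S"
  shows "quat_conj q \<in> spin_set S"
proof -
  have q: "norm q = 1" "quat_rotation q ` S = S" using assms by (auto simp: spin_set_def)
  have "quat_rotation (quat_conj q) ` S = quat_rotation (quat_conj q) ` (quat_rotation q ` S)" using q by simp
  also have "\<dots> = S" by (simp add: image_image quat_rotation_conj[OF q(1)])
  finally show ?thesis using q by (simp add: spin_set_def)
qed

lemma spin_set_minus: "q \<in> spin_set S \<Longrightarrow> - q \<in> spin_set S"
  by (simp add: spin_set_def)

lemma group_spin: "group (spin_preimage (rotation_group S))"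
proof (rule groupI)
  fix x assume "x \<in> carrier (spin_preimage (rotation_group S))"
  then have "quat_conj x \<in> spin_set S" "quat_mult (quat_conj x) x = (1, 0)"
    using spin_set_conj[of x S] quat_conj_inverse[of x] unfolding carrier_spin by (auto simp: spin_set_def)
  then show "\<exists>y\<in>carrier (spin_preimage (rotation_group S)).
      y \<otimes>\<^bsub>spin_preimage (rotation_group S)\<^esub> x = \<one>\<^bsub>spin_preimage (rotation_group S)\<^esub>"
    unfolding carrier_spin by (intro bexI[of _ "quat_conj x"]) (simp_all add: spin_preimage_def)
qed (unfold carrier_spin, auto simp: spin_preimage_def spin_set_mult spin_set_one quat_mult_assoc)

lemma inv_spin:
  assumes "q \<in> spin_set S"
  shows "inv\<^bsub>spin_preimage (rotation_group S)\<^esub> q = quat_conj q"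
proof -
  have "quat_mult (quat_conj q) q = (1, 0)" using assms by (auto simp: spin_set_def quat_conj_inverse)
  then show ?thesis
    using group.inv_equality[OF group_spin, of S "quat_conj q" q] assms spin_set_conj[OF assms]
    by (simp add: carrier_spin) (simp add: spin_preimage_def)
qed

text \<open>A vector fixed by the rotation commutes with q, so it is parallel to the imaginary part
  of q. Two fixed vectors that are not parallel force the imaginary part to vanish.\<close>

lemma quat_fixing_frame:
  assumes q: "norm q = 1" and fixed: "quat_rotation q u = u" "quat_rotation q v = v" and uv: "cross3 u v \<noteq> 0"
  shows "q = (1, 0) \<or> q = (-1, 0)"
proof -
  have par: "cross3 (snd q) w = 0" if "quat_rotation q w = w" for w
  proof -
    have "quat_mult q (0, w) = quat_mult (quat_mult q (0, w)) (quat_mult (quat_conj q) q)"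
      by (simp add: quat_conj_inverse[OF q])
    also have "\<dots> = quat_mult (0, w) q"
      using quat_rotation_pure[of q w] that by (simp add: quat_mult_assoc[symmetric])
    finally show ?thesis unfolding quat_eq_iff quat_mult_sel vec3_eq_iff by (simp add: mult.commute)
  qed
  have "snd q = 0"
  proof (rule ccontr)
    assume nz: "snd q \<noteq> 0"
    have "\<exists>c. w = c *\<^sub>R snd q" if "quat_rotation q w = w" for w
      using par[OF that] nz unfolding cross_eq_0 collinear_lemma by (metis scaleR_zero_left)
    then obtain c d where "u = c *\<^sub>R snd q" "v = d *\<^sub>R snd q" using fixed by metis
    then have "cross3 u v = 0" by (simp add: vec3_eq_iff)
    then show False using uv by simp
  qed
  then show ?thesis using q unfolding norm_quat_one_iff quat_eq_iff by (simp add: power2_eq_1_iff)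
qed

section \<open>Exact arithmetic with the golden ratio\<close>

lemma golden_ratio_square: "golden_ratio * golden_ratio = golden_ratio + 1"
  by (simp add: golden_ratio_def field_simps)

lemma golden_ratio_bounds: "8 / 5 < golden_ratio" "golden_ratio < 17 / 10"
proof -
  have "11 / 5 < sqrt 5" by (rule real_less_rsqrt) (simp add: power2_eq_square)
  then show "8 / 5 < golden_ratio" by (simp add: golden_ratio_def)
  have "sqrt 5 < 12 / 5" by (rule real_less_lsqrt) (simp_all add: power2_eq_square)
  then show "golden_ratio < 17 / 10" by (simp add: golden_ratio_def)
qed

text \<open>A pair \<open>(a, b)\<close> stands for \<open>a + b * golden_ratio\<close>.\<close>

type_synonym zphi = "int \<times> int"
type_synonym zvec = "zphi \<times> zphi \<times> zphi"
type_synonym zquat = "zphi \<times> zphi \<times> zphi \<times> zphi"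

definition zev :: "zphi \<Rightarrow> real"
  where "zev x = of_int (fst x) + of_int (snd x) * golden_ratio"

fun zadd :: "zphi \<Rightarrow> zphi \<Rightarrow> zphi" where "zadd (a, b) (c, d) = (a + c, b + d)"
fun zsub :: "zphi \<Rightarrow> zphi \<Rightarrow> zphi" where "zsub (a, b) (c, d) = (a - c, b - d)"
text \<open>Products are reduced by phi^2 = phi + 1.\<close>

fun zmul :: "zphi \<Rightarrow> zphi \<Rightarrow> zphi" where "zmul (a, b) (c, d) = (a * c + b * d, a * d + b * c + b * d)"

text \<open>Sufficient for \<open>x\<close> and \<open>y\<close> to have distinct values, by the bounds on the golden ratio.\<close>

fun zapart :: "zphi \<Rightarrow> zphi \<Rightarrow> bool" where
  "zapart (a, b) (c, d) \<longleftrightarrow>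
    (10 * (a - c) + 16 * (b - d) > 0 \<and> 10 * (a - c) + 17 * (b - d) > 0) \<or>
    (10 * (a - c) + 16 * (b - d) < 0 \<and> 10 * (a - c) + 17 * (b - d) < 0)"

lemma zev_add [simp]: "zev (zadd x y) = zev x + zev y"
  by (cases x; cases y) (simp add: zev_def algebra_simps)

lemma zev_sub [simp]: "zev (zsub x y) = zev x - zev y"
  by (cases x; cases y) (simp add: zev_def algebra_simps)

lemma zev_mul [simp]: "zev (zmul x y) = zev x * zev y"
proof (cases x; cases y)
  fix a b c d assume x: "x = (a, b)" and y: "y = (c, d)"
  have "zev x * zev y = of_int a * of_int c + (of_int a * of_int d + of_int b * of_int c) * golden_ratio
      + of_int b * of_int d * (golden_ratio * golden_ratio)"
    unfolding x y zev_def by (simp add: algebra_simps)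
  then show ?thesis unfolding golden_ratio_square x y by (simp add: zev_def algebra_simps)
qed

text \<open>The difference of the two values is affine in the golden ratio, so a common strict sign
  at 8/5 and 17/10, scaled by 10, persists in between.\<close>

lemma zev_apart:
  assumes "zapart x y"
  shows "zev x \<noteq> zev y"
proof (cases x; cases y)
  fix a b c d assume x: "x = (a, b)" and y: "y = (c, d)"
  define s t where "s = real_of_int (a - c)" and "t = real_of_int (b - d)"
  have cs: "(10 * s + 16 * t > 0 \<and> 10 * s + 17 * t > 0) \<or> (10 * s + 16 * t < 0 \<and> 10 * s + 17 * t < 0)"
    using assms unfolding x y zapart.simps s_def t_def by linarith
  have diff: "zev x - zev y = s + t * golden_ratio" by (simp add: x y zev_def s_def t_def algebra_simps)
  have g: "8 / 5 \<le> golden_ratio" "golden_ratio \<le> 17 / 10" using golden_ratio_bounds by auto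
  have "s + t * golden_ratio \<noteq> 0"
  proof (cases "t \<ge> 0")
    case True
    from mult_left_mono[OF g(1) True] mult_left_mono[OF g(2) True] cs show ?thesis
      by (elim disjE) linarith+
  next
    case False
    then have "t \<le> 0" by simp
    from mult_left_mono_neg[OF g(1) this] mult_left_mono_neg[OF g(2) this] cs show ?thesis
      by (elim disjE) linarith+
  qed
  then show ?thesis using diff by auto
qed

definition vev :: "zvec \<Rightarrow> real^3"
  where "vev v = (case v of (x, y, z) \<Rightarrow> vector [zev x, zev y, zev z])"

definition qev :: "zquat \<Rightarrow> quaternion"
  where "qev q = (case q of (a, v) \<Rightarrow> (zev a, vev v))"

fun zdot :: "zvec \<Rightarrow> zvec \<Rightarrow> zphi"
  where "zdot (a, b, c) (x, y, z) = zadd (zmul a x) (zadd (zmul b y) (zmul c z))"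

fun zscale :: "zphi \<Rightarrow> zvec \<Rightarrow> zvec"
  where "zscale c (x, y, z) = (zmul c x, zmul c y, zmul c z)"

fun zvadd :: "zvec \<Rightarrow> zvec \<Rightarrow> zvec"
  where "zvadd (a, b, c) (x, y, z) = (zadd a x, zadd b y, zadd c z)"

fun zcross :: "zvec \<Rightarrow> zvec \<Rightarrow> zvec"
  where "zcross (a, b, c) (x, y, z) =
    (zsub (zmul b z) (zmul c y), zsub (zmul c x) (zmul a z), zsub (zmul a y) (zmul b x))"

fun zvapart :: "zvec \<Rightarrow> zvec \<Rightarrow> bool"
  where "zvapart (a, b, c) (x, y, z) \<longleftrightarrow> zapart a x \<or> zapart b y \<or> zapart c z"

fun znorm :: "zquat \<Rightarrow> zphi"
  where "znorm (a, v) = zadd (zmul a a) (zdot v v)"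

fun zre :: "zquat \<Rightarrow> zquat \<Rightarrow> zphi"
  where "zre (a, u) (b, v) = zsub (zmul a b) (zdot u v)"

text \<open>The rotation by the normalised quaternion, multiplied by the squared norm of q; the
  coordinates thereby stay in Z[phi].\<close>

fun zrot :: "zquat \<Rightarrow> zvec \<Rightarrow> zvec"
  where "zrot (a, u) v = zvadd (zscale (zsub (zmul a a) (zdot u u)) v)
    (zscale (2, 0) (zvadd (zscale (zdot u v) u) (zscale a (zcross u v))))"

lemma vev_nth [simp]: "vev (x, y, z) $ 1 = zev x" "vev (x, y, z) $ 2 = zev y" "vev (x, y, z) $ 3 = zev z"
  by (simp_all add: vev_def)

lemma zev_dot: "zev (zdot u v) = inner (vev u) (vev v)"
  by (cases u rule: prod_cases3; cases v rule: prod_cases3) (simp add: inner_vec3)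

lemma vev_scale: "vev (zscale c v) = zev c *\<^sub>R vev v"
  by (cases v rule: prod_cases3) (simp add: vec3_eq_iff)

lemma vev_add: "vev (zvadd u v) = vev u + vev v"
  by (cases u rule: prod_cases3; cases v rule: prod_cases3) (simp add: vec3_eq_iff)

lemma vev_cross: "vev (zcross u v) = cross3 (vev u) (vev v)"
  by (cases u rule: prod_cases3; cases v rule: prod_cases3) (simp add: vec3_eq_iff)

lemma vev_apart: "zvapart u v \<Longrightarrow> vev u \<noteq> vev v"
  by (cases u rule: prod_cases3; cases v rule: prod_cases3) (auto simp: vec3_eq_iff dest: zev_apart)

lemma zev_norm: "zev (znorm q) = (norm (qev q))\<^sup>2"
  unfolding norm_quat by (cases q rule: prod_cases4) (simp add: qev_def power2_eq_square)

lemma zev_re: "zev (zre p q) = fst (quat_mult (qev p) (qev q))"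
  by (cases p rule: prod_cases4; cases q rule: prod_cases4) (simp add: qev_def quat_mult_def inner_vec3)

lemma vev_rot: "vev (zrot q v) = quat_rotation (qev q) (vev v)"
proof -
  obtain a u where q: "q = (a, u)" by (metis surj_pair)
  have two: "zev (2, 0) = 2" by (simp add: zev_def)
  show ?thesis
    unfolding q zrot.simps vev_add vev_scale vev_cross two vec3_eq_iff quat_rotation_nth
    by (simp add: qev_def zev_dot inner_vec3) (simp add: algebra_simps power2_eq_square)
qed

text \<open>A certificate that enumerates the group: the i-th member of the transversal
  \<open>Ls\<close> takes the vertex \<open>p0\<close> to the i-th vertex, and the j-th member of
  the stabiliser \<open>Ks\<close> of \<open>p0\<close> takes \<open>p1\<close> to the j-th entry of
  \<open>Ns\<close>. Every vertex that could have the inner product of \<open>p1\<close> with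
  \<open>p0\<close> must occur in \<open>Ns\<close>. As \<open>p0\<close> and \<open>p1\<close> are
  not parallel, their images determine a rotation.\<close>

definition good_frame :: "zvec list \<Rightarrow> zquat list \<Rightarrow> zquat list \<Rightarrow> zvec list \<Rightarrow> zvec \<Rightarrow> zvec \<Rightarrow> bool"
  where "good_frame Vs Ls Ks Ns p0 p1 \<longleftrightarrow>
    length Ls = length Vs \<and> length Ks = length Ns \<and> p0 \<in> set Vs \<and> p1 \<in> set Vs \<and>
    list_all2 (\<lambda>q v. zrot q p0 = zscale (znorm q) v) Ls Vs \<and>
    list_all2 (\<lambda>q v. zrot q p1 = zscale (znorm q) v \<and> zrot q p0 = zscale (znorm q) p0) Ks Ns \<and>
    sorted_wrt zvapart Vs \<and> sorted_wrt zvapart Ns \<and>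
    (\<forall>v\<in>set Vs. v \<in> set Ns \<or> zapart (zdot v p0) (zdot p1 p0)) \<and>
    (\<forall>q\<in>set Ls \<union> set Ks. zapart (znorm q) (0, 0) \<and> (\<forall>v\<in>set Vs. zrot q v \<in> zscale (znorm q) ` set Vs)) \<and>
    zvapart (zcross p0 p1) ((0, 0), (0, 0), (0, 0))"

text \<open>The pair (x, n) encodes the real part x / sqrt n of the normalised product. Keeping n
  apart confines the sqrt 2 of the octahedral group to this quotient.\<close>

definition traces :: "zquat list \<Rightarrow> zquat list \<Rightarrow> (zphi \<times> zphi) list"
  where "traces Ls Ks = concat (map (\<lambda>l. map (\<lambda>k. (zre l k, zmul (znorm l) (znorm k))) Ks) Ls)"

definition unit_quat :: "zquat \<Rightarrow> quaternion"
  where "unit_quat q = (1 / norm (qev q)) *\<^sub>R qev q"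

lemma unit_quat:
  assumes "zapart (znorm q) (0, 0)"
  shows "norm (unit_quat q) = 1"
    and "zrot q v = zscale (znorm q) w \<Longrightarrow> quat_rotation (unit_quat q) (vev v) = vev w"
proof -
  have "(norm (qev q))\<^sup>2 \<noteq> 0" using zev_apart[OF assms] by (simp add: zev_norm) (simp add: zev_def)
  then have nz: "norm (qev q) \<noteq> 0" by simp
  then show "norm (unit_quat q) = 1" by (simp add: unit_quat_def)
  assume "zrot q v = zscale (znorm q) w"
  then have "quat_rotation (qev q) (vev v) = (norm (qev q))\<^sup>2 *\<^sub>R vev w"
    by (metis vev_rot vev_scale zev_norm)
  then show "quat_rotation (unit_quat q) (vev v) = vev w"
    unfolding unit_quat_def quat_rotation_scaleR using nz by (simp add: power2_eq_square)
qed

lemma sorted_wrt_zvapart_inj: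
  assumes "sorted_wrt zvapart vs" "i < length vs" "j < length vs" "vev (vs ! i) = vev (vs ! j)"
  shows "i = j"
proof (rule ccontr)
  assume "i \<noteq> j"
  then consider "i < j" | "j < i" by linarith
  then show False
    by cases (use assms sorted_wrt_nth_less[OF assms(1)] vev_apart in metis)+
qed

lemma sum_quat_product_list:
  fixes F :: "real \<Rightarrow> complex"
  shows "(\<Sum>l\<leftarrow>Ls. \<Sum>k\<leftarrow>Ks. F (fst (quat_mult (unit_quat l) (unit_quat k)))) =
    (\<Sum>(x, n)\<leftarrow>traces Ls Ks. F (zev x / sqrt (zev n)))"
proof -
  have "fst (quat_mult (unit_quat l) (unit_quat k)) = zev (zre l k) / sqrt (zev (zmul (znorm l) (znorm k)))" for l k
    unfolding unit_quat_def quat_mult_scaleR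
    by (simp add: zev_re zev_norm real_sqrt_mult)
  moreover have "(\<Sum>(x, n)\<leftarrow>traces Ls Ks. H x n) =
      (\<Sum>l\<leftarrow>Ls. \<Sum>k\<leftarrow>Ks. H (zre l k) (zmul (znorm l) (znorm k)))" for H :: "zphi \<Rightarrow> zphi \<Rightarrow> complex"
    by (induction Ls) (simp_all add: traces_def o_def)
  ultimately show ?thesis by simp
qed

text \<open>An element of the binary group is determined up to sign by the images of two vertices:
  the first image selects a transversal element, the second an element of the stabiliser.\<close>

lemma spin_set_bij:
  assumes "good_frame Vs Ls Ks Ns p0 p1"
  shows "bij_betw (\<lambda>(i, j, s). (if s then quat_mult (unit_quat (Ls ! i)) (unit_quat (Ks ! j))
      else - quat_mult (unit_quat (Ls ! i)) (unit_quat (Ks ! j))))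
    ({..<length Ls} \<times> {..<length Ks} \<times> (UNIV :: bool set)) (spin_set (vev ` set Vs))"
proof -
  let ?S = "vev ` set Vs"
  note gf = assms[unfolded good_frame_def]
  have lenL: "length Ls = length Vs" and lenK: "length Ks = length Ns" and p0: "p0 \<in> set Vs" and p1: "p1 \<in> set Vs" using gf by auto
  have spin: "unit_quat q \<in> spin_set ?S" if "q \<in> set Ls \<union> set Ks" for q
  proof -
    have ap: "zapart (znorm q) (0, 0)" and im: "\<forall>v\<in>set Vs. zrot q v \<in> zscale (znorm q) ` set Vs"
      using gf that by auto
    have sub: "quat_rotation (unit_quat q) ` ?S \<subseteq> ?S"
    proof clarify
      fix v assume "v \<in> set Vs"
      then obtain w where "w \<in> set Vs" "zrot q v = zscale (znorm q) w" using im by auto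
      then show "quat_rotation (unit_quat q) (vev v) \<in> vev ` set Vs" using unit_quat(2)[OF ap] by auto
    qed
    have "inj (quat_rotation (unit_quat q))"
      by (metis quat_rotation_conj[OF unit_quat(1)[OF ap]] injI)
    then have "card (quat_rotation (unit_quat q) ` ?S) = card ?S"
      by (metis card_image inj_on_subset subset_UNIV)
    then have "quat_rotation (unit_quat q) ` ?S = ?S" using sub by (intro card_subset_eq) auto
    then show ?thesis using unit_quat(1)[OF ap] by (simp add: spin_set_def)
  qed
  have L0: "quat_rotation (unit_quat (Ls ! i)) (vev p0) = vev (Vs ! i)" if "i < length Ls" for i
  proof (rule unit_quat(2))
    show "zapart (znorm (Ls ! i)) (0, 0)" using gf that by auto
    show "zrot (Ls ! i) p0 = zscale (znorm (Ls ! i)) (Vs ! i)" using gf that by (auto simp: list_all2_conv_all_nth)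
  qed
  have K0: "quat_rotation (unit_quat (Ks ! j)) (vev p0) = vev p0" if "j < length Ks" for j
  proof (rule unit_quat(2))
    show "zapart (znorm (Ks ! j)) (0, 0)" using gf that by auto
    show "zrot (Ks ! j) p0 = zscale (znorm (Ks ! j)) p0" using gf that by (auto simp: list_all2_conv_all_nth)
  qed
  have K1: "quat_rotation (unit_quat (Ks ! j)) (vev p1) = vev (Ns ! j)" if "j < length Ks" for j
  proof (rule unit_quat(2))
    show "zapart (znorm (Ks ! j)) (0, 0)" using gf that by auto
    show "zrot (Ks ! j) p1 = zscale (znorm (Ks ! j)) (Ns ! j)" using gf that by (auto simp: list_all2_conv_all_nth)
  qed
  have sV: "sorted_wrt zvapart Vs" and sN: "sorted_wrt zvapart Ns" using gf by auto
  let ?f = "\<lambda>(i, j, s). (if s then quat_mult (unit_quat (Ls ! i)) (unit_quat (Ks ! j))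
      else - quat_mult (unit_quat (Ls ! i)) (unit_quat (Ks ! j)))"
  let ?D = "{..<length Ls} \<times> {..<length Ks} \<times> (UNIV :: bool set)"
  have rot: "quat_rotation (?f (i, j, s)) v = quat_rotation (unit_quat (Ls ! i)) (quat_rotation (unit_quat (Ks ! j)) v)" for i j s v
    by (simp add: quat_rotation_mult)
  have into: "?f t \<in> spin_set ?S" if tD: "t \<in> ?D" for t
  proof -
    obtain i j s where t: "t = (i, j, s)" "i < length Ls" "j < length Ks" using tD by auto
    then have "quat_mult (unit_quat (Ls ! i)) (unit_quat (Ks ! j)) \<in> spin_set ?S"
      by (intro spin_set_mult spin) auto
    then show ?thesis using t(1) spin_set_minus by simp
  qed
  have inj: "inj_on ?f ?D"
  proof (rule inj_onI)
    fix t t' assume t: "t \<in> ?D" "t' \<in> ?D" and eqt: "?f t = ?f t'"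
    obtain i j s i' j' s' where tt: "t = (i, j, s)" "t' = (i', j', s')" by (metis surj_pair)
    then have b: "i < length Ls" "j < length Ks" "i' < length Ls" "j' < length Ks" using t by auto
    have eq: "?f (i, j, s) = ?f (i', j', s')" using eqt tt by simp
    have l: "norm (unit_quat (Ls ! i)) = 1" and k: "norm (unit_quat (Ks ! j)) = 1"
      using spin b by (auto simp: spin_set_def)
    have "vev (Vs ! i) = vev (Vs ! i')"
      using arg_cong[OF eq, of "\<lambda>q. quat_rotation q (vev p0)"] b unfolding rot by (simp add: K0 L0)
    then have i: "i = i'" using sorted_wrt_zvapart_inj[OF sV] b lenL by simp
    have "quat_rotation (unit_quat (Ls ! i)) (vev (Ns ! j)) = quat_rotation (unit_quat (Ls ! i)) (vev (Ns ! j'))"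
      using arg_cong[OF eq, of "\<lambda>q. quat_rotation q (vev p1)"] b unfolding rot i by (simp add: K1)
    then have "vev (Ns ! j) = vev (Ns ! j')" by (metis quat_rotation_conj[OF l])
    then have j: "j = j'" using sorted_wrt_zvapart_inj[OF sN] b lenK by simp
    have "norm (quat_mult (unit_quat (Ls ! i)) (unit_quat (Ks ! j))) = 1" by (simp add: norm_quat_mult l k)
    then have nz: "quat_mult (unit_quat (Ls ! i)) (unit_quat (Ks ! j)) \<noteq> 0" by auto
    have "s = s'"
    proof (rule ccontr)
      assume "s \<noteq> s'"
      then have "quat_mult (unit_quat (Ls ! i)) (unit_quat (Ks ! j)) = - quat_mult (unit_quat (Ls ! i)) (unit_quat (Ks ! j))"
        using eq i j by (cases s; cases s') auto
      then have "2 *\<^sub>R quat_mult (unit_quat (Ls ! i)) (unit_quat (Ks ! j)) = 0"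
        by (metis scaleR_2 add.right_inverse)
      then show False using nz by simp
    qed
    then show "t = t'" using i j tt by simp
  qed
  have surj: "h \<in> ?f ` ?D" if h: "h \<in> spin_set ?S" for h
  proof -
    have nh: "norm h = 1" using h by (simp add: spin_set_def)
    have "quat_rotation h (vev p0) \<in> ?S" using h p0 by (auto simp: spin_set_def)
    then obtain i where i: "i < length Ls" "quat_rotation h (vev p0) = vev (Vs ! i)"
      using lenL by (auto simp: in_set_conv_nth)
    define l where "l = unit_quat (Ls ! i)"
    have l: "l \<in> spin_set ?S" "norm l = 1" using spin[of "Ls ! i"] i by (auto simp: l_def spin_set_def)
    define q where "q = quat_mult (quat_conj l) h"
    have q: "q \<in> spin_set ?S" "norm q = 1"
      using spin_set_mult[OF spin_set_conj[OF l(1)] h] by (auto simp: q_def spin_set_def)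
    have q0: "quat_rotation q (vev p0) = vev p0"
      using quat_rotation_conj[OF l(2), of "vev p0"] L0[OF i(1)] i(2) by (simp add: q_def quat_rotation_mult l_def)
    have "quat_rotation q (vev p1) \<in> ?S" using q p1 by (auto simp: spin_set_def)
    then obtain v where v: "v \<in> set Vs" "quat_rotation q (vev p1) = vev v" by auto
    \<comment> \<open>Since q fixes \<open>p0\<close> and preserves inner products, the image of
      \<open>p1\<close> is one of the candidates in \<open>Ns\<close>.\<close>
    have "inner (vev v) (vev p0) = inner (vev p1) (vev p0)"
      using inner_quat_rotation[OF q(2), of "vev p1" "vev p0"] v q0 by simp
    then have "\<not> zapart (zdot v p0) (zdot p1 p0)" using zev_apart[of "zdot v p0" "zdot p1 p0"] by (auto simp: zev_dot)
    then have "v \<in> set Ns" using gf v(1) by blast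
    then obtain j where j: "j < length Ks" "v = Ns ! j" using lenK by (auto simp: in_set_conv_nth)
    define k where "k = unit_quat (Ks ! j)"
    have k: "k \<in> spin_set ?S" "norm k = 1" using spin[of "Ks ! j"] j by (auto simp: k_def spin_set_def)
    define r where "r = quat_mult (quat_conj k) q"
    have r: "norm r = 1" using k q by (simp add: r_def norm_quat_mult)
    have "quat_rotation r (vev p0) = vev p0"
      using quat_rotation_conj[OF k(2), of "vev p0"] K0[OF j(1)] q0 by (simp add: r_def quat_rotation_mult k_def)
    moreover have "quat_rotation r (vev p1) = vev p1"
      using quat_rotation_conj[OF k(2), of "vev p1"] K1[OF j(1)] v j by (simp add: r_def quat_rotation_mult k_def)
    moreover have "cross3 (vev p0) (vev p1) \<noteq> 0"
    proof -
      have "vev (zcross p0 p1) \<noteq> vev ((0, 0), (0, 0), (0, 0))" using gf by (intro vev_apart) auto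
      moreover have "vev ((0, 0), (0, 0), (0, 0)) = 0" by (simp add: vec3_eq_iff zev_def)
      ultimately show ?thesis by (simp add: vev_cross)
    qed
    ultimately have "r = (1, 0) \<or> r = (-1, 0)" by (rule quat_fixing_frame[OF r])
    moreover have "h = quat_mult (quat_mult l k) r"
    proof -
      have "quat_mult (quat_mult l k) r = quat_mult l (quat_mult (quat_mult k (quat_conj k)) (quat_mult (quat_conj l) h))"
        by (simp add: r_def q_def quat_mult_assoc)
      also have "\<dots> = quat_mult (quat_mult l (quat_conj l)) h"
        by (simp add: quat_conj_inverse[OF k(2)] quat_mult_assoc)
      finally show ?thesis by (simp add: quat_conj_inverse[OF l(2)])
    qed
    moreover have "quat_mult (quat_mult l k) (-1, 0) = - quat_mult l k"
      by (simp add: quat_eq_iff quat_mult_sel)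
    \<comment> \<open>The remaining factor r is 1 or -1 and becomes the Boolean component of the
      index.\<close>
    ultimately have "h = ?f (i, j, r = (1, 0))" by (auto simp: l_def k_def)
    then show ?thesis using i(1) j(1) by blast
  qed
  show ?thesis unfolding bij_betw_def using inj into surj by blast
qed

text \<open>Each pair of a transversal and a stabiliser element stands for a quaternion and its
  negative, whence the two summands.\<close>

lemma sum_spin_set:
  fixes F :: "real \<Rightarrow> complex"
  assumes "good_frame Vs Ls Ks Ns p0 p1"
  shows "(\<Sum>q\<in>spin_set (vev ` set Vs). F (fst q)) =
    (\<Sum>(x, n)\<leftarrow>traces Ls Ks. F (zev x / sqrt (zev n)) + F (- (zev x / sqrt (zev n))))"
proof -
  let ?g = "\<lambda>i j. quat_mult (unit_quat (Ls ! i)) (unit_quat (Ks ! j))"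
  have "(\<Sum>q\<in>spin_set (vev ` set Vs). F (fst q)) =
    (\<Sum>t\<in>{..<length Ls} \<times> {..<length Ks} \<times> (UNIV :: bool set).
      F (fst ((\<lambda>(i, j, s). (if s then ?g i j else - ?g i j)) t)))"
    by (rule sum.reindex_bij_betw[OF spin_set_bij[OF assms], symmetric])
  also have "\<dots> = (\<Sum>i<length Ls. \<Sum>j<length Ks. \<Sum>s\<in>(UNIV :: bool set). F (fst (if s then ?g i j else - ?g i j)))"
    by (simp add: sum.cartesian_product split_def)
  also have "\<dots> = (\<Sum>i<length Ls. \<Sum>j<length Ks. (\<lambda>x. F x + F (- x)) (fst (?g i j)))"
    by (simp add: UNIV_bool add.commute)
  also have "\<dots> = (\<Sum>l\<leftarrow>Ls. \<Sum>k\<leftarrow>Ks. (\<lambda>x. F x + F (- x)) (fst (quat_mult (unit_quat l) (unit_quat k))))"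
    by (simp add: sum_list_sum_nth lessThan_atLeast0)
  also have "\<dots> = (\<Sum>(x, n)\<leftarrow>traces Ls Ks. (\<lambda>x. F x + F (- x)) (zev x / sqrt (zev n)))"
    by (rule sum_quat_product_list)
  finally show ?thesis by simp
qed

section \<open>Enumeration of the three binary polyhedral groups\<close>

definition tet_vertices :: "zvec list"
  where "tet_vertices = [((1, 0), (1, 0), (1, 0)),
    ((1, 0), (-1, 0), (-1, 0)),
    ((-1, 0), (1, 0), (-1, 0)),
    ((-1, 0), (-1, 0), (1, 0))]"

definition tet_neighbours :: "zvec list"
  where "tet_neighbours = [((1, 0), (-1, 0), (-1, 0)),
    ((-1, 0), (1, 0), (-1, 0)),
    ((-1, 0), (-1, 0), (1, 0))]"

definition tet_transversal :: "zquat list"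
  where "tet_transversal = [((1, 0), (0, 0), (0, 0), (0, 0)),
    ((0, 0), (1, 0), (0, 0), (0, 0)),
    ((0, 0), (0, 0), (1, 0), (0, 0)),
    ((0, 0), (0, 0), (0, 0), (1, 0))]"

definition tet_stabiliser :: "zquat list"
  where "tet_stabiliser = [((1, 0), (0, 0), (0, 0), (0, 0)),
    ((1, 0), (1, 0), (1, 0), (1, 0)),
    ((1, 0), (-1, 0), (-1, 0), (-1, 0))]"


definition oct_vertices :: "zvec list"
  where "oct_vertices = [((1, 0), (0, 0), (0, 0)),
    ((-1, 0), (0, 0), (0, 0)),
    ((0, 0), (1, 0), (0, 0)),
    ((0, 0), (-1, 0), (0, 0)),
    ((0, 0), (0, 0), (1, 0)),
    ((0, 0), (0, 0), (-1, 0))]"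

definition oct_neighbours :: "zvec list"
  where "oct_neighbours = [((0, 0), (1, 0), (0, 0)),
    ((0, 0), (-1, 0), (0, 0)),
    ((0, 0), (0, 0), (1, 0)),
    ((0, 0), (0, 0), (-1, 0))]"

text \<open>The entries such as 1 + k have squared norm 2; they are the source of the real parts 1 /
  sqrt 2.\<close>

definition oct_transversal :: "zquat list"
  where "oct_transversal = [((1, 0), (0, 0), (0, 0), (0, 0)),
    ((0, 0), (0, 0), (1, 0), (0, 0)),
    ((1, 0), (0, 0), (0, 0), (1, 0)),
    ((1, 0), (0, 0), (0, 0), (-1, 0)),
    ((1, 0), (0, 0), (-1, 0), (0, 0)),
    ((1, 0), (0, 0), (1, 0), (0, 0))]"

definition oct_stabiliser :: "zquat list"
  where "oct_stabiliser = [((1, 0), (0, 0), (0, 0), (0, 0)),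
    ((0, 0), (1, 0), (0, 0), (0, 0)),
    ((1, 0), (1, 0), (0, 0), (0, 0)),
    ((1, 0), (-1, 0), (0, 0), (0, 0))]"


definition ico_vertices :: "zvec list"
  where "ico_vertices = [((0, 0), (1, 0), (0, 1)),
    ((1, 0), (0, 1), (0, 0)),
    ((0, 1), (0, 0), (1, 0)),
    ((0, 0), (1, 0), (0, -1)),
    ((1, 0), (0, -1), (0, 0)),
    ((0, -1), (0, 0), (1, 0)),
    ((0, 0), (-1, 0), (0, 1)),
    ((-1, 0), (0, 1), (0, 0)),
    ((0, 1), (0, 0), (-1, 0)),
    ((0, 0), (-1, 0), (0, -1)),
    ((-1, 0), (0, -1), (0, 0)),
    ((0, -1), (0, 0), (-1, 0))]"

definition ico_neighbours :: "zvec list"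
  where "ico_neighbours = [((1, 0), (0, 1), (0, 0)),
    ((0, 1), (0, 0), (1, 0)),
    ((0, -1), (0, 0), (1, 0)),
    ((0, 0), (-1, 0), (0, 1)),
    ((-1, 0), (0, 1), (0, 0))]"

text \<open>Twice unit icosians: all squared norms are 4, as in the stabiliser, so every trace below
  has the denominator sqrt 16.\<close>

definition ico_transversal :: "zquat list"
  where "ico_transversal = [((2, 0), (0, 0), (0, 0), (0, 0)),
    ((0, 1), (-1, 0), (0, 0), (1, -1)),
    ((0, 1), (-1, 1), (1, 0), (0, 0)),
    ((1, 0), (0, -1), (-1, 1), (0, 0)),
    ((1, 0), (1, 0), (1, 0), (-1, 0)),
    ((0, 1), (-1, 1), (-1, 0), (0, 0)),
    ((0, 1), (1, 0), (0, 0), (-1, 1)),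
    ((0, 1), (-1, 0), (0, 0), (-1, 1)),
    ((1, 0), (-1, 0), (1, 0), (-1, 0)),
    ((0, 0), (-2, 0), (0, 0), (0, 0)),
    ((1, 0), (1, 0), (-1, 0), (1, 0)),
    ((1, 0), (-1, 0), (-1, 0), (1, 0))]"

definition ico_stabiliser :: "zquat list"
  where "ico_stabiliser = [((2, 0), (0, 0), (0, 0), (0, 0)),
    ((0, 1), (0, 0), (1, -1), (-1, 0)),
    ((-1, 1), (0, 0), (1, 0), (0, 1)),
    ((-1, 1), (0, 0), (-1, 0), (0, -1)),
    ((0, 1), (0, 0), (-1, 1), (1, 0))]"




lemma frame_tet: "good_frame tet_vertices tet_transversal tet_stabiliser tet_neighbours ((1, 0), (1, 0), (1, 0)) ((1, 0), (-1, 0), (-1, 0))"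
  by code_simp

lemma traces_tet: "traces tet_transversal tet_stabiliser =
  [((1, 0), (1, 0)), ((1, 0), (4, 0)), ((1, 0), (4, 0)), ((0, 0), (1, 0)), ((-1, 0), (4, 0)), ((1, 0), (4, 0)), ((0, 0), (1, 0)), ((-1, 0), (4, 0)), ((1, 0), (4, 0)), ((0, 0), (1, 0)), ((-1, 0), (4, 0)), ((1, 0), (4, 0))]"
  by code_simp

lemma frame_oct: "good_frame oct_vertices oct_transversal oct_stabiliser oct_neighbours ((1, 0), (0, 0), (0, 0)) ((0, 0), (1, 0), (0, 0))"
  by code_simp

lemma traces_oct: "traces oct_transversal oct_stabiliser =
  [((1, 0), (1, 0)), ((0, 0), (1, 0)), ((1, 0), (2, 0)), ((1, 0), (2, 0)), ((0, 0), (1, 0)), ((0, 0), (1, 0)),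
    ((0, 0), (2, 0)), ((0, 0), (2, 0)), ((1, 0), (2, 0)), ((0, 0), (2, 0)), ((1, 0), (4, 0)), ((1, 0), (4,
    0)), ((1, 0), (2, 0)), ((0, 0), (2, 0)), ((1, 0), (4, 0)), ((1, 0), (4, 0)), ((1, 0), (2, 0)), ((0, 0),
    (2, 0)), ((1, 0), (4, 0)), ((1, 0), (4, 0)), ((1, 0), (2, 0)), ((0, 0), (2, 0)), ((1, 0), (4, 0)), ((1,
    0), (4, 0))]"
  by code_simp

lemma frame_ico: "good_frame ico_vertices ico_transversal ico_stabiliser ico_neighbours ((0, 0), (1, 0), (0, 1)) ((1, 0), (0, 1), (0, 0))"
  by code_simp

lemma traces_ico: "traces ico_transversal ico_stabiliser =
  [((4, 0), (16, 0)), ((0, 2), (16, 0)), ((-2, 2), (16, 0)), ((-2, 2), (16, 0)), ((0, 2), (16, 0)), ((0, 2),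
    (16, 0)), ((2, 0), (16, 0)), ((2, 0), (16, 0)), ((0, 0), (16, 0)), ((0, 2), (16, 0)), ((0, 2), (16, 0)),
    ((0, 2), (16, 0)), ((0, 0), (16, 0)), ((2, 0), (16, 0)), ((2, 0), (16, 0)), ((2, 0), (16, 0)), ((2, 0),
    (16, 0)), ((0, 0), (16, 0)), ((-2, 2), (16, 0)), ((-2, 2), (16, 0)), ((2, 0), (16, 0)), ((-2, 2), (16,
    0)), ((-2, 2), (16, 0)), ((0, 0), (16, 0)), ((2, 0), (16, 0)), ((0, 2), (16, 0)), ((2, 0), (16, 0)), ((2,
    0), (16, 0)), ((0, 0), (16, 0)), ((0, 2), (16, 0)), ((0, 2), (16, 0)), ((0, 2), (16, 0)), ((0, 0), (16,
    0)), ((2, 0), (16, 0)), ((2, 0), (16, 0)), ((0, 2), (16, 0)), ((0, 2), (16, 0)), ((0, 0), (16, 0)), ((2,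
    0), (16, 0)), ((2, 0), (16, 0)), ((2, 0), (16, 0)), ((-2, 2), (16, 0)), ((-2, 2), (16, 0)), ((0, 0), (16,
    0)), ((2, 0), (16, 0)), ((0, 0), (16, 0)), ((0, 0), (16, 0)), ((0, 0), (16, 0)), ((0, 0), (16, 0)), ((0,
    0), (16, 0)), ((2, 0), (16, 0)), ((2, 0), (16, 0)), ((0, 0), (16, 0)), ((-2, 2), (16, 0)), ((-2, 2), (16,
    0)), ((2, 0), (16, 0)), ((2, 0), (16, 0)), ((0, 0), (16, 0)), ((-2, 2), (16, 0)), ((-2, 2), (16, 0))]"
  by code_simp


lemma vev_tet: "vev ` set tet_vertices = tetrahedron"
  by (simp add: tet_vertices_def vev_def zev_def tetrahedron_def)

lemma vev_ico: "vev ` set ico_vertices = icosahedron"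
  by (simp add: ico_vertices_def vev_def zev_def icosahedron_def insert_commute)

lemma vev_oct: "vev ` set oct_vertices = octahedron"
proof -
  have "octahedron = (\<Union>i\<in>UNIV. (\<lambda>s. s *\<^sub>R axis i 1) ` {1, -1})"
    unfolding octahedron_def by blast
  also have "\<dots> = {axis 1 1, - axis 1 1, axis 2 1, - axis 2 1, axis 3 1, - axis 3 1}"
    unfolding UNIV_3 by auto
  also have "\<dots> = vev ` set oct_vertices"
  proof -
    have "axis 1 1 = (vector [1, 0, 0] :: real^3)" "- axis 1 1 = (vector [-1, 0, 0] :: real^3)"
      "axis 2 1 = (vector [0, 1, 0] :: real^3)" "- axis 2 1 = (vector [0, -1, 0] :: real^3)"
      "axis 3 1 = (vector [0, 0, 1] :: real^3)" "- axis 3 1 = (vector [0, 0, -1] :: real^3)"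
      by (simp_all add: vec3_eq_iff axis_def)
    then show ?thesis by (simp add: oct_vertices_def vev_def zev_def)
  qed
  finally show ?thesis by simp
qed

lemma sum_spin_tet:
  fixes F :: "real \<Rightarrow> complex"
  shows "(\<Sum>q\<in>spin_set tetrahedron. F (fst q)) = F 1 + F (-1) + 6 * F 0 + 8 * F (1/2) + 8 * F (-1/2)"
  unfolding vev_tet[symmetric] sum_spin_set[OF frame_tet] traces_tet by (simp add: zev_def)

lemma sum_spin_oct:
  fixes F :: "real \<Rightarrow> complex"
  shows "(\<Sum>q\<in>spin_set octahedron. F (fst q)) = F 1 + F (-1) + 18 * F 0 + 8 * F (1/2) + 8 * F (-1/2)
    + 6 * F (1 / sqrt 2) + 6 * F (- 1 / sqrt 2)"
  unfolding vev_oct[symmetric] sum_spin_set[OF frame_oct] traces_oct by (simp add: zev_def)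

lemma sum_spin_ico:
  fixes F :: "real \<Rightarrow> complex"
  shows "(\<Sum>q\<in>spin_set icosahedron. F (fst q)) = F 1 + F (-1) + 30 * F 0 + 20 * F (1/2) + 20 * F (-1/2)
    + 12 * F (golden_ratio / 2) + 12 * F (- golden_ratio / 2)
    + 12 * F ((golden_ratio - 1) / 2) + 12 * F ((1 - golden_ratio) / 2)"
proof -
  have 16: "sqrt 16 = 4" by (rule real_sqrt_unique) auto
  have v: "zev (4, 0) / sqrt (zev (16, 0)) = 1" "zev (0, 0) / sqrt (zev (16, 0)) = 0"
    "zev (2, 0) / sqrt (zev (16, 0)) = 1/2" "zev (0, 2) / sqrt (zev (16, 0)) = golden_ratio / 2"
    "zev (-2, 2) / sqrt (zev (16, 0)) = (golden_ratio - 1) / 2"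
    by (simp_all add: zev_def 16 field_simps)
  have m: "- ((golden_ratio - 1) / 2) = (1 - golden_ratio) / 2" by (simp add: field_simps)
  show ?thesis
    unfolding vev_ico[symmetric] sum_spin_set[OF frame_ico] traces_ico
    by (simp add: v m)
qed

section \<open>The irreducible characters of the binary polyhedral groups\<close>

text \<open>The isomorphism of the unit quaternions with SU(2). Its trace, twice the real part, is
  the character of the defining representation V.\<close>

definition su2 :: "quaternion \<Rightarrow> complex mat"
  where "su2 q = mat 2 2 (\<lambda>(i, j).
    if i = 0 then (if j = 0 then Complex (fst q) (snd q $ 1) else Complex (snd q $ 2) (snd q $ 3))
    else (if j = 0 then Complex (- snd q $ 2) (snd q $ 3) else Complex (fst q) (- snd q $ 1)))"

lemma su2_mult: "su2 (quat_mult p q) = su2 p * su2 q"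
proof (rule eq_matI)
  fix i j assume "i < dim_row (su2 p * su2 q)" "j < dim_col (su2 p * su2 q)"
  then have ij: "i < 2" "j < 2" by (auto simp: su2_def)
  have "(su2 p * su2 q) $$ (i, j) = (\<Sum>k<2. su2 p $$ (i, k) * su2 q $$ (k, j))"
    using ij by (intro index_mult_mat_sum) (auto simp: su2_def)
  also have "\<dots> = su2 (quat_mult p q) $$ (i, j)"
    using ij by (auto simp: numeral_2_eq_2 less_Suc_eq su2_def quat_mult_sel complex_eq_iff algebra_simps)
  finally show "su2 (quat_mult p q) $$ (i, j) = (su2 p * su2 q) $$ (i, j)" by simp
qed (auto simp: su2_def)

lemma is_rep_su2: "is_rep (spin_preimage (rotation_group S)) 2 su2"
proof -
  have "su2 (1, 0) = 1\<^sub>m 2" by (rule eq_matI) (auto simp: su2_def complex_eq_iff)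
  then show ?thesis by (simp add: is_rep_def spin_preimage_def su2_mult) (simp add: su2_def)
qed

lemma mtr_su2: "mtr 2 (su2 q) = of_real (2 * fst q)"
  by (simp add: mtr_def su2_def numeral_2_eq_2 complex_eq_iff)

primrec ipoly :: "int list \<Rightarrow> real \<Rightarrow> real"
  where "ipoly [] x = 0" | "ipoly (c # cs) x = of_int c + x * ipoly cs x"

primrec zpoly :: "int list \<Rightarrow> zphi \<Rightarrow> zphi"
  where "zpoly [] z = (0, 0)" | "zpoly (c # cs) z = zadd (c, 0) (zmul z (zpoly cs z))"

lemma zev_poly: "zev (zpoly cs z) = ipoly cs (zev z)"
  by (induction cs) (simp_all add: zev_def[of "(_, 0)"])

text \<open>An integer polynomial in the character of V is a virtual character, and its values
  depend on the real part only. Coefficient lists start with the constant term.\<close>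

definition trace_poly :: "int list \<Rightarrow> quaternion \<Rightarrow> complex"
  where "trace_poly cs q = of_real (ipoly cs (2 * fst q))"

text \<open>Multiplicities of the traces \<open>2 * fst q\<close> over the group; the sum is the group order times
  the inner product.\<close>

definition zinner :: "(int \<times> zphi) list \<Rightarrow> int list \<Rightarrow> int list \<Rightarrow> zphi"
  where "zinner cls cs ds = foldr (\<lambda>(m, z). zadd (zmul (m, 0) (zmul (zpoly cs z) (zpoly ds z)))) cls (0, 0)"

lemma zev_inner:
  "zev (zinner cls cs ds) = (\<Sum>(m, z)\<leftarrow>cls. of_int m * (ipoly cs (zev z) * ipoly ds (zev z)))"
  unfolding zinner_def
  by (induction cls) (auto simp: zev_poly zev_def[of "(_, 0)"] simp del: zadd.simps zmul.simps)

context fin_group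
begin

lemma cinner_add_left:
  assumes "\<And>g. g \<in> carrier G \<Longrightarrow> f g = a g + b g"
  shows "cinner G f h = cinner G a h + cinner G b h"
proof -
  have "cinner G f h = cinner G (\<lambda>g. a g + b g) h" using assms by (intro cinner_cong) auto
  then show ?thesis by (simp add: cinner_def algebra_simps sum.distrib add_divide_distrib)
qed

lemma cinner_add_right:
  assumes "\<And>g. g \<in> carrier G \<Longrightarrow> f g = a g + b g"
  shows "cinner G h f = cinner G h a + cinner G h b"
proof -
  have "cinner G h f = cinner G h (\<lambda>g. a g + b g)" using assms by (intro cinner_cong) auto
  then show ?thesis by (simp add: cinner_def algebra_simps sum.distrib add_divide_distrib)
qed

lemma irr_dim_sum_list:
  assumes "set xs \<subseteq> irr_chars G" "distinct xs" "(\<Sum>\<psi>\<leftarrow>xs. (cdeg \<psi>)\<^sup>2) = order G"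
  shows "irr_dim_sum G = (\<Sum>\<psi>\<leftarrow>xs. cdeg \<psi>)"
  using irr_dim_sumI[of "set xs"] assms by (simp add: sum_list_distinct_conv_sum_set)

lemma sum_list_cdeg_squared_le:
  assumes "set xs \<subseteq> irr_chars G" "distinct xs"
  shows "(\<Sum>\<psi>\<leftarrow>xs. (cdeg \<psi>)\<^sup>2) \<le> order G"
proof -
  have "(\<Sum>\<psi>\<leftarrow>xs. (cdeg \<psi>)\<^sup>2) = (\<Sum>\<psi>\<in>set xs. (cdeg \<psi>)\<^sup>2)"
    using assms(2) by (rule sum_list_distinct_conv_sum_set)
  also have "\<dots> \<le> (\<Sum>\<psi>\<in>irr_chars G. (cdeg \<psi>)\<^sup>2)"
    using assms(1) finite_irr_chars by (intro sum_mono2) auto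
  finally show ?thesis using sum_cdeg_squared by simp
qed

lemma cdeg_add:
  assumes "\<alpha> \<in> irr_chars G" "\<beta> \<in> irr_chars G" "\<And>g. g \<in> carrier G \<Longrightarrow> f g = \<alpha> g + \<beta> g" "f \<one> = of_nat n"
  shows "cdeg \<alpha> + cdeg \<beta> = n"
proof -
  have "(of_nat (cdeg \<alpha> + cdeg \<beta>) :: complex) = of_nat n"
    using assms(3)[of \<one>] assms(4) cdeg_irr(1)[OF assms(1)] cdeg_irr(1)[OF assms(2)] by simp
  then show ?thesis by (simp only: of_nat_eq_iff)
qed

end

section \<open>Trace polynomials as characters of finite groups of unit quaternions\<close>

locale spin_group =
  fixes S :: "(real^3) set"
  assumes finite_spin: "finite (spin_set S)"
begin

sublocale fin_group "spin_preimage (rotation_group S)"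
  using group_spin finite_spin by (intro fin_group.intro fin_group_axioms.intro) (simp_all add: carrier_spin)

abbreviation G where "G \<equiv> spin_preimage (rotation_group S)"

definition tchar :: "int list \<Rightarrow> quaternion \<Rightarrow> complex"
  where "tchar cs = restrict (trace_poly cs) (carrier G)"

lemma one_G: "\<one>\<^bsub>G\<^esub> = (1, 0)" by (simp add: spin_preimage_def)

lemma trace_poly_one: "trace_poly cs \<one>\<^bsub>G\<^esub> = of_real (ipoly cs 2)"
  by (simp add: trace_poly_def one_G)

lemma tchar_one: "tchar cs \<one>\<^bsub>G\<^esub> = of_real (ipoly cs 2)"
  using one_closed by (simp add: tchar_def trace_poly_one)

lemma cdeg_tchar: "cdeg (tchar cs) = nat \<lfloor>ipoly cs 2\<rfloor>"
  by (simp add: cdeg_def tchar_one)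

lemma tchar_apply: "g \<in> carrier G \<Longrightarrow> tchar cs g = trace_poly cs g"
  by (simp add: tchar_def)

lemma vchar_trace_poly: "vchar (trace_poly cs)"
proof (induction cs)
  case Nil
  have "vchar (\<lambda>g. of_int 0 * 1)" by (rule vchar_scale[OF vchar_one])
  then show ?case by (rule vchar_cong) (simp add: trace_poly_def)
next
  case (Cons c cs)
  have "vchar (\<lambda>g. of_int c * 1 + mtr 2 (su2 g) * trace_poly cs g)"
    by (intro vchar_add vchar_scale vchar_one vchar_mult Cons gchar_imp_vchar gchar_rep is_rep_su2)
  then show ?case by (rule vchar_cong) (simp add: trace_poly_def mtr_su2)
qed

text \<open>The inverse of a unit quaternion is its conjugate and has the same real part.\<close>

lemma cinner_trace_poly:
  "cinner G (trace_poly cs) (trace_poly ds) =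
    (\<Sum>q\<in>spin_set S. of_real (ipoly cs (2 * fst q) * ipoly ds (2 * fst q))) / of_nat (order G)"
proof -
  have "fst (inv\<^bsub>G\<^esub> q) = fst q" if "q \<in> spin_set S" for q
    using inv_spin[OF that] by (simp add: quat_conj_def)
  then show ?thesis unfolding cinner_def carrier_spin
    by (intro arg_cong2[where f="(/)"] sum.cong refl) (simp add: trace_poly_def)
qed

lemma cinner_tchar_left: "cinner G (tchar cs) h = cinner G (trace_poly cs) h"
  by (rule cinner_cong) (simp_all add: tchar_apply)

lemma cinner_tchar_right: "cinner G h (tchar cs) = cinner G h (trace_poly cs)"
  by (rule cinner_cong) (simp_all add: tchar_apply)

lemma tchar_irr:
  assumes "cinner G (trace_poly cs) (trace_poly cs) = 1" "ipoly cs 2 > 0"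
  shows "tchar cs \<in> irr_chars G"
  unfolding tchar_def using assms by (intro vchar_irreducible vchar_trace_poly) (simp_all add: trace_poly_one)

lemma tchar_neq:
  assumes "cinner G (trace_poly cs) (trace_poly ds) \<noteq> cinner G (trace_poly ds) (trace_poly ds)"
  shows "tchar cs \<noteq> tchar ds"
  using assms cinner_tchar_left by metis

lemma tchar_neq_degree: "ipoly cs 2 \<noteq> ipoly ds 2 \<Longrightarrow> tchar cs \<noteq> tchar ds"
  using tchar_one by (metis of_real_eq_iff)

text \<open>Tensoring with V multiplies the polynomial by its variable.\<close>

lemma gchar_trace_poly_shift:
  assumes "gchar (trace_poly cs)"
  shows "gchar (trace_poly (0 # cs))"
  using gchar_mult_rep[OF assms is_rep_su2[of S]]
  by (rule gchar_cong) (simp add: trace_poly_def mtr_su2)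

lemma gchar_trace_poly_irr: "tchar cs \<in> irr_chars G \<Longrightarrow> gchar (trace_poly cs)"
proof -
  assume "tchar cs \<in> irr_chars G"
  then have "gchar (tchar cs)" by (rule gchar_irr)
  then show "gchar (trace_poly cs)" by (rule gchar_cong) (simp add: tchar_apply)
qed

lemma gchar_trace_poly_diff:
  assumes "gchar (trace_poly cs)" "tchar ds \<in> irr_chars G"
    "cinner G (trace_poly cs) (trace_poly ds) = of_nat k"
    "\<And>x. ipoly es x = ipoly cs x - real k * ipoly ds x"
  shows "gchar (trace_poly es)"
proof -
  have "gchar (\<lambda>g. trace_poly cs g - of_nat k * tchar ds g)"
    by (rule gchar_diff[OF assms(1,2), of k k]) (simp_all add: cinner_tchar_right assms(3))
  then show ?thesis by (rule gchar_cong) (simp add: tchar_apply trace_poly_def assms(4))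
qed

end

lemma finite_spin_set: "good_frame Vs Ls Ks Ns p0 p1 \<Longrightarrow> finite (spin_set (vev ` set Vs))"
  using bij_betw_finite[OF spin_set_bij] by simp

lemma distinct_map_if_sorted_wrt: "sorted_wrt (\<lambda>x y. f x \<noteq> f y) xs \<Longrightarrow> distinct (map f xs)"
  by (induction xs) auto

subsection \<open>The binary tetrahedral group\<close>

interpretation tet: spin_group tetrahedron
  using finite_spin_set[OF frame_tet] by unfold_locales (simp add: vev_tet)

definition tet_classes :: "(int \<times> zphi) list"
  where "tet_classes = [(1, (2, 0)), (1, (-2, 0)), (6, (0, 0)), (8, (1, 0)), (8, (-1, 0))]"

lemma order_tet: "order tet.G = 24"
proof -
  have "(of_nat (order tet.G) :: complex) = of_nat 24"
    using sum_spin_tet[of "\<lambda>_. 1"] by (simp add: order_def carrier_spin)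
  then show ?thesis by (simp only: of_nat_eq_iff)
qed

lemma cinner_tet: "cinner tet.G (trace_poly cs) (trace_poly ds) = of_real (zev (zinner tet_classes cs ds) / 24)"
  unfolding tet.cinner_trace_poly order_tet
    sum_spin_tet[of "\<lambda>x. of_real (ipoly cs (2 * x) * ipoly ds (2 * x))"] zev_inner
  by (simp add: tet_classes_def zev_def)

lemma tet_values:
  "zinner tet_classes [1] [1] = (24, 0)"
  "zinner tet_classes [0, 1] [0, 1] = (24, 0)"
  "zinner tet_classes [-1, 0, 1] [-1, 0, 1] = (24, 0)"
  "zinner tet_classes [0, -1, 0, 1] [0, 1] = (24, 0)"
  "zinner tet_classes [0, 0, -2, 0, 1] [-1, 0, 1] = (48, 0)"
  "zinner tet_classes [0, -2, 0, 1] [0, -2, 0, 1] = (48, 0)"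
  "zinner tet_classes [2, 0, -4, 0, 1] [2, 0, -4, 0, 1] = (48, 0)"
  "zinner tet_classes [0, -2, 0, 1] [2, 0, -4, 0, 1] = (0, 0)"
  "zinner tet_classes [0, -2, 0, 1] [1] = (0, 0)"
  "zinner tet_classes [0, -2, 0, 1] [0, 1] = (0, 0)"
  "zinner tet_classes [0, -2, 0, 1] [-1, 0, 1] = (0, 0)"
  "zinner tet_classes [2, 0, -4, 0, 1] [1] = (0, 0)"
  "zinner tet_classes [2, 0, -4, 0, 1] [0, 1] = (0, 0)"
  "zinner tet_classes [2, 0, -4, 0, 1] [-1, 0, 1] = (0, 0)"
  by code_simp+

text \<open>Besides \<open>1, V, Sym\<^sup>2 V\<close> there are the constituents of \<open>Sym\<^sup>3 V\<close> and of \<open>Sym\<^sup>4 V - Sym\<^sup>2 V\<close>, each of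
  norm 2; their degrees are forced by the sum of the squares of all degrees.\<close>

lemma irr_dim_sum_binary_tetrahedral: "irr_dim_sum binary_tetrahedral = 12"
proof -
  note val = cinner_tet tet_values zev_def
  have irr: "tet.tchar [1] \<in> irr_chars tet.G" "tet.tchar [0, 1] \<in> irr_chars tet.G" "tet.tchar [-1, 0, 1] \<in> irr_chars tet.G"
    by (rule tet.tchar_irr; simp add: val)+
  \<comment> \<open>V tensor Sym^2 V is the sum of Sym^3 V and V; removing V leaves Sym^3 V.\<close>
  have "tet.gchar (trace_poly [0, -1, 0, 1])"
    by (intro tet.gchar_trace_poly_shift tet.gchar_trace_poly_irr irr)
  then have g3: "tet.gchar (trace_poly [0, -2, 0, 1])"
    by (rule tet.gchar_trace_poly_diff[OF _ irr(2), where k=1]) (simp_all add: val algebra_simps)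
  \<comment> \<open>V tensor Sym^3 V is the sum of Sym^4 V and Sym^2 V, and Sym^4 V contains Sym^2 V
    once more, whence k = 2.\<close>
  have "tet.gchar (trace_poly [0, 0, -2, 0, 1])" by (rule tet.gchar_trace_poly_shift[OF g3])
  then have g4: "tet.gchar (trace_poly [2, 0, -4, 0, 1])"
    by (rule tet.gchar_trace_poly_diff[OF _ irr(3), where k=2]) (simp_all add: val algebra_simps)
  have "cinner tet.G (trace_poly [0, -2, 0, 1]) (trace_poly [0, -2, 0, 1]) = 2" by (simp add: val)
  then obtain \<alpha> \<beta> where ab: "\<alpha> \<in> irr_chars tet.G" "\<beta> \<in> irr_chars tet.G" "\<alpha> \<noteq> \<beta>"
    "\<And>g. g \<in> carrier tet.G \<Longrightarrow> trace_poly [0, -2, 0, 1] g = \<alpha> g + \<beta> g"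
    using tet.gchar_norm2[OF g3] by blast
  have "cinner tet.G (trace_poly [2, 0, -4, 0, 1]) (trace_poly [2, 0, -4, 0, 1]) = 2" by (simp add: val)
  then obtain \<gamma> \<delta> where cd: "\<gamma> \<in> irr_chars tet.G" "\<delta> \<in> irr_chars tet.G" "\<gamma> \<noteq> \<delta>"
    "\<And>g. g \<in> carrier tet.G \<Longrightarrow> trace_poly [2, 0, -4, 0, 1] g = \<gamma> g + \<delta> g"
    using tet.gchar_norm2[OF g4] by blast
  have addab: "cinner tet.G (trace_poly [0, -2, 0, 1]) h = cinner tet.G \<alpha> h + cinner tet.G \<beta> h" for h
    by (rule tet.cinner_add_left) (rule ab(4))
  have addcd: "cinner tet.G (trace_poly [2, 0, -4, 0, 1]) h = cinner tet.G \<gamma> h + cinner tet.G \<delta> h" for h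
    by (rule tet.cinner_add_left) (rule cd(4))
  have addcd': "cinner tet.G h (trace_poly [2, 0, -4, 0, 1]) = cinner tet.G h \<gamma> + cinner tet.G h \<delta>" for h
    by (rule tet.cinner_add_right) (rule cd(4))
  \<comment> \<open>The inner product is a sum of two multiplicities that are 0 or 1, so if it
    vanishes neither constituent is \<psi>.\<close>
  have z: "\<alpha> \<noteq> \<psi> \<and> \<beta> \<noteq> \<psi>" if "\<psi> \<in> irr_chars tet.G" "cinner tet.G (trace_poly [0, -2, 0, 1]) \<psi> = 0" for \<psi>
    using that(2) unfolding addab tet.cinner_irr_chars[OF ab(1) that(1)] tet.cinner_irr_chars[OF ab(2) that(1)]
    by (auto split: if_splits)
  have w: "\<gamma> \<noteq> \<psi> \<and> \<delta> \<noteq> \<psi>" if "\<psi> \<in> irr_chars tet.G" "cinner tet.G (trace_poly [2, 0, -4, 0, 1]) \<psi> = 0" for \<psi>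
    using that(2) unfolding addcd tet.cinner_irr_chars[OF cd(1) that(1)] tet.cinner_irr_chars[OF cd(2) that(1)]
    by (auto split: if_splits)
  have "cinner tet.G (trace_poly [0, -2, 0, 1]) (trace_poly [2, 0, -4, 0, 1]) = 0" by (simp add: val)
  then have x: "\<alpha> \<noteq> \<gamma>" "\<alpha> \<noteq> \<delta>" "\<beta> \<noteq> \<gamma>" "\<beta> \<noteq> \<delta>"
    unfolding addab addcd'
      tet.cinner_irr_chars[OF ab(1) cd(1)] tet.cinner_irr_chars[OF ab(1) cd(2)]
      tet.cinner_irr_chars[OF ab(2) cd(1)] tet.cinner_irr_chars[OF ab(2) cd(2)]
    by (auto split: if_splits)
  define xs where "xs = [tet.tchar [1], tet.tchar [0, 1], tet.tchar [-1, 0, 1], \<alpha>, \<beta>, \<gamma>, \<delta>]"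
  have "tet.tchar [1] \<noteq> tet.tchar [0, 1]" "tet.tchar [1] \<noteq> tet.tchar [-1, 0, 1]" "tet.tchar [0, 1] \<noteq> tet.tchar [-1, 0, 1]"
    by (rule tet.tchar_neq_degree; simp)+
  then have xs: "distinct xs" "set xs \<subseteq> irr_chars tet.G"
    using x ab(1-3) cd(1-3) irr z[OF irr(1)] z[OF irr(2)] z[OF irr(3)] w[OF irr(1)] w[OF irr(2)] w[OF irr(3)]
    unfolding xs_def by (auto simp: tet.cinner_tchar_right val)
  have dab: "tet.cdeg \<alpha> + tet.cdeg \<beta> = 4"
    by (rule tet.cdeg_add[OF ab(1,2,4)]) (simp_all add: tet.trace_poly_one)
  have dcd: "tet.cdeg \<gamma> + tet.cdeg \<delta> = 2"
    by (rule tet.cdeg_add[OF cd(1,2,4)]) (simp_all add: tet.trace_poly_one)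
  have c: "tet.cdeg \<gamma> = 1" "tet.cdeg \<delta> = 1" using dcd tet.cdeg_irr(2)[OF cd(1)] tet.cdeg_irr(2)[OF cd(2)] by auto
  \<comment> \<open>The known degrees 1, 2, 3, 1, 1 leave 24 - 16 = 8 for the squares; with the sum
    4 this excludes 1 + 3.\<close>
  have le: "(tet.cdeg \<alpha>)\<^sup>2 + (tet.cdeg \<beta>)\<^sup>2 \<le> 8"
    using tet.sum_list_cdeg_squared_le[OF xs(2,1)] by (simp add: xs_def tet.cdeg_tchar c order_tet)
  have "tet.cdeg \<alpha> \<in> {1, 2, 3}" using dab tet.cdeg_irr(2)[OF ab(1)] tet.cdeg_irr(2)[OF ab(2)] by auto
  then have a: "tet.cdeg \<alpha> = 2" "tet.cdeg \<beta> = 2"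
    using dab le by (auto simp: power2_eq_square)
  have "irr_dim_sum tet.G = (\<Sum>\<psi>\<leftarrow>xs. tet.cdeg \<psi>)"
    by (rule tet.irr_dim_sum_list[OF xs(2,1)]) (simp add: xs_def tet.cdeg_tchar a c order_tet)
  then show ?thesis by (simp add: xs_def tet.cdeg_tchar a c binary_tetrahedral_def)
qed

subsection \<open>The binary octahedral group\<close>

interpretation oct: spin_group octahedron
  using finite_spin_set[OF frame_oct] by unfold_locales (simp add: vev_oct)

text \<open>Defined over the reals because the traces sqrt 2 and - sqrt 2 lie outside Z[phi]. The
  weights are the numbers of elements with each trace, so the value is 48 times the inner
  product.\<close>

definition oct_inner :: "int list \<Rightarrow> int list \<Rightarrow> real"
  where "oct_inner cs ds = ipoly cs 2 * ipoly ds 2 + ipoly cs (-2) * ipoly ds (-2) + 18 * (ipoly cs 0 * ipoly ds 0)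
    + 8 * (ipoly cs 1 * ipoly ds 1) + 8 * (ipoly cs (-1) * ipoly ds (-1))
    + 6 * (ipoly cs (sqrt 2) * ipoly ds (sqrt 2)) + 6 * (ipoly cs (- sqrt 2) * ipoly ds (- sqrt 2))"

lemma order_oct: "order oct.G = 48"
proof -
  have "(of_nat (order oct.G) :: complex) = of_nat 48"
    using sum_spin_oct[of "\<lambda>_. 1"] by (simp add: order_def carrier_spin)
  then show ?thesis by (simp only: of_nat_eq_iff)
qed

lemma cinner_oct: "cinner oct.G (trace_poly cs) (trace_poly ds) = of_real (oct_inner cs ds / 48)"
proof -
  have "2 / sqrt 2 = sqrt 2" "- (2 / sqrt 2) = - sqrt 2" by (simp_all add: real_div_sqrt)
  then show ?thesis
    unfolding oct.cinner_trace_poly order_oct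
      sum_spin_oct[of "\<lambda>x. of_real (ipoly cs (2 * x) * ipoly ds (2 * x))"]
    by (simp add: oct_inner_def)
qed

lemma sqrt2_simps: "sqrt 2 * sqrt 2 = 2" "sqrt 2 * (sqrt 2 * x) = 2 * x"
  by (simp_all add: mult.assoc[symmetric])

lemma oct_values:
  "oct_inner [1] [1] = 48"
  "oct_inner [0, 1] [0, 1] = 48"
  "oct_inner [-1, 0, 1] [-1, 0, 1] = 48"
  "oct_inner [0, -2, 0, 1] [0, -2, 0, 1] = 48"
  "oct_inner [0, 5, 0, -5, 0, 1] [0, 5, 0, -5, 0, 1] = 48"
  "oct_inner [0, 1] [0, 5, 0, -5, 0, 1] = 0"
  "oct_inner [0, 0, -2, 0, 1] [-1, 0, 1] = 48"
  "oct_inner [1, 0, -3, 0, 1] [1, 0, -3, 0, 1] = 96"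
  "oct_inner [0, 0, 5, 0, -5, 0, 1] [0, 0, 5, 0, -5, 0, 1] = 96"
  "oct_inner [0, 0, 5, 0, -5, 0, 1] [1, 0, -3, 0, 1] = 48"
  "oct_inner [1, 0, -3, 0, 1] [1] = 0"
  "oct_inner [1, 0, -3, 0, 1] [0, 1] = 0"
  "oct_inner [1, 0, -3, 0, 1] [-1, 0, 1] = 0"
  "oct_inner [1, 0, -3, 0, 1] [0, -2, 0, 1] = 0"
  "oct_inner [1, 0, -3, 0, 1] [0, 5, 0, -5, 0, 1] = 0"
  "oct_inner [0, 0, 5, 0, -5, 0, 1] [1] = 0"
  "oct_inner [0, 0, 5, 0, -5, 0, 1] [0, 1] = 0"
  "oct_inner [0, 0, 5, 0, -5, 0, 1] [-1, 0, 1] = 0"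
  "oct_inner [0, 0, 5, 0, -5, 0, 1] [0, -2, 0, 1] = 0"
  "oct_inner [0, 0, 5, 0, -5, 0, 1] [0, 5, 0, -5, 0, 1] = 0"
  by (simp_all add: oct_inner_def algebra_simps sqrt2_simps)

text \<open>The degrees of the three remaining characters, the constituents of \<open>Sym\<^sup>4 V\<close> and of \<open>V \<otimes> V'\<close>, which
  share one constituent, are forced by the sum of the squares of all degrees.\<close>

lemma irr_dim_sum_binary_octahedral: "irr_dim_sum binary_octahedral = 18"
proof -
  note val = cinner_oct oct_values
  \<comment> \<open>The last list is the trace of q^5 as a polynomial in the trace of q. It
    exchanges sqrt 2 and - sqrt 2 and fixes the other traces, so it gives the Galois conjugate V' of
    V.\<close>
  have irr: "oct.tchar [1] \<in> irr_chars oct.G" "oct.tchar [0, 1] \<in> irr_chars oct.G" "oct.tchar [-1, 0, 1] \<in> irr_chars oct.G"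
    "oct.tchar [0, -2, 0, 1] \<in> irr_chars oct.G" "oct.tchar [0, 5, 0, -5, 0, 1] \<in> irr_chars oct.G"
    by (rule oct.tchar_irr; simp add: val)+
  have "oct.gchar (trace_poly [0, 0, -2, 0, 1])"
    by (intro oct.gchar_trace_poly_shift oct.gchar_trace_poly_irr irr)
  then have g4: "oct.gchar (trace_poly [1, 0, -3, 0, 1])"
    by (rule oct.gchar_trace_poly_diff[OF _ irr(3), where k=1]) (simp_all add: val algebra_simps)
  have g3: "oct.gchar (trace_poly [0, 0, 5, 0, -5, 0, 1])"
    by (intro oct.gchar_trace_poly_shift oct.gchar_trace_poly_irr irr)
  have "cinner oct.G (trace_poly [0, 0, 5, 0, -5, 0, 1]) (trace_poly [0, 0, 5, 0, -5, 0, 1]) = 2" by (simp add: val)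
  then obtain \<alpha>' \<beta>' where ab': "\<alpha>' \<in> irr_chars oct.G" "\<beta>' \<in> irr_chars oct.G" "\<alpha>' \<noteq> \<beta>'"
    "\<And>g. g \<in> carrier oct.G \<Longrightarrow> trace_poly [0, 0, 5, 0, -5, 0, 1] g = \<alpha>' g + \<beta>' g"
    using oct.gchar_norm2[OF g3] by blast
  have "cinner oct.G (trace_poly [1, 0, -3, 0, 1]) (trace_poly [1, 0, -3, 0, 1]) = 2" by (simp add: val)
  then obtain \<gamma>' \<delta>' where cd': "\<gamma>' \<in> irr_chars oct.G" "\<delta>' \<in> irr_chars oct.G" "\<gamma>' \<noteq> \<delta>'"
    "\<And>g. g \<in> carrier oct.G \<Longrightarrow> trace_poly [1, 0, -3, 0, 1] g = \<gamma>' g + \<delta>' g"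
    using oct.gchar_norm2[OF g4] by blast
  have addab: "cinner oct.G (trace_poly [0, 0, 5, 0, -5, 0, 1]) h = cinner oct.G \<alpha>' h + cinner oct.G \<beta>' h" for h
    by (rule oct.cinner_add_left) (rule ab'(4))
  have addcd: "cinner oct.G h (trace_poly [1, 0, -3, 0, 1]) = cinner oct.G h \<gamma>' + cinner oct.G h \<delta>'" for h
    by (rule oct.cinner_add_right) (rule cd'(4))
  have "cinner oct.G (trace_poly [0, 0, 5, 0, -5, 0, 1]) (trace_poly [1, 0, -3, 0, 1]) = 1" by (simp add: val)
  then have x: "(if \<alpha>' = \<gamma>' then 1 else 0) + (if \<alpha>' = \<delta>' then 1 else 0) +
      ((if \<beta>' = \<gamma>' then 1 else 0) + (if \<beta>' = \<delta>' then 1 else 0)) = (1 :: complex)"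
    unfolding addab addcd
      oct.cinner_irr_chars[OF ab'(1) cd'(1)] oct.cinner_irr_chars[OF ab'(1) cd'(2)]
      oct.cinner_irr_chars[OF ab'(2) cd'(1)] oct.cinner_irr_chars[OF ab'(2) cd'(2)]
    by (simp add: add_ac)
  \<comment> \<open>The common constituent of V tensor V' and Sym^4 V is renamed \<alpha>, whichever
    position it has in the two decompositions.\<close>
  obtain \<alpha> \<beta> \<gamma> where abc: "\<alpha> \<in> irr_chars oct.G" "\<beta> \<in> irr_chars oct.G" "\<gamma> \<in> irr_chars oct.G" "\<alpha> \<noteq> \<beta>" "\<alpha> \<noteq> \<gamma>" "\<beta> \<noteq> \<gamma>"
    "\<And>g. g \<in> carrier oct.G \<Longrightarrow> trace_poly [0, 0, 5, 0, -5, 0, 1] g = \<alpha> g + \<beta> g"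
    "\<And>g. g \<in> carrier oct.G \<Longrightarrow> trace_poly [1, 0, -3, 0, 1] g = \<alpha> g + \<gamma> g"
  proof -
    consider "\<alpha>' = \<gamma>'" "\<beta>' \<noteq> \<delta>'" | "\<alpha>' = \<delta>'" "\<beta>' \<noteq> \<gamma>'" | "\<beta>' = \<gamma>'" "\<alpha>' \<noteq> \<delta>'" | "\<beta>' = \<delta>'" "\<alpha>' \<noteq> \<gamma>'"
      using x by (auto split: if_splits)
    then show ?thesis
    proof cases
      case 1
      then show ?thesis using ab' cd' that[of \<alpha>' \<beta>' \<delta>'] by simp
    next
      case 2
      then show ?thesis using ab' cd' that[of \<alpha>' \<beta>' \<gamma>'] by (simp add: add.commute)
    next
      case 3
      then show ?thesis using ab' cd' that[of \<beta>' \<alpha>' \<delta>'] by (simp add: add.commute)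
    next
      case 4
      then show ?thesis using ab' cd' that[of \<beta>' \<alpha>' \<gamma>'] by (simp add: add.commute)
    qed
  qed
  have add7: "cinner oct.G (trace_poly [0, 0, 5, 0, -5, 0, 1]) h = cinner oct.G \<alpha> h + cinner oct.G \<beta> h" for h
    by (rule oct.cinner_add_left) (rule abc(7))
  have add8: "cinner oct.G (trace_poly [1, 0, -3, 0, 1]) h = cinner oct.G \<alpha> h + cinner oct.G \<gamma> h" for h
    by (rule oct.cinner_add_left) (rule abc(8))
  have z: "\<alpha> \<noteq> \<psi> \<and> \<beta> \<noteq> \<psi>" if "\<psi> \<in> irr_chars oct.G" "cinner oct.G (trace_poly [0, 0, 5, 0, -5, 0, 1]) \<psi> = 0" for \<psi>
    using that(2) unfolding add7 oct.cinner_irr_chars[OF abc(1) that(1)] oct.cinner_irr_chars[OF abc(2) that(1)]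
    by (auto split: if_splits)
  have w: "\<gamma> \<noteq> \<psi>" if "\<psi> \<in> irr_chars oct.G" "cinner oct.G (trace_poly [1, 0, -3, 0, 1]) \<psi> = 0" for \<psi>
    using that(2) unfolding add8 oct.cinner_irr_chars[OF abc(1) that(1)] oct.cinner_irr_chars[OF abc(3) that(1)]
    by (auto split: if_splits)
  define xs where "xs = [oct.tchar [1], oct.tchar [0, 1], oct.tchar [-1, 0, 1], oct.tchar [0, -2, 0, 1],
    oct.tchar [0, 5, 0, -5, 0, 1], \<alpha>, \<beta>, \<gamma>]"
  have "oct.tchar [0, 1] \<noteq> oct.tchar [0, 5, 0, -5, 0, 1]" by (rule oct.tchar_neq) (simp add: val)
  moreover have "oct.tchar [1] \<noteq> oct.tchar [0, 1]" "oct.tchar [1] \<noteq> oct.tchar [-1, 0, 1]" "oct.tchar [1] \<noteq> oct.tchar [0, -2, 0, 1]"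
    "oct.tchar [1] \<noteq> oct.tchar [0, 5, 0, -5, 0, 1]" "oct.tchar [0, 1] \<noteq> oct.tchar [-1, 0, 1]" "oct.tchar [0, 1] \<noteq> oct.tchar [0, -2, 0, 1]"
    "oct.tchar [-1, 0, 1] \<noteq> oct.tchar [0, -2, 0, 1]" "oct.tchar [-1, 0, 1] \<noteq> oct.tchar [0, 5, 0, -5, 0, 1]"
    "oct.tchar [0, -2, 0, 1] \<noteq> oct.tchar [0, 5, 0, -5, 0, 1]"
    by (rule oct.tchar_neq_degree; simp)+
  ultimately have xs: "distinct xs" "set xs \<subseteq> irr_chars oct.G"
    using abc(1-6) irr z[OF irr(1)] z[OF irr(2)] z[OF irr(3)] z[OF irr(4)] z[OF irr(5)]
      w[OF irr(1)] w[OF irr(2)] w[OF irr(3)] w[OF irr(4)] w[OF irr(5)]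
    unfolding xs_def by (auto simp: oct.cinner_tchar_right val)
  have dab: "oct.cdeg \<alpha> + oct.cdeg \<beta> = 4"
    by (rule oct.cdeg_add[OF abc(1,2,7)]) (simp_all add: oct.trace_poly_one)
  have dac: "oct.cdeg \<alpha> + oct.cdeg \<gamma> = 5"
    by (rule oct.cdeg_add[OF abc(1,3,8)]) (simp_all add: oct.trace_poly_one)
  \<comment> \<open>The known degrees 1, 2, 3, 4, 2 leave 48 - 34 = 14 for the squares. Of the
    degrees with the sums 4 and 5, only 3, 1, 2 fit.\<close>
  have le: "(oct.cdeg \<alpha>)\<^sup>2 + ((oct.cdeg \<beta>)\<^sup>2 + (oct.cdeg \<gamma>)\<^sup>2) \<le> 14"
    using oct.sum_list_cdeg_squared_le[OF xs(2,1)] by (simp add: xs_def oct.cdeg_tchar order_oct)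
  have "oct.cdeg \<alpha> \<in> {1, 2, 3}" using dab oct.cdeg_irr(2)[OF abc(1)] oct.cdeg_irr(2)[OF abc(2)] by auto
  then consider "oct.cdeg \<alpha> = 1" "oct.cdeg \<beta> = 3" "oct.cdeg \<gamma> = 4" | "oct.cdeg \<alpha> = 2" "oct.cdeg \<beta> = 2" "oct.cdeg \<gamma> = 3"
    | "oct.cdeg \<alpha> = 3" "oct.cdeg \<beta> = 1" "oct.cdeg \<gamma> = 2"
    using dab dac by fastforce
  then have a: "oct.cdeg \<alpha> = 3" "oct.cdeg \<beta> = 1" "oct.cdeg \<gamma> = 2" using le by (cases; simp)+
  have "irr_dim_sum oct.G = (\<Sum>\<psi>\<leftarrow>xs. oct.cdeg \<psi>)"
    by (rule oct.irr_dim_sum_list[OF xs(2,1)]) (simp add: xs_def oct.cdeg_tchar a order_oct)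
  then show ?thesis by (simp add: xs_def oct.cdeg_tchar a binary_octahedral_def)
qed

subsection \<open>The binary icosahedral group\<close>

interpretation ico: spin_group icosahedron
  using finite_spin_set[OF frame_ico] by unfold_locales (simp add: vev_ico)

definition ico_classes :: "(int \<times> zphi) list"
  where "ico_classes = [(1, (2, 0)), (1, (-2, 0)), (30, (0, 0)), (20, (1, 0)), (20, (-1, 0)),
    (12, (0, 1)), (12, (0, -1)), (12, (-1, 1)), (12, (1, -1))]"

lemma order_ico: "order ico.G = 120"
proof -
  have "(of_nat (order ico.G) :: complex) = of_nat 120"
    using sum_spin_ico[of "\<lambda>_. 1"] by (simp add: order_def carrier_spin)
  then show ?thesis by (simp only: of_nat_eq_iff)
qed

lemma cinner_ico: "cinner ico.G (trace_poly cs) (trace_poly ds) = of_real (zev (zinner ico_classes cs ds) / 120)"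
proof -
  have e: "(2 * golden_ratio - 2) / 2 = golden_ratio - 1" "(2 - 2 * golden_ratio) / 2 = 1 - golden_ratio"
    by (simp_all add: field_simps)
  show ?thesis
    unfolding ico.cinner_trace_poly order_ico
      sum_spin_ico[of "\<lambda>x. of_real (ipoly cs (2 * x) * ipoly ds (2 * x))"] zev_inner
    by (simp add: ico_classes_def zev_def e)
qed

text \<open>The characters of \<open>Sym\<^sup>k V\<close> for \<open>k \<le> 5\<close>, of the Galois conjugate \<open>V'\<close> of \<open>V\<close>, whose value at \<open>q\<close> is
  the trace of \<open>q^7\<close>, and of \<open>Sym\<^sup>2 V'\<close> and \<open>V \<otimes> V'\<close>.\<close>

definition ico_polys :: "int list list"
  where "ico_polys = [[1], [0, 1], [-1, 0, 1], [0, -2, 0, 1], [1, 0, -3, 0, 1], [0, 3, 0, -4, 0, 1],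
    [0, -7, 0, 14, 0, -7, 0, 1],
    [-1, 0, 49, 0, -196, 0, 294, 0, -210, 0, 77, 0, -14, 0, 1],
    [0, 0, -7, 0, 14, 0, -7, 0, 1]]"

lemma ico_norms: "list_all (\<lambda>cs. zinner ico_classes cs cs = (120, 0)) ico_polys"
  by code_simp

lemma ico_orthogonal: "sorted_wrt (\<lambda>cs ds. zinner ico_classes cs ds = (0, 0)) ico_polys"
  by code_simp

lemma ico_degrees: "map (\<lambda>cs. ipoly cs 2) ico_polys = [1, 2, 3, 4, 5, 6, 2, 3, 4]"
  by (simp add: ico_polys_def)

text \<open>The nine characters are orthonormal, and 1 + 4 + 9 + 16 + 25 + 36 + 4 + 9 + 16 = 120
  shows that they are all.\<close>

lemma irr_dim_sum_binary_icosahedral: "irr_dim_sum binary_icosahedral = 30"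
proof -
  let ?xs = "map ico.tchar ico_polys"
  have degs: "map (\<lambda>\<psi>. ico.cdeg \<psi>) ?xs = [1, 2, 3, 4, 5, 6, 2, 3, 4]"
    by (simp add: ico_polys_def ico.cdeg_tchar)
  have pos: "ipoly cs 2 > 0" if "cs \<in> set ico_polys" for cs
  proof -
    have "ipoly cs 2 \<in> set (map (\<lambda>cs. ipoly cs 2) ico_polys)" using that by simp
    then show ?thesis unfolding ico_degrees by auto
  qed
  have norm: "cinner ico.G (trace_poly cs) (trace_poly cs) = 1" if "cs \<in> set ico_polys" for cs
    using ico_norms that by (simp add: list_all_iff cinner_ico zev_def)
  have irr: "set ?xs \<subseteq> irr_chars ico.G"
    using ico.tchar_irr norm pos by auto
  have "sorted_wrt (\<lambda>cs ds. ico.tchar cs \<noteq> ico.tchar ds) ico_polys"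
    using ico_orthogonal
  proof (rule sorted_wrt_mono_rel[rotated])
    fix cs ds assume "cs \<in> set ico_polys" "ds \<in> set ico_polys" "zinner ico_classes cs ds = (0, 0)"
    then have "cinner ico.G (trace_poly cs) (trace_poly ds) = 0" by (simp add: cinner_ico zev_def)
    then show "ico.tchar cs \<noteq> ico.tchar ds" using norm[OF \<open>ds \<in> set ico_polys\<close>] by (intro ico.tchar_neq) simp
  qed
  then have dist: "distinct ?xs" by (rule distinct_map_if_sorted_wrt)
  have "(\<Sum>\<psi>\<leftarrow>?xs. (ico.cdeg \<psi>)\<^sup>2) = sum_list (map (\<lambda>d. d\<^sup>2) (map ico.cdeg ?xs))" by (simp add: o_def)
  also have "\<dots> = 120" unfolding degs by simp
  finally have "irr_dim_sum ico.G = (\<Sum>\<psi>\<leftarrow>?xs. ico.cdeg \<psi>)"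
    using ico.irr_dim_sum_list[OF irr dist] order_ico by simp
  then show ?thesis unfolding degs by (simp add: binary_icosahedral_def)
qed

section \<open>Coxeter elements\<close>

lemma linear_reflection: "linear (reflection \<alpha>)"
  by (rule linearI) (simp_all add: reflection_def inner_add_left add_divide_distrib algebra_simps)

lemma reflection_self: "\<alpha> \<noteq> 0 \<Longrightarrow> reflection \<alpha> \<alpha> = - \<alpha>"
  by (simp add: reflection_def scaleR_2)

lemma reflection_involution: "reflection \<alpha> (reflection \<alpha> x) = x"
  by (cases "\<alpha> = 0") (simp_all add: reflection_def inner_diff_left algebra_simps)

lemma inner_reflection: "inner (reflection \<alpha> x) (reflection \<alpha> y) = inner x y"
proof (cases "\<alpha> = 0")
  case False
  then have "inner \<alpha> \<alpha> \<noteq> 0" by simp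
  then show ?thesis
    by (simp add: reflection_def inner_diff_left inner_diff_right inner_commute field_simps)
qed (simp add: reflection_def)

lemma orthogonal_reflection: "orthogonal_transformation (reflection \<alpha>)"
  by (simp add: orthogonal_transformation_def linear_reflection inner_reflection)

lemma bij_reflection: "bij (reflection \<alpha>)"
  by (rule o_bij[of "reflection \<alpha>"]) (simp_all add: reflection_involution fun_eq_iff)

lemma reflection_image:
  assumes "orthogonal_transformation u"
  shows "u (reflection \<alpha> x) = reflection (u \<alpha>) (u x)"
proof -
  have "linear u" "\<And>v w. inner (u v) (u w) = inner v w" using assms by (auto simp: orthogonal_transformation_def)
  then show ?thesis by (simp add: reflection_def linear_diff linear_scale)
qed

lemma reflection_commute:
  assumes "inner a b = 0"
  shows "reflection a \<circ> reflection b = reflection b \<circ> reflection a"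
  using assms by (auto simp: fun_eq_iff reflection_def inner_diff_left inner_commute algebra_simps)

definition coxeter_product :: "'a::euclidean_space list \<Rightarrow> 'a \<Rightarrow> 'a"
  where "coxeter_product \<alpha>s = foldr (\<circ>) (map reflection \<alpha>s) id"

lemma coxeter_product_simps [simp]:
  fixes \<alpha>s \<beta>s :: "'a::euclidean_space list"
  shows "coxeter_product [] = id"
  "coxeter_product (a # \<alpha>s) = reflection a \<circ> coxeter_product \<alpha>s"
  "coxeter_product (\<alpha>s @ \<beta>s) = coxeter_product \<alpha>s \<circ> coxeter_product \<beta>s"
proof -
  have "foldr (\<circ>) fs g = foldr (\<circ>) fs id \<circ> g" for fs :: "('a \<Rightarrow> 'a) list" and g
    by (induction fs) (auto simp: o_assoc)
  from this[of "map reflection \<alpha>s" "coxeter_product \<beta>s"]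
  show "coxeter_product (\<alpha>s @ \<beta>s) = coxeter_product \<alpha>s \<circ> coxeter_product \<beta>s"
    by (simp add: coxeter_product_def)
qed (simp_all add: coxeter_product_def)

lemma bij_coxeter_product: "bij (coxeter_product \<alpha>s)"
proof (induction \<alpha>s)
  case Nil
  show ?case unfolding coxeter_product_simps by (rule bij_id)
next
  case (Cons a \<alpha>s)
  then show ?case unfolding coxeter_product_simps by (rule bij_comp[OF _ bij_reflection])
qed

lemma linear_coxeter_product: "linear (coxeter_product \<alpha>s)"
proof (induction \<alpha>s)
  case Nil
  then show ?case by (simp add: linear_iff)
next
  case (Cons a \<alpha>s)
  then show ?case unfolding coxeter_product_simps by (rule linear_compose[OF _ linear_reflection])
qed

lemma coxeter_product_image:
  assumes "orthogonal_transformation u"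
  shows "u \<circ> coxeter_product \<alpha>s = coxeter_product (map u \<alpha>s) \<circ> u"
  by (induction \<alpha>s) (auto simp: fun_eq_iff reflection_image[OF assms])

text \<open>Conjugacy by an arbitrary bijection; it serves to compare orders.\<close>

definition conjugate :: "('a \<Rightarrow> 'a) \<Rightarrow> ('a \<Rightarrow> 'a) \<Rightarrow> bool"
  where "conjugate f g \<longleftrightarrow> (\<exists>u. bij u \<and> u \<circ> f = g \<circ> u)"

lemma conjugate_refl: "conjugate f f"
  unfolding conjugate_def by (intro exI[of _ id]) simp

lemma conjugate_sym: "conjugate f g \<Longrightarrow> conjugate g f"
  unfolding conjugate_def
proof (elim exE conjE)
  fix u assume u: "bij u" "u \<circ> f = g \<circ> u"
  have "inv_into UNIV u \<circ> g = inv_into UNIV u \<circ> (g \<circ> u) \<circ> inv_into UNIV u" using u(1) by (auto simp: fun_eq_iff bij_is_surj surj_f_inv_f)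
  also have "\<dots> = inv_into UNIV u \<circ> (u \<circ> f) \<circ> inv_into UNIV u" by (simp add: u(2))
  also have "\<dots> = f \<circ> inv_into UNIV u" using u(1) by (auto simp: fun_eq_iff bij_is_inj inv_f_f)
  finally show "\<exists>u. bij u \<and> u \<circ> g = f \<circ> u" using u(1) bij_imp_bij_inv by blast
qed

lemma conjugate_trans: "conjugate f g \<Longrightarrow> conjugate g h \<Longrightarrow> conjugate f h"
  unfolding conjugate_def
proof (elim exE conjE)
  fix u v assume u: "bij u" "u \<circ> f = g \<circ> u" and v: "bij v" "v \<circ> g = h \<circ> v"
  have "(v \<circ> u) \<circ> f = h \<circ> (v \<circ> u)" using u(2) v(2) by (metis o_assoc)
  then show "\<exists>u. bij u \<and> u \<circ> f = h \<circ> u" using u(1) v(1) bij_comp by blast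
qed

lemma conjugate_funpow_id:
  assumes "conjugate f g"
  shows "f ^^ k = id \<longleftrightarrow> g ^^ k = id"
proof -
  have *: "g ^^ k = id" if "conjugate f g" "f ^^ k = id" for f g :: "'a \<Rightarrow> 'a"
  proof -
    obtain u where u: "bij u" "u \<circ> f = g \<circ> u" using \<open>conjugate f g\<close> by (auto simp: conjugate_def)
    have ufg: "u (f x) = g (u x)" for x using u(2) by (metis comp_apply)
    have pw: "u ((f ^^ n) x) = (g ^^ n) (u x)" for n x
      by (induction n) (simp_all add: ufg)
    have "(g ^^ k) y = y" for y
    proof -
      obtain x where "y = u x" using u(1) by (metis bij_pointE)
      then show ?thesis using pw[of k x] \<open>f ^^ k = id\<close> by simp
    qed
    then show ?thesis by auto
  qed
  show ?thesis using *[of f g] *[of g f] assms conjugate_sym by blast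
qed

subsection \<open>Reorderings of the simple reflections\<close>

text \<open>The moves keep the product of the reflections up to conjugacy: orthogonal reflections
  commute, and a rotation of the list is a conjugation by its first reflection.\<close>

inductive cyclic_shuffle :: "'a::euclidean_space list \<Rightarrow> 'a list \<Rightarrow> bool" where
  shuffle_refl: "cyclic_shuffle xs xs"
| shuffle_sym: "cyclic_shuffle xs ys \<Longrightarrow> cyclic_shuffle ys xs"
| shuffle_trans: "cyclic_shuffle xs ys \<Longrightarrow> cyclic_shuffle ys zs \<Longrightarrow> cyclic_shuffle xs zs"
| shuffle_swap: "inner a b = 0 \<Longrightarrow> cyclic_shuffle (xs @ a # b # ys) (xs @ b # a # ys)"
| shuffle_rotate: "cyclic_shuffle (a # xs) (xs @ [a])"

declare cyclic_shuffle.shuffle_trans [trans]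

lemma cyclic_shuffle_conjugate:
  "cyclic_shuffle xs ys \<Longrightarrow> conjugate (coxeter_product xs) (coxeter_product ys)"
proof (induction rule: cyclic_shuffle.induct)
  case (shuffle_swap a b xs ys)
  then have "reflection a \<circ> reflection b = reflection b \<circ> reflection a" by (rule reflection_commute)
  then have "coxeter_product (xs @ a # b # ys) = coxeter_product (xs @ b # a # ys)"
    by (auto simp: fun_eq_iff)
  then show ?case by (simp add: conjugate_refl del: coxeter_product_simps)
next
  case (shuffle_rotate a xs)
  show ?case unfolding conjugate_def
    by (intro exI[of _ "reflection a"]) (auto simp: bij_reflection fun_eq_iff reflection_involution)
qed (blast intro: conjugate_refl conjugate_sym conjugate_trans)+

lemma cyclic_shuffle_mset: "cyclic_shuffle xs ys \<Longrightarrow> mset xs = mset ys"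
  by (induction rule: cyclic_shuffle.induct) auto

lemma cyclic_shuffle_move: "(\<And>x. x \<in> set xs \<Longrightarrow> inner s x = 0) \<Longrightarrow> cyclic_shuffle (ys @ s # xs @ zs) (ys @ xs @ s # zs)"
proof (induction xs arbitrary: ys)
  case (Cons x xs)
  have "cyclic_shuffle (ys @ s # x # xs @ zs) (ys @ x # s # xs @ zs)"
    by (rule shuffle_swap) (use Cons.prems in simp)
  also have "cyclic_shuffle (ys @ x # s # xs @ zs) (ys @ x # xs @ s # zs)"
    using Cons.IH[of "ys @ [x]"] Cons.prems by simp
  finally show ?case by simp
qed (simp add: shuffle_refl)

lemma cyclic_shuffle_rotate_append: "cyclic_shuffle (xs @ ys) (ys @ xs)"
proof (induction xs arbitrary: ys)
  case (Cons x xs)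
  have "cyclic_shuffle (x # xs @ ys) (xs @ ys @ [x])" using shuffle_rotate[of x "xs @ ys"] by simp
  also have "cyclic_shuffle (xs @ ys @ [x]) (ys @ x # xs)" using Cons.IH[of "ys @ [x]"] by simp
  finally show ?case by simp
qed (simp add: shuffle_refl)

text \<open>A new reflection with at most one neighbour can be carried along: it passes over every other
  element, and around its neighbour by a rotation.\<close>

lemma cyclic_shuffle_Cons:
  assumes "cyclic_shuffle xs ys" "distinct xs"
    "\<And>a b. a \<in> set xs \<Longrightarrow> b \<in> set xs \<Longrightarrow> inner s a \<noteq> 0 \<Longrightarrow> inner s b \<noteq> 0 \<Longrightarrow> a = b"
  shows "cyclic_shuffle (s # xs) (s # ys)"
  using assms
proof (induction rule: cyclic_shuffle.induct)
  case (shuffle_sym xs ys)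
  have m: "mset xs = mset ys" using cyclic_shuffle_mset[OF shuffle_sym.hyps] .
  have d: "distinct xs" using shuffle_sym.prems(1) mset_eq_imp_distinct_iff[OF m] by blast
  have "cyclic_shuffle (s # xs) (s # ys)"
    by (rule shuffle_sym.IH[OF d]) (use shuffle_sym.prems(2) in \<open>unfold mset_eq_setD[OF m], blast\<close>)
  then show ?case by (rule cyclic_shuffle.shuffle_sym)
next
  case (shuffle_trans xs ys zs)
  have m: "mset xs = mset ys" using cyclic_shuffle_mset[OF shuffle_trans.hyps(1)] .
  have d: "distinct ys" using shuffle_trans.prems(1) mset_eq_imp_distinct_iff[OF m] by blast
  have "cyclic_shuffle (s # xs) (s # ys)"
    by (rule shuffle_trans.IH(1)[OF shuffle_trans.prems(1)]) (use shuffle_trans.prems(2) in blast)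
  moreover have "cyclic_shuffle (s # ys) (s # zs)"
    by (rule shuffle_trans.IH(2)[OF d]) (use shuffle_trans.prems(2) in \<open>unfold mset_eq_setD[OF m], blast\<close>)
  ultimately show ?case by (rule cyclic_shuffle.shuffle_trans)
next
  case (shuffle_swap a b xs ys)
  show ?case using cyclic_shuffle.shuffle_swap[OF shuffle_swap.hyps, of "s # xs" ys] by simp
next
  case (shuffle_rotate a xs)
  show ?case
  proof (cases "inner s a = 0")
    case True
    have "cyclic_shuffle (s # a # xs) (a # s # xs)" using cyclic_shuffle.shuffle_swap[OF True, of "[]" xs] by simp
    also have "cyclic_shuffle (a # s # xs) ((s # xs) @ [a])" by (rule cyclic_shuffle.shuffle_rotate)
    finally show ?thesis by simp
  next
    case False
    have o: "inner s x = 0" if "x \<in> set xs" for x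
    proof (rule ccontr)
      assume "inner s x \<noteq> 0"
      then have "x = a" using shuffle_rotate.prems(2)[of x a] that False by simp
      then show False using shuffle_rotate.prems(1) that by simp
    qed
    \<comment> \<open>Here a is the neighbour of s, so s passes over all of xs: s is rotated to the
      end, travels back to the place behind a, and then a is rotated to the end.\<close>
    have "cyclic_shuffle (s # a # xs) ((a # xs) @ [s])" by (rule cyclic_shuffle.shuffle_rotate)
    also have "cyclic_shuffle ((a # xs) @ [s]) ([a] @ s # xs @ [])"
    proof (rule cyclic_shuffle.shuffle_sym)
      have "cyclic_shuffle ([a] @ s # xs @ []) ([a] @ xs @ s # [])" by (rule cyclic_shuffle_move) (rule o)
      then show "cyclic_shuffle ([a] @ s # xs @ []) ((a # xs) @ [s])" by simp
    qed
    also have "cyclic_shuffle ([a] @ s # xs @ []) ((s # xs) @ [a])"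
      using cyclic_shuffle.shuffle_rotate[of a "s # xs"] by simp
    finally show ?thesis by simp
  qed
qed (rule shuffle_refl)

text \<open>The Coxeter diagram is a forest, witnessed by an order in which each root has at most
  one earlier neighbour.\<close>

definition forest_order :: "'a::euclidean_space list \<Rightarrow> bool"
  where "forest_order zs \<longleftrightarrow> distinct zs \<and>
    (\<forall>j<length zs. \<forall>i<j. \<forall>i'<j. inner (zs ! j) (zs ! i) \<noteq> 0 \<and> inner (zs ! j) (zs ! i') \<noteq> 0 \<longrightarrow> i = i')"

text \<open>The last root s is a leaf or isolated. Both lists are rotated to begin with s, the rests
  are related by induction, and s is carried along.\<close>

lemma forest_order_shuffle:
  assumes "forest_order zs" "distinct xs" "set xs = set zs" "distinct ys" "set ys = set zs"
  shows "cyclic_shuffle xs ys"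
  using assms
proof (induction zs arbitrary: xs ys rule: rev_induct)
  case (snoc s zs)
  have f: "forest_order zs"
    unfolding forest_order_def
  proof (intro conjI allI impI)
    show "distinct zs" using snoc.prems(1) by (simp add: forest_order_def)
    fix j i i' assume "j < length zs" "i < j" "i' < j" "inner (zs ! j) (zs ! i) \<noteq> 0 \<and> inner (zs ! j) (zs ! i') \<noteq> 0"
    then show "i = i'"
      using snoc.prems(1)[unfolded forest_order_def, THEN conjunct2, rule_format, of j i i'] by (simp add: nth_append)
  qed
  have s: "s \<notin> set zs" using snoc.prems(1) by (simp add: forest_order_def)
  have nb: "a = b" if ab: "a \<in> set zs" "b \<in> set zs" "inner s a \<noteq> 0" "inner s b \<noteq> 0" for a b
  proof -
    obtain i i' where i: "i < length zs" "a = zs ! i" "i' < length zs" "b = zs ! i'"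
      using ab(1,2) by (auto simp: in_set_conv_nth)
    then have "i = i'"
      using snoc.prems(1)[unfolded forest_order_def, THEN conjunct2, rule_format, of "length zs" i i'] ab(3,4)
      by (simp add: nth_append)
    then show ?thesis using i by simp
  qed
  have key: "\<exists>us. distinct us \<and> set us = set zs \<and> cyclic_shuffle xs (s # us)" if xs: "distinct xs" "set xs = set (zs @ [s])" for xs
  proof -
    have "s \<in> set xs" using xs by simp
    then obtain l1 l2 where l: "xs = l1 @ s # l2" by (meson split_list)
    have "cyclic_shuffle (l1 @ (s # l2)) ((s # l2) @ l1)" by (rule cyclic_shuffle_rotate_append)
    moreover have "distinct (l2 @ l1)" "set (l2 @ l1) = set zs" using xs l s by auto
    ultimately show ?thesis using l by (intro exI[of _ "l2 @ l1"]) simp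
  qed
  obtain us where us: "distinct us" "set us = set zs" "cyclic_shuffle xs (s # us)" using key[OF snoc.prems(2,3)] by blast
  obtain vs where vs: "distinct vs" "set vs = set zs" "cyclic_shuffle ys (s # vs)" using key[OF snoc.prems(4,5)] by blast
  have "cyclic_shuffle us vs" using snoc.IH[OF f us(1,2) vs(1,2)] .
  then have "cyclic_shuffle (s # us) (s # vs)"
    by (rule cyclic_shuffle_Cons[OF _ us(1)]) (use nb us(2) in blast)
  then show ?case using us(3) vs(3) shuffle_trans shuffle_sym by blast
qed (simp add: shuffle_refl)

subsection \<open>Any two simple systems are related by an isometry\<close>

definition positive_roots :: "'a::euclidean_space set \<Rightarrow> 'a set \<Rightarrow> 'a set"
  where "positive_roots \<Phi> \<Delta> = {\<alpha> \<in> \<Phi>. \<forall>\<delta>\<in>\<Delta>. representation \<Delta> \<alpha> \<delta> \<ge> 0}"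

locale simple_roots =
  fixes \<Phi> \<Delta> :: "'a::euclidean_space set"
  assumes root: "root_system \<Phi>" and simple: "simple_system \<Phi> \<Delta>"
begin

lemma sub: "\<Delta> \<subseteq> \<Phi>" and indep: "independent \<Delta>" and span: "span \<Delta> = UNIV"
  using simple by (auto simp: simple_system_def)

lemma fin_roots: "finite \<Phi>" using root by (simp add: root_system_def)

lemma fin_simple: "finite \<Delta>" using fin_roots sub finite_subset by blast

lemma nonzero: "\<alpha> \<in> \<Phi> \<Longrightarrow> \<alpha> \<noteq> 0" using root by (auto simp: root_system_def)

lemma reduced: "\<alpha> \<in> \<Phi> \<Longrightarrow> c *\<^sub>R \<alpha> \<in> \<Phi> \<Longrightarrow> c = 1 \<or> c = -1"
proof -
  assume a: "\<alpha> \<in> \<Phi>" "c *\<^sub>R \<alpha> \<in> \<Phi>"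
  then have "c *\<^sub>R \<alpha> \<in> \<Phi> \<inter> range (\<lambda>c. c *\<^sub>R \<alpha>)" by blast
  then have "c *\<^sub>R \<alpha> = 1 *\<^sub>R \<alpha> \<or> c *\<^sub>R \<alpha> = (-1) *\<^sub>R \<alpha>" using root a(1) by (auto simp: root_system_def)
  then show ?thesis using nonzero[OF a(1)] by (metis scaleR_cancel_right)
qed

lemma minus_root: "\<alpha> \<in> \<Phi> \<Longrightarrow> - \<alpha> \<in> \<Phi>" using root by (auto simp: root_system_def)

lemma reflection_root: "\<alpha> \<in> \<Phi> \<Longrightarrow> \<beta> \<in> \<Phi> \<Longrightarrow> reflection \<alpha> \<beta> \<in> \<Phi>"
  using root unfolding root_system_def by blast

abbreviation coord where "coord v \<equiv> representation \<Delta> v"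

lemma sum_coord: "(\<Sum>\<delta>\<in>\<Delta>. coord v \<delta> *\<^sub>R \<delta>) = v"
  using sum_representation_eq[OF indep, of v \<Delta>] span fin_simple by simp

lemma coord_add: "coord (v + w) \<delta> = coord v \<delta> + coord w \<delta>"
  using representation_add[OF indep, of w v] span by simp

lemma coord_scale: "coord (c *\<^sub>R v) \<delta> = c * coord v \<delta>"
  using representation_scale[OF indep, of v c] span by simp

lemma coord_minus: "coord (- v) \<delta> = - coord v \<delta>"
  using coord_scale[of "-1" v \<delta>] by simp

lemma coord_diff: "coord (v - w) \<delta> = coord v \<delta> - coord w \<delta>"
  using coord_add[of v "- w"] coord_minus by simp

lemma coord_sum: "coord (\<Sum>i\<in>A. f i) \<delta> = (\<Sum>i\<in>A. coord (f i) \<delta>)"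
proof (induction A rule: infinite_finite_induct)
  case (insert x F)
  then show ?case by (simp add: coord_add)
qed (simp_all add: representation_zero)

lemma coord_simple: "\<delta> \<in> \<Delta> \<Longrightarrow> coord \<delta> \<epsilon> = (if \<epsilon> = \<delta> then 1 else 0)"
  using representation_basis[OF indep, of \<delta>] by auto

lemma coord_unique:
  assumes "v = (\<Sum>\<delta>\<in>\<Delta>. c \<delta> *\<^sub>R \<delta>)" "\<epsilon> \<in> \<Delta>"
  shows "coord v \<epsilon> = c \<epsilon>"
proof -
  have "coord v \<epsilon> = (\<Sum>\<delta>\<in>\<Delta>. c \<delta> * (if \<epsilon> = \<delta> then 1 else 0))"
    unfolding assms(1) by (simp add: coord_sum coord_scale coord_simple)
  then show ?thesis using assms(2) fin_simple by (simp add: if_distrib cong: if_cong)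
qed

lemma coord_sign:
  assumes "\<alpha> \<in> \<Phi>"
  shows "(\<forall>\<delta>\<in>\<Delta>. coord \<alpha> \<delta> \<ge> 0) \<or> (\<forall>\<delta>\<in>\<Delta>. coord \<alpha> \<delta> \<le> 0)"
proof -
  obtain c where c: "\<alpha> = (\<Sum>\<delta>\<in>\<Delta>. c \<delta> *\<^sub>R \<delta>)" "(\<forall>\<delta>\<in>\<Delta>. c \<delta> \<ge> 0) \<or> (\<forall>\<delta>\<in>\<Delta>. c \<delta> \<le> 0)"
    using simple assms by (auto simp: simple_system_def)
  then show ?thesis using coord_unique[OF c(1)] by auto
qed

abbreviation Pos where "Pos \<equiv> positive_roots \<Phi> \<Delta>"

lemma pos_or_neg: "\<alpha> \<in> \<Phi> \<Longrightarrow> \<alpha> \<in> Pos \<or> - \<alpha> \<in> Pos"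
  using coord_sign[of \<alpha>] minus_root by (auto simp: positive_roots_def coord_minus)

lemma not_pos_and_neg: "\<alpha> \<in> Pos \<Longrightarrow> - \<alpha> \<notin> Pos"
proof
  assume "\<alpha> \<in> Pos" "- \<alpha> \<in> Pos"
  then have "\<forall>\<delta>\<in>\<Delta>. coord \<alpha> \<delta> = 0" "\<alpha> \<in> \<Phi>" by (fastforce simp: positive_roots_def coord_minus)+
  then show False using sum_coord[of \<alpha>] nonzero[of \<alpha>] by simp
qed

lemma simple_pos: "\<delta> \<in> \<Delta> \<Longrightarrow> \<delta> \<in> Pos"
  using sub by (auto simp: positive_roots_def coord_simple)

text \<open>This is where reducedness enters: the only positive multiple of \<delta> among the roots
  is \<delta> itself.\<close>

lemma multiple_of_simple:
  assumes "\<delta> \<in> \<Delta>" "\<alpha> \<in> Pos" "\<And>\<epsilon>. \<epsilon> \<in> \<Delta> \<Longrightarrow> \<epsilon> \<noteq> \<delta> \<Longrightarrow> coord \<alpha> \<epsilon> = 0"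
  shows "\<alpha> = \<delta>"
proof -
  have "\<alpha> = (\<Sum>\<epsilon>\<in>\<Delta>. coord \<alpha> \<epsilon> *\<^sub>R \<epsilon>)" by (simp add: sum_coord)
  also have "\<dots> = coord \<alpha> \<delta> *\<^sub>R \<delta>"
    using assms(1,3) fin_simple by (subst sum.remove[of _ \<delta>]) auto
  finally have a: "\<alpha> = coord \<alpha> \<delta> *\<^sub>R \<delta>" .
  have "coord \<alpha> \<delta> *\<^sub>R \<delta> \<in> \<Phi>" using a assms(2) by (simp add: positive_roots_def)
  then have "coord \<alpha> \<delta> = 1 \<or> coord \<alpha> \<delta> = -1" using reduced assms(1) sub by blast
  moreover have "coord \<alpha> \<delta> \<ge> 0" using assms by (simp add: positive_roots_def)
  ultimately have "coord \<alpha> \<delta> = 1" by auto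
  then show ?thesis using a by simp
qed

text \<open>The reflection changes only the \<delta>-coordinate, and \<alpha> has another coordinate
  that is positive; a root with one positive coordinate is positive.\<close>

lemma reflection_simple_pos:
  assumes "\<delta> \<in> \<Delta>" "\<alpha> \<in> Pos" "\<alpha> \<noteq> \<delta>"
  shows "reflection \<delta> \<alpha> \<in> Pos"
proof -
  obtain \<epsilon> where e: "\<epsilon> \<in> \<Delta>" "\<epsilon> \<noteq> \<delta>" "coord \<alpha> \<epsilon> \<noteq> 0" using multiple_of_simple assms by blast
  have "coord \<alpha> \<epsilon> \<ge> 0" using e(1) assms(2) by (auto simp: positive_roots_def)
  then have "coord \<alpha> \<epsilon> > 0" using e(3) by simp
  moreover have "coord (reflection \<delta> \<alpha>) \<epsilon> = coord \<alpha> \<epsilon>"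
    using e assms(1) by (simp add: reflection_def coord_diff coord_scale coord_simple)
  moreover have "reflection \<delta> \<alpha> \<in> \<Phi>" using assms sub reflection_root by (auto simp: positive_roots_def)
  ultimately show ?thesis using coord_sign[of "reflection \<delta> \<alpha>"] e(1) by (force simp: positive_roots_def)
qed

end

text \<open>Expand \<delta> over \<Delta>' and then over \<Delta>. The coordinates other than that
  of \<delta> cancel although all terms are nonnegative, so each term vanishes, and a member of
  \<Delta>' that occurs is a multiple of \<delta>.\<close>

lemma simple_determined_by_positive:
  assumes "simple_roots \<Phi> \<Delta>" "simple_roots \<Phi> \<Delta>'" "positive_roots \<Phi> \<Delta> = positive_roots \<Phi> \<Delta>'"
  shows "\<Delta> \<subseteq> \<Delta>'"
proof
  interpret A: simple_roots \<Phi> \<Delta> by fact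
  interpret B: simple_roots \<Phi> \<Delta>' by fact
  fix \<delta> assume d: "\<delta> \<in> \<Delta>"
  then have dB: "\<delta> \<in> positive_roots \<Phi> \<Delta>'" using A.simple_pos assms(3) by simp
  then have "\<delta> \<noteq> 0" using A.nonzero by (auto simp: positive_roots_def)
  then obtain \<epsilon> where e: "\<epsilon> \<in> \<Delta>'" "B.coord \<delta> \<epsilon> \<noteq> 0" using B.sum_coord[of \<delta>] by (metis (no_types, lifting) scaleR_zero_left sum.neutral)
  have nonneg: "B.coord \<delta> \<eta> \<ge> 0" if "\<eta> \<in> \<Delta>'" for \<eta> using dB that by (simp add: positive_roots_def)
  have eP: "\<eta> \<in> positive_roots \<Phi> \<Delta>" if "\<eta> \<in> \<Delta>'" for \<eta> using B.simple_pos[OF that] assms(3) by simp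
  have "A.coord \<epsilon> \<delta>' = 0" if d': "\<delta>' \<in> \<Delta>" "\<delta>' \<noteq> \<delta>" for \<delta>'
  proof -
    have "(\<Sum>\<eta>\<in>\<Delta>'. B.coord \<delta> \<eta> * A.coord \<eta> \<delta>') = A.coord (\<Sum>\<eta>\<in>\<Delta>'. B.coord \<delta> \<eta> *\<^sub>R \<eta>) \<delta>'"
      by (simp add: A.coord_sum A.coord_scale)
    also have "\<dots> = 0" using d d' by (simp add: B.sum_coord A.coord_simple)
    finally have "\<forall>\<eta>\<in>\<Delta>'. B.coord \<delta> \<eta> * A.coord \<eta> \<delta>' = 0"
      using nonneg eP d'(1) B.fin_simple by (subst (asm) sum_nonneg_eq_0_iff) (auto simp: positive_roots_def)
    then show ?thesis using e by auto
  qed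
  then have "\<epsilon> = \<delta>" using A.multiple_of_simple[OF d eP[OF e(1)]] by blast
  then show "\<delta> \<in> \<Delta>'" using e(1) by simp
qed

lemma simple_roots_image:
  assumes "simple_roots \<Phi> \<Delta>" "orthogonal_transformation u" "u ` \<Phi> = \<Phi>"
  shows "simple_roots \<Phi> (u ` \<Delta>)" "positive_roots \<Phi> (u ` \<Delta>) = u ` positive_roots \<Phi> \<Delta>"
proof -
  interpret A: simple_roots \<Phi> \<Delta> by fact
  have lin: "linear u" and inj: "inj u" and surj: "surj u"
    using assms(2) orthogonal_transformation_inj orthogonal_transformation_surj orthogonal_transformation_def by blast+
  have inj': "inj_on u \<Delta>" using inj inj_on_subset by blast
  have ind: "independent (u ` \<Delta>)" using linear_independent_injective_image[OF lin A.indep] inj inj_on_subset by blast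
  have spn: "span (u ` \<Delta>) = UNIV" using linear_span_image[OF lin, of \<Delta>] A.span surj by simp
  have expand: "u v = (\<Sum>\<epsilon>\<in>u ` \<Delta>. A.coord v (the_inv_into \<Delta> u \<epsilon>) *\<^sub>R \<epsilon>)" for v
  proof -
    have "u v = u (\<Sum>\<delta>\<in>\<Delta>. A.coord v \<delta> *\<^sub>R \<delta>)" by (simp add: A.sum_coord)
    also have "\<dots> = (\<Sum>\<delta>\<in>\<Delta>. A.coord v \<delta> *\<^sub>R u \<delta>)" using lin by (simp add: linear_sum linear_scale)
    also have "\<dots> = (\<Sum>\<epsilon>\<in>u ` \<Delta>. A.coord v (the_inv_into \<Delta> u \<epsilon>) *\<^sub>R \<epsilon>)"
      by (simp add: sum.reindex[OF inj'] the_inv_into_f_f[OF inj'])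
    finally show ?thesis .
  qed
  have ss: "simple_system \<Phi> (u ` \<Delta>)"
    unfolding simple_system_def
  proof (intro conjI ballI ind spn)
    show "u ` \<Delta> \<subseteq> \<Phi>" using A.sub assms(3) by blast
    fix \<alpha> assume "\<alpha> \<in> \<Phi>"
    then obtain \<beta> where b: "\<beta> \<in> \<Phi>" "\<alpha> = u \<beta>" using assms(3) by blast
    show "\<exists>c. \<alpha> = (\<Sum>\<delta>\<in>u ` \<Delta>. c \<delta> *\<^sub>R \<delta>) \<and> ((\<forall>\<delta>\<in>u ` \<Delta>. 0 \<le> c \<delta>) \<or> (\<forall>\<delta>\<in>u ` \<Delta>. c \<delta> \<le> 0))"
    proof (intro exI conjI)
      show "\<alpha> = (\<Sum>\<delta>\<in>u ` \<Delta>. A.coord \<beta> (the_inv_into \<Delta> u \<delta>) *\<^sub>R \<delta>)" unfolding b(2) by (rule expand)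
      show "(\<forall>\<delta>\<in>u ` \<Delta>. 0 \<le> A.coord \<beta> (the_inv_into \<Delta> u \<delta>)) \<or> (\<forall>\<delta>\<in>u ` \<Delta>. A.coord \<beta> (the_inv_into \<Delta> u \<delta>) \<le> 0)"
        using A.coord_sign[OF b(1)] by (simp add: the_inv_into_f_f[OF inj'])
    qed
  qed
  then show sr: "simple_roots \<Phi> (u ` \<Delta>)" using A.root by (simp add: simple_roots_def)
  interpret B: simple_roots \<Phi> "u ` \<Delta>" by (rule sr)
  have co: "B.coord (u v) (u \<delta>) = A.coord v \<delta>" if "\<delta> \<in> \<Delta>" for v \<delta>
    using B.coord_unique[OF expand, of "u \<delta>" v] that by (simp add: the_inv_into_f_f[OF inj'])
  show "positive_roots \<Phi> (u ` \<Delta>) = u ` positive_roots \<Phi> \<Delta>"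
  proof (intro equalityI subsetI)
    fix \<alpha> assume a: "\<alpha> \<in> positive_roots \<Phi> (u ` \<Delta>)"
    then have "\<alpha> \<in> u ` \<Phi>" using assms(3) by (simp add: positive_roots_def)
    then obtain \<beta> where b: "\<beta> \<in> \<Phi>" "\<alpha> = u \<beta>" by blast
    have "A.coord \<beta> \<delta> \<ge> 0" if "\<delta> \<in> \<Delta>" for \<delta>
      unfolding co[OF that, symmetric] using a that unfolding positive_roots_def b(2) by blast
    then show "\<alpha> \<in> u ` positive_roots \<Phi> \<Delta>" using b by (simp add: positive_roots_def)
  next
    fix \<alpha> assume "\<alpha> \<in> u ` positive_roots \<Phi> \<Delta>"
    then obtain \<beta> where b: "\<beta> \<in> \<Phi>" "\<forall>\<delta>\<in>\<Delta>. A.coord \<beta> \<delta> \<ge> 0" "\<alpha> = u \<beta>" by (auto simp: positive_roots_def)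
    have "u \<beta> \<in> \<Phi>" using b(1) assms(3) by blast
    then show "\<alpha> \<in> positive_roots \<Phi> (u ` \<Delta>)" using b(2,3) by (simp add: positive_roots_def co)
  qed
qed

text \<open>Induction on the number of roots that are positive for \<Delta> and negative for
  \<Delta>'. If a root \<delta> of \<Delta> is negative for \<Delta>', reflecting \<Delta> in
  \<delta> removes \<delta> from these roots and adds none. If there is no such \<delta>, the
  positive roots coincide.\<close>

lemma simple_systems_isometric:
  assumes "simple_roots \<Phi> \<Delta>" "simple_roots \<Phi> \<Delta>'"
  shows "\<exists>u. orthogonal_transformation u \<and> u ` \<Delta> = \<Delta>'"
  using assms
proof (induction "card (positive_roots \<Phi> \<Delta> \<inter> uminus ` positive_roots \<Phi> \<Delta>')" arbitrary: \<Delta> rule: less_induct)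
  case less
  interpret A: simple_roots \<Phi> \<Delta> by (rule less.prems(1))
  interpret B: simple_roots \<Phi> \<Delta>' by (rule less.prems(2))
  show ?case
  proof (cases "\<Delta> \<subseteq> B.Pos")
    case True
    have "A.Pos \<subseteq> B.Pos"
    proof
      fix \<alpha> assume a: "\<alpha> \<in> A.Pos"
      have "B.coord \<alpha> \<epsilon> \<ge> 0" if "\<epsilon> \<in> \<Delta>'" for \<epsilon>
      proof -
        have "B.coord (\<Sum>\<delta>\<in>\<Delta>. A.coord \<alpha> \<delta> *\<^sub>R \<delta>) \<epsilon> \<ge> 0"
          unfolding B.coord_sum B.coord_scale
          using a True that by (intro sum_nonneg mult_nonneg_nonneg) (auto simp: positive_roots_def)
        then show ?thesis by (simp add: A.sum_coord)
      qed
      then show "\<alpha> \<in> B.Pos" using a by (auto simp: positive_roots_def)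
    qed
    moreover have "B.Pos \<subseteq> A.Pos"
    proof
      fix \<alpha> assume a: "\<alpha> \<in> B.Pos"
      then have "\<alpha> \<in> \<Phi>" by (simp add: positive_roots_def)
      then show "\<alpha> \<in> A.Pos" using A.pos_or_neg[of \<alpha>] B.not_pos_and_neg[OF a] \<open>A.Pos \<subseteq> B.Pos\<close> by blast
    qed
    ultimately have "A.Pos = B.Pos" by simp
    then have "\<Delta> = \<Delta>'" using simple_determined_by_positive less.prems by (metis subset_antisym)
    then show ?thesis by (intro exI[of _ "\<lambda>x. x"]) (simp add: orthogonal_transformation_id)
  next
    case False
    then obtain \<delta> where d: "\<delta> \<in> \<Delta>" "\<delta> \<notin> B.Pos" by blast
    have dP: "\<delta> \<in> \<Phi>" using d(1) A.sub by blast
    have refl: "reflection \<delta> ` \<Phi> = \<Phi>" using A.root dP by (auto simp: root_system_def)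
    note im = simple_roots_image[OF less.prems(1) orthogonal_reflection refl]
    have sub: "positive_roots \<Phi> (reflection \<delta> ` \<Delta>) \<subseteq> insert (- \<delta>) (A.Pos - {\<delta>})"
    proof
      fix \<alpha> assume "\<alpha> \<in> positive_roots \<Phi> (reflection \<delta> ` \<Delta>)"
      then obtain \<beta> where b: "\<beta> \<in> A.Pos" "\<alpha> = reflection \<delta> \<beta>" using im(2) by blast
      show "\<alpha> \<in> insert (- \<delta>) (A.Pos - {\<delta>})"
      proof (cases "\<beta> = \<delta>")
        case True
        then show ?thesis using b reflection_self[OF A.nonzero[OF dP]] by simp
      next
        case False
        have "\<alpha> \<noteq> \<delta>"
        proof
          assume "\<alpha> = \<delta>"
          then have "\<beta> = - \<delta>" using b(2) reflection_involution[of \<delta> \<beta>] reflection_self[OF A.nonzero[OF dP]] by simp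
          then show False using b(1) A.not_pos_and_neg[OF A.simple_pos[OF d(1)]] by simp
        qed
        then show ?thesis using A.reflection_simple_pos[OF d(1) b(1) False] b(2) by simp
      qed
    qed
    have not_mem: "- \<delta> \<notin> uminus ` B.Pos"
    proof
      assume "- \<delta> \<in> uminus ` B.Pos"
      then obtain \<beta> where "\<beta> \<in> B.Pos" "- \<delta> = - \<beta>" by blast
      then show False using d(2) by simp
    qed
    have mem: "\<delta> \<in> uminus ` B.Pos"
    proof -
      have "- \<delta> \<in> B.Pos" using B.pos_or_neg[OF dP] d(2) by blast
      then have "- (- \<delta>) \<in> uminus ` B.Pos" by (rule imageI)
      then show ?thesis by simp
    qed
    have "card (positive_roots \<Phi> (reflection \<delta> ` \<Delta>) \<inter> U) < card (A.Pos \<inter> U)"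
      if "- \<delta> \<notin> U" "\<delta> \<in> U" for U
    proof (rule psubset_card_mono)
      show "finite (A.Pos \<inter> U)"
        by (rule finite_subset[OF _ A.fin_roots]) (unfold positive_roots_def, blast)
      show "positive_roots \<Phi> (reflection \<delta> ` \<Delta>) \<inter> U \<subset> A.Pos \<inter> U"
      proof (rule psubsetI)
        show "positive_roots \<Phi> (reflection \<delta> ` \<Delta>) \<inter> U \<subseteq> A.Pos \<inter> U"
        proof
          fix \<alpha> assume "\<alpha> \<in> positive_roots \<Phi> (reflection \<delta> ` \<Delta>) \<inter> U"
          then have "\<alpha> \<in> insert (- \<delta>) (A.Pos - {\<delta>})" "\<alpha> \<in> U" using subsetD[OF sub] by simp_all
          then show "\<alpha> \<in> A.Pos \<inter> U" using that(1) by auto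
        qed
        have "\<delta> \<notin> positive_roots \<Phi> (reflection \<delta> ` \<Delta>)"
        proof
          assume "\<delta> \<in> positive_roots \<Phi> (reflection \<delta> ` \<Delta>)"
          then have "\<delta> = - \<delta>" using subsetD[OF sub, of \<delta>] by blast
          then have "- \<delta> \<in> U" using that(2) by (rule subst)
          then show False using that(1) by simp
        qed
        then show "positive_roots \<Phi> (reflection \<delta> ` \<Delta>) \<inter> U \<noteq> A.Pos \<inter> U"
          using that(2) A.simple_pos[OF d(1)] by (metis IntD1 IntI)
      qed
    qed
    from this[OF not_mem mem]
    have "card (positive_roots \<Phi> (reflection \<delta> ` \<Delta>) \<inter> uminus ` B.Pos) < card (A.Pos \<inter> uminus ` B.Pos)" .
    from less.hyps[OF this im(1) less.prems(2)] obtain u where u: "orthogonal_transformation u" "u ` reflection \<delta> ` \<Delta> = \<Delta>'" by blast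
    then show ?thesis
      by (intro exI[of _ "u \<circ> reflection \<delta>"]) (auto simp: image_image orthogonal_transformation_compose orthogonal_reflection)
  qed
qed

lemma coxeter_elements_conjugate:
  assumes root: "root_system \<Phi>" and zs: "forest_order zs" "simple_system \<Phi> (set zs)"
    and ys: "distinct ys" "simple_system \<Phi> (set ys)"
  shows "conjugate (coxeter_product zs) (coxeter_product ys)"
proof -
  obtain u where u: "orthogonal_transformation u" "u ` set zs = set ys"
    using simple_systems_isometric[of \<Phi> "set zs" "set ys"] assms by (auto simp: simple_roots_def)
  have bij: "bij u" using u(1) by (simp add: orthogonal_transformation_bij)
  \<comment> \<open>Pulled back along the isometry, \<open>ys\<close> becomes a rearrangement of
    \<open>zs\<close>.\<close>
  define xs where "xs = map (inv_into UNIV u) ys"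
  have iu: "map u xs = ys" using bij by (simp add: xs_def o_def bij_is_surj surj_f_inv_f)
  have "set xs = inv_into UNIV u ` u ` set zs" by (simp add: xs_def u(2))
  then have "set xs = set zs" using bij by (simp add: image_image bij_is_inj inv_f_f)
  moreover have "distinct xs" using ys(1) iu by (metis distinct_map)
  ultimately have "cyclic_shuffle zs xs"
    using zs(1) by (intro forest_order_shuffle[OF zs(1)]) (auto simp: forest_order_def)
  then have "conjugate (coxeter_product zs) (coxeter_product xs)" by (rule cyclic_shuffle_conjugate)
  moreover have "conjugate (coxeter_product xs) (coxeter_product ys)"
    using coxeter_product_image[OF u(1), of xs] bij unfolding iu conjugate_def by blast
  ultimately show ?thesis by (rule conjugate_trans)
qed

section \<open>The Coxeter number as the order of one product\<close>

lemma ord_BijGroup: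
  assumes "bij (w :: 'a \<Rightarrow> 'a)" "\<And>k. w ^^ k = id \<longleftrightarrow> h dvd k"
  shows "group.ord (BijGroup UNIV) w = h"
proof -
  interpret B: group "BijGroup (UNIV :: 'a set)" by (rule group_BijGroup)
  have car: "f \<in> carrier (BijGroup UNIV) \<longleftrightarrow> bij f" for f :: "'a \<Rightarrow> 'a"
    by (simp add: BijGroup_def Bij_def)
  have one: "\<one>\<^bsub>BijGroup (UNIV :: 'a set)\<^esub> = id" by (simp add: BijGroup_def fun_eq_iff)
  have mult: "f \<otimes>\<^bsub>BijGroup UNIV\<^esub> g = f \<circ> g" if "bij f" "bij g" for f g :: "'a \<Rightarrow> 'a"
    using that by (simp add: BijGroup_def Bij_def compose_def fun_eq_iff)
  have "w [^]\<^bsub>BijGroup UNIV\<^esub> k = w ^^ k" for k :: nat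
  proof (induction k)
    case (Suc k)
    have "bij (w ^^ k)" using assms(1) by (rule bij_fn)
    then have "w [^]\<^bsub>BijGroup UNIV\<^esub> Suc k = w ^^ k \<circ> w" using Suc assms(1) by (simp add: mult)
    then show ?case by (simp only: funpow_Suc_right)
  qed (simp add: one)
  then have all: "\<forall>k. w [^]\<^bsub>BijGroup UNIV\<^esub> (k::nat) = \<one>\<^bsub>BijGroup UNIV\<^esub> \<longleftrightarrow> h dvd k"
    unfolding one using assms(2) by metis
  have "w \<in> carrier (BijGroup UNIV)" using assms(1) by (simp only: car)
  from B.ord_unique[OF this] all show ?thesis by blast
qed

lemma coxeter_number_eqI:
  assumes root: "root_system \<Phi>" and zs: "forest_order zs" "simple_system \<Phi> (set zs)"
    and ord: "\<And>k. coxeter_product zs ^^ k = id \<longleftrightarrow> h dvd k"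
  shows "coxeter_number \<Phi> = h"
proof -
  have all: "group.ord (BijGroup UNIV) w = h" if w: "coxeter_element \<Phi> w" for w
  proof -
    obtain ys where ys: "distinct ys" "simple_system \<Phi> (set ys)" "w = coxeter_product ys"
      using w by (auto simp: coxeter_element_def coxeter_product_def)
    have "conjugate (coxeter_product zs) w"
      unfolding ys(3) by (rule coxeter_elements_conjugate[OF root zs ys(1,2)])
    then show ?thesis
      using conjugate_funpow_id ord bij_coxeter_product[of ys] ys(3) by (intro ord_BijGroup) blast+
  qed
  \<comment> \<open>The existence of a Coxeter element is what makes the number in the definite
    description unique.\<close>
  moreover have "coxeter_element \<Phi> (coxeter_product zs)"
    using zs by (auto simp: coxeter_element_def coxeter_product_def forest_order_def)
  ultimately show ?thesis unfolding coxeter_number_def by (intro the_equality) auto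
qed

subsection \<open>The order of a Coxeter element in the simply-laced types\<close>

lemma linear_funpow:
  fixes f :: "'a::real_vector \<Rightarrow> 'a"
  shows "linear f \<Longrightarrow> linear (f ^^ k)"
proof (induction k)
  case 0
  then show ?case by (simp add: linear_iff)
next
  case (Suc k)
  then show ?case unfolding funpow.simps by (intro linear_compose) auto
qed

lemma funpow_commute_apply: "(f ^^ a) ((f ^^ b) x) = (f ^^ b) ((f ^^ a) x)"
proof -
  have "(f ^^ (a + b)) x = (f ^^ (b + a)) x" by (simp only: add.commute)
  then show ?thesis unfolding funpow_add comp_apply .
qed

locale dynkin =
  fixes \<Phi> :: "'a::euclidean_space set" and \<alpha>s :: "'a list" and adj :: "nat \<Rightarrow> nat \<Rightarrow> bool"
  assumes root: "root_system \<Phi>" and dist: "distinct \<alpha>s" and simple: "simple_system \<Phi> (set \<alpha>s)"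
    and cartan: "\<And>i j. i < length \<alpha>s \<Longrightarrow> j < length \<alpha>s \<Longrightarrow> i \<noteq> j \<Longrightarrow>
      2 * inner (\<alpha>s ! i) (\<alpha>s ! j) / inner (\<alpha>s ! j) (\<alpha>s ! j) = (if adj i j then -1 else 0)"
begin

sublocale simple_roots \<Phi> "set \<alpha>s"
  using root simple by (simp add: simple_roots_def)

abbreviation m where "m \<equiv> length \<alpha>s"
abbreviation r where "r i \<equiv> \<alpha>s ! i"
abbreviation s where "s i \<equiv> reflection (\<alpha>s ! i)"

lemma r_nonzero: "i < m \<Longrightarrow> r i \<noteq> 0"
  using sub nonzero nth_mem by blast

lemma s_self: "i < m \<Longrightarrow> s i (r i) = - r i"
  by (rule reflection_self) (rule r_nonzero)

lemma s_other:
  assumes "i < m" "j < m" "i \<noteq> j"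
  shows "s j (r i) = (if adj i j then r i + r j else r i)"
  using cartan[OF assms] by (simp add: reflection_def)

lemma inner_eq_0_iff:
  assumes "i < m" "j < m" "i \<noteq> j"
  shows "inner (r i) (r j) = 0 \<longleftrightarrow> \<not> adj i j"
  using cartan[OF assms] r_nonzero[OF assms(2)] by (auto split: if_splits)

lemma s_linear: "s j (v + w) = s j v + s j w" "s j (v - w) = s j v - s j w" "s j (- v) = - s j v"
  "s j (c *\<^sub>R v) = c *\<^sub>R s j v" "s j (\<Sum>i\<in>A. f i) = (\<Sum>i\<in>A. s j (f i))"
  using linear_reflection[of "r j"] by (simp_all add: linear_add linear_diff linear_neg linear_scale linear_sum)

lemma coord_r: "i < m \<Longrightarrow> j < m \<Longrightarrow> coord (r i) (r j) = (if i = j then 1 else 0)"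
  using coord_simple[of "r i" "r j"] dist nth_eq_iff_index_eq[OF dist] by auto

lemma forest_orderI:
  assumes "\<And>i i' j. i < j \<Longrightarrow> i' < j \<Longrightarrow> j < m \<Longrightarrow> adj j i \<Longrightarrow> adj j i' \<Longrightarrow> i = i'"
  shows "forest_order \<alpha>s"
  unfolding forest_order_def
proof (intro conjI allI impI dist)
  fix j i i' assume j: "j < m" "i < j" "i' < j" and "inner (r j) (r i) \<noteq> 0 \<and> inner (r j) (r i') \<noteq> 0"
  then have "adj j i" "adj j i'" using inner_eq_0_iff[of j i] inner_eq_0_iff[of j i'] by auto
  then show "i = i'" using assms j by blast
qed

text \<open>The simple roots span the space, so if they are fixed the power h is the identity; the
  vector v with exact period h excludes smaller orders.\<close>

lemma coxeter_number_orbit: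
  assumes forest: "forest_order \<alpha>s" and h: "h > 0"
    and fixed: "\<And>i. i < m \<Longrightarrow> (coxeter_product \<alpha>s ^^ h) (r i) = r i"
    and moved: "\<And>k. 0 < k \<Longrightarrow> k < h \<Longrightarrow> (coxeter_product \<alpha>s ^^ k) v \<noteq> v"
  shows "coxeter_number \<Phi> = h"
proof (rule coxeter_number_eqI[OF root forest simple])
  let ?c = "coxeter_product \<alpha>s"
  have "(?c ^^ h) v = v" for v
  proof (rule linear_eq_on_span[of "?c ^^ h" "\<lambda>x. x" "set \<alpha>s"])
    show "linear (?c ^^ h)" by (rule linear_funpow[OF linear_coxeter_product])
    show "linear (\<lambda>x. x)" by (simp add: linear_iff)
    show "v \<in> Real_Vector_Spaces.span (set \<alpha>s)" using span by simp
    fix x assume "x \<in> set \<alpha>s"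
    then show "(?c ^^ h) x = x" using fixed by (auto simp: in_set_conv_nth)
  qed
  then have ch: "?c ^^ h = id" by auto
  have mul: "?c ^^ (h * q) = id" for q using ch by (simp add: funpow_mult[symmetric])
  fix k
  show "?c ^^ k = id \<longleftrightarrow> h dvd k"
  proof
    assume "h dvd k"
    then show "?c ^^ k = id" using mul by (auto elim!: dvdE)
  next
    assume k: "?c ^^ k = id"
    have "?c ^^ k = ?c ^^ (h * (k div h)) \<circ> ?c ^^ (k mod h)" by (simp add: funpow_add[symmetric])
    then have "?c ^^ (k mod h) = id" using k mul by simp
    then have "k mod h = 0" using moved[of "k mod h"] h by (metis gr0I id_apply mod_less_divisor)
    then show "h dvd k" by auto
  qed
qed

abbreviation P where "P k \<equiv> coxeter_product (take k \<alpha>s)"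

lemma P_Suc: "k < m \<Longrightarrow> P (Suc k) v = P k (s k v)"
  by (simp add: take_Suc_conv_app_nth del: take_Suc)

lemma P_fixed: "k \<le> m \<Longrightarrow> (\<And>i. i < k \<Longrightarrow> s i v = v) \<Longrightarrow> P k v = v"
  by (induction k) (auto simp: P_Suc)

lemma P_linear: "P k (v + w) = P k v + P k w" "P k (v - w) = P k v - P k w" "P k (- v) = - P k v"
  "P k (c *\<^sub>R v) = c *\<^sub>R P k v" "P k (\<Sum>i\<in>A. f i) = (\<Sum>i\<in>A. P k (f i))"
  using linear_coxeter_product[of "take k \<alpha>s"] by (simp_all add: linear_add linear_diff linear_neg linear_scale linear_sum)

text \<open>With \<sigma> the sum of the simple roots, the Coxeter element permutes the m simple
  roots and - \<sigma> in one cycle of length m + 1.\<close>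

lemma coxeter_number_A:
  assumes m: "m \<ge> 1" and adj: "\<And>i j. i < m \<Longrightarrow> j < m \<Longrightarrow> adj i j \<longleftrightarrow> j = Suc i \<or> i = Suc j"
  shows "coxeter_number \<Phi> = Suc m"
proof -
  let ?c = "coxeter_product \<alpha>s"
  \<comment> \<open>Reflections with an index beyond \<open>Suc i\<close> fix \<open>r i\<close>, so
    the computation takes place in the prefix that ends with \<open>s (Suc i)\<close>.\<close>
  have up: "P k (r i) = r (Suc i)" if "k \<le> m" "Suc i < k" for k i
    using that
  proof (induction k)
    case (Suc k)
    show ?case
    proof (cases "Suc i = k")
      case True
      have "P k (r k) + P k (r i) = r k"
      proof -
        have "P k (r i) = - P i (r i)"
          using P_Suc[of i "r i"] s_self[of i] Suc.prems True by (simp add: P_linear)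
        moreover have "P k (r k) = P i (r k) + P i (r i)"
          using P_Suc[of i "r k"] s_other[of k i] adj[of k i] Suc.prems True by (simp add: P_linear)
        moreover have "P i (r k) = r k"
        proof (rule P_fixed)
          fix j assume "j < i"
          then show "s j (r k) = r k" using s_other[of k j] adj[of k j] Suc.prems True by auto
        qed (use Suc.prems True in simp)
        ultimately show ?thesis by simp
      qed
      then show ?thesis
        using P_Suc[of k "r i"] s_other[of i k] adj[of i k] Suc.prems True by (simp add: P_linear add.commute)
    next
      case False
      then have "s k (r i) = r i" using s_other[of i k] adj[of i k] Suc.prems by auto
      then show ?thesis using Suc P_Suc[of k "r i"] False by simp
    qed
  qed simp
  have diag: "P j (r j) = (\<Sum>i\<le>j. r i)" if "j < m" for j
    using that
  proof (induction j)
    case (Suc j)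
    have "P (Suc j) (r (Suc j)) = P j (r (Suc j)) + P j (r j)"
      using P_Suc[of j "r (Suc j)"] s_other[of "Suc j" j] adj[of "Suc j" j] Suc.prems by (simp add: P_linear)
    moreover have "P j (r (Suc j)) = r (Suc j)"
    proof (rule P_fixed)
      fix i assume "i < j"
      then show "s i (r (Suc j)) = r (Suc j)" using s_other[of "Suc j" i] adj[of "Suc j" i] Suc.prems by auto
    qed (use Suc.prems in simp)
    ultimately show ?case using Suc by simp
  qed simp
  obtain l where l: "m = Suc l" using m by (cases m) auto
  have Pl: "P (Suc l) = ?c" using l by (metis order_refl take_all)
  define \<sigma> where "\<sigma> = (\<Sum>i\<le>l. r i)"
  have c1: "?c (r i) = r (Suc i)" if "i < l" for i using up[of "Suc l" i] that l unfolding Pl by simp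
  have c2: "?c (r l) = - \<sigma>"
    using P_Suc[of l "r l"] s_self[of l] diag[of l] l unfolding Pl by (simp add: P_linear \<sigma>_def)
  have c3: "?c (- \<sigma>) = r 0"
  proof -
    have "?c \<sigma> = (\<Sum>i\<le>l. ?c (r i))" unfolding \<sigma>_def Pl[symmetric] by (rule P_linear(5))
    also have "\<dots> = (\<Sum>i<l. ?c (r i)) + ?c (r l)" by (metis lessThan_Suc_atMost sum.lessThan_Suc)
    also have "\<dots> = (\<Sum>i<l. r (Suc i)) - \<sigma>" using c1 c2 by simp
    finally have "?c \<sigma> = (\<Sum>i<l. r (Suc i)) - \<sigma>" .
    moreover have "\<sigma> = r 0 + (\<Sum>i<l. r (Suc i))"
      unfolding \<sigma>_def by (metis lessThan_Suc_atMost sum.lessThan_Suc_shift)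
    ultimately have "?c \<sigma> = - r 0" by (simp add: algebra_simps)
    then show ?thesis using P_linear(3)[of "Suc l" \<sigma>] unfolding Pl by simp
  qed
  have pw: "(?c ^^ k) (r 0) = r k" if "k \<le> l" for k
    using that by (induction k) (simp_all add: c1)
  have pm: "(?c ^^ Suc l) (r 0) = - \<sigma>" using pw[of l] c2 by simp
  have pmm: "(?c ^^ Suc m) (r 0) = r 0" using pm c3 l by simp
  show ?thesis
  proof (rule coxeter_number_orbit)
    show "forest_order \<alpha>s" by (rule forest_orderI) (use adj in fastforce)
    fix i assume "i < m"
    then have ri: "r i = (?c ^^ i) (r 0)" using pw[of i] l by simp
    show "(?c ^^ Suc m) (r i) = r i" unfolding ri funpow_commute_apply[of "Suc m"] pmm ..
  next
    fix k assume k: "0 < k" "k < Suc m"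
    show "(?c ^^ k) (r 0) \<noteq> r 0"
    proof (cases "k \<le> l")
      case True
      then show ?thesis using pw[of k] k nth_eq_iff_index_eq[OF dist, of k 0] l by simp
    next
      case False
      then have "k = Suc l" using k l by simp
      moreover have "coord (- \<sigma>) (r 0) = -1"
        using l by (simp add: \<sigma>_def coord_minus coord_sum coord_r)
      moreover have "coord (r 0) (r 0) = 1" using l by (simp add: coord_r)
      ultimately show ?thesis using pm by force
    qed
  qed simp
qed

end

context dynkin
begin

text \<open>In type \<open>D\<close> the simple roots are \<open>e i - e (Suc i)\<close> and \<open>e (m - 2) + e (m - 1)\<close>, and the Coxeter
  element permutes the vectors \<open>e i\<close> up to sign.\<close>

lemma coxeter_number_D:
  assumes m: "m = n + 2" "n \<ge> 2"
    and adj: "\<And>i j. i < m \<Longrightarrow> j < m \<Longrightarrow> adj i j \<longleftrightarrow> (j = Suc i \<and> j \<le> n) \<or> (i = Suc j \<and> i \<le> n)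
      \<or> (i = n - 1 \<and> j = Suc n) \<or> (j = n - 1 \<and> i = Suc n)"
  shows "coxeter_number \<Phi> = 2 * n + 2"
proof -
  let ?c = "coxeter_product \<alpha>s"
  \<comment> \<open>Solved from the simple roots: half the difference of the last two is the last
    vector, and adding \<open>r i\<close> leads from \<open>e (Suc i)\<close> to
    \<open>e i\<close>.\<close>
  define e where "e i = (1/2) *\<^sub>R (r (Suc n) - r n) + (\<Sum>l\<in>{i..<Suc n}. r l)" for i
  have e_last: "e (Suc n) = (1/2) *\<^sub>R (r (Suc n) - r n)" by (simp add: e_def)
  have e_step: "e i = e (Suc i) + r i" if "i \<le> n" for i
    using sum.atLeast_Suc_lessThan[of i "Suc n" "\<lambda>l. r l"] that
    unfolding e_def by (simp del: sum.op_ivl_Suc add: add_ac)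
  have so: "s j (r i) = (if i = j then - r i else if (j = Suc i \<and> j \<le> n) \<or> (i = Suc j \<and> i \<le> n)
      \<or> (i = n - 1 \<and> j = Suc n) \<or> (j = n - 1 \<and> i = Suc n) then r i + r j else r i)"
    if "i < m" "j < m" for i j
    using s_self[of i] s_other[of i j] adj[of i j] that by auto
  have half: "(1/2) *\<^sub>R v + (1/2) *\<^sub>R v = v" for v :: 'a by (simp add: scaleR_left_distrib[symmetric])
  \<comment> \<open>Index inequalities with which the simplifier decides the conditions in
    \<open>so\<close>.\<close>
  have "n \<noteq> n - Suc 0" "n - Suc 0 \<noteq> n" "n - Suc 0 \<noteq> Suc n" "Suc n \<noteq> n - Suc 0" using m(2) by auto
  note m = m this
  have swap: "s j (e i) = (if i = j then e (Suc j) else if i = Suc j then e j else e i)" if "j \<le> n" "i \<le> Suc n" for i j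
    using that
  proof (induction "Suc n - i" arbitrary: i)
    case 0
    then have i: "i = Suc n" by simp
    consider "j = n" | "j = n - 1" | "j < n - 1" using 0 by linarith
    then show ?case
    proof cases
      case 1
      have "s n (e (Suc n)) = (1/2) *\<^sub>R (r (Suc n) + r n)"
        using so[of "Suc n" n] so[of n n] m by (simp add: e_last s_linear)
      also have "\<dots> = e n"
        unfolding e_step[of n, simplified] e_last by (simp add: scaleR_right_distrib scaleR_right_diff_distrib) (simp add: half algebra_simps)
      finally show ?thesis using i 1 by simp
    next
      case 2
      then have "n = Suc j" "j < m" using m by auto
      then have "s j (r (Suc n)) = r (Suc n) + r j" "s j (r n) = r n + r j"
        using so[of "Suc n" j] so[of n j] m by auto
      then have "s j (e (Suc n)) = e (Suc n)" by (simp add: e_last s_linear)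
      then show ?thesis using i \<open>n = Suc j\<close> by simp
    next
      case 3
      then have j: "j \<noteq> n" "j \<noteq> Suc n" "n \<noteq> Suc j" "j \<noteq> n - 1" "j < m" using m by auto
      then have "s j (r (Suc n)) = r (Suc n)" "s j (r n) = r n"
        using so[of "Suc n" j] so[of n j] m by auto
      then have "s j (e (Suc n)) = e (Suc n)" by (simp add: e_last s_linear)
      then show ?thesis using i j by simp
    qed
  next
    case (Suc x)
    then have i: "i \<le> n" "x = Suc n - Suc i" by auto
    have IH: "s j (e (Suc i)) = (if Suc i = j then e (Suc j) else if i = j then e j else e (Suc i))"
      using Suc.hyps(1)[of "Suc i"] i Suc.prems by auto
    have st: "s j (e i) = s j (e (Suc i)) + s j (r i)" using e_step[OF i(1)] by (simp add: s_linear)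
    have im: "i < m" "j < m" using i(1) Suc.prems m(1) by auto
    consider "i = j" | "i = Suc j" | "j = Suc i" | "i \<noteq> j" "i \<noteq> Suc j" "j \<noteq> Suc i" by blast
    then show ?case
    proof cases
      case 1
      have "s j (e (Suc i)) = e i" "s j (r i) = - r i" using IH so[OF im] 1 by simp_all
      then have "s j (e i) = e (Suc i)" unfolding st using e_step[OF i(1)] by simp
      then show ?thesis using 1 by simp
    next
      case 2
      have "s j (e (Suc i)) = e (Suc i)" "s j (r i) = r i + r j" using IH so[OF im] 2 i(1) by simp_all
      then have "s j (e i) = e i + r j" unfolding st using e_step[OF i(1)] by simp
      also have "\<dots> = e j" using e_step[of j] 2 Suc.prems(1) by simp
      finally show ?thesis using 2 by simp
    next
      case 3
      have "s j (e (Suc i)) = e (Suc j)" "s j (r i) = r i + r j" using IH so[OF im] 3 Suc.prems(1) by simp_all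
      then have "s j (e i) = e (Suc j) + r j + r i" unfolding st by simp
      also have "\<dots> = e i" using e_step[of j] e_step[of i] 3 Suc.prems(1) i(1) by simp
      finally show ?thesis using 3 by simp
    next
      case 4
      have "j \<noteq> Suc n" "i \<noteq> Suc n" using Suc.prems(1) i(1) by auto
      then have "s j (e (Suc i)) = e (Suc i)" "s j (r i) = r i" using IH so[OF im] 4 by simp_all
      then have "s j (e i) = e i" unfolding st using e_step[OF i(1)] by simp
      then show ?thesis using 4 by simp
    qed
  qed
  have last_swap: "s (Suc n) (e i) = (if i = n then - e (Suc n) else if i = Suc n then - e n else e i)" if "i \<le> Suc n" for i
    using that
  proof (induction "Suc n - i" arbitrary: i)
    case 0
    then have i: "i = Suc n" by simp
    have "s (Suc n) (e (Suc n)) = - ((1/2) *\<^sub>R (r (Suc n) + r n))"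
      using so[of "Suc n" "Suc n"] so[of n "Suc n"] m by (simp add: e_last s_linear scaleR_right_diff_distrib scaleR_right_distrib)
    also have "(1/2) *\<^sub>R (r (Suc n) + r n) = e n"
      unfolding e_step[of n, simplified] e_last by (simp add: scaleR_right_distrib scaleR_right_diff_distrib) (simp add: half algebra_simps)
    finally show ?case using i by simp
  next
    case (Suc x)
    then have i: "i \<le> n" "x = Suc n - Suc i" by auto
    have IH: "s (Suc n) (e (Suc i)) = (if Suc i = n then - e (Suc n) else if i = n then - e n else e (Suc i))"
      using Suc.hyps(1)[of "Suc i"] i by auto
    have st: "s (Suc n) (e i) = s (Suc n) (e (Suc i)) + s (Suc n) (r i)" using e_step[OF i(1)] by (simp add: s_linear)
    consider "i = n" | "Suc i = n" | "Suc i < n" using i by linarith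
    then show ?case
    proof cases
      case 1
      have "s (Suc n) (r n) = r n" using so[of n "Suc n"] m by simp
      then show ?thesis using st IH 1 e_step[of n] by simp
    next
      case 2
      have "s (Suc n) (r i) = r i + r (Suc n)" using so[of i "Suc n"] m 2 by auto
      moreover have "r (Suc n) = e (Suc n) + e n"
        unfolding e_step[of n, simplified] e_last by (simp add: scaleR_right_diff_distrib) (simp add: half algebra_simps)
      moreover have "e i = e n + r i" using e_step[of i] i 2 by simp
      ultimately show ?thesis using st IH 2 by simp
    next
      case 3
      have "s (Suc n) (r i) = r i" using so[of i "Suc n"] m 3 by auto
      then show ?thesis using st IH 3 i e_step[of i] by simp
    qed
  qed
  have Pe: "P k (e i) = (if i < k then e (Suc i) else if i = k then e 0 else e i)" if "k \<le> Suc n" "i \<le> Suc n" for k i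
    using that
  proof (induction k arbitrary: i)
    case (Suc k)
    have "P (Suc k) (e i) = P k (s k (e i))" using Suc.prems m by (intro P_Suc) simp
    then show ?case using Suc swap[of k i] by auto
  qed simp
  have cP: "?c v = P (Suc n) (s (Suc n) v)" for v
    using P_Suc[of "Suc n" v] m by simp
  \<comment> \<open>The orbit of \<open>e 0\<close> runs through e 0, ..., e n and then through
    their negatives, 2 n + 2 vectors in all, while \<open>e (Suc n)\<close> only changes its
    sign.\<close>
  have c1: "?c (e i) = e (Suc i)" if "i < n" for i using cP Pe[of "Suc n" i] last_swap[of i] that by simp
  have c2: "?c (e n) = - e 0" using cP Pe[of "Suc n" "Suc n"] last_swap[of n] by (simp add: P_linear)
  have c3: "?c (e (Suc n)) = - e (Suc n)" using cP Pe[of "Suc n" n] last_swap[of "Suc n"] by (simp add: P_linear)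
  have clin: "(?c ^^ k) (v + w) = (?c ^^ k) v + (?c ^^ k) w" "(?c ^^ k) (- v) = - (?c ^^ k) v"
    "(?c ^^ k) (v - w) = (?c ^^ k) v - (?c ^^ k) w" for k v w
    using linear_funpow[OF linear_coxeter_product[of \<alpha>s], of k] by (simp_all add: linear_add linear_neg linear_diff)
  have comp: "(?c ^^ (a + b)) v = (?c ^^ a) ((?c ^^ b) v)" for a b v by (simp add: funpow_add)
  have pw: "(?c ^^ k) (e 0) = e k" if "k \<le> n" for k
    using that by (induction k) (simp_all add: c1)
  have neg: "(?c ^^ Suc n) (e 0) = - e 0" using pw[of n] c2 by simp
  have pw2: "(?c ^^ (k + Suc n)) (e 0) = - e k" if "k \<le> n" for k
    using comp[of k "Suc n" "e 0"] neg pw[OF that] clin(2) by simp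
  have full0: "(?c ^^ (2 * n + 2)) (e 0) = e 0"
    using comp[of "Suc n" "Suc n" "e 0"] neg clin(2)[of "Suc n" "e 0"] by (simp add: mult_2)
  have full: "(?c ^^ (2 * n + 2)) (e i) = e i" if "i \<le> Suc n" for i
  proof (cases "i \<le> n")
    case True
    then show ?thesis using comp[of "2 * n + 2" i "e 0"] comp[of i "2 * n + 2" "e 0"] pw[OF True] full0 by (simp add: add.commute)
  next
    case False
    then have i: "i = Suc n" using that by simp
    have ev: "(?c ^^ k) (e (Suc n)) = (if even k then e (Suc n) else - e (Suc n))" for k
      by (induction k) (use c3 clin(2)[of 1] in auto)
    show ?thesis unfolding i ev by simp
  qed
  have coord0: "coord (e i) (r 0) = (if i = 0 then 1 else 0)" if "i \<le> n" for i
  proof -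
    have "coord (e i) (r 0) = (\<Sum>l\<in>{i..<Suc n}. if l = 0 then 1 else 0)"
      using m unfolding e_def by (simp add: coord_add coord_scale coord_diff coord_sum coord_r representation_zero del: sum.op_ivl_Suc)
    then show ?thesis by (simp)
  qed
  have coordn: "coord (e i) (r (Suc n)) = 1/2" if "i \<le> n" for i
    using m unfolding e_def by (simp add: coord_add coord_scale coord_diff coord_sum coord_r representation_zero del: sum.op_ivl_Suc)
  show ?thesis
  proof (rule coxeter_number_orbit)
    show "forest_order \<alpha>s"
    proof (rule forest_orderI)
      fix i i' j assume *: "i < j" "i' < j" "j < m" "adj j i" "adj j i'"
      then have "i < m" "i' < m" by simp_all
      with * adj[of j i] adj[of j i'] m(1) show "i = i'" by linarith
    qed
    fix i assume i: "i < m"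
    show "(?c ^^ (2 * n + 2)) (r i) = r i"
    proof (cases "i = Suc n")
      case True
      then have ri: "r i = e (Suc n) + e n"
        unfolding e_step[of n, simplified] e_last by (simp add: scaleR_right_diff_distrib) (simp add: half algebra_simps)
      have "(?c ^^ (2 * n + 2)) (e n) = e n" "(?c ^^ (2 * n + 2)) (e (Suc n)) = e (Suc n)"
        by (rule full, simp)+
      then show ?thesis unfolding ri clin by (simp only:)
    next
      case False
      then have ri: "r i = e i - e (Suc i)" using e_step[of i] i m by simp
      have "i \<le> Suc n" "Suc i \<le> Suc n" using False i m by auto
      then show ?thesis unfolding ri clin by (simp only: full)
    qed
  next
    fix k assume k: "0 < k" "k < 2 * n + 2"
    show "(?c ^^ k) (e 0) \<noteq> e 0"
    proof (cases "k \<le> n")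
      case True
      then show ?thesis using pw[OF True] coord0[of k] coord0[of 0] k by (metis less_irrefl zero_neq_one le0)
    next
      case False
      define j where "j = k - Suc n"
      have j: "j \<le> n" "k = j + Suc n" using False k by (auto simp: j_def)
      \<comment> \<open>In the second half of the period the sign is visible at the last simple
        root, where all of e 0, ..., e n have the coordinate 1/2.\<close>
      have "coord (- e j) (r (Suc n)) \<noteq> coord (e 0) (r (Suc n))" using coordn[of j] coordn[of 0] j by (simp add: coord_minus)
      then show ?thesis using pw2[OF j(1)] j(2) by metis
    qed
  qed simp
qed

end

section \<open>Type E by computation with integer coordinates\<close>

context dynkin
begin

definition combination :: "int list \<Rightarrow> 'a"
  where "combination c = (\<Sum>i<m. of_int (c ! i) *\<^sub>R r i)"

end

text \<open>The simple reflections and the Coxeter element on integer coordinates with respect to the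
  simple roots.\<close>

definition zrefl :: "(nat \<Rightarrow> nat \<Rightarrow> bool) \<Rightarrow> nat \<Rightarrow> nat \<Rightarrow> int list \<Rightarrow> int list"
  where "zrefl adj m j c = c[j := sum_list (map (\<lambda>i. c ! i) (filter (\<lambda>i. adj i j) [0..<m])) - c ! j]"

definition zcox :: "(nat \<Rightarrow> nat \<Rightarrow> bool) \<Rightarrow> nat \<Rightarrow> int list \<Rightarrow> int list"
  where "zcox adj m c = foldr (zrefl adj m) [0..<m] c"

definition unit_list :: "nat \<Rightarrow> nat \<Rightarrow> int list"
  where "unit_list m i = map (\<lambda>j. if j = i then 1 else 0) [0..<m]"

fun avoids :: "('b \<Rightarrow> 'b) \<Rightarrow> 'b \<Rightarrow> nat \<Rightarrow> 'b \<Rightarrow> bool"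
  where
    "avoids f v 0 u = True"
  | "avoids f v (Suc n) u = (u \<noteq> v \<and> avoids f v n (f u))"

lemma avoids_funpow: "avoids f v n u \<Longrightarrow> k < n \<Longrightarrow> (f ^^ k) u \<noteq> v"
proof (induction n arbitrary: u k)
  case (Suc n)
  show ?case
  proof (cases k)
    case 0
    then show ?thesis using Suc.prems by simp
  next
    case (Suc l)
    then show ?thesis using Suc.IH[of "f u" l] Suc.prems by (simp add: funpow_swap1)
  qed
qed simp

text \<open>The search for a return of the first simple root starts at its image and runs over h - 1
  vectors, that is over the powers 1, ..., h - 1. The last clause yields a forest order.\<close>

definition order_check :: "(nat \<Rightarrow> nat \<Rightarrow> bool) \<Rightarrow> nat \<Rightarrow> nat \<Rightarrow> bool"
  where "order_check adj m h \<longleftrightarrow>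
    list_all (\<lambda>u. (zcox adj m ^^ h) u = u) (map (unit_list m) [0..<m]) \<and>
    avoids (zcox adj m) (unit_list m 0) (h - 1) (zcox adj m (unit_list m 0)) \<and>
    list_all (\<lambda>j. length (filter (adj j) [0..<j]) \<le> 1 \<and> \<not> adj j j) [0..<m]"

context dynkin
begin

text \<open>In a simply-laced diagram a simple reflection replaces the j-th coordinate by the sum of
  the adjacent coordinates minus itself.\<close>

lemma combination_zrefl:
  assumes j: "j < m" and c: "length c = m" and irr: "\<not> adj j j"
  shows "combination (zrefl adj m j c) = s j (combination c)"
proof -
  define t where "t = sum_list (map (\<lambda>i. c ! i) (filter (\<lambda>i. adj i j) [0..<m]))"
  have t: "t = (\<Sum>i<m. if adj i j then c ! i else 0)"
  proof -
    have "t = (\<Sum>i\<leftarrow>[0..<m]. if adj i j then c ! i else 0)"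
      unfolding t_def by (rule sum_list_map_filter')
    then show ?thesis by (simp add: sum_list_distinct_conv_sum_set lessThan_atLeast0)
  qed
  have two: "(2 * x) *\<^sub>R v = x *\<^sub>R v + x *\<^sub>R v" for x and v :: 'a
    by (simp add: scaleR_left_distrib[symmetric])
  have "s j (combination c) = (\<Sum>i<m. of_int (c ! i) *\<^sub>R s j (r i))"
    by (simp add: combination_def s_linear)
  also have "\<dots> = (\<Sum>i<m. of_int (c ! i) *\<^sub>R r i + (if adj i j then of_int (c ! i) *\<^sub>R r j else 0)
      - (if i = j then (2 * of_int (c ! j)) *\<^sub>R r j else 0))"
  proof (intro sum.cong refl)
    fix i assume i: "i \<in> {..<m}"
    show "of_int (c ! i) *\<^sub>R s j (r i) = of_int (c ! i) *\<^sub>R r i + (if adj i j then of_int (c ! i) *\<^sub>R r j else 0)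
      - (if i = j then (2 * of_int (c ! j)) *\<^sub>R r j else 0)"
    proof (cases "i = j")
      case True
      then show ?thesis using j irr by (simp add: s_self two)
    next
      case False
      then show ?thesis using i j by (simp add: s_other scaleR_right_distrib)
    qed
  qed
  also have "\<dots> = combination c + (\<Sum>i<m. if adj i j then of_int (c ! i) *\<^sub>R r j else 0) - (2 * of_int (c ! j)) *\<^sub>R r j"
    using j by (simp add: sum.distrib sum_subtractf combination_def)
  also have "(\<Sum>i<m. if adj i j then of_int (c ! i) *\<^sub>R r j else 0) = of_int t *\<^sub>R r j"
    unfolding t by (simp add: scaleR_sum_left of_int_sum if_distrib[of of_int] if_distribR cong: if_cong) (rule sum.cong, auto)
  finally have 1: "s j (combination c) = combination c + of_int t *\<^sub>R r j - (2 * of_int (c ! j)) *\<^sub>R r j" .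
  have "combination (zrefl adj m j c) = (\<Sum>i<m. of_int (c ! i) *\<^sub>R r i + (if i = j then (of_int t - 2 * of_int (c ! j)) *\<^sub>R r j else 0))"
    unfolding combination_def zrefl_def t_def[symmetric] using c j
    by (intro sum.cong refl) (auto simp: nth_list_update scaleR_left_distrib scaleR_left_diff_distrib two)
  also have "\<dots> = combination c + (of_int t - 2 * of_int (c ! j)) *\<^sub>R r j"
    using j by (simp add: sum.distrib combination_def)
  finally show ?thesis using 1 by (simp add: scaleR_left_diff_distrib)
qed

lemma length_zrefl [simp]: "length (zrefl a k j c) = length c"
  by (simp add: zrefl_def)

lemma combination_zcox:
  assumes c: "length c = m" and irr: "\<And>j. j < m \<Longrightarrow> \<not> adj j j"
  shows "combination (zcox adj m c) = coxeter_product \<alpha>s (combination c)" "length (zcox adj m c) = m"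
proof -
  have "combination (foldr (zrefl adj m) js c) = coxeter_product (map (\<lambda>j. r j) js) (combination c) \<and>
      length (foldr (zrefl adj m) js c) = m" if "set js \<subseteq> {..<m}" for js
    using that
  proof (induction js)
    case (Cons j js)
    then show ?case using combination_zrefl[of j "foldr (zrefl adj m) js c"] irr[of j] by auto
  qed (simp add: c)
  from this[of "[0..<m]"]
  show "combination (zcox adj m c) = coxeter_product \<alpha>s (combination c)" "length (zcox adj m c) = m"
    by (auto simp: zcox_def map_nth lessThan_atLeast0)
qed

lemma combination_unit:
  assumes "i < m"
  shows "combination (unit_list m i) = r i"
proof -
  have "combination (unit_list m i) = (\<Sum>j<m. if j = i then r j else 0)"
    unfolding combination_def unit_list_def by (intro sum.cong refl) simp
  then show ?thesis using assms by simp
qed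

lemma coord_combination: "j < m \<Longrightarrow> coord (combination c) (r j) = of_int (c ! j)"
  by (simp add: combination_def coord_sum coord_scale coord_r if_distrib cong: if_cong)

lemma coxeter_number_check:
  assumes "order_check adj m h" "h > 0" "m > 0" and sym: "\<And>i j. adj i j \<Longrightarrow> adj j i"
  shows "coxeter_number \<Phi> = h"
proof -
  let ?c = "coxeter_product \<alpha>s"
  have irr: "\<not> adj j j" if "j < m" for j using assms(1) that by (auto simp: order_check_def list_all_iff)
  have pw: "(?c ^^ k) (combination u) = combination ((zcox adj m ^^ k) u) \<and> length ((zcox adj m ^^ k) u) = m" if "length u = m" for k u
    by (induction k) (use combination_zcox irr that in auto)
  show ?thesis
  proof (rule coxeter_number_orbit[OF _ assms(2)])
    show "forest_order \<alpha>s"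
    proof (rule forest_orderI)
      fix i i' j assume j: "i < j" "i' < j" "j < m" "adj j i" "adj j i'"
      have "length (filter (adj j) [0..<j]) \<le> 1" using assms(1) j by (auto simp: order_check_def list_all_iff)
      moreover have "card {i, i'} \<le> card (set (filter (adj j) [0..<j]))" using j by (intro card_mono) auto
      moreover have "card (set (filter (adj j) [0..<j])) = length (filter (adj j) [0..<j])" by (intro distinct_card) simp
      ultimately show "i = i'" by (cases "i = i'") auto
    qed
  next
    fix i assume i: "i < m"
    then have "(zcox adj m ^^ h) (unit_list m i) = unit_list m i" using assms(1) by (auto simp: order_check_def list_all_iff)
    then show "(?c ^^ h) (r i) = r i" using pw[of "unit_list m i" h] combination_unit[OF i] by (simp add: unit_list_def)
  next
    fix k assume k: "0 < k" "k < h"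
    let ?v = "(zcox adj m ^^ k) (unit_list m 0)"
    have len: "length ?v = m" "(?c ^^ k) (r 0) = combination ?v"
      using pw[of "unit_list m 0" k] combination_unit[of 0] assms(3) by (auto simp: unit_list_def)
    have "avoids (zcox adj m) (unit_list m 0) (h - 1) (zcox adj m (unit_list m 0))" using assms(1) by (simp add: order_check_def)
    from avoids_funpow[OF this, of "k - 1"] k have "?v \<noteq> unit_list m 0"
      by (cases k) (simp_all add: funpow_swap1)
    then obtain j where j: "j < m" "?v ! j \<noteq> unit_list m 0 ! j"
      using len(1) by (metis (no_types, lifting) length_map length_upt minus_nat.diff_0 nth_equalityI unit_list_def)
    then have "coord (combination ?v) (r j) \<noteq> coord (combination (unit_list m 0)) (r j)" by (simp add: coord_combination)
    then show "(?c ^^ k) (r 0) \<noteq> r 0" using len(2) combination_unit[of 0] assms(3) by auto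
  qed
qed

end

section \<open>The Coxeter numbers of the simply-laced types\<close>

lemma root_system_of_typeE:
  assumes "root_system_of_type X \<Psi>"
  obtains \<alpha>s where "length \<alpha>s = rank X"
    "dynkin \<Psi> \<alpha>s (\<lambda>i j. (i, j) \<in> dynkin_edges X \<or> (j, i) \<in> dynkin_edges X)"
proof -
  obtain \<alpha>s where a: "root_system \<Psi>" "length \<alpha>s = rank X" "distinct \<alpha>s" "simple_system \<Psi> (set \<alpha>s)"
    "\<forall>i<rank X. \<forall>j<rank X. i \<noteq> j \<longrightarrow>
        2 * inner (\<alpha>s ! i) (\<alpha>s ! j) / inner (\<alpha>s ! j) (\<alpha>s ! j) =
          (if (i, j) \<in> dynkin_edges X \<or> (j, i) \<in> dynkin_edges X then -1 else 0)"
    using assms unfolding root_system_of_type_def by (elim conjE exE)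
  show thesis
  proof (rule that[OF a(2)])
    show "dynkin \<Psi> \<alpha>s (\<lambda>i j. (i, j) \<in> dynkin_edges X \<or> (j, i) \<in> dynkin_edges X)"
      by unfold_locales (use a in auto)
  qed
qed

lemma coxeter_number_type_A:
  assumes "root_system_of_type (Type_A m) \<Psi>" "m \<ge> 1"
  shows "coxeter_number \<Psi> = m + 1"
proof -
  obtain \<alpha>s where a: "length \<alpha>s = rank (Type_A m)"
    "dynkin \<Psi> \<alpha>s (\<lambda>i j. (i, j) \<in> dynkin_edges (Type_A m) \<or> (j, i) \<in> dynkin_edges (Type_A m))"
    by (rule root_system_of_typeE[OF assms(1)])
  interpret dynkin \<Psi> \<alpha>s "\<lambda>i j. (i, j) \<in> dynkin_edges (Type_A m) \<or> (j, i) \<in> dynkin_edges (Type_A m)" by (rule a(2))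
  show ?thesis using coxeter_number_A a(1) assms(2) by auto
qed

lemma coxeter_number_type_D:
  assumes "root_system_of_type (Type_D (n + 2)) \<Psi>" "n \<ge> 2"
  shows "coxeter_number \<Psi> = 2 * n + 2"
proof -
  let ?E = "dynkin_edges (Type_D (n + 2))"
  obtain \<alpha>s where a: "length \<alpha>s = rank (Type_D (n + 2))" "dynkin \<Psi> \<alpha>s (\<lambda>i j. (i, j) \<in> ?E \<or> (j, i) \<in> ?E)"
    by (rule root_system_of_typeE[OF assms(1)])
  interpret dynkin \<Psi> \<alpha>s "\<lambda>i j. (i, j) \<in> ?E \<or> (j, i) \<in> ?E" by (rule a(2))
  show ?thesis by (rule coxeter_number_D[OF a(1)[unfolded rank.simps] assms(2)]) (use assms(2) in auto)
qed

definition e_adj :: "nat \<Rightarrow> nat \<Rightarrow> nat \<Rightarrow> bool"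
  where "e_adj m i j \<longleftrightarrow> (j = Suc i \<and> j < m - 1) \<or> (i = Suc j \<and> i < m - 1) \<or> (i = 2 \<and> j = m - 1) \<or> (j = 2 \<and> i = m - 1)"

lemma coxeter_number_type_E:
  assumes "length \<alpha>s = m" "dynkin \<Psi> \<alpha>s (\<lambda>i j. (i, j) \<in> E \<or> (j, i) \<in> E)"
    "E = {(i, i + 1) | i. i + 1 < m - 1} \<union> {(2, m - 1)}" "order_check (e_adj m) m h" "h > 0" "m > 0"
  shows "coxeter_number \<Psi> = h"
proof -
  have adj: "(\<lambda>i j. (i, j) \<in> E \<or> (j, i) \<in> E) = e_adj m"
    unfolding assms(3) by (auto simp: fun_eq_iff e_adj_def)
  interpret dynkin \<Psi> \<alpha>s "e_adj m" using assms(2) unfolding adj .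
  show ?thesis by (rule coxeter_number_check) (use assms(1,4-6) in \<open>auto simp: e_adj_def\<close>)
qed

lemma order_check_E6: "order_check (e_adj 6) 6 12"
proof -
  define w where "w = zcox (e_adj 6) 6"
  \<comment> \<open>Multiplying out the six reflections once gives an explicit linear map, so that
    each further power is a single rewriting.\<close>
  have w: "w [a, b, c, d, e, p] =
    [c - e - p, a + c - e - p, b + c - e - p, c - e, d - e, c - p]" for a b c d e p
    by (simp add: w_def zcox_def zrefl_def e_adj_def upt_rec)
  have units: "map (unit_list 6) [0..<6] =
    [[1, 0, 0, 0, 0, 0], [0, 1, 0, 0, 0, 0], [0, 0, 1, 0, 0, 0], [0, 0, 0, 1, 0, 0], [0, 0, 0, 0, 1, 0], [0, 0, 0, 0, 0, 1]]"
    by (simp add: unit_list_def upt_rec)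
  have unit_0: "unit_list 6 0 = [1, 0, 0, 0, 0, 0]"
    by (simp add: unit_list_def upt_rec)
  have "list_all (\<lambda>u. (w ^^ 12) u = u) (map (unit_list 6) [0..<6])"
    unfolding units by (simp add: w numeral_eq_Suc)
  moreover have "avoids w (unit_list 6 0) (12 - 1) (w (unit_list 6 0))"
    unfolding unit_0 by (simp add: w numeral_eq_Suc)
  moreover have "list_all (\<lambda>j. length (filter (e_adj 6 j) [0..<j]) \<le> 1 \<and> \<not> e_adj 6 j j) [0..<6]"
    by code_simp
  ultimately show ?thesis
    unfolding order_check_def w_def by blast
qed

lemma order_check_E7: "order_check (e_adj 7) 7 18"
proof -
  define w where "w = zcox (e_adj 7) 7"
  have w: "w [a, b, c, d, e, p, q] =
    [c - p - q, a + c - p - q, b + c - p - q, c - p, d - p, e - p, c - q]" for a b c d e p q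
    by (simp add: w_def zcox_def zrefl_def e_adj_def upt_rec)
  have units: "map (unit_list 7) [0..<7] =
    [[1, 0, 0, 0, 0, 0, 0], [0, 1, 0, 0, 0, 0, 0], [0, 0, 1, 0, 0, 0, 0], [0, 0, 0, 1, 0, 0, 0], [0, 0, 0, 0, 1, 0, 0], [0, 0, 0, 0, 0, 1, 0], [0, 0, 0, 0, 0, 0, 1]]"
    by (simp add: unit_list_def upt_rec)
  have unit_0: "unit_list 7 0 = [1, 0, 0, 0, 0, 0, 0]"
    by (simp add: unit_list_def upt_rec)
  have "list_all (\<lambda>u. (w ^^ 18) u = u) (map (unit_list 7) [0..<7])"
    unfolding units by (simp add: w numeral_eq_Suc)
  moreover have "avoids w (unit_list 7 0) (18 - 1) (w (unit_list 7 0))"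
    unfolding unit_0 by (simp add: w numeral_eq_Suc)
  moreover have "list_all (\<lambda>j. length (filter (e_adj 7 j) [0..<j]) \<le> 1 \<and> \<not> e_adj 7 j j) [0..<7]"
    by code_simp
  ultimately show ?thesis
    unfolding order_check_def w_def by blast
qed

lemma order_check_E8: "order_check (e_adj 8) 8 30"
proof -
  define w where "w = zcox (e_adj 8) 8"
  have w: "w [a, b, c, d, e, p, q, t] =
    [c - q - t, a + c - q - t, b + c - q - t, c - q, d - q, e - q, p - q, c - t]" for a b c d e p q t
    by (simp add: w_def zcox_def zrefl_def e_adj_def upt_rec)
  have units: "map (unit_list 8) [0..<8] =
    [[1, 0, 0, 0, 0, 0, 0, 0], [0, 1, 0, 0, 0, 0, 0, 0], [0, 0, 1, 0, 0, 0, 0, 0], [0, 0, 0, 1, 0, 0, 0, 0], [0, 0, 0, 0, 1, 0, 0, 0], [0, 0, 0, 0, 0, 1, 0, 0], [0, 0, 0, 0, 0, 0, 1, 0], [0, 0, 0, 0, 0, 0, 0, 1]]"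
    by (simp add: unit_list_def upt_rec)
  have unit_0: "unit_list 8 0 = [1, 0, 0, 0, 0, 0, 0, 0]"
    by (simp add: unit_list_def upt_rec)
  have "list_all (\<lambda>u. (w ^^ 30) u = u) (map (unit_list 8) [0..<8])"
    unfolding units by (simp add: w numeral_eq_Suc)
  moreover have "avoids w (unit_list 8 0) (30 - 1) (w (unit_list 8 0))"
    unfolding unit_0 by (simp add: w numeral_eq_Suc)
  moreover have "list_all (\<lambda>j. length (filter (e_adj 8 j) [0..<j]) \<le> 1 \<and> \<not> e_adj 8 j j) [0..<8]"
    by code_simp
  ultimately show ?thesis
    unfolding order_check_def w_def by blast
qed

lemma coxeter_number_type_E6:
  assumes "root_system_of_type Type_E6 \<Psi>"
  shows "coxeter_number \<Psi> = 12"
proof -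
  obtain \<alpha>s where a: "length \<alpha>s = rank Type_E6"
    "dynkin \<Psi> \<alpha>s (\<lambda>i j. (i, j) \<in> dynkin_edges Type_E6 \<or> (j, i) \<in> dynkin_edges Type_E6)"
    by (rule root_system_of_typeE[OF assms])
  show ?thesis
    by (rule coxeter_number_type_E[OF a(1)[unfolded rank.simps] a(2) _ order_check_E6]) simp_all
qed

lemma coxeter_number_type_E7:
  assumes "root_system_of_type Type_E7 \<Psi>"
  shows "coxeter_number \<Psi> = 18"
proof -
  obtain \<alpha>s where a: "length \<alpha>s = rank Type_E7"
    "dynkin \<Psi> \<alpha>s (\<lambda>i j. (i, j) \<in> dynkin_edges Type_E7 \<or> (j, i) \<in> dynkin_edges Type_E7)"
    by (rule root_system_of_typeE[OF assms])
  show ?thesis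
    by (rule coxeter_number_type_E[OF a(1)[unfolded rank.simps] a(2) _ order_check_E7]) simp_all
qed

lemma coxeter_number_type_E8:
  assumes "root_system_of_type Type_E8 \<Psi>"
  shows "coxeter_number \<Psi> = 30"
proof -
  obtain \<alpha>s where a: "length \<alpha>s = rank Type_E8"
    "dynkin \<Psi> \<alpha>s (\<lambda>i j. (i, j) \<in> dynkin_edges Type_E8 \<or> (j, i) \<in> dynkin_edges Type_E8)"
    by (rule root_system_of_typeE[OF assms])
  show ?thesis
    by (rule coxeter_number_type_E[OF a(1)[unfolded rank.simps] a(2) _ order_check_E8]) simp_all
qed

section \<open>Counting roots\<close>

text \<open>Roots are only determined up to length; the root system is counted through the unit vectors
  in the directions of its roots.\<close>

lemma card_root_directions:
  assumes "root_system \<Phi>"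
  shows "card (sgn ` \<Phi>) = card \<Phi>"
proof (rule card_image, rule inj_onI)
  fix x y assume xy: "x \<in> \<Phi>" "y \<in> \<Phi>" and eq: "sgn x = sgn y"
  have nz: "x \<noteq> 0" "y \<noteq> 0" using assms xy by (auto simp: root_system_def)
  have "x = norm x *\<^sub>R sgn x" using nz by (simp add: sgn_div_norm)
  also have "\<dots> = (norm x / norm y) *\<^sub>R y" unfolding eq by (simp add: sgn_div_norm divide_inverse)
  finally have x: "x = (norm x / norm y) *\<^sub>R y" .
  then have "x \<in> \<Phi> \<inter> range (\<lambda>c. c *\<^sub>R y)" using xy by blast
  then have "x = y \<or> x = - y" using assms xy by (auto simp: root_system_def)
  moreover have "x \<noteq> - y"
  proof
    assume "x = - y"
    then have "sgn x = - sgn x" using eq by (simp add: sgn_minus)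
    then have "2 *\<^sub>R sgn x = 0" by (metis add.right_inverse scaleR_2)
    then show False using nz by (simp add: sgn_zero_iff)
  qed
  ultimately show "x = y" by simp
qed

lemma reflection_scaleR: "c \<noteq> 0 \<Longrightarrow> reflection (c *\<^sub>R \<alpha>) x = reflection \<alpha> x"
  by (simp add: reflection_def)

lemma reflection_sgn: "reflection (sgn \<alpha>) x = reflection \<alpha> x"
  by (cases "\<alpha> = 0") (simp_all add: sgn_div_norm reflection_scaleR)

lemma norm_reflection: "norm (reflection \<alpha> x) = norm x"
  using orthogonal_reflection[of \<alpha>] orthogonal_transformation_norm by blast

lemma sgn_reflection: "sgn (reflection \<alpha> x) = reflection (sgn \<alpha>) (sgn x)"
proof -
  have "reflection \<alpha> (inverse (norm x) *\<^sub>R x) = inverse (norm x) *\<^sub>R reflection \<alpha> x"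
    using linear_reflection[of \<alpha>] by (simp add: linear_scale)
  then show ?thesis by (simp add: sgn_div_norm norm_reflection reflection_sgn[unfolded sgn_div_norm])
qed

lemma sgn_scaleR_pos: "c > 0 \<Longrightarrow> sgn (c *\<^sub>R x) = sgn (x :: 'a::real_normed_vector)"
  by (simp add: sgn_scaleR)

lemma minus_direction:
  assumes "root_system \<Phi>" "v \<in> sgn ` \<Phi>"
  shows "- v \<in> sgn ` \<Phi>"
proof -
  obtain \<alpha> where a: "\<alpha> \<in> \<Phi>" "v = sgn \<alpha>" using assms(2) by blast
  have "\<Phi> \<inter> range (\<lambda>c. c *\<^sub>R \<alpha>) = {\<alpha>, - \<alpha>}" using assms(1) a(1) unfolding root_system_def by blast
  then have "- \<alpha> \<in> \<Phi>" by blast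
  then have "sgn (- \<alpha>) \<in> sgn ` \<Phi>" by (rule imageI)
  then show ?thesis using a(2) by (simp add: sgn_minus)
qed

lemma reflection_direction:
  assumes "root_system \<Phi>" "v \<in> sgn ` \<Phi>" "w \<in> sgn ` \<Phi>"
  shows "reflection v w \<in> sgn ` \<Phi>"
proof -
  obtain \<alpha> \<beta> where a: "\<alpha> \<in> \<Phi>" "v = sgn \<alpha>" "\<beta> \<in> \<Phi>" "w = sgn \<beta>" using assms(2,3) by blast
  have "reflection \<alpha> ` \<Phi> = \<Phi>" using assms(1) a(1) unfolding root_system_def by blast
  then have "reflection \<alpha> \<beta> \<in> \<Phi>" using a(3) by blast
  then have "sgn (reflection \<alpha> \<beta>) \<in> sgn ` \<Phi>" by (rule imageI)
  then show ?thesis using a by (simp add: sgn_reflection)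
qed

lemma reflection_in_group: "\<alpha> \<in> \<Phi> \<Longrightarrow> reflection \<alpha> \<in> reflection_group \<Phi>"
  unfolding reflection_group_def by (intro generate.incl imageI)

text \<open>Applied with T = \<Phi>, and in the octahedral case with sets whose invariance shows
  that a class of mirrors alone generates too little.\<close>

lemma reflection_group_preserves:
  assumes "f \<in> reflection_group \<Phi>" "\<And>\<alpha>. \<alpha> \<in> \<Phi> \<Longrightarrow> reflection \<alpha> ` T = T"
  shows "bij f \<and> f ` T = T"
  using assms(1) unfolding reflection_group_def
proof (induction rule: generate.induct)
  case one
  have "\<one>\<^bsub>BijGroup (UNIV :: 'a set)\<^esub> = id" by (simp add: BijGroup_def fun_eq_iff)
  then show ?case by (elim ssubst) (intro conjI bij_id, simp)
next
  case (incl h)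
  then show ?case using assms(2) bij_reflection by blast
next
  case (inv h)
  then obtain \<alpha> where a: "\<alpha> \<in> \<Phi>" "h = reflection \<alpha>" by blast
  interpret B: group "BijGroup (UNIV :: 'a set)" by (rule group_BijGroup)
  have c: "h \<in> carrier (BijGroup UNIV)" using bij_reflection[of \<alpha>] a by (simp add: BijGroup_def Bij_def)
  have "h \<otimes>\<^bsub>BijGroup UNIV\<^esub> h = \<one>\<^bsub>BijGroup UNIV\<^esub>"
    using c unfolding a(2) by (simp add: BijGroup_def compose_def fun_eq_iff reflection_involution)
  then have "inv\<^bsub>BijGroup UNIV\<^esub> h = h" using B.inv_equality c by blast
  then show ?case using a assms(2)[OF a(1)] bij_reflection by simp
next
  case (eng h1 h2)
  then have "h1 \<otimes>\<^bsub>BijGroup UNIV\<^esub> h2 = h1 \<circ> h2" by (simp add: BijGroup_def Bij_def compose_def fun_eq_iff)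
  then show ?case using eng bij_comp[of h2 h1] by (metis image_comp)
qed

subsection \<open>The planar root systems\<close>

definition direction :: "real \<Rightarrow> real^2"
  where "direction t = vector [cos t, sin t]"

lemma vec2_eq_iff: "(u :: real^2) = v \<longleftrightarrow> u $ 1 = v $ 1 \<and> u $ 2 = v $ 2"
  by (simp add: Finite_Cartesian_Product.vec_eq_iff forall_2)

lemma inner_vec2: "inner (u :: real^2) v = u $ 1 * v $ 1 + u $ 2 * v $ 2"
  by (simp add: inner_vec_def sum_2)

lemma norm_direction: "norm (direction t) = 1"
proof -
  have "inner (direction t) (direction t) = 1"
    using sin_cos_squared_add3[of t] by (simp add: direction_def inner_vec2 algebra_simps)
  then show ?thesis by (simp add: norm_eq_sqrt_inner)
qed

lemma direction_add_pi: "direction (t + pi) = - direction t"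
  by (simp add: direction_def vec2_eq_iff)

text \<open>The mirror lies at the angle a + pi/2, so the angle b goes to 2 a - b + pi, and the
  summand pi is the sign.\<close>

lemma reflection_direction_angle: "reflection (direction a) (direction b) = - direction (2 * a - b)"
proof -
  have u: "inner (direction a) (direction a) = 1" using norm_direction[of a] by (simp add: norm_eq_sqrt_inner)
  have i: "inner (direction b) (direction a) = cos b * cos a + sin b * sin a" by (simp add: direction_def inner_vec2)
  have "sin a * sin a = 1 - cos a * cos a" using sin_cos_squared_add3[of a] by linarith
  then have s: "sin a * (sin a * x) = x - cos a * (cos a * x)" for x by (simp add: mult.assoc[symmetric] left_diff_distrib)
  then have s': "x * (sin a * sin a) = x - cos a * (cos a * x)" for x by (simp add: mult_ac)
  have "2 * a - b = a + (a - b)" by simp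
  then have d: "direction (2 * a - b) = direction (a + (a - b))" by (rule arg_cong)
  show ?thesis
    unfolding reflection_def u i d unfolding direction_def cos_add sin_add cos_diff sin_diff
    by (simp add: vec2_eq_iff algebra_simps s s')
qed

lemma direction_inj:
  assumes "n > 0" "k < 2 * n" "l < 2 * n" "direction (- (pi * real k / real n)) = direction (- (pi * real l / real n))"
  shows "k = l"
proof -
  have "sin (- (pi * real k / real n)) = sin (- (pi * real l / real n)) \<and>
      cos (- (pi * real k / real n)) = cos (- (pi * real l / real n))"
    using assms(4) by (simp add: direction_def vec2_eq_iff)
  then obtain z :: int where "- (pi * real k / real n) = - (pi * real l / real n) + 2 * pi * of_int z"
    unfolding sin_cos_eq_iff by blast
  then have "pi * real k = pi * (real l - 2 * of_int z * real n)" using assms(1) by (simp add: field_simps)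
  then have "real k = real l - 2 * of_int z * real n" by simp
  then have "of_int (int k) = (of_int (int l - 2 * z * int n) :: real)" by simp
  then have "int k = int l - 2 * z * int n" by (simp only: of_int_eq_iff)
  then have e: "int k = int l - z * (2 * int n)" by (simp add: mult_ac)
  have "z = 0"
  proof (rule ccontr)
    assume "z \<noteq> 0"
    then consider "z \<ge> 1" | "z \<le> -1" by linarith
    then show False
    proof cases
      case 1
      then have "1 * (2 * int n) \<le> z * (2 * int n)" by (intro mult_right_mono) auto
      then show False using e assms by linarith
    next
      case 2
      then have "z * (2 * int n) \<le> (-1) * (2 * int n)" by (intro mult_right_mono) auto
      then show False using e assms by linarith
    qed
  qed
  then show ?thesis using e by simp
qed

lemma I2_directions:
  assumes "is_I2 n \<Phi>" "n \<ge> 2"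
  shows "sgn ` \<Phi> = (\<lambda>k. direction (- (pi * real k / real n))) ` {..<2 * n}"
proof (intro equalityI subsetI)
  have root: "root_system \<Phi>" and grp: "reflection_group \<Phi> = symmetry_group (regular_polygon n)"
    and simple: "simple_system \<Phi> {vector [1, 0], vector [- cos (pi / real n), sin (pi / real n)]}"
    using assms by (auto simp: is_I2_def)
  fix v assume "v \<in> sgn ` \<Phi>"
  then obtain \<alpha> where a: "\<alpha> \<in> \<Phi>" "v = sgn \<alpha>" by blast
  have "\<alpha> \<noteq> 0" using a root by (auto simp: root_system_def)
  then have "norm v = 1" using a(2) by (simp add: norm_sgn)
  then have v1: "v $ 1 * v $ 1 + v $ 2 * v $ 2 = 1" by (simp add: norm_eq_sqrt_inner inner_vec2)
  have "reflection \<alpha> ` regular_polygon n = regular_polygon n"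
    using reflection_in_group[OF a(1)] unfolding grp symmetry_group_def by blast
  moreover have "vector [0, 1] \<in> regular_polygon n"
    unfolding regular_polygon_def using assms(2) by (auto intro!: exI[of _ 0])
  ultimately have "reflection \<alpha> (vector [0, 1]) \<in> regular_polygon n" by blast
  then obtain k where k: "k < n" "reflection \<alpha> (vector [0, 1]) = vector [sin (2 * pi * real k / real n), cos (2 * pi * real k / real n)]"
    unfolding regular_polygon_def by blast
  define t where "t = pi * real k / real n"
  have t2: "2 * pi * real k / real n = 2 * t" by (simp add: t_def)
  have "reflection v (vector [0, 1]) = vector [sin (2 * t), cos (2 * t)]"
    using k(2) unfolding a(2) reflection_sgn t2 .
  moreover have "inner v v = 1" using v1 by (simp add: inner_vec2)
  ultimately have 1: "- (2 * (v $ 2 * v $ 1)) = sin (2 * t)" "1 - 2 * (v $ 2 * v $ 2) = cos (2 * t)"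
    by (simp_all add: reflection_def vec2_eq_iff inner_vec2)
  have "v $ 1 * v $ 1 - v $ 2 * v $ 2 = cos t * cos t - sin t * sin t" "v $ 2 * v $ 1 = - (sin t * cos t)"
    using 1 v1 sin_cos_squared_add3[of t] unfolding sin_double cos_double power2_eq_square mult.assoc by linarith+
  \<comment> \<open>As complex numbers, v and exp (- i t) have the same square, so they agree up to
    sign.\<close>
  then have "(Complex (v $ 1) (v $ 2))\<^sup>2 = (Complex (cos t) (- sin t))\<^sup>2"
    by (simp add: complex_eq_iff power2_eq_square mult.commute)
  then have "Complex (v $ 1) (v $ 2) = Complex (cos t) (- sin t) \<or> Complex (v $ 1) (v $ 2) = - Complex (cos t) (- sin t)"
    by (simp only: power2_eq_iff)
  then have "v = direction (- t) \<or> v = - direction (- t)" by (auto simp: direction_def vec2_eq_iff complex_eq_iff)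
  then show "v \<in> (\<lambda>k. direction (- (pi * real k / real n))) ` {..<2 * n}"
  proof
    assume "v = direction (- t)"
    then show ?thesis using k(1) by (intro image_eqI[of _ _ k]) (auto simp: t_def)
  next
    assume v: "v = - direction (- t)"
    \<comment> \<open>The opposite direction is a further half turn away and has the index k +
      n.\<close>
    have "- (pi * real (k + n) / real n) + pi = - t" using assms(2) by (simp add: t_def field_simps)
    then have "v = direction (- (pi * real (k + n) / real n))"
      using direction_add_pi[of "- (pi * real (k + n) / real n)"] v by simp
    then show ?thesis using k(1) by (intro image_eqI[of _ _ "k + n"]) auto
  qed
next
  have root: "root_system \<Phi>"
    and simple: "simple_system \<Phi> {vector [1, 0], vector [- cos (pi / real n), sin (pi / real n)]}"
    using assms by (auto simp: is_I2_def)
  fix v assume "v \<in> (\<lambda>k. direction (- (pi * real k / real n))) ` {..<2 * n}"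
  then obtain k where v: "v = direction (- (pi * real k / real n))" by blast
  have unit: "u \<in> sgn ` \<Phi>" if "u \<in> \<Phi>" "norm u = 1" for u
    using imageI[OF that(1), of sgn] that(2) by (simp add: sgn_div_norm)
  have d0: "direction 0 = vector [1, 0]" by (simp add: direction_def)
  have "direction 0 \<in> \<Phi>" unfolding d0 using simple by (simp add: simple_system_def)
  then have 0: "direction 0 \<in> sgn ` \<Phi>" using unit norm_direction by blast
  have d1: "- direction (- (pi / real n)) = vector [- cos (pi / real n), sin (pi / real n)]"
    by (simp add: direction_def vec2_eq_iff)
  have "- direction (- (pi / real n)) \<in> \<Phi>" unfolding d1 using simple by (simp add: simple_system_def)
  then have "- direction (- (pi / real n)) \<in> sgn ` \<Phi>" using unit norm_direction by simp
  from minus_direction[OF root this] have 1: "direction (- (pi / real n)) \<in> sgn ` \<Phi>" by simp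
  \<comment> \<open>Reflecting one direction in the next and negating continues an arithmetic
    progression of angles. Its first two terms come from the simple roots.\<close>
  have "direction (- (pi * real k / real n)) \<in> sgn ` \<Phi> \<and> direction (- (pi * real (Suc k) / real n)) \<in> sgn ` \<Phi>"
  proof (induction k)
    case 0
    then show ?case using \<open>direction 0 \<in> sgn ` \<Phi>\<close> 1 by simp
  next
    case (Suc k)
    let ?a = "- (pi * real (Suc k) / real n)" and ?b = "- (pi * real k / real n)"
    have "- reflection (direction ?a) (direction ?b) \<in> sgn ` \<Phi>"
      using Suc by (intro minus_direction[OF root] reflection_direction[OF root]) auto
    moreover have "2 * ?a - ?b = - (pi * real (Suc (Suc k)) / real n)" using assms(2) by (simp add: field_simps)
    ultimately show ?case using Suc by (simp only: reflection_direction_angle) simp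
  qed
  then show "v \<in> sgn ` \<Phi>" using v by simp
qed

lemma card_I2:
  assumes "is_I2 n \<Phi>" "n \<ge> 2"
  shows "card \<Phi> = 2 * n"
proof -
  have root: "root_system \<Phi>" using assms by (simp add: is_I2_def)
  have "inj_on (\<lambda>k. direction (- (pi * real k / real n))) {..<2 * n}"
    using direction_inj assms(2) by (intro inj_onI) auto
  then show ?thesis
    using card_root_directions[OF root] unfolding I2_directions[OF assms] by (simp add: card_image)
qed

lemma card_A1_I2:
  assumes "is_A1_I2 n \<Phi>" "n \<ge> 2"
  shows "card \<Phi> = 2 * n + 2"
proof -
  obtain \<Phi>' where i: "is_I2 n \<Phi>'" and \<Phi>: "\<Phi> = {vector [0, 0, 1], vector [0, 0, -1]} \<union> (\<lambda>v. vector [v $ 1, v $ 2, 0]) ` \<Phi>'"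
    using assms(1) by (auto simp: is_A1_I2_def)
  have fin: "finite \<Phi>'" using i by (simp add: is_I2_def root_system_def)
  have inj: "inj_on (\<lambda>v :: real^2. vector [v $ 1, v $ 2, 0] :: real^3) \<Phi>'"
    by (rule inj_onI) (simp add: vec2_eq_iff vec3_eq_iff)
  have "vector [0, 0, 1] \<noteq> (vector [0, 0, -1] :: real^3)" by (simp add: vec3_eq_iff)
  then have c2: "card {vector [0, 0, 1], vector [0, 0, -1] :: real^3} = 2" by simp
  have "{vector [0, 0, 1], vector [0, 0, -1]} \<inter> (\<lambda>v :: real^2. vector [v $ 1, v $ 2, 0] :: real^3) ` \<Phi>' = {}"
    by (auto simp: vec3_eq_iff)
  then have "card \<Phi> = 2 + card \<Phi>'"
    unfolding \<Phi> using fin c2 by (subst card_Un_disjoint) (simp_all add: card_image[OF inj])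
  then show ?thesis using card_I2[OF i assms(2)] by simp
qed

subsection \<open>The polyhedral root systems\<close>

definition zdiff :: "zvec \<Rightarrow> zvec \<Rightarrow> zvec"
  where "zdiff u v = zvadd u (zscale (-1, 0) v)"

text \<open>The reflection multiplied by the squared norm of w, which avoids division.\<close>

definition zreflect :: "zvec \<Rightarrow> zvec \<Rightarrow> zvec"
  where "zreflect w v = zdiff (zscale (zdot w w) v) (zscale (zmul (2, 0) (zdot v w)) w)"

text \<open>A root is proportional to the difference of two vertices; either this difference is up to
  the scale \<open>1\<close> or the golden ratio in the list of mirrors, or its reflection is not a symmetry.\<close>

definition mirror_check :: "zvec list \<Rightarrow> zvec list \<Rightarrow> bool"
  where "mirror_check Vs Ms \<longleftrightarrow>
    (\<forall>p\<in>set Vs. \<forall>q\<in>set Vs. if p = q then True else if zdiff p q \<in> set Ms then True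
      else if zdiff p q \<in> set (map (zscale (0, 1)) Ms) then True
      else zapart (zdot (zdiff p q) (zdiff p q)) (0, 0) \<and>
        (\<exists>v\<in>set Vs. \<forall>u\<in>set Vs. zvapart (zreflect (zdiff p q) v) (zscale (zdot (zdiff p q) (zdiff p q)) u))) \<and>
    (\<forall>w\<in>set Ms. zapart (zdot w w) (0, 0) \<and> (\<forall>v\<in>set Vs. zreflect w v \<in> set (map (zscale (zdot w w)) Vs))) \<and>
    sorted_wrt (\<lambda>v w. w = zscale (-1, 0) v \<or> zapart (zmul (zdot v w) (zdot v w)) (zmul (zdot v v) (zdot w w))) Ms"

text \<open>A spanning tree of a class of mirror vectors, rooted at the first one: for each later
  vector i a step (j, k) names an earlier vector j and a mirror k whose reflection takes j to
  i.\<close>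

definition connected_check :: "zvec list \<Rightarrow> zvec list \<Rightarrow> (nat \<times> nat) list \<Rightarrow> bool"
  where "connected_check Ms Cs steps \<longleftrightarrow> length Cs = Suc (length steps) \<and>
    list_all (\<lambda>(i, j, k). j < i \<and> k < length Ms \<and> zreflect (Ms ! k) (Cs ! j) = zscale (zdot (Ms ! k) (Ms ! k)) (Cs ! i))
      (zip [1..<length Cs] steps)"

lemma vev_diff: "vev (zdiff u v) = vev u - vev v"
  by (simp add: zdiff_def vev_add vev_scale zev_def)

lemma vev_reflect:
  assumes "zapart (zdot w w) (0, 0)"
  shows "vev (zreflect w v) = zev (zdot w w) *\<^sub>R reflection (vev w) (vev v)" "vev w \<noteq> 0" "zev (zdot w w) > 0"
proof -
  have "zev (zdot w w) \<noteq> 0" using zev_apart[OF assms] by (simp add: zev_def[of "(0, 0)"])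
  then have nz: "inner (vev w) (vev w) \<noteq> 0" by (simp add: zev_dot)
  then show "vev w \<noteq> 0" "zev (zdot w w) > 0" by (auto simp: zev_dot)
  have "zev (2, 0) = 2" by (simp add: zev_def)
  then show "vev (zreflect w v) = zev (zdot w w) *\<^sub>R reflection (vev w) (vev v)"
    using nz by (simp add: zreflect_def vev_diff vev_scale zev_dot reflection_def scaleR_right_diff_distrib)
qed

lemma reflection_preserves_vertices:
  assumes "zapart (zdot w w) (0, 0)" "\<forall>v\<in>set Vs. zreflect w v \<in> set (map (zscale (zdot w w)) Vs)"
  shows "reflection (vev w) ` vev ` set Vs = vev ` set Vs"
proof (rule card_subset_eq)
  show "reflection (vev w) ` vev ` set Vs \<subseteq> vev ` set Vs"
  proof clarify
    fix v assume "v \<in> set Vs"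
    then obtain u where u: "u \<in> set Vs" "zreflect w v = zscale (zdot w w) u"
      using assms(2) unfolding set_map by blast
    have "zev (zdot w w) *\<^sub>R reflection (vev w) (vev v) = zev (zdot w w) *\<^sub>R vev u"
      using vev_reflect(1)[OF assms(1), of v] unfolding u(2) by (simp only: vev_scale)
    then have "reflection (vev w) (vev v) = vev u"
      by (rule scaleR_left_imp_eq[rotated]) (use vev_reflect(3)[OF assms(1)] in simp)
    then show "reflection (vev w) (vev v) \<in> vev ` set Vs" using u(1) by simp
  qed
  show "card (reflection (vev w) ` vev ` set Vs) = card (vev ` set Vs)"
    by (rule card_image) (use bij_reflection in \<open>metis bij_is_inj inj_on_subset subset_UNIV\<close>)
qed simp

locale polyhedral_mirrors =
  fixes Vs Ms :: "zvec list" and \<Phi> :: "(real^3) set"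
  assumes check: "mirror_check Vs Ms"
    and spanning: "\<And>\<alpha>. (\<And>p. p \<in> set Vs \<Longrightarrow> inner (vev p) \<alpha> = 0) \<Longrightarrow> \<alpha> = 0"
    and root: "root_system \<Phi>" and grp: "reflection_group \<Phi> = symmetry_group (vev ` set Vs)"
begin

lemma mirror_pos: "w \<in> set Ms \<Longrightarrow> zapart (zdot w w) (0, 0)"
  using check by (simp add: mirror_check_def)

lemma mirror_symmetry:
  assumes "w \<in> set Ms"
  shows "reflection (vev w) \<in> symmetry_group (vev ` set Vs)"
proof -
  have "\<forall>v\<in>set Vs. zreflect w v \<in> set (map (zscale (zdot w w)) Vs)"
    using check assms unfolding mirror_check_def by blast
  from reflection_preserves_vertices[OF mirror_pos[OF assms] this] show ?thesis
    by (simp add: symmetry_group_def orthogonal_reflection)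
qed

text \<open>The vertices span the space, so the reflection in a root moves some vertex. The
  difference of this vertex and its image is a multiple of the root, and the check covers all
  differences.\<close>

lemma direction_is_mirror:
  assumes "\<alpha> \<in> \<Phi>"
  shows "\<exists>w\<in>set Ms. sgn \<alpha> = sgn (vev w)"
proof -
  have a0: "\<alpha> \<noteq> 0" using assms root by (auto simp: root_system_def)
  have sym: "reflection \<alpha> ` vev ` set Vs = vev ` set Vs"
    using reflection_in_group[OF assms] unfolding grp symmetry_group_def by blast
  obtain p0 where p0: "p0 \<in> set Vs" "inner (vev p0) \<alpha> \<noteq> 0" using spanning a0 by blast
  obtain q0 where q0: "q0 \<in> set Vs" "reflection \<alpha> (vev p0) = vev q0" using sym p0(1) by blast
  define c0 where "c0 = 2 * (inner (vev p0) \<alpha> / inner \<alpha> \<alpha>)"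
  have c0: "c0 \<noteq> 0" "vev p0 - vev q0 = c0 *\<^sub>R \<alpha>"
    using p0(2) a0 unfolding c0_def q0(2)[symmetric] by (simp_all add: reflection_def)
  \<comment> \<open>Exchanging the two vertices if necessary makes the factor positive, so that
    directions agree and not merely lines.\<close>
  obtain p q c where p: "p \<in> set Vs" "q \<in> set Vs" and c: "c > 0" "vev (zdiff p q) = c *\<^sub>R \<alpha>"
  proof (cases "c0 > 0")
    case True
    then show ?thesis using that[of p0 q0 c0] p0 q0 c0 by (simp add: vev_diff)
  next
    case False
    then have "- c0 > 0" using c0 by simp
    moreover have "vev q0 - vev p0 = (- c0) *\<^sub>R \<alpha>" using c0(2) by (simp add: algebra_simps)
    ultimately show ?thesis using that[of q0 p0 "- c0"] p0 q0 by (simp add: vev_diff)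
  qed
  have "vev (zdiff p q) \<noteq> 0" using c a0 by simp
  then have pq: "p \<noteq> q" by (auto simp: vev_diff)
  have refl: "reflection (vev (zdiff p q)) v = reflection \<alpha> v" for v
    unfolding c(2) using c(1) by (intro reflection_scaleR) simp
  have "zdiff p q \<in> set Ms \<or> zdiff p q \<in> zscale (0, 1) ` set Ms"
  proof (rule ccontr)
    assume n: "\<not> ?thesis"
    let ?d = "zdiff p q"
    have "(if p = q then True else if ?d \<in> set Ms then True else if ?d \<in> set (map (zscale (0, 1)) Ms) then True
      else zapart (zdot ?d ?d) (0, 0) \<and> (\<exists>v\<in>set Vs. \<forall>u\<in>set Vs. zvapart (zreflect ?d v) (zscale (zdot ?d ?d) u)))"
      using check p unfolding mirror_check_def by blast
    then have z: "zapart (zdot ?d ?d) (0, 0)" and ex: "\<exists>v\<in>set Vs. \<forall>u\<in>set Vs. zvapart (zreflect ?d v) (zscale (zdot ?d ?d) u)"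
      using pq n by (auto split: if_splits)
    from ex obtain v where v: "v \<in> set Vs" "\<forall>u\<in>set Vs. zvapart (zreflect ?d v) (zscale (zdot ?d ?d) u)" by blast
    obtain u where u: "u \<in> set Vs" "reflection \<alpha> (vev v) = vev u" using sym v(1) by blast
    have "vev (zreflect ?d v) = vev (zscale (zdot ?d ?d) u)"
      unfolding vev_reflect(1)[OF z] refl u(2) by (simp add: vev_scale)
    then show False using v(2) u(1) vev_apart by blast
  qed
  then show ?thesis
  proof
    assume "zdiff p q \<in> set Ms"
    then show ?thesis using c by (intro bexI[of _ "zdiff p q"]) (simp_all add: sgn_scaleR_pos)
  next
    assume "zdiff p q \<in> zscale (0, 1) ` set Ms"
    then obtain w where w: "w \<in> set Ms" "zdiff p q = zscale (0, 1) w" by blast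
    then have "golden_ratio *\<^sub>R vev w = c *\<^sub>R \<alpha>" using c(2) by (simp add: vev_scale zev_def)
    moreover have "golden_ratio > 0" using golden_ratio_bounds by simp
    ultimately have "sgn (vev w) = sgn \<alpha>" using sgn_scaleR_pos c(1) by metis
    then show ?thesis using w(1) by metis
  qed
qed

text \<open>Equal directions would give equality in the Cauchy-Schwarz inequality with a nonnegative
  inner product. The check excludes equality unless the vectors are opposite.\<close>

lemma sgn_mirror_distinct: "distinct (map (\<lambda>w. sgn (vev w)) Ms)"
proof (rule distinct_map_if_sorted_wrt)
  have "sorted_wrt (\<lambda>v w. w = zscale (-1, 0) v \<or> zapart (zmul (zdot v w) (zdot v w)) (zmul (zdot v v) (zdot w w))) Ms"
    using check by (simp add: mirror_check_def)
  then show "sorted_wrt (\<lambda>v w. sgn (vev v) \<noteq> sgn (vev w)) Ms"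
  proof (rule sorted_wrt_mono_rel[rotated])
    fix v w assume vw: "v \<in> set Ms" "w \<in> set Ms"
      and *: "w = zscale (-1, 0) v \<or> zapart (zmul (zdot v w) (zdot v w)) (zmul (zdot v v) (zdot w w))"
    have nz: "vev v \<noteq> 0" "vev w \<noteq> 0" using vev_reflect(2)[OF mirror_pos] vw by auto
    show "sgn (vev v) \<noteq> sgn (vev w)"
    proof
      assume eq: "sgn (vev v) = sgn (vev w)"
      have v: "vev v = norm (vev v) *\<^sub>R sgn (vev v)" and w: "vev w = norm (vev w) *\<^sub>R sgn (vev v)"
        using nz unfolding eq by (simp_all add: sgn_div_norm) (metis eq sgn_div_norm scaleR_scaleR right_inverse norm_eq_zero scaleR_one)
      have s1: "inner (sgn (vev v)) (sgn (vev v)) = 1" using nz(1) by (simp add: norm_sgn power2_norm_eq_inner[symmetric])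
      have i: "inner (vev v) (vev w) = norm (vev v) * norm (vev w)"
        by (subst v, subst w) (simp add: s1)
      from * show False
      proof
        assume "w = zscale (-1, 0) v"
        then have "vev w = - vev v" by (simp add: vev_scale zev_def)
        then have "inner (vev v) (vev w) = - inner (vev v) (vev v)" by simp
        then have "inner (vev v) (vev w) < 0" using nz(1) by simp
        moreover have "norm (vev v) * norm (vev w) \<ge> 0" by simp
        ultimately show False using i by simp
      next
        assume "zapart (zmul (zdot v w) (zdot v w)) (zmul (zdot v v) (zdot w w))"
        then have "inner (vev v) (vev w) * inner (vev v) (vev w) \<noteq> inner (vev v) (vev v) * inner (vev w) (vev w)"
          using zev_apart by (fastforce simp: zev_dot)
        then show False unfolding i by (simp add: power2_norm_eq_inner[symmetric] power2_eq_square)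
      qed
    qed
  qed
qed

text \<open>The reflection in a mirror vector belongs to the reflection group, which permutes the
  roots, even while it is still open whether that vector is itself a root direction.\<close>

lemma direction_closed:
  assumes "w \<in> set Ms" "v \<in> sgn ` \<Phi>"
  shows "reflection (vev w) v \<in> sgn ` \<Phi>"
proof -
  obtain \<alpha> where a: "\<alpha> \<in> \<Phi>" "v = sgn \<alpha>" using assms(2) by blast
  have "reflection (vev w) \<in> reflection_group \<Phi>" unfolding grp by (rule mirror_symmetry[OF assms(1)])
  then have "reflection (vev w) ` \<Phi> = \<Phi>"
    using reflection_group_preserves[of "reflection (vev w)" \<Phi> \<Phi>] root unfolding root_system_def by blast
  then have "reflection (vev w) \<alpha> \<in> \<Phi>" using a(1) by blast
  then have "sgn (reflection (vev w) \<alpha>) \<in> sgn ` \<Phi>" by (rule imageI)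
  then show ?thesis using a(2) by (simp add: sgn_reflection reflection_sgn)
qed

lemma step_direction:
  assumes "w \<in> set Ms" "zreflect w u = zscale (zdot w w) v"
  shows "sgn (vev v) = reflection (vev w) (sgn (vev u))" "sgn (vev u) = reflection (vev w) (sgn (vev v))"
proof -
  note z = vev_reflect[OF mirror_pos[OF assms(1)]]
  have "zev (zdot w w) *\<^sub>R reflection (vev w) (vev u) = zev (zdot w w) *\<^sub>R vev v"
    using z(1)[of u] unfolding assms(2) by (simp only: vev_scale)
  then have "reflection (vev w) (vev u) = vev v" by (rule scaleR_left_imp_eq[rotated]) (use z(3) in simp)
  then show 1: "sgn (vev v) = reflection (vev w) (sgn (vev u))" using sgn_reflection[of "vev w" "vev u"] by (simp add: reflection_sgn)
  show "sgn (vev u) = reflection (vev w) (sgn (vev v))" unfolding 1 by (simp add: reflection_involution)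
qed

text \<open>Along the tree each vector arises from an earlier one by an involution that preserves
  the root directions, so either all are root directions or none.\<close>

lemma class_directions:
  assumes con: "connected_check Ms Cs steps" and w: "w \<in> set Cs" "sgn (vev w) \<in> sgn ` \<Phi>"
  shows "\<forall>v\<in>set Cs. sgn (vev v) \<in> sgn ` \<Phi>"
proof -
  have len: "length Cs = Suc (length steps)" using con by (simp add: connected_check_def)
  have step: "\<exists>j k. j < i \<and> k < length Ms \<and> zreflect (Ms ! k) (Cs ! j) = zscale (zdot (Ms ! k) (Ms ! k)) (Cs ! i)"
    if "0 < i" "i < length Cs" for i
  proof -
    have n: "i - 1 < length (zip [1..<length Cs] steps)" using that len by simp
    obtain j k where jk: "steps ! (i - 1) = (j, k)" by fastforce
    have e: "zip [1..<length Cs] steps ! (i - 1) = (i, j, k)" using that len n jk by (simp del: upt_Suc)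
    have "(i, j, k) \<in> set (zip [1..<length Cs] steps)" using nth_mem[OF n] unfolding e .
    moreover have "\<forall>(i, j, k)\<in>set (zip [1..<length Cs] steps). j < i \<and> k < length Ms \<and>
        zreflect (Ms ! k) (Cs ! j) = zscale (zdot (Ms ! k) (Ms ! k)) (Cs ! i)"
      using con unfolding connected_check_def list_all_iff by (rule conjunct2)
    ultimately show ?thesis by blast
  qed
  have iff: "sgn (vev (Cs ! i)) \<in> sgn ` \<Phi> \<longleftrightarrow> sgn (vev (Cs ! 0)) \<in> sgn ` \<Phi>" if "i < length Cs" for i
    using that
  proof (induction i rule: less_induct)
    case (less i)
    show ?case
    proof (cases "i = 0")
      case False
      then obtain j k where jk: "j < i" "k < length Ms" "zreflect (Ms ! k) (Cs ! j) = zscale (zdot (Ms ! k) (Ms ! k)) (Cs ! i)"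
        using step less.prems by blast
      have m: "Ms ! k \<in> set Ms" using jk(2) by simp
      have "sgn (vev (Cs ! i)) \<in> sgn ` \<Phi> \<longleftrightarrow> sgn (vev (Cs ! j)) \<in> sgn ` \<Phi>"
        using direction_closed[OF m] step_direction[OF m jk(3)] by metis
      also have "\<dots> \<longleftrightarrow> sgn (vev (Cs ! 0)) \<in> sgn ` \<Phi>"
        using jk(1) less.prems by (intro less.IH) linarith+
      finally show ?thesis .
    qed simp
  qed
  obtain l where l: "l < length Cs" "w = Cs ! l" using w(1) unfolding in_set_conv_nth by blast
  show ?thesis
  proof
    fix v assume "v \<in> set Cs"
    then obtain i where i: "i < length Cs" "v = Cs ! i" unfolding in_set_conv_nth by blast
    show "sgn (vev v) \<in> sgn ` \<Phi>" using w(2) unfolding i(2) l(2) iff[OF i(1)] iff[OF l(1)] .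
  qed
qed

lemma card_if_all_directions:
  assumes "\<forall>w\<in>set Ms. sgn (vev w) \<in> sgn ` \<Phi>"
  shows "card \<Phi> = length Ms"
proof -
  have "sgn ` \<Phi> = (\<lambda>w. sgn (vev w)) ` set Ms"
  proof (intro equalityI subsetI)
    fix v assume "v \<in> sgn ` \<Phi>"
    then obtain \<alpha> where a: "\<alpha> \<in> \<Phi>" "v = sgn \<alpha>" by blast
    obtain w where "w \<in> set Ms" "sgn \<alpha> = sgn (vev w)" using direction_is_mirror[OF a(1)] by blast
    then show "v \<in> (\<lambda>w. sgn (vev w)) ` set Ms" using a(2) by (metis imageI)
  qed (use assms in blast)
  then show ?thesis using card_root_directions[OF root] distinct_card[OF sgn_mirror_distinct] by simp
qed

lemma nonempty: "\<exists>\<alpha>. \<alpha> \<in> \<Phi>"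
proof (rule ccontr)
  assume "\<nexists>\<alpha>. \<alpha> \<in> \<Phi>"
  then have "\<Phi> = {}" by blast
  then have "(UNIV :: (real^3) set) = {0}" using root by (simp add: root_system_def)
  moreover have "(axis 1 1 :: real^3) \<noteq> 0" by (simp add: axis_eq_0_iff)
  ultimately show False by blast
qed

end

section \<open>Mirror vectors of the polyhedra and the three counts\<close>

definition tet_mirrors :: "zvec list"
  where "tet_mirrors = [((0, 0), (2, 0), (2, 0)), ((0, 0), (-2, 0), (-2, 0)),
    ((-2, 0), (2, 0), (0, 0)), ((-2, 0), (0, 0), (2, 0)),
    ((2, 0), (0, 0), (2, 0)), ((2, 0), (2, 0), (0, 0)),
    ((2, 0), (-2, 0), (0, 0)), ((2, 0), (0, 0), (-2, 0)),
    ((-2, 0), (0, 0), (-2, 0)), ((-2, 0), (-2, 0), (0, 0)),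
    ((0, 0), (2, 0), (-2, 0)), ((0, 0), (-2, 0), (2, 0))]"


text \<open>Differences of opposite vertices; \<open>oct_mirrors2\<close> consists of differences of
  adjacent ones. The two classes are not conjugate and need separate trees.\<close>

definition oct_mirrors1 :: "zvec list"
  where "oct_mirrors1 = [((2, 0), (0, 0), (0, 0)), ((-2, 0), (0, 0), (0, 0)),
    ((0, 0), (2, 0), (0, 0)), ((0, 0), (-2, 0), (0, 0)),
    ((0, 0), (0, 0), (2, 0)), ((0, 0), (0, 0), (-2, 0))]"


definition oct_mirrors2 :: "zvec list"
  where "oct_mirrors2 = [((1, 0), (-1, 0), (0, 0)), ((-1, 0), (-1, 0), (0, 0)),
    ((1, 0), (1, 0), (0, 0)), ((-1, 0), (1, 0), (0, 0)),
    ((0, 0), (-1, 0), (1, 0)), ((0, 0), (-1, 0), (-1, 0)),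
    ((1, 0), (0, 0), (-1, 0)), ((1, 0), (0, 0), (1, 0)),
    ((-1, 0), (0, 0), (-1, 0)), ((-1, 0), (0, 0), (1, 0)),
    ((0, 0), (1, 0), (1, 0)), ((0, 0), (1, 0), (-1, 0))]"


text \<open>Differences of adjacent vertices. Vertices two edges apart give these times the golden
  ratio, and the difference of opposite vertices is normal to no mirror.\<close>

definition ico_mirrors :: "zvec list"
  where "ico_mirrors = [((-1, 0), (1, -1), (0, 1)), ((1, 0), (-1, 1), (0, -1)),
    ((-1, 1), (0, -1), (1, 0)), ((0, 0), (0, 0), (2, 0)),
    ((-1, 0), (-1, 1), (0, 1)), ((-2, 0), (0, 0), (0, 0)),
    ((0, -1), (1, 0), (-1, 1)), ((0, -1), (-1, 0), (-1, 1)),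
    ((1, 0), (1, -1), (0, 1)), ((1, -1), (0, -1), (1, 0)),
    ((0, 1), (1, 0), (-1, 1)), ((-1, 0), (1, -1), (0, -1)),
    ((-1, 1), (0, -1), (-1, 0)), ((0, 0), (2, 0), (0, 0)),
    ((1, -1), (0, 1), (-1, 0)), ((0, 0), (0, 0), (-2, 0)),
    ((1, 0), (1, -1), (0, -1)), ((2, 0), (0, 0), (0, 0)),
    ((0, 1), (-1, 0), (1, -1)), ((0, 1), (1, 0), (1, -1)),
    ((-1, 0), (-1, 1), (0, -1)), ((-1, 1), (0, 1), (-1, 0)),
    ((0, -1), (-1, 0), (1, -1)), ((1, 0), (-1, 1), (0, 1)),
    ((1, -1), (0, 1), (1, 0)), ((0, 0), (-2, 0), (0, 0)),
    ((-1, 1), (0, 1), (1, 0)), ((0, 1), (-1, 0), (-1, 1)),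
    ((0, -1), (1, 0), (1, -1)), ((1, -1), (0, -1), (-1, 0))]"

lemma mirror_check_tet: "mirror_check tet_vertices tet_mirrors" by code_simp
lemma connected_check_tet: "connected_check tet_mirrors tet_mirrors [(0, 0), (0, 4), (0, 5), (0, 2), (0, 3), (1, 4), (1, 5), (1, 2), (1, 3), (2, 3), (3, 2)]" by code_simp
lemma mirror_check_oct: "mirror_check oct_vertices (oct_mirrors1 @ oct_mirrors2)" by code_simp
lemma connected_check_oct1: "connected_check (oct_mirrors1 @ oct_mirrors2) oct_mirrors1 [(0, 0), (0, 6), (0, 7), (0, 12), (0, 13)]" by code_simp
lemma connected_check_oct2: "connected_check (oct_mirrors1 @ oct_mirrors2) oct_mirrors2 [(0, 0), (0, 2), (0, 6), (0, 12), (0, 13), (0, 10), (0, 11), (1, 10), (1, 11), (2, 12), (2, 13)]" by code_simp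
lemma mirror_check_ico: "mirror_check ico_vertices ico_mirrors" by code_simp
lemma connected_check_ico: "connected_check ico_mirrors ico_mirrors [(0, 0), (0, 6), (0, 10), (0, 13), (0, 8),
    (0, 2), (0, 11), (0, 5), (0, 12), (0, 7), (0, 3), (0, 4), (0, 9), (1, 6), (1, 10), (1, 13), (1, 8), (1,
    2), (1, 11), (1, 5), (1, 12), (1, 7), (1, 3), (1, 4), (1, 9), (2, 13), (2, 7), (3, 8), (6, 12)]" by
    code_simp

definition axis_vertices :: "zvec list"
  where "axis_vertices = [((1, 0), (0, 0), (0, 0)), ((-1, 0), (0, 0), (0, 0))]"

lemma oct_mirrors1_preserve:
  "list_all (\<lambda>w. zapart (zdot w w) (0, 0) \<and>
    (\<forall>v\<in>set axis_vertices. zreflect w v \<in> set (map (zscale (zdot w w)) axis_vertices))) oct_mirrors1"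
  by code_simp

lemma oct_mirrors2_preserve:
  "list_all (\<lambda>w. zapart (zdot w w) (0, 0) \<and>
    (\<forall>v\<in>set tet_vertices. zreflect w v \<in> set (map (zscale (zdot w w)) tet_vertices))) oct_mirrors2"
  by code_simp

lemma card_A3:
  assumes "is_A3 \<Phi>"
  shows "card \<Phi> = 12"
proof -
  interpret polyhedral_mirrors tet_vertices tet_mirrors \<Phi>
  proof
    fix \<alpha> :: "real^3" assume *: "\<And>p. p \<in> set tet_vertices \<Longrightarrow> inner (vev p) \<alpha> = 0"
    have "\<alpha> $ 1 = 0 \<and> \<alpha> $ 2 = 0 \<and> \<alpha> $ 3 = 0"
      using *[of "((1, 0), (1, 0), (1, 0))"] *[of "((1, 0), (-1, 0), (-1, 0))"] *[of "((-1, 0), (1, 0), (-1, 0))"]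
      by (simp add: tet_vertices_def inner_vec3 zev_def)
    then show "\<alpha> = 0" by (simp add: vec3_eq_iff)
  qed (use assms mirror_check_tet vev_tet in \<open>auto simp: is_A3_def\<close>)
  obtain \<alpha> where "\<alpha> \<in> \<Phi>" using nonempty by blast
  then obtain w where "w \<in> set tet_mirrors" "sgn \<alpha> = sgn (vev w)" "\<alpha> \<in> \<Phi>" using direction_is_mirror by blast
  then have "w \<in> set tet_mirrors" "sgn (vev w) \<in> sgn ` \<Phi>" by (metis imageI)+
  then have "\<forall>v\<in>set tet_mirrors. sgn (vev v) \<in> sgn ` \<Phi>"
    by (rule class_directions[OF connected_check_tet])
  from card_if_all_directions[OF this] show ?thesis by (simp add: tet_mirrors_def)
qed

lemma card_H3:
  assumes "is_H3 \<Phi>"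
  shows "card \<Phi> = 30"
proof -
  interpret polyhedral_mirrors ico_vertices ico_mirrors \<Phi>
  proof
    fix \<alpha> :: "real^3" assume *: "\<And>p. p \<in> set ico_vertices \<Longrightarrow> inner (vev p) \<alpha> = 0"
    have "\<alpha> $ 2 + golden_ratio * \<alpha> $ 3 = 0" "golden_ratio * \<alpha> $ 3 - \<alpha> $ 2 = 0"
      "\<alpha> $ 1 + golden_ratio * \<alpha> $ 2 = 0"
      using *[of "((0, 0), (1, 0), (0, 1))"] *[of "((0, 0), (-1, 0), (0, 1))"] *[of "((1, 0), (0, 1), (0, 0))"]
      by (simp_all add: ico_vertices_def inner_vec3 zev_def)
    moreover from this have "\<alpha> $ 2 = 0" by simp
    moreover have "golden_ratio \<noteq> 0" using golden_ratio_bounds by simp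
    ultimately show "\<alpha> = 0" by (simp add: vec3_eq_iff)
  qed (use assms mirror_check_ico vev_ico in \<open>auto simp: is_H3_def\<close>)
  obtain \<alpha> where "\<alpha> \<in> \<Phi>" using nonempty by blast
  then obtain w where "w \<in> set ico_mirrors" "sgn \<alpha> = sgn (vev w)" "\<alpha> \<in> \<Phi>" using direction_is_mirror by blast
  then have "w \<in> set ico_mirrors" "sgn (vev w) \<in> sgn ` \<Phi>" by (metis imageI)+
  then have "\<forall>v\<in>set ico_mirrors. sgn (vev v) \<in> sgn ` \<Phi>"
    by (rule class_directions[OF connected_check_ico])
  from card_if_all_directions[OF this] show ?thesis by (simp add: ico_mirrors_def)
qed

text \<open>The octahedron has two classes of mirrors. The reflections in only one of them do not generate
  the whole group: they preserve the first axis or a tetrahedron, respectively.\<close>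

lemma card_B3:
  assumes "is_B3 \<Phi>"
  shows "card \<Phi> = 18"
proof -
  interpret polyhedral_mirrors oct_vertices "oct_mirrors1 @ oct_mirrors2" \<Phi>
  proof
    fix \<alpha> :: "real^3" assume *: "\<And>p. p \<in> set oct_vertices \<Longrightarrow> inner (vev p) \<alpha> = 0"
    have "\<alpha> $ 1 = 0 \<and> \<alpha> $ 2 = 0 \<and> \<alpha> $ 3 = 0"
      using *[of "((1, 0), (0, 0), (0, 0))"] *[of "((0, 0), (1, 0), (0, 0))"] *[of "((0, 0), (0, 0), (1, 0))"]
      by (simp add: oct_vertices_def inner_vec3 zev_def)
    then show "\<alpha> = 0" by (simp add: vec3_eq_iff)
  qed (use assms mirror_check_oct vev_oct in \<open>auto simp: is_B3_def\<close>)
  \<comment> \<open>If no root had its direction in \<open>Cs\<close>, all reflections in roots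
    would preserve T, and so would the whole group, which contains the reflection in w.\<close>
  have no_class: "\<exists>w\<in>set Cs. sgn (vev w) \<in> sgn ` \<Phi>"
    if other: "set (oct_mirrors1 @ oct_mirrors2) = set Cs \<union> set Ds"
      and pres: "\<And>w. w \<in> set Ds \<Longrightarrow> reflection (vev w) ` T = T"
      and w: "w \<in> set Cs" "reflection (vev w) ` T \<noteq> T" for Cs Ds w and T :: "(real^3) set"
  proof (rule ccontr)
    assume n: "\<not> ?thesis"
    have "reflection \<alpha> ` T = T" if a: "\<alpha> \<in> \<Phi>" for \<alpha>
    proof -
      obtain d where d: "d \<in> set (oct_mirrors1 @ oct_mirrors2)" "sgn \<alpha> = sgn (vev d)" using direction_is_mirror[OF a] by blast
      have "sgn (vev d) \<in> sgn ` \<Phi>" using d(2) a by (metis imageI)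
      then have "d \<notin> set Cs" using n by blast
      then have "d \<in> set Ds" using d(1) other by blast
      moreover have "reflection \<alpha> = reflection (vev d)"
        using reflection_sgn[of \<alpha>] reflection_sgn[of "vev d"] d(2) by (auto simp: fun_eq_iff)
      ultimately show ?thesis using pres by simp
    qed
    moreover have "w \<in> set (oct_mirrors1 @ oct_mirrors2)" using w(1) other by blast
    from mirror_symmetry[OF this] have "reflection (vev w) \<in> reflection_group \<Phi>" unfolding grp .
    ultimately show False using reflection_group_preserves[of _ \<Phi> T] w(2) by blast
  qed
  have 1: "\<exists>w\<in>set oct_mirrors1. sgn (vev w) \<in> sgn ` \<Phi>"
  proof (rule no_class[where Ds = oct_mirrors2 and T = "vev ` set tet_vertices" and w = "((2, 0), (0, 0), (0, 0))"])
    fix w assume "w \<in> set oct_mirrors2"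
    then show "reflection (vev w) ` vev ` set tet_vertices = vev ` set tet_vertices"
      using oct_mirrors2_preserve unfolding list_all_iff by (intro reflection_preserves_vertices) blast+
  next
    have "reflection (vev ((2, 0), (0, 0), (0, 0))) (vector [1, 1, 1]) \<notin> tetrahedron"
      by (simp add: tetrahedron_def reflection_def vec3_eq_iff inner_vec3 zev_def)
    moreover have "vector [1, 1, 1] \<in> tetrahedron" by (simp add: tetrahedron_def)
    ultimately show "reflection (vev ((2, 0), (0, 0), (0, 0))) ` vev ` set tet_vertices \<noteq> vev ` set tet_vertices"
      unfolding vev_tet by blast
  qed (auto simp: oct_mirrors1_def)
  have 2: "\<exists>w\<in>set oct_mirrors2. sgn (vev w) \<in> sgn ` \<Phi>"
  proof (rule no_class[where Ds = oct_mirrors1 and T = "vev ` set axis_vertices" and w = "((1, 0), (-1, 0), (0, 0))"])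
    fix w assume "w \<in> set oct_mirrors1"
    then show "reflection (vev w) ` vev ` set axis_vertices = vev ` set axis_vertices"
      using oct_mirrors1_preserve unfolding list_all_iff by (intro reflection_preserves_vertices) blast+
  next
    have "reflection (vev ((1, 0), (-1, 0), (0, 0))) (vev ((1, 0), (0, 0), (0, 0))) \<notin> vev ` set axis_vertices"
      by (simp add: axis_vertices_def reflection_def vec3_eq_iff inner_vec3 zev_def)
    moreover have "vev ((1, 0), (0, 0), (0, 0)) \<in> vev ` set axis_vertices" by (simp add: axis_vertices_def)
    ultimately show "reflection (vev ((1, 0), (-1, 0), (0, 0))) ` vev ` set axis_vertices \<noteq> vev ` set axis_vertices"
      by blast
  qed (auto simp: oct_mirrors2_def)
  have "\<forall>v\<in>set oct_mirrors1. sgn (vev v) \<in> sgn ` \<Phi>" using 1 class_directions[OF connected_check_oct1] by blast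
  moreover have "\<forall>v\<in>set oct_mirrors2. sgn (vev v) \<in> sgn ` \<Phi>" using 2 class_directions[OF connected_check_oct2] by blast
  ultimately have "card \<Phi> = length (oct_mirrors1 @ oct_mirrors2)" by (intro card_if_all_directions) auto
  then show ?thesis by (simp add: oct_mirrors1_def oct_mirrors2_def)
qed

section \<open>Cyclic groups and the assembled result\<close>

lemma irr_dim_sum_cyclic:
  assumes "group G" "cyclic_group G" "order G > 0"
  shows "irr_dim_sum G = order G"
proof -
  interpret group G by (rule assms(1))
  have "finite (carrier G)" using assms(3) by (simp add: order_gt_0_iff_finite)
  then interpret fin_group G by unfold_locales
  show ?thesis by (rule irr_dim_sum_commutative) (rule cyclic_imp_abelian_group[OF assms(2)])
qed

text \<open>Because \<open>\<Psi>\<close> varies over all root systems of its type in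
  \<open>'v\<close>, the Coxeter number is shown to depend on the type alone. Such a
  \<open>\<Psi>\<close> spans \<open>'v\<close>, so it exists only if the dimension of
  \<open>'v\<close> equals the rank; the other equalities stand outside that implication.\<close>

theorem mainTheorem1:
  shows
    "(\<forall>n\<ge>2. \<forall>\<Phi> (G :: 'g monoid).
        is_I2 n \<Phi> \<and> group G \<and> cyclic_group G \<and> order G = 2 * n \<longrightarrow>
        card \<Phi> = irr_dim_sum G \<and>
        (\<forall>\<Psi> :: 'v::euclidean_space set. root_system_of_type (Type_A (2 * n - 1)) \<Psi> \<longrightarrow>
          irr_dim_sum G = coxeter_number \<Psi>) \<and>
        irr_dim_sum G = 2 * n) \<and>
     (\<forall>n\<ge>2. \<forall>\<Phi> (G :: 'g monoid).
        is_A1_I2 n \<Phi> \<and> is_dicyclic n G \<longrightarrow>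
        card \<Phi> = irr_dim_sum G \<and>
        (\<forall>\<Psi> :: 'v set. root_system_of_type (Type_D (n + 2)) \<Psi> \<longrightarrow>
          irr_dim_sum G = coxeter_number \<Psi>) \<and>
        irr_dim_sum G = 2 * n + 2) \<and>
     (\<forall>\<Phi>. is_A3 \<Phi> \<longrightarrow>
        card \<Phi> = irr_dim_sum binary_tetrahedral \<and>
        (\<forall>\<Psi> :: 'v set. root_system_of_type Type_E6 \<Psi> \<longrightarrow>
          irr_dim_sum binary_tetrahedral = coxeter_number \<Psi>) \<and>
        irr_dim_sum binary_tetrahedral = 12) \<and>
     (\<forall>\<Phi>. is_B3 \<Phi> \<longrightarrow>
        card \<Phi> = irr_dim_sum binary_octahedral \<and>
        (\<forall>\<Psi> :: 'v set. root_system_of_type Type_E7 \<Psi> \<longrightarrow>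
          irr_dim_sum binary_octahedral = coxeter_number \<Psi>) \<and>
        irr_dim_sum binary_octahedral = 18) \<and>
     (\<forall>\<Phi>. is_H3 \<Phi> \<longrightarrow>
        card \<Phi> = irr_dim_sum binary_icosahedral \<and>
        (\<forall>\<Psi> :: 'v set. root_system_of_type Type_E8 \<Psi> \<longrightarrow>
          irr_dim_sum binary_icosahedral = coxeter_number \<Psi>) \<and>
        irr_dim_sum binary_icosahedral = 30)"
  proof (intro conjI allI impI; (elim conjE)?)
  fix n :: nat and \<Phi> :: "(real^2) set" and G :: "'g monoid"
  assume n: "n \<ge> 2" and \<Phi>: "is_I2 n \<Phi>" and G: "group G" "cyclic_group G" "order G = 2 * n"
  have irr: "irr_dim_sum G = 2 * n" using irr_dim_sum_cyclic[OF G(1,2)] G(3) n by simp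
  then show "irr_dim_sum G = 2 * n" .
  show "card \<Phi> = irr_dim_sum G" unfolding irr by (rule card_I2[OF \<Phi> n])
  fix \<Psi> :: "'v set" assume "root_system_of_type (Type_A (2 * n - 1)) \<Psi>"
  from coxeter_number_type_A[OF this] n show "irr_dim_sum G = coxeter_number \<Psi>" unfolding irr by simp
next
  fix n :: nat and \<Phi> :: "(real^3) set" and G :: "'g monoid"
  assume n: "n \<ge> 2" and \<Phi>: "is_A1_I2 n \<Phi>" and G: "is_dicyclic n G"
  note irr = irr_dim_sum_dicyclic[OF G n]
  show "irr_dim_sum G = 2 * n + 2" by (rule irr)
  show "card \<Phi> = irr_dim_sum G" unfolding irr by (rule card_A1_I2[OF \<Phi> n])
  fix \<Psi> :: "'v set" assume "root_system_of_type (Type_D (n + 2)) \<Psi>"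
  from coxeter_number_type_D[OF this n] show "irr_dim_sum G = coxeter_number \<Psi>" unfolding irr by simp
qed (simp_all only: card_A3 card_B3 card_H3 coxeter_number_type_E6 coxeter_number_type_E7 coxeter_number_type_E8
    irr_dim_sum_binary_tetrahedral irr_dim_sum_binary_octahedral irr_dim_sum_binary_icosahedral)

end
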